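(* Let $(X,0)=(X^{(1)}\cup\cdots\cup X^{(r)},0)\subset(\mathbb{C}^n,0)$ and $(Y,0)=(Y^{(1)}\cup\cdots\cup Y^{(r')},0)\subset(\mathbb{C}^{n'},0)$ be germs of reduced complex analytic curves ($n,n'\ge 2$), decomposed into their branches (irreducible components). Then $(X,0)$ and $(Y,0)$ are bi-Lipschitz equivalent (for the outer metric) if and only if $r=r'$ and there exists a bijection $\rho:\{1,\dots,r\}\to\{1,\dots,r'\}$ preserving all the auxiliary multiplicities, that is, $$ChAM(X^{(i)},0)=ChAM(Y^{(\rho(i))},0)\quad\text{and}\quad CoAM(X^{(i)},X^{(j)})=CoAM(Y^{(\rho(i))},Y^{(\rho(j))})$$ for all $i\in S(X)$ and all $(i,j)\in T(X)$ or $(i,j)\in NT(X)$.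
   Context: **Bi-Lipschitz equivalence.** The outer metric on a germ of curve $(X,0)\subset(\mathbb{C}^n,0)$ is the metric induced by that of the ambient space. Two germs of curves $(X,0)$, $(Y,0)$ are bi-Lipschitz equivalent if there is a germ of homeomorphism $h:(X,0)\to(Y,0)$ such that $h$ and $h^{-1}$ are Lipschitz for the outer metrics. **Index sets.** $S(X)\subset\{1,\dots,r\}$ is the set of indices $i$ such that the branch $(X^{(i)},0)$ is singular. $T(X)$ is the set of pairs $(i,j)$ with $i<j$ such that $(X^{(i)},0)$ is tangent to $(X^{(j)},0)$. $NT(X)$ is the set of pairs $(i,j)$ with $i<j$ such that $(X^{(i)},0)$ is not tangent to $(X^{(j)},0)$. **Puiseux parametrizations.** Let $(Z,0)\subset(\mathbb{C}^n,0)$ be a reduced irreducible curve germ of multiplicity $m$. A primitive parametrization is a finite holomorphic map germ $\varphi:(\mathbb{C},0)\to(\mathbb{C}^n,0)$ with image $(Z,0)$ through which every finite holomorphic map germ $(\mathbb{C},0)\to(\mathbb{C}^n,0)$ with image $(Z,0)$ factors in a unique way. It is a Puiseux parametrization if all its coordinates have order $\ge m$ at $0$ and some coordinate is exactly $u^m$; such a coordinate is called special. A system of Puiseux parametrizations of the branches of a curve is compatible if, for any two tangent branches, the corresponding parametrizations have a common special coordinate $j$, i.e. their $j$-th coordinates are $u^{m^{(1)}}$ and $u^{m^{(2)}}$, where $m^{(1)},m^{(2)}$ are the multiplicities of the two branches. Compatible systems always exist. **Auxiliary multiplicities.** $G_m$ is the group of $m$-th roots of unity, and $\mathrm{ord}_0$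 is the order of a power series at $0$, with $\mathrm{ord}_0(0)=\infty$. * Characteristic auxiliary multiplicities (defined for singular branches): for a singular branch $(Z,0)$ of multiplicity $m$ with Puiseux parametrization $\varphi=(\varphi_1,\dots,\varphi_n)$ and $\theta\in G_m\setminus\{1\}$, put $m_\theta=\min_j \mathrm{ord}_0[\varphi_j(u)-\varphi_j(\theta u)]$, and let $ChAM(Z,0)$ be the set $\{m\}\cup\{m_\theta:\theta\in G_m\setminus\{1\}\}$. * Contact auxiliary multiplicities: for two distinct branches of a curve, named $Z^{(1)},Z^{(2)}$ so that their multiplicities satisfy $m^{(1)}\ge m^{(2)}$, with compatible Puiseux parametrizations $\varphi^{(1)},\varphi^{(2)}$, and $\theta\in G_{m^{(2)}}$, put $m^{(1,2)}_\theta=\min_j \mathrm{ord}_0[\varphi^{(1)}_j(u^{m^{(2)}})-\varphi^{(2)}_j(\theta u^{m^{(1)}})]$. Then $CoAM(Z^{(1)},Z^{(2)})$ is the non-decreasing sequence of integers, with possible repetitions, formed by the $m^{(2)}$ values $m^{(1,2)}_\theta$, $\theta\in G_{m^{(2)}}$. It is attached to the pair of branches, with the branch of larger multiplicity taken first. These data do not depend on the choice of the compatible system of Puiseux parametrizations.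
   Formalization: Preservation also requires X^(i) to be singular if and only if Y^(ρ(i)) is singular; with only the displayed condition for i in S(X), a line X and a cusp Y (r=r'=1) satisfy it vacuously but are not bi-Lipschitz equivalent. *)

theory Defs
  imports "HOL-Complex_Analysis.Complex_Analysis" "HOL-Library.Extended_Nat"
    "HOL-Library.Multiset"
begin

text \<open>
  A reduced analytic germ at the origin is determined by its underlying set germ, so germs are given
  by subsets of \<open>complex ^ 'n\<close>. Every notion below depends only on the set near the origin.
\<close>

definition germ_le :: "(complex ^ 'n) set \<Rightarrow> (complex ^ 'n) set \<Rightarrow> bool" where
  "germ_le A B \<longleftrightarrow> (\<forall>\<^sub>F z in nhds 0. z \<in> A \<longrightarrow> z \<in> B)"

definition germ_eq :: "(complex ^ 'n) set \<Rightarrow> (complex ^ 'n) set \<Rightarrow> bool" where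
  "germ_eq A B \<longleftrightarrow> (\<forall>\<^sub>F z in nhds 0. z \<in> A \<longleftrightarrow> z \<in> B)"


section \<open>Analytic germs, components, dimension\<close>

definition holomorphic_several :: "(complex ^ 'n \<Rightarrow> complex) \<Rightarrow> (complex ^ 'n) set \<Rightarrow> bool" where
  "holomorphic_several f U \<longleftrightarrow>
     open U \<and> (\<forall>z\<in>U. \<exists>D. (f has_derivative D) (at z) \<and> (\<forall>c v. D (c *s v) = c * D v))"

definition analytic_germ :: "(complex ^ 'n) set \<Rightarrow> bool" where
  "analytic_germ A \<longleftrightarrow> 0 \<in> A \<and>
     (\<exists>U F. 0 \<in> U \<and> open U \<and> finite F \<and> (\<forall>f\<in>F. holomorphic_several f U) \<and>
            A \<inter> U = {z \<in> U. \<forall>f\<in>F. f z = 0})"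

definition irreducible_germ :: "(complex ^ 'n) set \<Rightarrow> bool" where
  "irreducible_germ A \<longleftrightarrow> analytic_germ A \<and>
     (\<forall>A1 A2. analytic_germ A1 \<and> analytic_germ A2 \<and> germ_eq A (A1 \<union> A2) \<longrightarrow>
              germ_eq A A1 \<or> germ_eq A A2)"

definition irreducible_component :: "(complex ^ 'n) set \<Rightarrow> (complex ^ 'n) set \<Rightarrow> bool" where
  "irreducible_component Z X \<longleftrightarrow> irreducible_germ Z \<and> germ_le Z X \<and>
     (\<forall>Z'. irreducible_germ Z' \<and> germ_le Z Z' \<and> germ_le Z' X \<longrightarrow> germ_eq Z Z')"

text \<open>
  The dimension in the sense of Grauert and Remmert: the least number of holomorphic germs vanishing
  at the origin whose common zeros on \<open>A\<close> have the origin as an isolated point.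
\<close>

definition germ_dim :: "(complex ^ 'n) set \<Rightarrow> nat" where
  "germ_dim A = (LEAST k. \<exists>F. finite F \<and> card F = k \<and>
     (\<forall>f\<in>F. f 0 = 0 \<and> (\<exists>U. 0 \<in> U \<and> holomorphic_several f U)) \<and>
     germ_eq {z \<in> A. \<forall>f\<in>F. f z = 0} {0})"

text \<open>Curves are of pure dimension one.\<close>

definition curve_germ :: "(complex ^ 'n) set \<Rightarrow> bool" where
  "curve_germ X \<longleftrightarrow> analytic_germ X \<and> (\<forall>Z. irreducible_component Z X \<longrightarrow> germ_dim Z = 1)"

definition branch_decomposition ::
    "(complex ^ 'n) set \<Rightarrow> nat \<Rightarrow> (nat \<Rightarrow> (complex ^ 'n) set) \<Rightarrow> bool" where
  "branch_decomposition X r B \<longleftrightarrow>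
     (\<forall>i\<in>{1..r}. irreducible_component (B i) X) \<and>
     (\<forall>i\<in>{1..r}. \<forall>j\<in>{1..r}. i \<noteq> j \<longrightarrow> \<not> germ_eq (B i) (B j)) \<and>
     germ_eq X (\<Union>i\<in>{1..r}. B i)"


section \<open>Bi-Lipschitz equivalence for the outer metric\<close>

definition bilipschitz_equivalent :: "(complex ^ 'n) set \<Rightarrow> (complex ^ 'm) set \<Rightarrow> bool" where
  "bilipschitz_equivalent X Y \<longleftrightarrow>
     (\<exists>U V h k C D. open U \<and> 0 \<in> U \<and> open V \<and> 0 \<in> V \<and>
        homeomorphism (X \<inter> U) (Y \<inter> V) h k \<and> h 0 = 0 \<and>
        C-lipschitz_on (X \<inter> U) h \<and> D-lipschitz_on (Y \<inter> V) k)"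


section \<open>Smoothness, multiplicity, tangency\<close>

definition smooth_germ :: "(complex ^ 'n) set \<Rightarrow> bool" where
  "smooth_germ Z \<longleftrightarrow>
     (\<exists>U (V :: (complex ^ 'n) set) h k S. 0 \<in> U \<and> homeomorphism U V h k \<and> h 0 = 0 \<and>
        (\<forall>j. holomorphic_several (\<lambda>z. h z $ j) U) \<and> (\<forall>j. holomorphic_several (\<lambda>z. k z $ j) V) \<and>
        vec.subspace S \<and> h ` (Z \<inter> U) = S \<inter> V)"

definition linear_form :: "complex ^ 'n \<Rightarrow> complex ^ 'n \<Rightarrow> complex" where
  "linear_form a z = (\<Sum>j\<in>UNIV. a $ j * z $ j)"

text \<open>
  The multiplicity of a curve germ \<open>Z\<close>: the least number of sheets, over all linear forms whose
  kernel meets \<open>Z\<close> only at the origin, of the local branched covering that the form defines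
  on \<open>Z\<close>. The minimum is attained by generic forms.
\<close>

definition sheet_number :: "(complex ^ 'n) set \<Rightarrow> complex ^ 'n \<Rightarrow> nat \<Rightarrow> bool" where
  "sheet_number Z a k \<longleftrightarrow>
     (\<exists>R>0. \<forall>\<epsilon>. 0 < \<epsilon> \<and> \<epsilon> < R \<longrightarrow>
        {z \<in> Z \<inter> ball 0 \<epsilon>. linear_form a z = 0} = {0} \<and>
        (\<forall>\<^sub>F c in at 0. finite {z \<in> Z \<inter> ball 0 \<epsilon>. linear_form a z = c} \<and>
                       card {z \<in> Z \<inter> ball 0 \<epsilon>. linear_form a z = c} = k))"

definition multiplicity_germ :: "(complex ^ 'n) set \<Rightarrow> nat" where
  "multiplicity_germ Z = (LEAST k. \<exists>a. sheet_number Z a k)"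

definition tangent_cone :: "(complex ^ 'n) set \<Rightarrow> (complex ^ 'n) set" where
  "tangent_cone Z = {v. \<exists>(z :: nat \<Rightarrow> complex ^ 'n) (t :: nat \<Rightarrow> complex).
     (\<forall>k. z k \<in> Z) \<and> z \<longlonglongrightarrow> 0 \<and> (\<lambda>k. t k *s z k) \<longlonglongrightarrow> v}"

text \<open>The tangent cone of a branch is a complex line, its tangent.\<close>

definition tangent_branches :: "(complex ^ 'n) set \<Rightarrow> (complex ^ 'n) set \<Rightarrow> bool" where
  "tangent_branches Z1 Z2 \<longleftrightarrow> tangent_cone Z1 = tangent_cone Z2"


section \<open>Puiseux parametrizations\<close>

definition ord0 :: "(complex \<Rightarrow> complex) \<Rightarrow> enat" where
  "ord0 f = (if fps_expansion f 0 = 0 then \<infinity> else enat (subdegree (fps_expansion f 0)))"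

text \<open>
  Finite holomorphic map germs \<open>(\<complex>, 0) \<rightarrow> (\<complex>\<^sup>n, 0)\<close> with image \<open>Z\<close>. A map germ is finite iff the
  origin is isolated in its fibre; the image germ is then that of the image of any small disc.
\<close>

definition finite_param :: "(complex ^ 'n) set \<Rightarrow> (complex \<Rightarrow> complex ^ 'n) \<Rightarrow> bool" where
  "finite_param Z \<phi> \<longleftrightarrow>
     (\<forall>j. (\<lambda>u. \<phi> u $ j) analytic_on {0}) \<and> \<phi> 0 = 0 \<and> (\<forall>\<^sub>F u in at 0. \<phi> u \<noteq> 0) \<and>
     (\<exists>R>0. \<forall>\<epsilon>. 0 < \<epsilon> \<and> \<epsilon> < R \<longrightarrow> germ_eq (\<phi> ` ball 0 \<epsilon>) Z)"

definition factorization_through ::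
    "(complex \<Rightarrow> complex ^ 'n) \<Rightarrow> (complex \<Rightarrow> complex ^ 'n) \<Rightarrow> (complex \<Rightarrow> complex) \<Rightarrow> bool" where
  "factorization_through \<phi> \<psi> g \<longleftrightarrow>
     g analytic_on {0} \<and> g 0 = 0 \<and> (\<forall>\<^sub>F u in nhds 0. \<psi> u = \<phi> (g u))"

definition primitive_param :: "(complex ^ 'n) set \<Rightarrow> (complex \<Rightarrow> complex ^ 'n) \<Rightarrow> bool" where
  "primitive_param Z \<phi> \<longleftrightarrow> finite_param Z \<phi> \<and>
     (\<forall>\<psi>. finite_param Z \<psi> \<longrightarrow>
        (\<exists>g. factorization_through \<phi> \<psi> g) \<and>
        (\<forall>g1 g2. factorization_through \<phi> \<psi> g1 \<and> factorization_through \<phi> \<psi> g2 \<longrightarrow>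
                 (\<forall>\<^sub>F u in nhds 0. g1 u = g2 u)))"

definition special_coordinate ::
    "(complex ^ 'n) set \<Rightarrow> (complex \<Rightarrow> complex ^ 'n) \<Rightarrow> 'n \<Rightarrow> bool" where
  "special_coordinate Z \<phi> j \<longleftrightarrow> (\<forall>\<^sub>F u in nhds 0. \<phi> u $ j = u ^ multiplicity_germ Z)"

definition puiseux_param :: "(complex ^ 'n) set \<Rightarrow> (complex \<Rightarrow> complex ^ 'n) \<Rightarrow> bool" where
  "puiseux_param Z \<phi> \<longleftrightarrow> primitive_param Z \<phi> \<and>
     (\<forall>j. enat (multiplicity_germ Z) \<le> ord0 (\<lambda>u. \<phi> u $ j)) \<and>
     (\<exists>j. special_coordinate Z \<phi> j)"

text \<open>Compatibility of a system of parametrizations is a condition on pairs of branches.\<close>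

definition compatible_params ::
    "(complex ^ 'n) set \<Rightarrow> (complex ^ 'n) set \<Rightarrow>
     (complex \<Rightarrow> complex ^ 'n) \<Rightarrow> (complex \<Rightarrow> complex ^ 'n) \<Rightarrow> bool" where
  "compatible_params Z1 Z2 \<phi>1 \<phi>2 \<longleftrightarrow>
     puiseux_param Z1 \<phi>1 \<and> puiseux_param Z2 \<phi>2 \<and>
     (tangent_branches Z1 Z2 \<longrightarrow> (\<exists>j. special_coordinate Z1 \<phi>1 j \<and> special_coordinate Z2 \<phi>2 j))"


section \<open>Auxiliary multiplicities\<close>

definition roots_of_unity :: "nat \<Rightarrow> complex set" where
  "roots_of_unity m = {\<theta>. \<theta> ^ m = 1}"

definition char_mult :: "(complex \<Rightarrow> complex ^ 'n) \<Rightarrow> complex \<Rightarrow> enat" where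
  "char_mult \<phi> \<theta> = Min (range (\<lambda>j. ord0 (\<lambda>u. \<phi> u $ j - \<phi> (\<theta> * u) $ j)))"

definition contact_mult ::
    "nat \<Rightarrow> nat \<Rightarrow> (complex \<Rightarrow> complex ^ 'n) \<Rightarrow> (complex \<Rightarrow> complex ^ 'n) \<Rightarrow> complex \<Rightarrow> enat" where
  "contact_mult m1 m2 \<phi>1 \<phi>2 \<theta> =
     Min (range (\<lambda>j. ord0 (\<lambda>u. \<phi>1 (u ^ m2) $ j - \<phi>2 (\<theta> * u ^ m1) $ j)))"

text \<open>
  The auxiliary multiplicities do not depend on the (compatible) Puiseux parametrizations, so an
  arbitrary choice is made. \<open>ChAM\<close> is meaningful for singular branches only.
\<close>

definition ChAM :: "(complex ^ 'n) set \<Rightarrow> enat set" where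
  "ChAM Z =
     (let \<phi> = (SOME \<phi>. puiseux_param Z \<phi>); m = multiplicity_germ Z
      in {enat m} \<union> char_mult \<phi> ` (roots_of_unity m - {1}))"

definition CoAM_ordered :: "(complex ^ 'n) set \<Rightarrow> (complex ^ 'n) set \<Rightarrow> enat list" where
  "CoAM_ordered Z1 Z2 =
     (let (\<phi>1, \<phi>2) = (SOME (\<phi>1, \<phi>2). compatible_params Z1 Z2 \<phi>1 \<phi>2);
          m1 = multiplicity_germ Z1; m2 = multiplicity_germ Z2
      in sorted_list_of_multiset
           (image_mset (contact_mult m1 m2 \<phi>1 \<phi>2) (mset_set (roots_of_unity m2))))"

text \<open>The branch of larger multiplicity comes first; for equal multiplicities the order is immaterial.\<close>

definition CoAM :: "(complex ^ 'n) set \<Rightarrow> (complex ^ 'n) set \<Rightarrow> enat list" where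
  "CoAM Z1 Z2 =
     (if multiplicity_germ Z1 \<ge> multiplicity_germ Z2 then CoAM_ordered Z1 Z2
      else CoAM_ordered Z2 Z1)"


section \<open>Index sets\<close>

definition singular_indices :: "nat \<Rightarrow> (nat \<Rightarrow> (complex ^ 'n) set) \<Rightarrow> nat set" where
  "singular_indices r B = {i \<in> {1..r}. \<not> smooth_germ (B i)}"

definition tangent_pairs :: "nat \<Rightarrow> (nat \<Rightarrow> (complex ^ 'n) set) \<Rightarrow> (nat \<times> nat) set" where
  "tangent_pairs r B =
     {(i, j). i \<in> {1..r} \<and> j \<in> {1..r} \<and> i < j \<and> tangent_branches (B i) (B j)}"

definition nontangent_pairs :: "nat \<Rightarrow> (nat \<Rightarrow> (complex ^ 'n) set) \<Rightarrow> (nat \<times> nat) set" where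
  "nontangent_pairs r B =
     {(i, j). i \<in> {1..r} \<and> j \<in> {1..r} \<and> i < j \<and> \<not> tangent_branches (B i) (B j)}"

text \<open>
  As \<open>ChAM\<close> is attached to the singular branches only, preserving all the auxiliary multiplicities
  entails that singular branches correspond to singular branches. Without this condition, a line
  and a cusp would satisfy the remaining ones vacuously.
\<close>

definition preserves_auxiliary_multiplicities ::
    "nat \<Rightarrow> (nat \<Rightarrow> (complex ^ 'n) set) \<Rightarrow> (nat \<Rightarrow> (complex ^ 'm) set) \<Rightarrow> (nat \<Rightarrow> nat) \<Rightarrow> bool" where
  "preserves_auxiliary_multiplicities r B B' \<rho> \<longleftrightarrow>
     (\<forall>i\<in>{1..r}. smooth_germ (B i) \<longleftrightarrow> smooth_germ (B' (\<rho> i))) \<and>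
     (\<forall>i\<in>singular_indices r B. ChAM (B i) = ChAM (B' (\<rho> i))) \<and>
     (\<forall>(i, j)\<in>tangent_pairs r B \<union> nontangent_pairs r B.
        CoAM (B i) (B j) = CoAM (B' (\<rho> i)) (B' (\<rho> j)))"

end

theory Submission
  imports Defs
begin

text \<open>
  Pull two branches back to a common ramification, that is, to maps \<open>F\<close> and \<open>G\<close> which have \<open>s ^ N\<close> as a common
  coordinate when the branches are tangent. For \<open>s'\<close> near \<open>w * s\<close> with \<open>w ^ N = 1\<close>, the distance of \<open>F s\<close> and
  \<open>G s'\<close> is comparable to \<open>\<bar>s ^ N - s' ^ N\<bar> + \<bar>s\<bar> ^ k w\<close>, where \<open>k w\<close> is the order of \<open>F s - G (w * s)\<close>; for \<open>s'\<close> far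
  from all \<open>w * s\<close> it is comparable to \<open>\<bar>s\<bar> ^ N + \<bar>s'\<bar> ^ N\<close>. So the orders \<open>k w\<close> determine the outer metric up to
  bounded factors. They satisfy an ultrametric inequality, by which the auxiliary multiplicities determine
  them up to rotations of the parameters, and matching the rotated parametrizations of \<open>X\<close> and \<open>Y\<close> gives a
  bi-Lipschitz map. Conversely, a bi-Lipschitz map permutes the branches; it preserves the maximal contact
  of two branches, which is their distance near \<open>0\<close>, and the self-contacts by a connectedness argument.
\<close>


section \<open>Local analytic geometry: from zero sets of holomorphic functions to injective
  parametrizations of branches\<close>

section \<open>Contour integrals depending on a parameter\<close>

text \<open>Branches are given as zero sets of holomorphic functions of several variables, so their
  parametrizations have to be produced. Dimension one supplies a function with an isolated zero on
  the branch; every coordinate is integral over it, Puiseux's theorem solves the integral equations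
  by finitely many curves, and irreducibility selects one. Roots are never followed individually:
  their power sums are contour integrals, hence holomorphic in parameters.

  Branches with different tangents need not share a coordinate. For them all orders
  \<open>k w\<close> equal \<open>N\<close>, and the distance is comparable to the sum of the
  \<open>N\<close>-th powers of the moduli, so the same comparison of metrics covers them.

  A bi-Lipschitz map lifts to the parameters only as a continuous map, which need not respect
  rotations by roots of unity. The self-contacts are therefore compared at one small scale, as a
  proportion between orders and multiplicities, and this proportion also yields equality of the
  multiplicities. Independence of the chosen parametrizations is the case of the identity
  map.\<close>

lemma continuous_on_circle_integral:
 fixes G :: "'a::topological_space => complex => complex" assumes "continuous_on (W \<times> sphere 0 r) (%(w, e). G w e)" "r > 0"
 shows "continuous_on W (%w. contour_integral (circlepath 0 r) (G w))"
proof -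
 have "continuous_on (W \<times> cbox 0 (1::real))
  (%(w, x). G w (circlepath 0 r x) * vector_derivative (circlepath 0 r) (at x))" unfolding vector_derivative_circlepath split_def
 proof (intro continuous_intros)
  show "continuous_on (W \<times> cbox 0 1) (%p. G (fst p) (circlepath 0 r (snd p)))"
  proof -
   have "continuous_on (W \<times> cbox 0 (1::real)) (%p. (fst p, circlepath 0 r (snd p)))"
    unfolding circlepath by (intro continuous_intros)
   moreover have "(%p. (fst p, circlepath 0 r (snd p))) ` (W \<times> cbox 0 (1::real)) <= W \<times> sphere 0 r"
    using assms(2) by (auto simp: circlepath norm_mult)
   ultimately show ?thesis using continuous_on_compose2[OF assms(1)] by (fastforce simp add: split_def)
  qed
 qed
 from integral_continuous_on_param[OF this] show ?thesis by (simp add: contour_integral_integral split_def)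
qed

text \<open>Morera's theorem: along each side of a triangle the order of integration is exchanged,
  and for fixed \<open>e\<close> the integral of \<open>G w e\<close> around the triangle vanishes
  by Cauchy's theorem.\<close>

lemma holomorphic_on_circle_integral:
 fixes G :: "complex => complex => complex" assumes "continuous_on (W \<times> sphere 0 r) (%(w, e). G w e)" "r > 0" "open W"
  and hol: "\<And>e. e : sphere 0 r ==> (%w. G w e) holomorphic_on W"
 shows "(%w. contour_integral (circlepath 0 r) (G w)) holomorphic_on W"
proof -
 have "(%w. contour_integral (circlepath 0 r) (G w)) analytic_on W"
 proof (rule Morera_triangle)
  show "continuous_on W (%w. contour_integral (circlepath 0 r) (G w))" by (rule continuous_on_circle_integral) (use assms in auto)
  fix a b c
  show "convex hull {a, b, c} <= W -->
   contour_integral (linepath a b) (%w. contour_integral (circlepath 0 r) (G w)) +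
   contour_integral (linepath b c) (%w. contour_integral (circlepath 0 r) (G w)) +
   contour_integral (linepath c a) (%w. contour_integral (circlepath 0 r) (G w)) = 0"
  proof
   assume abc: "convex hull {a, b, c} <= W"
   have seg: "closed_segment a b <= W" "closed_segment b c <= W" "closed_segment c a <= W"
    using abc by (simp_all add: segment_convex_hull) (meson hull_mono subset_trans insert_mono empty_subsetI subset_insertI insert_subset insertI1 insertI2)+
   have swap: "contour_integral (linepath x y) (%w. contour_integral (circlepath 0 r) (G w)) =
     contour_integral (circlepath 0 r) (%e. contour_integral (linepath x y) (%w. G w e))"
    and cont: "continuous_on (sphere 0 r) (%e. contour_integral (linepath x y) (%w. G w e))" if "closed_segment x y <= W" for x y
   proof -
    have c: "continuous_on (closed_segment x y \<times> sphere 0 r) (%(w, e). G w e)"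
     by (rule continuous_on_subset[OF assms(1)]) (use that in auto)
    show "contour_integral (linepath x y) (%w. contour_integral (circlepath 0 r) (G w)) =
     contour_integral (circlepath 0 r) (%e. contour_integral (linepath x y) (%w. G w e))" by (rule contour_integral_swap)
      (use c assms(2) in \<open>auto simp: vector_derivative_circlepath intro!: continuous_intros\<close>)
    have "continuous_on (sphere 0 r \<times> cbox 0 (1::real))
     (%(e, x'). G (linepath x y x') e * vector_derivative (linepath x y) (at x'))"
     unfolding split_def vector_derivative_linepath_at
    proof (intro continuous_intros)
     have "continuous_on (sphere (0::complex) r \<times> cbox 0 (1::real)) (%p. (linepath x y (snd p), fst p))"
      unfolding linepath_def by (intro continuous_intros)
     moreover have "(%p. (linepath x y (snd p), fst p)) ` (sphere (0::complex) r \<times> cbox 0 (1::real))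
       <= closed_segment x y \<times> sphere 0 r" by (auto intro: linepath_in_path)
     ultimately show "continuous_on (sphere 0 r \<times> cbox 0 1) (%p. G (linepath x y (snd p)) (fst p))"
      using continuous_on_compose2[OF c] by (fastforce simp add: split_def)
    qed
    from integral_continuous_on_param[OF this]
    show "continuous_on (sphere 0 r) (%e. contour_integral (linepath x y) (%w. G w e))"
     by (simp add: contour_integral_integral split_def)
   qed
   have int: "(%e. contour_integral (linepath x y) (%w. G w e)) contour_integrable_on circlepath 0 r"
    if "closed_segment x y <= W" for x y by (rule contour_integrable_continuous_circlepath) (use cont[OF that] assms(2) in auto)
   have z: "contour_integral (linepath a b) (%w. G w e) + contour_integral (linepath b c) (%w. G w e) +
       contour_integral (linepath c a) (%w. G w e) = 0" if "e : sphere 0 r" for e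
   proof -
    have h: "(%w. G w e) holomorphic_on convex hull {a, b, c}" using hol[OF that] abc holomorphic_on_subset by blast
    have *: "(%w. G w e) contour_integrable_on linepath x y" if "closed_segment x y <= W" for x y
     by (rule contour_integrable_continuous_linepath)
      (metis hol \<open>e : sphere 0 r\<close> that holomorphic_on_imp_continuous_on continuous_on_subset)
    have "((%w. G w e) has_contour_integral 0) (linepath a b +++ linepath b c +++ linepath c a)"
     by (rule Cauchy_theorem_triangle[OF h])
    hence "contour_integral (linepath a b +++ linepath b c +++ linepath c a) (%w. G w e) = 0"
     by (rule contour_integral_unique)
    thus ?thesis using *[OF seg(1)] *[OF seg(2)] *[OF seg(3)] by (simp add: add.assoc)
   qed
   have "contour_integral (circlepath 0 r) (%e. contour_integral (linepath a b) (%w. G w e)) +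
    contour_integral (circlepath 0 r) (%e. contour_integral (linepath b c) (%w. G w e)) +
    contour_integral (circlepath 0 r) (%e. contour_integral (linepath c a) (%w. G w e)) =
    contour_integral (circlepath 0 r) (%e. contour_integral (linepath a b) (%w. G w e) +
     contour_integral (linepath b c) (%w. G w e) + contour_integral (linepath c a) (%w. G w e))"
    by (simp add: contour_integral_add int seg contour_integrable_add)
   also have "... = contour_integral (circlepath 0 r) (%e. 0)" by (rule contour_integral_cong) (use z assms(2) in auto)
   finally show "contour_integral (linepath a b) (%w. contour_integral (circlepath 0 r) (G w)) +
   contour_integral (linepath b c) (%w. contour_integral (circlepath 0 r) (G w)) +
   contour_integral (linepath c a) (%w. contour_integral (circlepath 0 r) (G w)) = 0" by (simp add: swap seg)
  qed
 qed (use assms in auto)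
 thus ?thesis by (rule analytic_imp_holomorphic)
qed

section \<open>Power sums of roots and Newton's identities\<close>

text \<open>The cofactor is holomorphic on the disc of radius \<open>R\<close> but zero-free only on
  the closed disc of radius \<open>a\<close>. The circle of radius \<open>a\<close> is then a
  contour that encloses no zero except possibly 0, of order \<open>d\<close>.\<close>

definition zero_order :: "nat => real => real => (complex => complex) => bool" where
 "zero_order d R a f \<longleftrightarrow> (EX g. g holomorphic_on ball 0 R & (ALL z:ball 0 R. f z = z ^ d * g z) &
  (ALL z. norm z <= a --> g z ~= 0))"

text \<open>The weighted argument principle, with the zeros collected in a list according to
  multiplicity. The last clause serves the base point of a family: if the only zero is 0, of order
  \<open>d\<close>, the list is known explicitly.\<close>

lemma root_list_integral: assumes f: "f holomorphic_on ball 0 R" and a: "0 < a" "a < R" and nz: "\<And>q. norm q = a ==> f q ~= 0"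
 shows "EX rs. set rs = {q : ball 0 a. f q = 0} &
  (ALL h. h holomorphic_on ball 0 R -->
   contour_integral (circlepath 0 a) (%q. h q * (deriv f q / f q)) = 2 * pi * \<i> * (\<Sum>q\<leftarrow>rs. h q)) &
  (ALL d>0. zero_order d R a f --> rs = replicate d 0)"
proof -
 define R' where "R' = (a + R) / 2"
 have R': "a < R'" "R' < R" "R' > 0" using a by (auto simp: R'_def)
 have sub: "cball 0 R' <= ball 0 R" "ball 0 R' <= ball 0 R" using R' by auto
 have ne: "of_real a : ball (0::complex) R" "f (of_real a) ~= 0" using a by (auto intro!: nz)
 have fin: "finite {q : cball 0 R'. f q = 0}"
 proof (rule ccontr)
  assume inf: "infinite {q : cball 0 R'. f q = 0}"
  have "compact (cball (0::complex) R')" by simp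
  with inf obtain l where l: "l : cball 0 R'" "l islimpt {q : cball 0 R'. f q = 0}"
   using Heine_Borel_imp_Bolzano_Weierstrass by blast
  have "f (of_real a) = 0"
  proof (rule analytic_continuation[of f "ball 0 R" "{q : cball 0 R'. f q = 0}" l])
   show "of_real a : ball (0::complex) R" by (rule ne)
   show "l : ball 0 R" using l sub by blast
  qed (use f l sub in auto)
  with ne show False by simp
 qed
 define pz where "pz = {q : ball 0 R'. f q = 0}"
 have finpz: "finite pz" by (rule finite_subset[OF _ fin]) (auto simp: pz_def)
 define Z where "Z = {q : ball 0 a. f q = 0}"
 have ZP: "Z <= pz" using R' by (auto simp: Z_def pz_def)
 hence finZ: "finite Z" using finpz finite_subset by blast
 obtain ps where ps: "set ps = Z" "distinct ps" using finite_distinct_list[OF finZ] by blast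
 define rs where "rs = concat (map (%p. replicate (nat (zorder f p)) p) ps)"
 have zpos: "zorder f p > 0" if "p : Z" for p
 proof -
  have "(if f p = 0 then zorder f p > 0 else zorder f p = 0) & (EX r. r > 0 & cball p r <= ball 0 R &
      zor_poly f p holomorphic_on cball p r &
      (ALL w:cball p r. f w = zor_poly f p w * (w - p) ^ nat (zorder f p) & zor_poly f p w ~= 0))"
   by (rule zorder_exist_zero[OF f]) (use that ne a Z_def in auto)
  thus ?thesis using that by (auto simp: Z_def)
 qed
 have srs: "set rs = Z" unfolding rs_def using zpos by (force simp: ps(1))
 have sum: "(\<Sum>q\<leftarrow>rs. h q) = (\<Sum>p\<in>Z. h p * of_int (zorder f p))" for h :: "complex => complex"
 proof -
  have "(\<Sum>q\<leftarrow>rs. h q) = (\<Sum>p\<leftarrow>ps. h p * of_nat (nat (zorder f p)))"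
   unfolding rs_def by (induction ps) (auto simp: sum_list_replicate mult.commute)
  also have "... = (\<Sum>p\<in>Z. h p * of_nat (nat (zorder f p)))" using ps sum_list_distinct_conv_sum_set by fastforce
  also have "... = (\<Sum>p\<in>Z. h p * of_int (zorder f p))" using zpos by (intro sum.cong) (auto simp: order_less_imp_le)
  finally show ?thesis .
 qed
 show ?thesis
 proof (intro exI[of _ rs] conjI allI impI)
  show "set rs = {q : ball 0 a. f q = 0}" using srs by (simp add: Z_def)
 next
  fix h :: "complex => complex" assume h: "h holomorphic_on ball 0 R"
  have "contour_integral (circlepath 0 a) (%x. deriv f x * h x / f x) = 2 * pi * \<i> *
     (\<Sum>p\<in>{w : ball 0 R'. f w = 0 | w : {}}. winding_number (circlepath 0 a) p * h p * zorder f p)"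
  proof (rule argument_principle)
   show "path_image (circlepath 0 a) <= ball 0 R' - {w : ball 0 R'. f w = 0 | w : {}}" using a R' nz by auto
   show "ALL z. z ~: ball 0 R' --> winding_number (circlepath 0 a) z = 0"
   proof (intro allI impI)
    fix z :: complex assume z: "z ~: ball 0 R'"
    show "winding_number (circlepath 0 a) z = 0" by (rule winding_number_zero_outside[of _ "cball 0 a"]) (use z R' a in auto)
   qed
  qed (use f h sub finpz pz_def in \<open>auto intro: holomorphic_on_subset\<close>)
  also have "{w : ball 0 R'. f w = 0 | w : {}} = pz" by (auto simp: pz_def)
  also have "(\<Sum>p\<in>pz. winding_number (circlepath 0 a) p * h p * zorder f p) =
       (\<Sum>p\<in>Z. winding_number (circlepath 0 a) p * h p * zorder f p)"
  proof (rule sum.mono_neutral_right[OF finpz ZP], rule ballI)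
   fix p assume p: "p : pz - Z"
   hence "norm p > a" using nz by (auto simp: pz_def Z_def) (metis linorder_neqE_linordered_idom)
   hence "winding_number (circlepath 0 a) p = 0" by (intro winding_number_zero_outside[of _ "cball 0 a"]) (use a in auto)
   thus "winding_number (circlepath 0 a) p * h p * zorder f p = 0" by simp
  qed
  also have "... = (\<Sum>p\<in>Z. h p * zorder f p)" by (rule sum.cong) (auto simp: Z_def winding_number_circlepath)
  finally show "contour_integral (circlepath 0 a) (%q. h q * (deriv f q / f q)) = 2 * pi * \<i> * (\<Sum>q\<leftarrow>rs. h q)"
   by (simp add: sum mult.commute)
 next
  fix d :: nat assume d: "d > 0" and "zero_order d R a f"
  then obtain g where g: "g holomorphic_on ball 0 R"
   "\<And>q. q : ball 0 R ==> f q = q ^ d * g q" "\<And>q. norm q <= a ==> g q ~= 0" unfolding zero_order_def by blast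
  have Z0: "Z = {0}" using d a g(2,3) by (auto simp: Z_def)
  have "zorder f 0 = int d" by (rule zorder_eqI[of "ball 0 R"]) (use g a in \<open>auto simp: mult.commute\<close>)
  moreover have "ps = [0]" using ps Z0
   by (metis (no_types) distinct.simps(2) list.set_intros(1) list.exhaust list.simps(15) set_empty insert_not_empty singletonD subset_singletonD set_subset_Cons insert_absorb)
  ultimately show "rs = replicate d 0" by (simp add: rs_def)
 qed
qed

text \<open>Newton's identities. If \<open>p\<close> gives the power sums of some roots, these
  numbers are the coefficients of the product of the factors 1 - aX, that is, the elementary
  symmetric functions with alternating sign.\<close>

fun newton :: "(nat => complex) => nat => complex" where
 "newton p 0 = 1"
| "newton p (Suc k) = - (\<Sum>i\<le>k. newton p (k - i) * p (Suc i)) / of_nat (Suc k)"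

text \<open>The logarithmic derivative of the product E is -S, where S generates the power sums of
  positive exponent; comparing coefficients in the equation E' = -ES gives the recursion.\<close>

lemma newton_power_sums:
 "newton (%k. \<Sum>a\<leftarrow>as. a ^ k) n = fps_nth (\<Prod>a\<leftarrow>as. 1 - fps_const a * fps_X) n"
proof (induction n rule: less_induct)
 case (less n)
 define E where "E = (\<Prod>a\<leftarrow>as. 1 - fps_const a * fps_X :: complex fps)"
 define S where "S = Abs_fps (%k. \<Sum>a\<leftarrow>as. a ^ Suc k)"
 have dE: "fps_deriv E = - (E * S)" unfolding E_def S_def
 proof (induction as)
  case Nil
  show ?case by (simp add: fps_zero_def[symmetric])
 next
  case (Cons a as)
  define E where "E = (\<Prod>a\<leftarrow>as. 1 - fps_const a * fps_X :: complex fps)"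
  define S where "S = Abs_fps (%k. \<Sum>a\<leftarrow>as. a ^ Suc k)"
  define T where "T = Abs_fps (%k. a ^ Suc k)"
  have ST: "Abs_fps (%k. \<Sum>a\<leftarrow>a # as. a ^ Suc k) = T + S" by (simp add: S_def T_def fps_eq_iff)
  have T: "(1 - fps_const a * fps_X) * T = fps_const a"
  proof (rule fps_ext)
   fix n show "fps_nth ((1 - fps_const a * fps_X) * T) n = fps_nth (fps_const a) n"
    by (cases n) (simp_all add: left_diff_distrib mult.assoc T_def fps_X_mult_nth)
  qed
  have "fps_deriv ((1 - fps_const a * fps_X) * E) = - fps_const a * E - (1 - fps_const a * fps_X) * (E * S)"
   using Cons by (simp add: E_def S_def)
  also have "... = - (((1 - fps_const a * fps_X) * T) * E + (1 - fps_const a * fps_X) * (E * S))"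
   by (subst T) (simp add: algebra_simps fps_const_neg[symmetric] del: fps_const_neg)
  also have "... = - ((1 - fps_const a * fps_X) * E * (T + S))" by (simp add: algebra_simps)
  finally show ?case unfolding ST by (simp add: E_def)
 qed
 show ?case
 proof (cases n)
  case 0
  thus ?thesis by (induction as) auto
 next
  case (Suc k)
  have "of_nat (Suc k) * fps_nth E (Suc k) = fps_nth (fps_deriv E) k" by simp
  also have "... = - (\<Sum>i\<le>k. fps_nth E (k - i) * (\<Sum>a\<leftarrow>as. a ^ Suc i))"
   unfolding dE fps_neg_nth mult.commute[of E S] fps_mult_nth atLeast0AtMost by (simp add: S_def mult.commute)
  also have "... = - (\<Sum>i\<le>k. newton (%k. \<Sum>a\<leftarrow>as. a ^ k) (k - i) * (\<Sum>a\<leftarrow>as. a ^ Suc i))" using less.IH by (simp add: Suc E_def)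
  finally have "of_nat (Suc k) * fps_nth E (Suc k) =
   - (\<Sum>i\<le>k. newton (%k. \<Sum>a\<leftarrow>as. a ^ k) (k - i) * (\<Sum>a\<leftarrow>as. a ^ Suc i))" .
  hence "fps_nth E (Suc k) =
   - (\<Sum>i\<le>k. newton (%k. \<Sum>a\<leftarrow>as. a ^ k) (k - i) * (\<Sum>a\<leftarrow>as. a ^ Suc i)) / of_nat (Suc k)"
   by (metis mult.commute nonzero_mult_div_cancel_right of_nat_eq_0_iff nat.distinct(1))
  thus ?thesis by (simp add: Suc E_def)
 qed
qed

lemma prod_list_coeff_eq_0:
 "n > length as ==> fps_nth (\<Prod>a\<leftarrow>as. 1 - fps_const a * fps_X :: complex fps) n = 0"
proof (induction as arbitrary: n)
 case (Cons a as)
 thus ?case by (cases n) (auto simp: left_diff_distrib mult.assoc fps_X_mult_nth)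
qed auto

lemma prod_list_newton:
 "(\<Prod>a\<leftarrow>as. y - a) = (\<Sum>k\<le>length as. newton (%k. \<Sum>a\<leftarrow>as. a ^ k) k * y ^ (length as - k))" unfolding newton_power_sums
proof (induction as)
 case (Cons a as)
 define e where "e = fps_nth (\<Prod>a\<leftarrow>as. 1 - fps_const a * fps_X :: complex fps)"
 let ?n = "length as"
 have e: "fps_nth (\<Prod>a\<leftarrow>a # as. 1 - fps_const a * fps_X :: complex fps) k = e k - (if k = 0 then 0 else a * e (k - 1))" for k
  by (simp add: e_def left_diff_distrib mult.assoc fps_X_mult_nth)
 have "(\<Sum>k\<le>Suc ?n. (e k - (if k = 0 then 0 else a * e (k - 1))) * y ^ (Suc ?n - k)) =
   (\<Sum>k\<le>Suc ?n. e k * y ^ (Suc ?n - k)) - (\<Sum>k\<le>Suc ?n. (if k = 0 then 0 else a * e (k - 1)) * y ^ (Suc ?n - k))"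
  by (simp add: left_diff_distrib sum_subtractf)
 also have "(\<Sum>k\<le>Suc ?n. (if k = 0 then 0 else a * e (k - 1)) * y ^ (Suc ?n - k)) = a * (\<Sum>k\<le>?n. e k * y ^ (?n - k))"
  by (subst sum.atMost_Suc_shift) (simp add: sum_distrib_left mult.assoc)
 also have "(\<Sum>k\<le>Suc ?n. e k * y ^ (Suc ?n - k)) = (\<Sum>k\<le>?n. e k * y ^ (Suc ?n - k))"
  using prod_list_coeff_eq_0[of as "Suc ?n"] by (simp add: e_def)
 also have "... = y * (\<Sum>k\<le>?n. e k * y ^ (?n - k))" by (auto simp: sum_distrib_left Suc_diff_le intro!: sum.cong)
 finally show ?case using Cons unfolding e by (simp add: e_def left_diff_distrib)
qed auto

text \<open>The constant term of the polynomial. In elimination it becomes the norm of a function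
  over the zeros of another one, which vanishes exactly if one of the values does.\<close>

lemma prod_list_zero_newton:
 "newton (%k. \<Sum>a\<leftarrow>as. a ^ k) (length as) = (- 1) ^ length as * prod_list as"
proof -
 have "(\<Prod>a\<leftarrow>as. 0 - a) = (\<Sum>k\<le>length as. newton (%k. \<Sum>a\<leftarrow>as. a ^ k) k * (if k = length as then 1 else 0))"
  unfolding prod_list_newton by (intro sum.cong) auto
 also have "... = newton (%k. \<Sum>a\<leftarrow>as. a ^ k) (length as)" by (subst sum.mono_neutral_right[of _ "{length as}"]) auto
 finally have "newton (%k. \<Sum>a\<leftarrow>as. a ^ k) (length as) = (\<Prod>a\<leftarrow>as. - a)" by simp
 also have "... = (- 1) ^ length as * prod_list as" by (induction as) auto
 finally show ?thesis .
qed

section \<open>Separately holomorphic functions on polydiscs\<close>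

definition cube :: "real => (complex ^ 'k) set" where
 "cube r = {z. ALL i. norm (z $ i) < r}"

definition upd :: "complex ^ 'k => 'k => complex => complex ^ 'k" where
 "upd z i q = (\<chi> l. if l = i then q else z $ l)"

text \<open>Continuity together with holomorphy in each variable: both halves pass through contour
  integrals with parameters, one variable at a time.\<close>

definition sep_hol :: "real => (complex ^ 'k => complex) => bool" where
 "sep_hol r F \<longleftrightarrow> continuous_on (cube r) F &
  (ALL z:cube r. ALL i. (%q. F (upd z i q)) holomorphic_on ball 0 r)"

text \<open>Eliminating a variable keeps the type \<open>complex ^ 'k\<close> and only shrinks the
  set \<open>J\<close>, which avoids changing the dimension during an induction.\<close>

definition depends_on :: "'k set => (complex ^ 'k => complex) => bool" where
 "depends_on J F \<longleftrightarrow> (ALL z z'. (ALL i:J. z $ i = z' $ i) --> F z = F z')"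

lemma upd_nth [simp]: "upd z i q $ l = (if l = i then q else z $ l)" by (simp add: upd_def)

lemma upd_upd [simp]: "upd (upd z i a) i b = upd z i b" by (simp add: vec_eq_iff)

lemma upd_commute: "i ~= j ==> upd (upd z i a) j b = upd (upd z j b) i a" by (auto simp: vec_eq_iff)

lemma upd_same [simp]: "upd z i (z $ i) = z" by (simp add: vec_eq_iff)

lemma cube_nth: "z : cube r ==> norm (z $ i) < r" by (simp add: cube_def)

lemma cube_mono: "r' <= r ==> cube r' <= cube r" unfolding cube_def by (auto intro: less_le_trans)

lemma zero_in_cube: "r > 0 ==> 0 : cube r" by (simp add: cube_def)

lemma upd_in_cube: "z : cube r ==> norm q < r ==> upd z i q : cube r" by (auto simp: cube_def)

lemma open_cube: "open (cube r :: (complex ^ 'k) set)"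
 unfolding cube_def Collect_all_eq by (intro open_INT ballI finite open_Collect_less continuous_intros)

lemma convex_cube: "convex (cube r :: (complex ^ 'k) set)"
proof -
 have "cube r = (\<Inter>i. (%z. z $ i) -` ball 0 r :: (complex ^ 'k) set)" by (auto simp: cube_def)
 moreover have "convex ((%z. z $ i) -` ball 0 r :: (complex ^ 'k) set)" for i
  by (intro convex_linear_vimage) (auto intro: bounded_linear.linear bounded_linear_vec_nth)
 ultimately show ?thesis by (auto intro!: convex_INT)
qed

lemma cube_in_open: assumes "open X" "(0 :: complex ^ 'k) : X"
 obtains r where "r > 0" "cube r <= X"
proof -
 obtain e where e: "e > 0" "ball 0 e <= X" using assms open_contains_ball by blast
 have "cube (e / CARD('k)) <= ball (0 :: complex ^ 'k) e"
 proof
  fix z :: "complex ^ 'k" assume z: "z : cube (e / CARD('k))"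
  have "norm z <= (\<Sum>i\<in>UNIV. norm (z $ i))" using norm_le_l1_cart by (simp add: norm_vec_def L2_set_le_sum)
  also have "... < (\<Sum>i\<in>(UNIV :: 'k set). e / CARD('k))" by (rule sum_strict_mono) (use z in \<open>auto simp: cube_def\<close>)
  also have "... = e" by simp
  finally show "z : ball 0 e" by simp
 qed
 moreover have "e / CARD('k) > 0" using e by simp
 ultimately show thesis using that e by blast
qed

lemma continuous_on_upd [continuous_intros]: assumes "continuous_on S f" "continuous_on S g"
 shows "continuous_on S (%x. upd (f x) i (g x))"
proof -
 have "continuous_on S (%x. \<chi> l. if l = i then g x else f x $ l)"
 proof (rule continuous_on_vec_lambda)
  fix l show "continuous_on S (%x. if l = i then g x else f x $ l)" by (cases "l = i") (auto intro!: continuous_intros assms)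
 qed
 thus ?thesis by (simp add: upd_def)
qed

lemma sep_hol_mono:
 fixes F :: "complex ^ 'k => complex" assumes "sep_hol r F" "r' <= r" shows "sep_hol r' F" unfolding sep_hol_def
proof (intro conjI ballI allI)
 show "continuous_on (cube r') F"
  by (rule continuous_on_subset[OF _ cube_mono[OF assms(2)]]) (use assms(1) in \<open>simp add: sep_hol_def\<close>)
 fix z :: "complex ^ 'k" and i assume "z : cube r'"
 hence "(%q. F (upd z i q)) holomorphic_on ball 0 r" using assms cube_mono[OF assms(2)] by (auto simp: sep_hol_def)
 thus "(%q. F (upd z i q)) holomorphic_on ball 0 r'" by (rule holomorphic_on_subset) (use assms in auto)
qed

lemma sep_hol_cong:
 fixes f g :: "complex ^ 'k => complex" assumes f: "sep_hol r f" and eq: "\<And>w. w : cube r ==> f w = g w" shows "sep_hol r g"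
 unfolding sep_hol_def
proof (intro conjI ballI allI)
 show "continuous_on (cube r) g" using f eq by (auto simp: sep_hol_def intro: continuous_on_eq)
 fix z :: "complex ^ 'k" and i assume z: "z : cube r"
 show "(%q. g (upd z i q)) holomorphic_on ball 0 r" by (rule holomorphic_transform[of "%q. f (upd z i q)"])
   (use f z in \<open>auto simp: sep_hol_def intro!: eq upd_in_cube\<close>)
qed

lemma sep_hol_inverse:
 fixes f :: "complex ^ 'k => complex" assumes f: "sep_hol r f" and nz: "\<And>w. w : cube r ==> f w ~= 0"
 shows "sep_hol r (%w. inverse (f w))" unfolding sep_hol_def
proof (intro conjI ballI allI)
 show "continuous_on (cube r) (%w. inverse (f w))" using f nz by (auto simp: sep_hol_def intro!: continuous_intros)
 fix z :: "complex ^ 'k" and i assume z: "z : cube r"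
 have "f (upd z i q) ~= 0" if "q : ball 0 r" for q by (rule nz) (use that z in \<open>auto intro!: upd_in_cube\<close>)
 thus "(%q. inverse (f (upd z i q))) holomorphic_on ball 0 r"
  using f z by (auto simp: sep_hol_def intro!: holomorphic_intros)
qed

lemma sep_hol_const: "sep_hol r (%z. c)" by (simp add: sep_hol_def)

lemma sep_hol_add: "sep_hol r f ==> sep_hol r g ==> sep_hol r (%z. f z + g z)"
 by (auto simp: sep_hol_def intro!: continuous_intros holomorphic_intros)

lemma sep_hol_minus: "sep_hol r f ==> sep_hol r (%z. - f z)"
 by (auto simp: sep_hol_def intro!: continuous_intros holomorphic_intros)

lemma sep_hol_mult: "sep_hol r f ==> sep_hol r g ==> sep_hol r (%z. f z * g z)"
 by (auto simp: sep_hol_def intro!: continuous_intros holomorphic_intros)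

lemma sep_hol_power: "sep_hol r f ==> sep_hol r (%z. f z ^ n)"
 by (auto simp: sep_hol_def intro!: continuous_intros holomorphic_intros)

lemma sep_hol_sum: "(\<And>a. a : A ==> sep_hol r (f a)) ==> sep_hol r (%z. \<Sum>a\<in>A. f a z)"
 by (auto simp: sep_hol_def intro!: continuous_intros holomorphic_intros)

lemma sep_hol_newton: assumes "\<And>k. sep_hol r (p k)" shows "sep_hol r (%z. newton (%k. p k z) n)"
proof (induction n rule: less_induct)
 case (less n)
 show ?case
 proof (cases n)
  case (Suc k)
  have "sep_hol r (%z. - 1 / of_nat (Suc k) * (\<Sum>i\<le>k. newton (%k. p k z) (k - i) * p (Suc i) z))"
   by (intro sep_hol_mult sep_hol_const sep_hol_sum less assms) (auto simp: Suc)
  thus ?thesis by (simp add: Suc)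
 qed (simp add: sep_hol_const)
qed

lemma sep_hol_compose_nth: assumes "h holomorphic_on ball 0 r" shows "sep_hol r (%z. h (z $ i))" unfolding sep_hol_def
proof (intro conjI ballI allI)
 show "continuous_on (cube r) (%z. h (z $ i))" by (rule continuous_on_compose2[OF holomorphic_on_imp_continuous_on[OF assms]])
   (auto intro!: continuous_intros simp: cube_def)
 fix z :: "complex ^ 'a" and l assume "z : cube r"
 show "(%q. h (upd z l q $ i)) holomorphic_on ball 0 r" using assms by (cases "i = l") auto
qed

lemma sep_hol_nth: "sep_hol r (%z. z $ i)" by (rule sep_hol_compose_nth[of "%x. x"]) auto

lemma sep_hol_upd: assumes "sep_hol r F" "norm u < r" shows "sep_hol r (%z. F (upd z j u))" unfolding sep_hol_def
proof (intro conjI ballI allI)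
 show "continuous_on (cube r) (%z. F (upd z j u))" by (rule continuous_on_compose2[of "cube r" F])
   (use assms in \<open>auto simp: sep_hol_def intro!: continuous_intros upd_in_cube\<close>)
 fix z :: "complex ^ 'a" and i assume z: "z : cube r"
 show "(%q. F (upd (upd z i q) j u)) holomorphic_on ball 0 r"
 proof (cases "i = j")
  case False
  have "(%q. F (upd (upd z j u) i q)) holomorphic_on ball 0 r" using assms upd_in_cube[OF z] by (auto simp: sep_hol_def)
  thus ?thesis by (simp add: upd_commute[OF False])
 qed auto
qed

lemma sep_hol_circle_integral:
 fixes G :: "complex ^ 'k => complex => complex" assumes "continuous_on (cube R \<times> sphere 0 r) (%(w, e). G w e)" "r > 0"
  and hol: "\<And>e. e : sphere 0 r ==> sep_hol R (%w. G w e)" shows "sep_hol R (%w. contour_integral (circlepath 0 r) (G w))"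
 unfolding sep_hol_def
proof (intro conjI ballI allI)
 show "continuous_on (cube R) (%w. contour_integral (circlepath 0 r) (G w))"
  by (rule continuous_on_circle_integral) (use assms in auto)
 fix z :: "complex ^ 'k" and i assume z: "z : cube R"
 show "(%q. contour_integral (circlepath 0 r) (G (upd z i q))) holomorphic_on ball 0 R"
 proof (rule holomorphic_on_circle_integral)
  have "continuous_on (ball 0 R \<times> sphere 0 r) (%p. case (upd z i (fst p), snd p) of (w, e) => G w e)"
   by (rule continuous_on_compose2[OF assms(1)])
    (use z in \<open>auto intro!: continuous_intros upd_in_cube\<close>)
  thus "continuous_on (ball 0 R \<times> sphere 0 r) (%(w, e). G (upd z i w) e)" by (simp add: split_def)
  fix e :: complex assume "e : sphere 0 r"
  from hol[OF this] z show "(%w. G (upd z i w) e) holomorphic_on ball 0 R" by (auto simp: sep_hol_def)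
 qed (use assms in auto)
qed

text \<open>Cauchy's formula on a circle of radius between \<open>d\<close> and \<open>r\<close>
  writes the derivative as a contour integral depending on the parameters.\<close>

lemma partial_deriv:
 fixes P :: "complex ^ 'k => complex" assumes P: "sep_hol r P" and d: "0 < d" "d < r"
 shows "continuous_on (cube r \<times> sphere 0 d) (%(w, e). deriv (%z. P (upd w j z)) e)"
  and "e : sphere 0 d ==> sep_hol r (%w. deriv (%z. P (upd w j z)) e)"
proof -
 define R where "R = (d + r) / 2"
 have R: "d < R" "R < r" "R > 0" using d by (auto simp: R_def)
 have contP: "continuous_on (cube r) P" using P by (simp add: sep_hol_def)
 have cauchy: "deriv (%z. P (upd w j z)) e =
   contour_integral (circlepath 0 R) (%u. P (upd w j u) / (u - e)^2) / (2 * pi * \<i>)" if "w : cube r" "e : sphere 0 d" for w e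
 proof -
  have h: "(%z. P (upd w j z)) holomorphic_on ball 0 r" using P that by (auto simp: sep_hol_def)
  have "contour_integral (circlepath 0 R) (%u. P (upd w j u) / (u - e)^2) =
    (2 * pi * \<i>) * deriv (%z. P (upd w j z)) e"
  proof (rule Cauchy_contour_integral_circlepath_2)
   show "continuous_on (cball 0 R) (%z. P (upd w j z))"
    by (rule holomorphic_on_imp_continuous_on[OF holomorphic_on_subset[OF h]]) (use R in auto)
   show "(%z. P (upd w j z)) holomorphic_on ball 0 R" by (rule holomorphic_on_subset[OF h]) (use R in auto)
  qed (use R that in auto)
  thus ?thesis by simp
 qed
 have contG: "continuous_on ((cube r \<times> sphere 0 d) \<times> sphere 0 R) (%(p, u). P (upd (fst p) j u) / (u - snd p)^2)"
  unfolding split_def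
 proof (intro continuous_intros)
  show "continuous_on ((cube r \<times> sphere 0 d) \<times> sphere 0 R) (%p. P (upd (fst (fst p)) j (snd p)))"
   by (rule continuous_on_compose2[OF contP])
    (use R in \<open>auto intro!: continuous_intros upd_in_cube\<close>)
 qed (use R in auto)
 have "continuous_on (cube r \<times> sphere 0 d)
  (%p. contour_integral (circlepath 0 R) (%u. P (upd (fst p) j u) / (u - snd p)^2) / (2 * pi * \<i>))"
  by (intro continuous_intros continuous_on_circle_integral contG) (use R in auto)
 thus "continuous_on (cube r \<times> sphere 0 d) (%(w, e). deriv (%z. P (upd w j z)) e)"
  by (rule continuous_on_eq) (auto simp: cauchy)
 assume e: "e : sphere 0 d"
 have "sep_hol r (%w. 1 / (2 * pi * \<i>) * contour_integral (circlepath 0 R) (%u. P (upd w j u) / (u - e)^2))"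
 proof (intro sep_hol_mult sep_hol_const sep_hol_circle_integral)
  have "continuous_on (cube r \<times> sphere 0 R)
    (%q. case ((fst q, e), snd q) of (p, u) => P (upd (fst p) j u) / (u - snd p)^2)"
   by (rule continuous_on_compose2[OF contG]) (use e in \<open>auto intro!: continuous_intros\<close>)
  thus "continuous_on (cube r \<times> sphere 0 R) (%(w, u). P (upd w j u) / (u - e)\<^sup>2)" by (simp add: split_def)
  fix u :: complex assume "u : sphere 0 R"
  hence "sep_hol r (%w. P (upd w j u) * (1 / (u - e)^2))" using R by (intro sep_hol_mult sep_hol_const sep_hol_upd P) auto
  thus "sep_hol r (%w. P (upd w j u) / (u - e)^2)" by simp
 qed (use R in auto)
 thus "sep_hol r (%w. deriv (%z. P (upd w j z)) e)" by (rule sep_hol_cong) (subst cauchy[OF _ e], auto)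
qed

text \<open>By the argument principle this is the sum of \<open>g ^ k\<close> over the zeros of
  \<open>P\<close> in the variable \<open>j\<close> inside the circle of radius \<open>d\<close>,
  provided that none lies on the circle.\<close>

definition psum ::
  "(complex ^ 'k => complex) => (complex ^ 'k => complex) => 'k => real => nat => complex ^ 'k => complex" where
 "psum P g j d k w = 1 / (2 * pi * \<i>) * contour_integral (circlepath 0 d)
  (%z. g (upd w j z) ^ k * (deriv (%z. P (upd w j z)) z / P (upd w j z)))"

lemma sep_hol_psum: assumes P: "sep_hol r P" and g: "sep_hol r g" and d: "0 < d" "d < r" and r': "r' <= r"
  and nz: "\<And>w z. w : cube r' ==> norm z = d ==> P (upd w j z) ~= 0" shows "sep_hol r' (psum P g j d k)"
proof -
 have comp: "continuous_on (cube r' \<times> sphere 0 d) (%p. F (upd (fst p) j (snd p)))" if "sep_hol r F" for F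
  by (rule continuous_on_compose2[of "cube r" F])
   (use d that cube_mono[OF r'] in \<open>auto simp: sep_hol_def intro!: continuous_intros upd_in_cube\<close>)
 have D: "continuous_on (cube r' \<times> sphere 0 d) (%(w, e). deriv (%z. P (upd w j z)) e)"
  by (rule continuous_on_subset[OF partial_deriv(1)[OF P d]]) (use cube_mono[OF r'] in auto)
 have "sep_hol r' (%w. 1 / (2 * pi * \<i>) * contour_integral (circlepath 0 d)
  (%z. g (upd w j z) ^ k * (deriv (%z. P (upd w j z)) z / P (upd w j z))))"
 proof (rule sep_hol_mult[OF sep_hol_const], rule sep_hol_circle_integral)
  show "continuous_on (cube r' \<times> sphere 0 d)
   (%(w, z). g (upd w j z) ^ k * (deriv (%z. P (upd w j z)) z / P (upd w j z)))" unfolding split_def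
   by (intro continuous_intros comp P g D[unfolded split_def]) (use nz in auto)
  fix e :: complex assume e: "e : sphere 0 d"
  have inv: "sep_hol r' (%w. inverse (P (upd w j e)))"
   by (rule sep_hol_inverse[OF sep_hol_mono[OF sep_hol_upd[OF P] r']]) (use e d nz in auto)
  have "sep_hol r' (%w. g (upd w j e) ^ k * (deriv (%z. P (upd w j z)) e * inverse (P (upd w j e))))"
   by (intro sep_hol_mult sep_hol_power inv sep_hol_mono[OF sep_hol_upd[OF g] r']
     sep_hol_mono[OF partial_deriv(2)[OF P d e] r']) (use e d in auto)
  thus "sep_hol r' (%w. g (upd w j e) ^ k * (deriv (%z. P (upd w j z)) e / P (upd w j e)))" by (simp add: divide_inverse)
 qed (use d in auto)
 thus ?thesis by (simp add: psum_def[abs_def])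
qed

lemma psum_roots: assumes P: "sep_hol r P" and a: "0 < a" "a < r" and w: "w : cube r" and nz: "\<And>z. norm z = a ==> P (upd w j z) ~= 0"
 shows "EX rs. set rs = {z : ball 0 a. P (upd w j z) = 0} &
  (ALL g k. sep_hol r g --> psum P g j a k w = (\<Sum>z\<leftarrow>rs. g (upd w j z) ^ k)) &
  (ALL d>0. zero_order d r a (%z. P (upd w j z)) --> rs = replicate d 0)"
proof -
 define f where "f z = P (upd w j z)" for z
 have h: "(%z. F (upd w j z)) holomorphic_on ball 0 r" if "sep_hol r F" for F using that w by (auto simp: sep_hol_def)
 have "EX rs. set rs = {z : ball 0 a. f z = 0} &
  (ALL h. h holomorphic_on ball 0 r -->
   contour_integral (circlepath 0 a) (%z. h z * (deriv f z / f z)) = 2 * pi * \<i> * (\<Sum>z\<leftarrow>rs. h z)) &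
  (ALL d>0. zero_order d r a f --> rs = replicate d 0)"
  by (rule root_list_integral[OF _ a]) (use h[OF P] nz in \<open>simp_all add: f_def[abs_def]\<close>)
 then obtain rs where rs: "set rs = {z : ball 0 a. f z = 0}"
  "ALL h. h holomorphic_on ball 0 r -->
   contour_integral (circlepath 0 a) (%z. h z * (deriv f z / f z)) = 2 * pi * \<i> * (\<Sum>z\<leftarrow>rs. h z)"
  "ALL d>0. zero_order d r a f --> rs = replicate d 0" by (elim exE conjE)
 have "psum P g j a k w = (\<Sum>z\<leftarrow>rs. g (upd w j z) ^ k)" if g: "sep_hol r g" for g k
 proof -
  have "(%z. g (upd w j z) ^ k) holomorphic_on ball 0 r" by (intro holomorphic_intros h g)
  with rs(2) have "contour_integral (circlepath 0 a) (%z. g (upd w j z) ^ k * (deriv f z / f z)) =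
    2 * pi * \<i> * (\<Sum>z\<leftarrow>rs. g (upd w j z) ^ k)" by blast
  thus ?thesis by (simp add: psum_def f_def[abs_def])
 qed
 with rs(1,3) show ?thesis unfolding f_def[abs_def] by blast
qed

lemma nonvanishing_near_circle: assumes P: "sep_hol r P" and d: "0 < d" "d < r" and nz: "\<And>z. norm z = d ==> P (upd 0 j z) ~= 0"
 shows "EX r'>0. r' <= d & (ALL w:cube r'. ALL z. norm z = d --> P (upd w j z) ~= 0)"
proof -
 define W where "W = {p : cube r \<times> ball 0 r. P (upd (fst p) j (snd p)) ~= 0}"
 have "continuous_on (cube r \<times> ball 0 r) (%p. P (upd (fst p) j (snd p)))" by (rule continuous_on_compose2[of "cube r" P])
   (use P in \<open>auto simp: sep_hol_def intro!: continuous_intros upd_in_cube\<close>)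
 moreover have op: "open (cube r \<times> ball (0::complex) r)" by (intro open_Times open_cube open_ball)
 ultimately have "open ((cube r \<times> ball 0 r) Int (%p. P (upd (fst p) j (snd p))) -` (- {0}))"
  by (subst (asm) continuous_on_open_vimage[OF op]) (auto simp: Int_commute)
 also have "(cube r \<times> ball 0 r) Int (%p. P (upd (fst p) j (snd p))) -` (- {0}) = W" by (auto simp: W_def)
 finally have "open W" .
 moreover have "{0} \<times> sphere 0 d <= W" using d nz zero_in_cube[of r] by (auto simp: W_def)
 ultimately obtain X0 where X0: "0 : X0" "open X0" "X0 \<times> sphere 0 d <= W"
  using Elementary_Topology.tube_lemma[of "sphere 0 d" W 0] by auto
 obtain e where e: "e > 0" "cube e <= X0" by (rule cube_in_open[OF X0(2,1)]) blast
 show ?thesis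
 proof (intro exI[of _ "min e d"] conjI ballI allI impI)
  fix w :: "complex ^ 'a" and z :: complex assume w: "w : cube (min e d)" "norm z = d"
  hence "(w, z) : X0 \<times> sphere 0 d" using cube_mono[of "min e d" e] e by auto
  hence "(w, z) : W" using X0(3) by blast
  thus "P (upd w j z) ~= 0" by (simp add: W_def)
 qed (use e d in auto)
qed

text \<open>With weight 1 the integral counts zeros: it is continuous and integer-valued on a
  connected cube.\<close>

lemma psum_degree_constant: assumes P: "sep_hol r P" and d: "0 < d" "d < r" and r': "r' <= r"
  and nz: "\<And>w z. w : cube r' ==> norm z = d ==> P (upd w j z) ~= 0" and w: "w : cube r'" "w' : cube r'"
 shows "psum P (%_. 1) j d k w = psum P (%_. 1) j d k w'"
proof -
 let ?f = "psum P (%_. 1) j d k"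
 have nat: "EX n. ?f x = of_nat n" if x: "x : cube r'" for x
 proof -
  obtain rs where "ALL g k. sep_hol r g --> psum P g j d k x = (\<Sum>z\<leftarrow>rs. g (upd x j z) ^ k)"
   using psum_roots[OF P d, of x j] x nz[OF x] cube_mono[OF r'] by blast
  from this[rule_format, of "%_. 1" k] show ?thesis by (auto simp: sep_hol_const sum_list_triv)
 qed
 have "?f constant_on cube r'"
 proof (rule continuous_discrete_range_constant)
  show "connected (cube r' :: (complex ^ 'a) set)" by (intro convex_connected convex_cube)
  show "continuous_on (cube r') ?f" using sep_hol_psum[OF P sep_hol_const d r' nz] by (auto simp: sep_hol_def)
  fix x :: "complex ^ 'a" assume x: "x : cube r'"
  show "EX e>0. ALL y. y : cube r' & ?f y ~= ?f x --> e <= norm (?f y - ?f x)"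
  proof (intro exI[of _ 1] conjI allI impI)
   fix y assume y: "y : cube r' & ?f y ~= ?f x"
   obtain n m where nm: "?f y = of_nat n" "?f x = of_nat m" using nat x y by blast
   hence df: "?f y - ?f x = of_int (int n - int m)" by simp
   have "int n - int m ~= 0" using y nm by auto
   hence "1 <= \<bar>int n - int m\<bar>" by linarith
   hence "1 <= real_of_int \<bar>int n - int m\<bar>" by linarith
   thus "1 <= norm (?f y - ?f x)" by (simp only: norm_of_int df of_int_abs)
  qed simp
 qed
 then obtain c where "ALL x:cube r'. ?f x = c" unfolding constant_on_def by blast
 thus ?thesis using w by simp
qed

lemma depends_on_upd:
 fixes F :: "complex ^ 'k => complex" and w w' :: "complex ^ 'k" assumes "depends_on (insert j J) F" and "ALL i:J. w $ i = w' $ i"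
 shows "F (upd w j z) = F (upd w' j z)"
proof -
 have "ALL i:insert j J. upd w j z $ i = upd w' j z $ i" using assms(2) by simp
 thus ?thesis using assms(1) unfolding depends_on_def by blast
qed

lemma depends_on_psum: assumes "depends_on (insert j J) P" "depends_on (insert j J) g" shows "depends_on J (psum P g j d k)"
 unfolding depends_on_def
proof (intro allI impI)
 fix z z' :: "complex ^ 'a" assume "ALL i:J. z $ i = z' $ i"
 hence "P (upd z j q) = P (upd z' j q)" "g (upd z j q) = g (upd z' j q)" for q
  using depends_on_upd[OF assms(1)] depends_on_upd[OF assms(2)] by blast+
 thus "psum P g j d k z = psum P g j d k z'" by (simp add: psum_def)
qed

section \<open>Elimination\<close>

text \<open>Many simultaneous equations are replaced by combinations with weights
  \<open>of_nat c ^ i\<close>. If every vector \<open>v r\<close> were nonzero, each would give a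
  nonzero polynomial in \<open>c\<close> with at most \<open>k\<close> roots, and all of them
  together could account for at most \<open>d * k\<close> values of \<open>c\<close>.\<close>

lemma combination_pigeonhole:
 fixes v :: "'r => nat => complex" assumes R: "finite R" "card R <= d"
  and c: "\<And>c. c < d * k + 1 ==> EX r:R. (\<Sum>i<k. of_nat c ^ i * v r i) = 0"
 obtains r where "r : R" "\<And>i. i < k ==> v r i = 0"
proof -
 have "EX r:R. ALL i<k. v r i = 0"
 proof (rule ccontr)
 assume "~ (EX r:R. ALL i<k. v r i = 0)"
 hence ex: "EX i<k. v r i ~= 0" if "r : R" for r using that by blast
 define p where "p r = (\<Sum>i<k. monom (v r i) i)" for r
 have pp: "poly (p r) x = (\<Sum>i<k. x ^ i * v r i)" for r x by (simp add: p_def poly_sum poly_monom mult.commute)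
 have coeff: "coeff (p r) i = (if i < k then v r i else 0)" for r i by (simp add: p_def coeff_sum)
 have pnz: "p r ~= 0" if "r : R" for r using ex[OF that] coeff[of r] by (metis coeff_0)
 have deg: "degree (p r) <= k" for r by (rule degree_le) (simp add: coeff)
 have "of_nat ` {..<d * k + 1} <= (\<Union>r\<in>R. {x::complex. poly (p r) x = 0})" using c by (force simp: pp)
 hence "card (of_nat ` {..<d * k + 1} :: complex set) <= card (\<Union>r\<in>R. {x::complex. poly (p r) x = 0})"
  by (rule card_mono[rotated]) (use R pnz poly_roots_finite in auto)
 also have "... <= (\<Sum>r\<in>R. card {x::complex. poly (p r) x = 0})" by (rule card_UN_le[OF R(1)])
 also have "... <= (\<Sum>r\<in>R. k)" by (rule sum_mono) (rule order.trans[OF card_poly_roots_bound[OF pnz] deg])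
 also have "... <= d * k" using R by simp
 also have "card (of_nat ` {..<d * k + 1} :: complex set) = d * k + 1" by (subst card_image) (auto simp: inj_on_def)
 finally show False by simp
 qed
 thus thesis using that by blast
qed

lemma zero_order_exists: assumes h: "h holomorphic_on ball 0 R" and nz: "EX z:ball 0 R. h z ~= 0" and "e > 0"
 shows "EX d a. 0 < a & a < R & a < e & zero_order d R a h"
proof -
 have R: "R > 0" using nz by (auto intro: le_less_trans[OF norm_ge_zero])
 define d where "d = nat (zorder h 0)"
 have "0 : ball (0::complex) R" using R by simp
 note zorder_exist_zero[OF h open_ball connected_ball this nz]
 from conjunct2[OF this] obtain r where r: "r > 0" "cball (0::complex) r <= ball 0 R" "zor_poly h 0 holomorphic_on cball 0 r"
  "ALL w:cball 0 r. h w = zor_poly h 0 w * (w - 0) ^ d & zor_poly h 0 w ~= 0" unfolding d_def by blast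
 \<comment> \<open>\<open>zor_poly\<close> is known to be holomorphic only near 0; outside a small
   disc the cofactor is the plain quotient.\<close>
 define g where "g z = (if z : ball 0 r then zor_poly h 0 z else h z / z ^ d)" for z
 have "g holomorphic_on ball 0 r Un (ball 0 R - {0})"
 proof (rule holomorphic_on_Un)
  show "g holomorphic_on ball 0 r" by (rule holomorphic_transform[OF holomorphic_on_subset[OF r(3)]]) (auto simp: g_def)
  show "g holomorphic_on ball 0 R - {0}" by (rule holomorphic_transform[of "%z. h z / z ^ d"])
    (use r(4) in \<open>auto intro!: holomorphic_intros holomorphic_on_subset[OF h] simp: g_def\<close>)
 qed auto
 also have "ball 0 r Un (ball 0 R - {0}) = ball (0::complex) R" using r(1,2) by auto
 finally have g: "g holomorphic_on ball 0 R" .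
 have gg: "g z = zor_poly h 0 z" if "z : cball 0 r" for z using r(1) bspec[OF r(4) that] by (cases "z = 0") (auto simp: g_def)
 have "h z = z ^ d * g z" if "z : ball 0 R" for z using r(1) bspec[OF r(4), of z] by (auto simp: g_def)
 hence "zero_order d R (min (min r (e / 2)) (R / 2)) h" unfolding zero_order_def using g gg r(4) by (intro exI[of _ g]) auto
 thus ?thesis by (intro exI[of _ d] exI[of _ "min (min r (e / 2)) (R / 2)"]) (use r R assms(3) in auto)
qed

text \<open>The norm method. Over each point of a small cube a suitable member \<open>P\<close> of
  \<open>F\<close> has the same number \<open>d\<close> of zeros in the variable \<open>j\<close>.
  The product of the values of a combination of \<open>F\<close> over these zeros is a function of
  the other variables, and enough combinations detect a common zero of \<open>F\<close> above the
  point.\<close>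

lemma eliminate:
 fixes F :: "(complex ^ 'k => complex) set" assumes F: "finite F" "\<And>f. f : F ==> sep_hol R f & depends_on (insert j J) f & f 0 = 0"
  and R: "R > 0" and j: "j ~: J" "l : J"
  and iso: "\<And>z. z : cube R ==> ALL f:F. f z = 0 ==> z $ l = 0 ==> ALL i. i ~: insert j J --> z $ i = 0 ==> z = 0"
 shows "EX F' R'. 0 < R' & R' <= R & finite F' &
  (ALL f:F'. sep_hol R' f & depends_on J f & f 0 = 0) &
  (ALL z:cube R'. (ALL f:F. f z = 0) --> (ALL f:F'. f z = 0)) &
  (ALL z:cube R'. (ALL f:F'. f z = 0) --> z $ l = 0 --> (ALL i. i ~: J --> z $ i = 0) --> z = 0)"
proof -
 \<comment> \<open>By \<open>iso\<close> the functions in \<open>F\<close> have no common zero on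
   the \<open>j\<close>-axis except the origin, so one of them is not identically zero
   there.\<close>
 have "EX P:F. P (upd 0 j (of_real (R / 2))) ~= 0"
 proof (rule ccontr)
  assume "~ ?thesis"
  hence "upd 0 j (of_real (R / 2)) = 0" using R j by (intro iso) (auto simp: cube_def)
  hence "upd 0 j (of_real (R / 2)) $ j = 0" by simp
  thus False using R by simp
 qed
 then obtain P where P: "P : F" "P (upd 0 j (of_real (R / 2))) ~= 0" by blast
 have PF: "sep_hol R P" "depends_on (insert j J) P" using F P by auto
 have hP: "(%q. P (upd 0 j q)) holomorphic_on ball 0 R" using PF zero_in_cube[OF R] by (auto simp: sep_hol_def)
 have ex: "EX q:ball 0 R. P (upd 0 j q) ~= 0" using P(2) R by (intro bexI[of _ "of_real (R / 2)"]) auto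
 obtain d0 b where b: "0 < b" "b < R" "zero_order d0 R b (%q. P (upd 0 j q))" using zero_order_exists[OF hP ex R] by blast
 have nz0: "P (upd 0 j q) ~= 0" if "norm q = b" for q using b that unfolding zero_order_def by force
 obtain R' where R': "0 < R'" "R' <= b" and
  nz: "\<And>w q. w : cube R' ==> norm q = b ==> P (upd w j q) ~= 0" using nonvanishing_near_circle[OF PF(1) b(1,2) nz0] by blast
 have le: "R' <= R" using R' b by simp
 have "EX d. psum P (%_. 1) j b 0 0 = of_nat d"
 proof -
  obtain rs where "ALL g k. sep_hol R g --> psum P g j b k 0 = (\<Sum>q\<leftarrow>rs. g (upd 0 j q) ^ k)"
   using psum_roots[OF PF(1) b(1,2) zero_in_cube[OF R] nz0] by blast
  from this[rule_format, of "%_. 1" 0] show ?thesis by (auto simp: sep_hol_const sum_list_triv)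
 qed
 then obtain d where d: "psum P (%_. 1) j b 0 0 = of_nat d" by blast
 have roots: "EX rs. length rs = d & set rs = {q : ball 0 b. P (upd w j q) = 0} &
   (ALL g k. sep_hol R g --> psum P g j b k w = (\<Sum>q\<leftarrow>rs. g (upd w j q) ^ k))" if w: "w : cube R'" for w
 proof -
  have w': "w : cube R" using w cube_mono[OF le] by blast
  obtain rs where rs: "set rs = {q : ball 0 b. P (upd w j q) = 0}"
   "ALL g k. sep_hol R g --> psum P g j b k w = (\<Sum>q\<leftarrow>rs. g (upd w j q) ^ k)" using psum_roots[OF PF(1) b(1,2) w' nz[OF w]] by blast
  have "psum P (%_. 1) j b 0 w = psum P (%_. 1) j b 0 0"
   by (rule psum_degree_constant[OF PF(1) b(1,2) le nz w zero_in_cube[OF R'(1)]])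
  hence "(of_nat (length rs) :: complex) = of_nat d"
   using rs(2)[rule_format, of "%_. 1" 0] by (simp add: sep_hol_const sum_list_triv d)
  thus ?thesis using rs by auto
 qed
 obtain fs where fs: "set fs = F" using finite_list[OF F(1)] by blast
 define k where "k = length fs"
 define comb where "comb c z = (\<Sum>i<k. of_nat c ^ i * (fs ! i) z)" for c :: nat and z
 have fsF: "fs ! i : F" if "i < k" for i using that fs by (auto simp: k_def)
 have comb: "sep_hol R (comb c)" "depends_on (insert j J) (comb c)" for c
 proof -
  show "sep_hol R (comb c)" unfolding comb_def using F fsF by (intro sep_hol_sum sep_hol_mult sep_hol_const) auto
  show "depends_on (insert j J) (comb c)" unfolding depends_on_def
  proof (intro allI impI)
   fix z z' :: "complex ^ 'k" assume "ALL i:insert j J. z $ i = z' $ i"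
   hence "(fs ! i) z = (fs ! i) z'" if "i < k" for i using F(2)[OF fsF[OF that]] unfolding depends_on_def by blast
   thus "comb c z = comb c z'" by (simp add: comb_def)
  qed
 qed
 \<comment> \<open>Up to sign the norm of \<open>comb c\<close> over the zeros of \<open>P\<close>;
   by construction it no longer involves the variable \<open>j\<close>.\<close>
 define N where "N c w = newton (%n. psum P (comb c) j b n w) d" for c w
 have N0: "N c w = 0 \<longleftrightarrow> (EX q. norm q < b & P (upd w j q) = 0 & comb c (upd w j q) = 0)" if w: "w : cube R'" for c w
 proof -
  obtain rs where rs: "length rs = d" "set rs = {q : ball 0 b. P (upd w j q) = 0}"
   "\<And>g k. sep_hol R g ==> psum P g j b k w = (\<Sum>q\<leftarrow>rs. g (upd w j q) ^ k)" using roots[OF w] by blast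
  have "N c w = newton (%n. \<Sum>a\<leftarrow>map (%q. comb c (upd w j q)) rs. a ^ n) (length (map (%q. comb c (upd w j q)) rs))"
   unfolding N_def by (simp add: rs(1) rs(3)[OF comb(1)] o_def)
  also have "... = (- 1) ^ d * prod_list (map (%q. comb c (upd w j q)) rs)" by (subst prod_list_zero_newton) (simp add: rs(1))
  finally show ?thesis using rs(2) by (auto simp: prod_list_zero_iff image_iff)
 qed
 \<comment> \<open>For \<open>d\<close> zeros and \<open>k\<close> functions,
   \<open>d * k + 1\<close> vanishing combinations force all of \<open>F\<close> to vanish at one of
   the zeros.\<close>
 have common: "EX q. norm q < b & (ALL f:F. f (upd w j q) = 0)" if w: "w : cube R'" and z: "\<And>c. c < d * k + 1 ==> N c w = 0" for w
 proof -
  obtain rs where rs: "length rs = d" "set rs = {q : ball 0 b. P (upd w j q) = 0}" using roots[OF w] by blast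
  obtain q where q: "q : set rs" "\<And>i. i < k ==> (fs ! i) (upd w j q) = 0"
  proof (rule combination_pigeonhole[of "set rs" d k "%q i. (fs ! i) (upd w j q)"])
   show "finite (set rs)" "card (set rs) <= d" using rs(1) card_length[of rs] by auto
   fix c assume "c < d * k + 1"
   from z[OF this] show "EX r:set rs. (\<Sum>i<k. of_nat c ^ i * (fs ! i) (upd w j r)) = 0"
    using rs(2) unfolding N0[OF w] comb_def by auto
  qed blast
  have "ALL f:F. f (upd w j q) = 0" using q(2) fs by (metis in_set_conv_nth k_def)
  thus ?thesis using q(1) rs(2) by auto
 qed
 have fwd: "N c z = 0" if z: "z : cube R'" "ALL f:F. f z = 0" for z c
 proof -
  have "comb c z = 0" unfolding comb_def using z(2) fsF by (intro sum.neutral) auto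
  moreover have "norm (z $ j) < b" using cube_nth[OF z(1)] R' by (meson less_le_trans)
  ultimately show ?thesis using z P(1) by (subst N0[OF z(1)]) (auto intro!: exI[of _ "z $ j"])
 qed
 show ?thesis
 proof (intro exI[of _ R'] exI[of _ "N ` {..<d * k + 1}"] conjI ballI impI)
  fix f assume "f : N ` {..<d * k + 1}"
  then obtain c where c: "f = N c" by blast
  have "sep_hol R' (N c)" unfolding N_def[abs_def] by (intro sep_hol_newton sep_hol_psum[OF PF(1) comb(1) b(1,2) le nz])
  moreover have "depends_on J (N c)" unfolding depends_on_def N_def
  proof (intro allI impI)
   fix z z' :: "complex ^ 'k" assume "ALL i:J. z $ i = z' $ i"
   hence "psum P (comb c) j b n z = psum P (comb c) j b n z'" for n
    using depends_on_psum[OF PF(2) comb(2)] unfolding depends_on_def by blast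
   thus "newton (%n. psum P (comb c) j b n z) d = newton (%n. psum P (comb c) j b n z') d" by simp
  qed
  moreover have "N c 0 = 0" by (rule fwd) (use F zero_in_cube[OF R'(1)] in auto)
  ultimately show "sep_hol R' f" "depends_on J f" "f 0 = 0" by (simp_all add: c)
 next
  fix z assume z: "z : cube R'" "ALL f:N ` {..<d * k + 1}. f z = 0" "z $ l = 0" "ALL i. i ~: J --> z $ i = 0"
  obtain q where q: "norm q < b" "ALL f:F. f (upd z j q) = 0" using common[OF z(1)] z(2) by blast
  have zj: "upd z j q = 0" by (rule iso) (use z q b j cube_mono[OF le] in \<open>auto intro!: upd_in_cube\<close>)
  have "z $ i = 0" for i using arg_cong[OF zj, of "%x. x $ i"] z(4) j(1) by (cases "i = j") auto
  thus "z = 0" by (simp add: vec_eq_iff)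
 qed (use R' le fwd in auto)
qed

lemma eliminate_set:
 fixes F :: "(complex ^ 'k => complex) set" assumes "finite E" "l ~: E" and F: "finite F" "ALL f:F. sep_hol r f & f 0 = 0"
  and r: "r > 0" and iso: "ALL z:cube r. (ALL f:F. f z = 0) --> z $ l = 0 --> z = 0" shows "EX F' r'. 0 < r' & r' <= r & finite F' &
  (ALL f:F'. sep_hol r' f & depends_on (- E) f & f 0 = 0) &
  (ALL z:cube r'. (ALL f:F. f z = 0) --> (ALL f:F'. f z = 0)) &
  (ALL z:cube r'. (ALL f:F'. f z = 0) --> z $ l = 0 --> (ALL i:E. z $ i = 0) --> z = 0)" using assms(1,2)
proof (induction E rule: finite_induct)
 case empty
 show ?case
 proof (intro exI[of _ F] exI[of _ r] conjI ballI impI)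
  fix f assume "f : F"
  thus "depends_on (- {}) f" "sep_hol r f" "f 0 = 0" using F by (auto simp: depends_on_def vec_eq_iff[symmetric])
 qed (use F(1) r iso in auto)
next
 case (insert j E)
 hence lE: "l ~: E" by simp
 from insert.IH[OF lE] obtain F1 r1 where 1: "0 < r1" "r1 <= r" "finite F1"
  "ALL f:F1. sep_hol r1 f & depends_on (- E) f & f 0 = 0"
  "ALL z:cube r1. (ALL f:F. f z = 0) --> (ALL f:F1. f z = 0)"
  "ALL z:cube r1. (ALL f:F1. f z = 0) --> z $ l = 0 --> (ALL i:E. z $ i = 0) --> z = 0" by (elim exE conjE) (rule that)
 have E: "insert j (- insert j E) = - E" using insert by auto
 have "EX F' r'. 0 < r' & r' <= r1 & finite F' &
  (ALL f:F'. sep_hol r' f & depends_on (- insert j E) f & f 0 = 0) &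
  (ALL z:cube r'. (ALL f:F1. f z = 0) --> (ALL f:F'. f z = 0)) &
  (ALL z:cube r'. (ALL f:F'. f z = 0) --> z $ l = 0 --> (ALL i. i ~: - insert j E --> z $ i = 0) --> z = 0)"
 proof (rule eliminate[OF 1(3) _ 1(1)])
  fix f assume "f : F1"
  thus "sep_hol r1 f & depends_on (insert j (- insert j E)) f & f 0 = 0" unfolding E using 1(4) by blast
 next
  fix z assume z: "z : cube r1" "ALL f:F1. f z = 0" "z $ l = 0" "ALL i. i ~: insert j (- insert j E) --> z $ i = 0"
  have "ALL i:E. z $ i = 0" using z(4) unfolding E by blast
  thus "z = 0" using 1(6) z(1-3) by blast
 qed (use insert in auto)
 then obtain F' r' where 2: "0 < r'" "r' <= r1" "finite F'"
  "ALL f:F'. sep_hol r' f & depends_on (- insert j E) f & f 0 = 0"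
  "ALL z:cube r'. (ALL f:F1. f z = 0) --> (ALL f:F'. f z = 0)"
  "ALL z:cube r'. (ALL f:F'. f z = 0) --> z $ l = 0 --> (ALL i. i ~: - insert j E --> z $ i = 0) --> z = 0" by (elim exE conjE) (rule that)
 show ?case
 proof (intro exI[of _ F'] exI[of _ r'] conjI ballI impI)
  fix z f assume z: "z : cube r'" "ALL f:F. f z = 0" and f: "f : F'"
  have "z : cube r1" using z(1) cube_mono[OF 2(2)] by blast
  thus "f z = 0" using 1(5) z 2(5) f by blast
 next
  fix z assume z: "z : cube r'" "ALL f:F'. f z = 0" "z $ l = 0" "ALL i:insert j E. z $ i = 0"
  thus "z = 0" using 2(6) by blast
 next
  fix f assume "f : F'"
  thus "sep_hol r' f" "depends_on (- insert j E) f" "f 0 = 0" using 2(4) by blast+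
 qed (use 1(2) 2(1-3) in auto)
qed

text \<open>Weierstrass preparation: the coefficients are the Newton expressions in the power sums
  of the \<open>d\<close> zeros near 0, hence holomorphic. Over the base point the zeros are
  \<open>d\<close> copies of 0, which makes the coefficients of positive index vanish there.\<close>

lemma weierstrass_polynomial:
 fixes P :: "complex ^ 'k => complex" assumes P: "sep_hol r P" "depends_on {l, i} P" and il: "i ~= l" and b: "0 < b" "b < r"
  and d: "d > 0" "zero_order d r b (%q. P (upd 0 i q))"
 shows "EX r' e. 0 < r' & r' <= b & (ALL k. e k holomorphic_on ball 0 r') & (ALL t. e 0 t = 1) &
  (ALL k>0. e k 0 = 0) &
  (ALL z. norm (z $ l) < r' --> norm (z $ i) < b --> P z = 0 --> (\<Sum>k\<le>d. e k (z $ l) * (z $ i) ^ (d - k)) = 0)"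
proof -
 have r: "r > 0" using b by simp
 have nz0: "P (upd 0 i q) ~= 0" if "norm q = b" for q using d(2) b that unfolding zero_order_def by force
 obtain r' where r': "0 < r'" "r' <= b" and
  nz: "\<And>w q. w : cube r' ==> norm q = b ==> P (upd w i q) ~= 0" using nonvanishing_near_circle[OF P(1) b nz0] by blast
 have le: "r' <= r" using r' b by simp
 define e where "e k t = newton (%n. psum P (%z. z $ i) i b n (upd 0 l t)) k" for k t
 obtain rs0 where rs0: "ALL g k. sep_hol r g --> psum P g i b k 0 = (\<Sum>q\<leftarrow>rs0. g (upd 0 i q) ^ k)"
  "rs0 = replicate d 0" using psum_roots[OF P(1) b zero_in_cube[OF r] nz0] d by blast
 show ?thesis
 proof (intro exI[of _ r'] exI[of _ e] conjI allI impI)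
  fix k
  have "sep_hol r' (%w. newton (%n. psum P (%z. z $ i) i b n w) k)"
   by (intro sep_hol_newton sep_hol_psum[OF P(1) sep_hol_nth b le nz])
  thus "e k holomorphic_on ball 0 r'" using zero_in_cube[OF r'(1)] unfolding e_def[abs_def] sep_hol_def by blast
  assume "0 < k"
  have "e k 0 = newton (%n. \<Sum>a\<leftarrow>rs0. a ^ n) k"
   using upd_same[of 0 l] rs0(1)[rule_format, OF sep_hol_nth, of i] by (simp add: e_def)
  also have "... = 0" unfolding newton_power_sums using \<open>0 < k\<close> by (simp add: rs0(2) fps_one_nth)
  finally show "e k 0 = 0" .
 next
  fix z :: "complex ^ 'k" assume z: "norm (z $ l) < r'" "norm (z $ i) < b" "P z = 0"
  define w where "w = upd 0 l (z $ l)"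
  have w: "w : cube r'" using z r' unfolding w_def by (intro upd_in_cube zero_in_cube) auto
  have w': "w : cube r" using w cube_mono[OF le] by blast
  obtain rs where rs: "set rs = {q : ball 0 b. P (upd w i q) = 0}"
   "ALL g k. sep_hol r g --> psum P g i b k w = (\<Sum>q\<leftarrow>rs. g (upd w i q) ^ k)" using psum_roots[OF P(1) b w' nz[OF w]] by blast
  have "psum P (%_. 1) i b 0 w = psum P (%_. 1) i b 0 0" by (rule psum_degree_constant[OF P(1) b le nz w zero_in_cube[OF r'(1)]])
  hence "(of_nat (length rs) :: complex) = of_nat d"
   using rs(2)[rule_format, of "%_. 1" 0] rs0(1)[rule_format, of "%_. 1" 0] by (simp add: sep_hol_const sum_list_replicate sum_list_triv rs0(2))
  hence len: "length rs = d" by simp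
  have "ALL a:{l, i}. upd w i (z $ i) $ a = z $ a" using il by (auto simp: w_def)
  hence "P (upd w i (z $ i)) = P z" using P(2) unfolding depends_on_def by blast
  hence "z $ i : set rs" using z rs(1) by auto
  hence "0 : set (map (%a. z $ i - a) rs)" by force
  hence "0 = (\<Prod>a\<leftarrow>rs. z $ i - a)" using prod_list_zero_iff by metis
  also have "... = (\<Sum>k\<le>d. e k (z $ l) * (z $ i) ^ (d - k))"
   unfolding prod_list_newton len e_def w_def[symmetric] using rs(2)[rule_format, OF sep_hol_nth, of i] by simp
  finally show "(\<Sum>k\<le>d. e k (z $ l) * (z $ i) ^ (d - k)) = 0" by simp
 qed (use r' e_def in auto)
qed

text \<open>Finiteness over the \<open>l\<close>-th coordinate: elimination of all variables except
  \<open>l\<close> and \<open>i\<close> leaves a relation between these two, and its Weierstrass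
  polynomial is an equation of integral dependence.\<close>

lemma integral_coordinate:
 fixes F :: "(complex ^ 'k => complex) set" assumes F: "finite F" "ALL f:F. sep_hol r f & f 0 = 0" and r: "r > 0" and il: "i ~= l"
  and iso: "ALL z:cube r. (ALL f:F. f z = 0) --> z $ l = 0 --> z = 0"
 shows "EX r' d e. 0 < r' & d > 0 & (ALL k. e k holomorphic_on ball 0 r') & (ALL t. e 0 t = 1) &
  (ALL k>0. e k 0 = 0) &
  (ALL z:cube r'. (ALL f:F. f z = 0) --> (\<Sum>k\<le>d. e k (z $ l) * (z $ i) ^ (d - k)) = 0)"
proof -
 have fin: "finite (UNIV - {l, i})" by simp
 have J: "- (UNIV - {l, i}) = {l, i}" by auto
 have "l ~: UNIV - {l, i}" by simp
 from eliminate_set[OF fin this F r iso, unfolded J] obtain F1 r1 where 1: "0 < r1" "r1 <= r" "finite F1"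
  "ALL f:F1. sep_hol r1 f & depends_on {l, i} f & f 0 = 0"
  "ALL z:cube r1. (ALL f:F. f z = 0) --> (ALL f:F1. f z = 0)"
  "ALL z:cube r1. (ALL f:F1. f z = 0) --> z $ l = 0 --> (ALL i:UNIV - {l, i}. z $ i = 0) --> z = 0" by (elim exE conjE) (rule that)
 have "EX P:F1. P (upd 0 i (of_real (r1 / 2))) ~= 0"
 proof (rule ccontr)
  assume "~ ?thesis"
  hence "upd 0 i (of_real (r1 / 2)) = 0" using 1(1) il by (intro 1(6)[rule_format]) (auto simp: cube_def)
  hence "upd 0 i (of_real (r1 / 2)) $ i = 0" by simp
  thus False using 1(1) by simp
 qed
 then obtain P where P: "P : F1" "P (upd 0 i (of_real (r1 / 2))) ~= 0" by blast
 have PF: "sep_hol r1 P" "depends_on {l, i} P" "P 0 = 0" using 1(4) P(1) by blast+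
 have hP: "(%q. P (upd 0 i q)) holomorphic_on ball 0 r1" using PF zero_in_cube[OF 1(1)] by (auto simp: sep_hol_def)
 have ex: "EX q:ball 0 r1. P (upd 0 i q) ~= 0" using P(2) 1(1) by (intro bexI[of _ "of_real (r1 / 2)"]) auto
 obtain d a where a: "0 < a" "a < r1" "zero_order d r1 a (%q. P (upd 0 i q))" using zero_order_exists[OF hP ex 1(1)] by blast
 have "upd 0 i 0 = (0 :: complex ^ 'k)" using upd_same[of 0 i] by simp
 \<comment> \<open>The value of \<open>P\<close> at the origin, read in its factorization; as
   \<open>0 ^ 0 = 1\<close>, it excludes \<open>d = 0\<close>.\<close>
 hence "EX c. 0 = 0 ^ d * c & c ~= (0 :: complex)"
 proof -
  obtain g where g: "ALL q:ball 0 r1. P (upd 0 i q) = q ^ d * g q" "ALL q. norm q <= a --> g q ~= 0"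
   using a(3) unfolding zero_order_def by blast
  have "0 = 0 ^ d * g 0" using bspec[OF g(1), of 0] PF(3) 1(1) \<open>upd 0 i 0 = 0\<close> by simp
  moreover have "g 0 ~= 0" using g(2) a(1) by simp
  ultimately show ?thesis by blast
 qed
 hence d: "d > 0" by (cases d) auto
 from weierstrass_polynomial[OF PF(1,2) il a(1,2) d a(3)] obtain r' e where
  2: "0 < r'" "r' <= a" "ALL k. e k holomorphic_on ball 0 r'" "ALL t. e 0 t = 1" "ALL k>0. e k 0 = 0"
  "ALL z. norm (z $ l) < r' --> norm (z $ i) < a --> P z = 0 --> (\<Sum>k\<le>d. e k (z $ l) * (z $ i) ^ (d - k)) = 0"
  by (elim exE conjE) (rule that)
 show ?thesis
 proof (intro exI[of _ r'] exI[of _ d] exI[of _ e] conjI ballI impI)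
  fix z :: "complex ^ 'k" assume z: "z : cube r'" "ALL f:F. f z = 0"
  have "z : cube r1" using z(1) cube_mono[of r' r1] 2(2) a(2) by auto
  with 1(5) z(2) P(1) have "P z = 0" by blast
  thus "(\<Sum>k\<le>d. e k (z $ l) * (z $ i) ^ (d - k)) = 0"
   using cube_nth[OF z(1), of l] cube_nth[OF z(1), of i] 2(2) by (intro 2(6)[rule_format]) auto
 qed (use 2 d in auto)
qed

section \<open>Puiseux's theorem\<close>

lemma norm_power_le_self: "norm (s::complex) <= 1 ==> k > 0 ==> norm (s ^ k) <= norm s"
 using power_decreasing[of 1 k "norm s"] by (simp add: norm_power)

lemma power_in_ball: "s : ball (0::complex) r ==> r <= 1 ==> r <= r' ==> k > 0 ==> s ^ k : ball 0 r'"
 using norm_power_le_self[of s k] by simp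

lemma holomorphic_on_power_comp: assumes "h holomorphic_on ball 0 r'" "r <= 1" "r <= r'" "k > 0"
 shows "(%s. h (s ^ k)) holomorphic_on ball 0 r"
proof -
 have "(%s. s ^ k) ` ball 0 r <= ball (0::complex) r'" using power_in_ball[OF _ assms(2,3,4)] by blast
 moreover have "(%s. s ^ k) holomorphic_on ball (0::complex) r" by (intro holomorphic_intros)
 ultimately show ?thesis using holomorphic_on_compose_gen[of "%s. s ^ k" "ball 0 r" h "ball 0 r'"] assms(1) by (simp add: o_def)
qed

lemma shift_monic:
 fixes e :: "nat => complex" shows "(\<Sum>k\<le>d. e k * (Y - b) ^ (d - k)) =
  (\<Sum>m\<le>d. (\<Sum>k\<le>m. e k * of_nat ((d - k) choose (m - k)) * (- b) ^ (m - k)) * Y ^ (d - m))"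
proof -
 define g where "g k i = e k * of_nat ((d - k) choose i) * (- b) ^ i * Y ^ (d - (k + i))" for k i
 have "(\<Sum>k\<le>d. e k * (Y - b) ^ (d - k)) = (\<Sum>k\<le>d. \<Sum>i\<le>d - k. g k i)"
 proof (rule sum.cong[OF refl])
  fix k assume "k : {..d}"
  have "(Y - b) ^ (d - k) = ((- b) + Y) ^ (d - k)" by (simp add: algebra_simps)
  also have "... = (\<Sum>i\<le>d - k. of_nat ((d - k) choose i) * (- b) ^ i * Y ^ (d - k - i))" by (rule binomial_ring)
  finally show "e k * (Y - b) ^ (d - k) = (\<Sum>i\<le>d - k. g k i)" by (simp add: g_def sum_distrib_left mult.assoc)
 qed
 also have "... = (\<Sum>(k, i)\<in>(SIGMA k:{..d}. {..d - k}). g k i)" by (rule sum.Sigma) auto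
 also have "(SIGMA k:{..d}. {..d - k}) = {(k, i). k + i <= d}" by auto
 also have "(\<Sum>(k, i)\<in>{(k, i). k + i <= d}. g k i) = (\<Sum>m\<le>d. \<Sum>k\<le>m. g k (m - k))" by (rule sum.triangle_reindex_eq)
 also have "... = (\<Sum>m\<le>d. (\<Sum>k\<le>m. e k * of_nat ((d - k) choose (m - k)) * (- b) ^ (m - k)) * Y ^ (d - m))"
  by (auto simp: g_def sum_distrib_right intro!: sum.cong)
 finally show ?thesis .
qed

lemma monic_root_bound:
 fixes e :: "nat => complex" assumes "e 0 = 1" "(\<Sum>k\<le>d. e k * y ^ (d - k)) = 0" "ALL k<=d. norm (e k) <= B" "d > 0"
 shows "norm y <= 1 + real d * B"
proof (cases "norm y <= 1")
 case True
 have "B >= 0" using assms(3) norm_ge_zero order_trans by blast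
 thus ?thesis using True by (meson add_increasing2 mult_nonneg_nonneg of_nat_0_le_iff)
next
 case False
 have "(\<Sum>k\<le>d. e k * y ^ (d - k)) = e 0 * y ^ (d - 0) + (\<Sum>k\<in>{1..d}. e k * y ^ (d - k))"
  using assms(4) by (simp add: atMost_atLeast0 sum.atLeast_Suc_atMost)
 hence "y ^ d = - (\<Sum>k\<in>{1..d}. e k * y ^ (d - k))" using assms(1,2) by (simp add: eq_neg_iff_add_eq_0)
 hence "norm y ^ d = norm (\<Sum>k\<in>{1..d}. e k * y ^ (d - k))" by (metis norm_minus_cancel norm_power)
 also have "... <= (\<Sum>k\<in>{1..d}. norm (e k * y ^ (d - k)))" by (rule norm_sum)
 also have "... <= (\<Sum>k\<in>{1..d}. B * norm y ^ (d - 1))"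
 proof (rule sum_mono)
  fix k assume k: "k : {1..d}"
  have "norm y ^ (d - k) <= norm y ^ (d - 1)" by (rule power_increasing) (use k False in auto)
  moreover have "norm (e k) <= B" using assms(3) k by auto
  ultimately show "norm (e k * y ^ (d - k)) <= B * norm y ^ (d - 1)" unfolding norm_mult norm_power
   by (intro mult_mono) (auto intro: order_trans[OF norm_ge_zero])
 qed
 also have "... = real d * B * norm y ^ (d - 1)" by simp
 finally have "norm y * norm y ^ (d - 1) <= real d * B * norm y ^ (d - 1)" using assms(4) by (simp add: power_eq_if)
 moreover have "norm y ^ (d - 1) > 0" by (rule zero_less_power) (use False in linarith)
 ultimately have "norm y <= real d * B" by (rule mult_right_le_imp_le)
 thus ?thesis by linarith
qed

definition puiseux_cover ::
  "(complex => complex => complex) => nat => real => real => (complex => complex) set => bool" where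
 "puiseux_cover Q N r d A \<longleftrightarrow> N > 0 & r > 0 & r <= 1 & finite A & (ALL a:A. a holomorphic_on ball 0 r) &
  (ALL s:ball 0 r. ALL y. norm y < d --> Q (s ^ N) y = 0 --> (EX a:A. y = a s))"

text \<open>
 After the Tschirnhaus shift the coefficient of \<open>y ^ (d - 1)\<close> vanishes. Substituting \<open>t = s ^ q\<close> and
 \<open>y = s ^ p * y'\<close> along the steepest slope then yields a polynomial with at least two distinct roots
 at \<open>s = 0\<close>, so that the zeros near each of these roots satisfy an equation of smaller degree.
\<close>

lemma slope_substitution:
 fixes f :: "nat => complex => complex" assumes r: "r > 0" and hol: "ALL k. f k holomorphic_on ball 0 r" and f0: "ALL t. f 0 t = 1"
  and z: "ALL k>0. f k 0 = 0" and f1: "ALL t. f 1 t = 0" and ex: "EX k:{1..d}. EX t:ball 0 r. f k t ~= 0"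
 shows "EX p q E b. p > 0 & q > 0 & 0 < b & b <= 1 & b <= r & (ALL k. E k holomorphic_on ball 0 b) &
  (ALL s. E 0 s = 1) & (ALL s. E 1 s = 0) & (EX k:{2..d}. E k 0 ~= 0) &
  (ALL s:ball 0 b. ALL k<=d. f k (s ^ q) = s ^ (k * p) * E k s)"
proof -
 define K where "K = {k:{1..d}. EX t:ball 0 r. f k t ~= 0}"
 have K: "finite K" "K ~= {}" using ex by (auto simp: K_def)
 have "EX v g. g holomorphic_on ball 0 r & g 0 ~= 0 & v > 0 & (ALL t:ball 0 r. f k t = t ^ v * g t)" if k: "k : K" for k
 proof -
  obtain v e where e: "0 < e" "zero_order v r e (f k)" using zero_order_exists[of "f k" r 1] k hol by (auto simp: K_def)
  then obtain g where g: "g holomorphic_on ball 0 r" "ALL c:ball 0 r. f k c = c ^ v * g c"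
   "ALL c. norm c <= e --> g c ~= 0" unfolding zero_order_def by blast
  have g0: "g 0 ~= 0" using g(3) e(1) by simp
  have "f k 0 = 0" using z k by (auto simp: K_def)
  hence "v > 0" using bspec[OF g(2), of 0] g0 r by (cases v) auto
  thus ?thesis using g g0 by blast
 qed
 then obtain v g where vg: "ALL k:K. g k holomorphic_on ball 0 r & g k 0 ~= 0 & v k > 0 &
   (ALL t:ball 0 r. f k t = t ^ v k * g k t)" by metis
 \<comment> \<open>Minimality of \<open>v k / k\<close> makes every exponent
   \<open>q * v k - k * p\<close> nonnegative, and it is 0 for \<open>k = q\<close>, so that
   \<open>E q 0\<close> does not vanish.\<close>
 obtain q where q: "q : K" "ALL k:K. real (v q) / real q <= real (v k) / real k"
  using ex_is_arg_min_if_finite[OF K, of "%k. real (v k) / real k"] unfolding is_arg_min_linorder by blast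
 define p where "p = v q"
 have pq: "p > 0" "q > 0" using q(1) vg by (simp add: p_def) (use q(1) in \<open>simp add: K_def\<close>)
 have slope: "k * p <= q * v k" if "k : K" for k
 proof -
  have "real p * real k <= real (v k) * real q"
  proof -
   have "k > 0" using that by (simp add: K_def)
   thus ?thesis using bspec[OF q(2) that] pq by (simp add: p_def field_simps)
  qed
  hence "p * k <= v k * q" by (metis of_nat_le_iff of_nat_mult)
  thus ?thesis by (simp add: mult.commute)
 qed
 define b where "b = min 1 r"
 define E where "E k s = (if k = 0 then 1 else if k : K then s ^ (q * v k - k * p) * g k (s ^ q) else 0)" for k s
 \<comment> \<open>The vanishing of \<open>f 1\<close> excludes \<open>q = 1\<close>. A nonzero
   coefficient of index at least 2 together with \<open>E 1 = 0\<close> is what rules out a single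
   root of multiplicity \<open>d\<close>.\<close>
 have q2: "q : {2..d}"
 proof -
  have "q ~= 1" using q(1) f1 by (auto simp: K_def)
  thus ?thesis using q(1) by (auto simp: K_def)
 qed
 show ?thesis
 proof (rule exI[of _ p], rule exI[of _ q], rule exI[of _ E], rule exI[of _ b],
   intro conjI allI ballI impI)
  fix k
  show "E k holomorphic_on ball 0 b"
  proof (cases "k = 0 | k ~: K")
   case True
   hence "E k = (%s. if k = 0 then 1 else 0)" by (auto simp: E_def fun_eq_iff)
   thus ?thesis by simp
  next
   case False
   hence "E k = (%s. s ^ (q * v k - k * p) * g k (s ^ q))" by (auto simp: E_def fun_eq_iff)
   moreover have "(%s. g k (s ^ q)) holomorphic_on ball 0 b"
    by (rule holomorphic_on_power_comp[of _ r]) (use False vg pq in \<open>auto simp: b_def\<close>)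
   ultimately show ?thesis by (auto intro!: holomorphic_intros)
  qed
 next
  fix s :: complex and k assume s: "s : ball 0 b" and k: "k <= d"
  have sq: "s ^ q : ball 0 r" by (rule power_in_ball[OF s]) (use pq in \<open>auto simp: b_def\<close>)
  show "f k (s ^ q) = s ^ (k * p) * E k s"
  proof (cases "k : K")
   case True
   hence "f k (s ^ q) = s ^ (q * v k) * g k (s ^ q)" using vg sq by (simp add: power_mult)
   also have "s ^ (q * v k) = s ^ (k * p) * s ^ (q * v k - k * p)" using slope[OF True] by (metis le_add_diff_inverse power_add)
   moreover have "k ~= 0" using True by (auto simp: K_def)
   ultimately show ?thesis using True by (simp add: E_def)
  next
   case False
   thus ?thesis using sq f0 k by (cases "k = 0") (auto simp: E_def K_def)
  qed
 next
  show "E 1 s = 0" for s using f1 by (auto simp: E_def K_def)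
  have "E q 0 ~= 0" using q(1) vg pq by (auto simp: E_def p_def power_0_left)
  thus "EX k:{2..d}. E k 0 ~= 0" using q2 by blast
 qed (use pq r in \<open>auto simp: b_def E_def\<close>)
qed

text \<open>A root \<open>c\<close> of full order would make the polynomial the \<open>d\<close>-th
  power of a linear one. Its second coefficient is then a nonzero multiple of \<open>c\<close>, so
  \<open>c = 0\<close>, against the nonzero lower coefficient.\<close>

lemma order_lt_degree:
 fixes Q :: "complex poly" assumes "degree Q = d" "coeff Q d = 1" "coeff Q (d - 1) = 0" "k : {2..d}" "coeff Q (d - k) ~= 0"
 shows "order c Q < d"
proof (rule ccontr)
 assume "~ ?thesis"
 hence "[:- c, 1:] ^ d dvd Q" by (meson dvd_trans le_imp_power_dvd not_le order_1)
 then obtain R where R: "Q = [:- c, 1:] ^ d * R" by (auto elim: dvdE)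
 have Q0: "Q ~= 0" using assms(2) by auto
 hence "R ~= 0" using R by auto
 hence "degree Q = d + degree R" by (simp add: R degree_mult_eq degree_linear_power)
 hence "degree R = 0" using assms(1) by simp
 then obtain a where a: "R = [:a:]" by (meson degree_eq_zeroE)
 have co: "coeff Q i = a * (of_nat (d choose i) * (- c) ^ (d - i))" if "i <= d" for i using that
  by (simp add: R a coeff_linear_poly_power mult.commute)
 have a1: "a = 1" using co[of d] assms(2) by simp
 have "d choose (d - 1) = d" using assms(4) binomial_symmetric[of 1 d] by simp
 hence "coeff Q (d - 1) = of_nat d * (- c)" using assms(4) by (subst co) (auto simp: a1)
 hence "c = 0" using assms(3,4) by simp
 hence "coeff Q (d - k) = 0" using assms(4) by (subst co) auto
 thus False using assms(5) by simp
qed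

text \<open>Centred at the root \<open>c\<close> of the limit polynomial, the equation has order
  \<open>m < d\<close> in \<open>y\<close>. Its Weierstrass polynomial has degree \<open>m\<close>
  and falls under the induction hypothesis.\<close>

lemma root_cluster_cover:
 fixes E :: "nat => complex => complex"
 assumes IH: "\<And>m f e. m < d ==> m > 0 ==> f > 0 ==> ALL k. e k holomorphic_on ball 0 f ==> ALL t. e 0 t = 1 ==>
   ALL k>0. e k 0 = 0 ==>
   EX N r A. r <= f & (ALL a:A. a 0 = 0) & (ALL b. puiseux_cover (%t y. \<Sum>k\<le>m. e k t * y ^ (m - k)) N r b A)"
  and g: "0 < g" "g <= 1" and E: "ALL k. E k holomorphic_on ball 0 g" "ALL s. E 0 s = 1" "ALL s. E 1 s = 0"
  and nz: "k : {2..d}" "E k 0 ~= 0" and c: "(\<Sum>k\<le>d. E k 0 * c ^ (d - k)) = 0"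
 shows "EX N r b A. b > 0 & puiseux_cover (%t y. \<Sum>k\<le>d. E k t * (c + y) ^ (d - k)) N r b A"
proof -
 define Q where "Q = (\<Sum>k\<le>d. monom (E k 0) (d - k))"
 have Qy: "poly Q y = (\<Sum>k\<le>d. E k 0 * y ^ (d - k))" for y by (simp add: Q_def poly_sum poly_monom)
 have coQ: "coeff Q (d - j) = E j 0" if "j <= d" for j
 proof -
  have "coeff Q (d - j) = (\<Sum>k\<le>d. if k = j then E k 0 else 0)" unfolding Q_def coeff_sum using that by (intro sum.cong) auto
  thus ?thesis using that by simp
 qed
 have d2: "d >= 2" using nz by auto
 have Qd: "coeff Q d = 1" using coQ[of 0] E(2) by simp
 have degQ: "degree Q = d"
 proof (rule antisym)
  show "degree Q <= d" unfolding Q_def by (rule degree_sum_le) (auto intro: order_trans[OF degree_monom_le])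
  show "d <= degree Q" by (rule le_degree) (simp add: Qd)
 qed
 have Q0: "Q ~= 0" using Qd by auto
 define m where "m = order c Q"
 have m: "m < d" unfolding m_def by (rule order_lt_degree[OF degQ Qd _ nz(1)]) (use coQ[of 1] coQ[of k] E(3) nz d2 in auto)
 have "m ~= 0" using c Q0 by (simp add: m_def order_root Qy[symmetric])
 hence m0: "m > 0" by simp
 obtain R where R: "Q = [:- c, 1:] ^ m * R" "~ [:- c, 1:] dvd R" using order_decomp[OF Q0, of c] by (auto simp: m_def)
 have Rc: "poly R c ~= 0" using R(2) by (simp add: poly_eq_0_iff_dvd)
 have "isCont (%y. poly R (c + y)) 0" by (intro continuous_intros)
 from continuous_at_avoid[OF this, of 0] Rc
 obtain h where h: "h > 0" "\<And>y. dist 0 y < h ==> poly R (c + y) ~= 0" by auto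
 define b where "b = min (h / 2) (g / 2)"
 have b: "0 < b" "b < g" "b < h" using h g by (auto simp: b_def)
 \<comment> \<open>The index type \<open>bool\<close> provides two variables: \<open>False\<close>
   is the parameter, \<open>True\<close> the deviation from \<open>c\<close>.\<close>
 define P :: "complex ^ bool => complex" where
  "P z = (\<Sum>k\<le>d. E k (z $ False) * (c + z $ True) ^ (d - k))" for z
 have P: "sep_hol g P" unfolding P_def[abs_def]
  by (intro sep_hol_sum sep_hol_mult sep_hol_power sep_hol_add sep_hol_const sep_hol_nth sep_hol_compose_nth)
   (use E in auto)
 have dep: "depends_on {False, True} P" by (auto simp: depends_on_def P_def)
 have zo: "zero_order m g b (%q. P (upd 0 True q))" unfolding zero_order_def
 proof (intro exI[of _ "%q. poly R (c + q)"] conjI ballI allI impI)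
  show "(%q. poly R (c + q)) holomorphic_on ball 0 g" by (intro holomorphic_intros)
  fix q :: complex
  have "P (upd 0 True q) = poly Q (c + q)" by (simp add: P_def Qy)
  thus "P (upd 0 True q) = q ^ m * poly R (c + q)" by (simp add: R(1) poly_power)
  assume "norm q <= b"
  thus "poly R (c + q) ~= 0" using b by (intro h(2)) auto
 qed
 from weierstrass_polynomial[OF P dep _ b(1,2) m0 zo] obtain f' e where
  e: "0 < f'" "f' <= b" "ALL k. e k holomorphic_on ball 0 f'" "ALL t. e 0 t = 1" "ALL k>0. e k 0 = 0"
  "ALL z. norm (z $ False) < f' --> norm (z $ True) < b --> P z = 0 -->
   (\<Sum>k\<le>m. e k (z $ False) * (z $ True) ^ (m - k)) = 0" by auto
 obtain N r A where NrA: "r <= f'" "puiseux_cover (%t y. \<Sum>k\<le>m. e k t * y ^ (m - k)) N r b A" using IH[OF m m0 e(1,3,4,5)] by blast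
 have "puiseux_cover (%t y. \<Sum>k\<le>d. E k t * (c + y) ^ (d - k)) N r b A" unfolding puiseux_cover_def
 proof (intro conjI ballI allI impI)
  fix s y assume s: "s : ball 0 r" and y: "norm y < b" "(\<Sum>k\<le>d. E k (s ^ N) * (c + y) ^ (d - k)) = 0"
  define z :: "complex ^ bool" where "z = upd (upd 0 False (s ^ N)) True y"
  have z: "z $ False = s ^ N" "z $ True = y" by (simp_all add: z_def)
  have "s ^ N : ball 0 f'" by (rule power_in_ball[OF s]) (use NrA in \<open>auto simp: puiseux_cover_def\<close>)
  moreover have "P z = 0" using y(2) by (simp add: P_def z)
  ultimately have "(\<Sum>k\<le>m. e k (s ^ N) * y ^ (m - k)) = 0" using e(6)[rule_format, of z] y(1) by (simp add: z)
  thus "EX a:A. y = a s" using NrA(2) s y(1) unfolding puiseux_cover_def by blast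
 qed (use NrA(2) in \<open>auto simp: puiseux_cover_def\<close>)
 thus ?thesis using b(1) by blast
qed

text \<open>Continuity of roots. All roots lie in one disc; the part of the disc outside the
  prescribed neighbourhoods is compact and free of roots at \<open>s = 0\<close>, and the tube lemma
  extends this to small \<open>s\<close>.\<close>

lemma roots_near_limit_roots:
 fixes E :: "nat => complex => complex" assumes a: "0 < a" and E: "ALL k. E k holomorphic_on ball 0 a" "ALL s. E 0 s = 1" and d: "d > 0"
  and b: "ALL c. (\<Sum>k\<le>d. E k 0 * c ^ (d - k)) = 0 --> b c > 0" shows "EX h>0. h <= a & (ALL s:ball 0 h. ALL y. (\<Sum>k\<le>d. E k s * y ^ (d - k)) = 0 -->
  (EX c. (\<Sum>k\<le>d. E k 0 * c ^ (d - k)) = 0 & norm (y - c) < b c))"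
proof -
 define Q where "Q s y = (\<Sum>k\<le>d. E k s * y ^ (d - k))" for s y
 have contE: "continuous_on (ball 0 a) (E k)" for k using E(1) holomorphic_on_imp_continuous_on by blast
 have "EX B. ALL s:cball 0 (a / 2). norm (E k s) <= B" for k
 proof -
  have "compact (E k ` cball 0 (a / 2))" by (rule compact_continuous_image[OF continuous_on_subset[OF contE]]) (use a in auto)
  thus ?thesis using compact_imp_bounded bounded_iff by (metis image_eqI)
 qed
 then obtain Bk where Bk: "ALL k. ALL s:cball 0 (a / 2). norm (E k s) <= Bk k" by metis
 define B where "B = (\<Sum>k\<le>d. \<bar>Bk k\<bar>)"
 have B: "norm (E k s) <= B" if "k <= d" "s : cball 0 (a / 2)" for k s
 proof -
  have "norm (E k s) <= \<bar>Bk k\<bar>" using Bk that by (meson abs_ge_self order_trans)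
  also have "... <= B" unfolding B_def by (rule member_le_sum) (use that in auto)
  finally show ?thesis .
 qed
 define M where "M = 1 + real d * B"
 define K where "K = cball 0 M - (\<Union>c\<in>{c. Q 0 c = 0}. ball c (b c))"
 have K: "compact K" unfolding K_def by (intro compact_diff compact_cball open_UN ballI open_ball)
 define W where "W = {p : ball 0 a \<times> UNIV. Q (fst p) (snd p) ~= 0}"
 have "continuous_on (ball 0 a \<times> UNIV) (%p. Q (fst p) (snd p))" unfolding Q_def
  by (intro continuous_intros continuous_on_compose2[OF contE]) auto
 moreover have op: "open (ball (0::complex) a \<times> (UNIV :: complex set))" by (intro open_Times) auto
 ultimately have "open ((ball 0 a \<times> UNIV) Int (%p. Q (fst p) (snd p)) -` (- {0}))"
  by (subst (asm) continuous_on_open_vimage[OF op]) (auto simp: Int_commute)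
 also have "(ball 0 a \<times> UNIV) Int (%p. Q (fst p) (snd p)) -` (- {0}) = W" by (auto simp: W_def)
 finally have W: "open W" .
 have "{0} \<times> K <= W" using a b by (auto simp: W_def K_def Q_def)
 from Elementary_Topology.tube_lemma[OF K W this]
 obtain X0 where X0: "0 : X0" "open X0" "X0 \<times> K <= W" by blast
 obtain e where e: "e > 0" "ball 0 e <= X0" using X0 open_contains_ball by blast
 show ?thesis
 proof (intro exI[of _ "min e (a / 2)"] conjI ballI allI impI)
  fix s y assume s: "s : ball 0 (min e (a / 2))" and "(\<Sum>k\<le>d. E k s * y ^ (d - k)) = 0"
  hence Qsy: "Q s y = 0" by (simp add: Q_def)
  have "norm y <= M" unfolding M_def by (rule monic_root_bound[of "%k. E k s"]) (use E(2) Qsy B s d in \<open>auto simp: Q_def\<close>)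
  moreover have "y ~: K"
  proof
   assume "y : K"
   hence "(s, y) : W" using X0(3) e(2) s by auto
   thus False using Qsy by (simp add: W_def)
  qed
  ultimately obtain c where "Q 0 c = 0" "y : ball c (b c)" by (auto simp: K_def)
  thus "EX c. (\<Sum>k\<le>d. E k 0 * c ^ (d - k)) = 0 & norm (y - c) < b c"
   by (intro exI[of _ c]) (auto simp: Q_def dist_norm norm_minus_commute)
 qed (use e a in auto)
qed

text \<open>Strong induction on the degree. The bound \<open>i\<close> on the modulus of the roots
  is arbitrary, since over the small disc all roots of the polynomial are covered, not only those
  close to 0.\<close>

theorem puiseux_roots:
 fixes e :: "nat => complex => complex" assumes "d > 0" "R > 0" "ALL k. e k holomorphic_on ball 0 R" "ALL t. e 0 t = 1" "ALL k>0. e k 0 = 0"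
 shows "EX N r A. r <= R & (ALL a:A. a 0 = 0) &
  (ALL i. puiseux_cover (%t y. \<Sum>k\<le>d. e k t * y ^ (d - k)) N r i A)" using assms
proof (induction d arbitrary: R e rule: less_induct)
 case (less d)
 note d = less.prems(1) and R = less.prems(2) and hol = less.prems(3) and e0 = less.prems(4) and ez = less.prems(5)
 define b where "b t = e 1 t / of_nat d" for t
 have hb: "b holomorphic_on ball 0 R" unfolding b_def[abs_def] using hol d by (auto intro!: holomorphic_intros)
 have b0: "b 0 = 0" using ez by (simp add: b_def)
 define f where "f m t = (\<Sum>k\<le>m. e k t * of_nat ((d - k) choose (m - k)) * (- b t) ^ (m - k))" for m t
 have hf: "ALL m. f m holomorphic_on ball 0 R" unfolding f_def[abs_def] using hol hb by (auto intro!: holomorphic_intros)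
 have f0: "ALL t. f 0 t = 1" using e0 by (simp add: f_def)
 have f1: "ALL t. f 1 t = 0" using e0 d by (simp add: f_def b_def)
 have fz: "ALL m>0. f m 0 = 0"
 proof (intro allI impI)
  fix m :: nat assume "m > 0"
  thus "f m 0 = 0" unfolding f_def b0
  proof (intro sum.neutral ballI)
   fix k assume "k : {..m}"
   thus "e k 0 * of_nat ((d - k) choose (m - k)) * (- 0) ^ (m - k) = 0" using ez \<open>m > 0\<close> by (cases "k = 0") auto
  qed
 qed
 have shift: "(\<Sum>k\<le>d. e k t * y ^ (d - k)) = (\<Sum>m\<le>d. f m t * (y + b t) ^ (d - m))" for t y
  using shift_monic[of "%k. e k t" "y + b t" "b t" d] by (simp add: f_def)
 show ?case
 proof (cases "EX k:{1..d}. EX t:ball 0 R. f k t ~= 0")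
  \<comment> \<open>All shifted coefficients of positive index vanish, so the equation is
    \<open>(y + b s) ^ d = 0\<close>.\<close>
  case False
  have "puiseux_cover (%t y. \<Sum>k\<le>d. e k t * y ^ (d - k)) 1 (min 1 R) i {%s. - b s}" for i unfolding puiseux_cover_def
  proof (intro conjI ballI allI impI)
   fix s y assume s: "s : ball 0 (min 1 R)" and "(\<Sum>k\<le>d. e k (s ^ 1) * y ^ (d - k)) = 0"
   hence "(\<Sum>m\<le>d. f m s * (y + b s) ^ (d - m)) = 0" by (simp add: shift)
   moreover have "(\<Sum>m\<le>d. f m s * (y + b s) ^ (d - m)) = (\<Sum>m\<le>d. if m = 0 then (y + b s) ^ d else 0)"
    by (rule sum.cong) (use False s f0 in auto)
   ultimately have "(y + b s) ^ d = 0" by simp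
   thus "EX a:{%s. - b s}. y = a s" by (simp add: eq_neg_iff_add_eq_0)
  qed (use R hb in \<open>auto intro!: holomorphic_intros holomorphic_on_subset[OF hb]\<close>)
  thus ?thesis using b0 by (intro exI[of _ 1] exI[of _ "min 1 R"] exI[of _ "{%s. - b s}"]) auto
 next
  case True
  from slope_substitution[OF R hf f0 fz f1 True] obtain p q E g where
   pq: "p > 0" "q > 0" and g: "0 < g" "g <= 1" "g <= R" and E: "ALL k. E k holomorphic_on ball 0 g"
   "ALL s. E 0 s = 1" "ALL s. E 1 s = 0" and nz: "EX k:{2..d}. E k 0 ~= 0" and
   sub: "ALL s:ball 0 g. ALL k<=d. f k (s ^ q) = s ^ (k * p) * E k s" by (elim exE conjE) (rule that)
  obtain k where k: "k : {2..d}" "E k 0 ~= 0" using nz by blast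
  define C where "C = {c. (\<Sum>k\<le>d. E k 0 * c ^ (d - k)) = 0}"
  have "ALL c:C. EX N r i A. i > 0 & puiseux_cover (%t y. \<Sum>k\<le>d. E k t * (c + y) ^ (d - k)) N r i A" unfolding C_def
   using root_cluster_cover[OF less.IH g(1,2) E k] by blast
  then obtain Nf rf df Af where cov: "ALL c:C. df c > 0 &
    puiseux_cover (%t y. \<Sum>k\<le>d. E k t * (c + y) ^ (d - k)) (Nf c) (rf c) (df c) (Af c)"
   unfolding bchoice_iff by (elim exE) (rule that)
  have finC: "finite C"
  proof -
   define Q where "Q = (\<Sum>k\<le>d. monom (E k 0) (d - k))"
   have "poly Q y = (\<Sum>k\<le>d. E k 0 * y ^ (d - k))" for y by (simp add: Q_def poly_sum poly_monom)
   moreover have "coeff Q d = (\<Sum>k\<le>d. if k = 0 then 1 else 0)" unfolding Q_def coeff_sum using E(2) by (intro sum.cong) auto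
   hence "Q ~= 0" by auto
   ultimately show ?thesis using poly_roots_finite[of Q] by (simp add: C_def)
  qed
  from roots_near_limit_roots[OF g(1) E(1,2) d, of df] cov obtain h where h: "h > 0" "h <= g"
   "ALL s:ball 0 h. ALL y. (\<Sum>k\<le>d. E k s * y ^ (d - k)) = 0 --> (EX c:C. norm (y - c) < df c)" unfolding C_def by auto
  \<comment> \<open>One ramification for all clusters: \<open>s ^ N'\<close> is the
    \<open>Nf c\<close>-th power of \<open>s ^ M c\<close> for every limit root
    \<open>c\<close>.\<close>
  define N' where "N' = (\<Prod>c\<in>C. Nf c)"
  define M where "M c = (\<Prod>c'\<in>C - {c}. Nf c')" for c
  have Npos: "Nf c > 0" if "c : C" for c using cov that by (auto simp: puiseux_cover_def)
  have N': "N' > 0" unfolding N'_def using Npos by (auto intro!: prod_pos)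
  have Mpos: "M c > 0" for c unfolding M_def by (rule prod_pos) (use Npos in blast)
  have NM: "N' = M c * Nf c" if "c : C" for c
   unfolding N'_def M_def using prod.remove[OF finC that, of Nf] by (simp add: mult.commute)
  define r where "r = Min (insert h (rf ` C))"
  have r: "r > 0" "r <= h" "r <= g" "r <= 1" "r <= R" "\<And>c. c : C ==> r <= rf c"
  proof -
   show "r > 0" unfolding r_def using finC h(1) cov by (auto simp: puiseux_cover_def)
   show 1: "r <= h" unfolding r_def using finC by auto
   show "r <= g" "r <= 1" "r <= R" using 1 h(2) g by linarith+
   show "r <= rf c" if "c : C" for c unfolding r_def using finC that by auto
  qed
  define F where "F c a s = - b (s ^ (q * N')) + s ^ (N' * p) * (c + a (s ^ M c))" for c a s
  \<comment> \<open>At \<open>s = 0\<close> the substitution \<open>y = s ^ p * Y\<close> carries no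
    information; the zero function covers the only root there.\<close>
  define A where "A = insert (%s. 0) (\<Union>c\<in>C. F c ` Af c)"
  have "puiseux_cover (%t y. \<Sum>k\<le>d. e k t * y ^ (d - k)) (q * N') r i A" for i unfolding puiseux_cover_def
  proof (intro conjI ballI allI impI)
   show "finite A" unfolding A_def using finC cov by (auto simp: puiseux_cover_def)
   fix a assume "a : A"
   then consider "a = (%s. 0)" | c a' where "c : C" "a' : Af c" "a = F c a'" by (auto simp: A_def)
   thus "a holomorphic_on ball 0 r"
   proof cases
    case 2
    have ha: "a' holomorphic_on ball 0 (rf c)" using cov 2 by (auto simp: puiseux_cover_def)
    show ?thesis unfolding 2(3) F_def
     by (intro holomorphic_intros holomorphic_on_power_comp[OF hb] holomorphic_on_power_comp[OF ha])
      (use r pq N' Mpos 2 in auto)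
   qed auto
  next
   fix s y assume s: "s : ball 0 r" and y: "(\<Sum>k\<le>d. e k (s ^ (q * N')) * y ^ (d - k)) = 0"
   show "EX a:A. y = a s"
   proof (cases "s = 0")
    case True
    have "(\<Sum>k\<le>d. e k 0 * y ^ (d - k)) = (\<Sum>k\<le>d. if k = 0 then y ^ d else 0)" by (rule sum.cong) (use ez e0 in auto)
    hence "y = 0" using y True pq N' by (auto simp: power_0_left)
    thus ?thesis by (auto simp: A_def)
   next
    case False
    define s1 where "s1 = s ^ N'"
    have s1: "s1 ~= 0" "s1 : ball 0 h" "s ^ (q * N') = s1 ^ q"
     using False power_in_ball[OF s r(4,2) N'] by (auto simp: s1_def power_mult[symmetric] mult.commute)
    define Y where "Y = (y + b (s1 ^ q)) / s1 ^ p"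
    have Y: "y + b (s1 ^ q) = s1 ^ p * Y" using s1 by (simp add: Y_def)
    have "0 = (\<Sum>m\<le>d. f m (s1 ^ q) * (s1 ^ p * Y) ^ (d - m))" using y unfolding shift s1(3) Y by simp
    also have "... = (\<Sum>m\<le>d. s1 ^ (d * p) * (E m s1 * Y ^ (d - m)))"
    proof (rule sum.cong[OF refl])
     fix m assume m: "m : {..d}"
     have "f m (s1 ^ q) = s1 ^ (m * p) * E m s1" using sub s1(2) h(2) m by auto
     moreover have "s1 ^ (m * p) * (s1 ^ p) ^ (d - m) = s1 ^ (d * p)"
     proof -
      have "m * p + p * (d - m) = d * p" using m by (simp add: algebra_simps)
      thus ?thesis by (metis power_add power_mult)
     qed
     ultimately show "f m (s1 ^ q) * (s1 ^ p * Y) ^ (d - m) = s1 ^ (d * p) * (E m s1 * Y ^ (d - m))"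
      by (simp add: power_mult_distrib algebra_simps)
    qed
    finally have "(\<Sum>m\<le>d. E m s1 * Y ^ (d - m)) = 0" using s1(1) by (simp add: sum_distrib_left[symmetric])
    then obtain c where c: "c : C" "norm (Y - c) < df c" using h(3) s1(2) by blast
    define s2 where "s2 = s ^ M c"
    have s2: "s2 : ball 0 (rf c)" unfolding s2_def using power_in_ball[OF s r(4) r(6)[OF c(1)] Mpos] .
    have s12: "s1 = s2 ^ Nf c" using NM[OF c(1)] by (simp add: s1_def s2_def power_mult[symmetric])
    have "(\<Sum>k\<le>d. E k (s2 ^ Nf c) * (c + (Y - c)) ^ (d - k)) = 0" using \<open>(\<Sum>m\<le>d. E m s1 * Y ^ (d - m)) = 0\<close> by (simp add: s12)
    then obtain a where a: "a : Af c" "Y - c = a s2" using cov c s2 unfolding puiseux_cover_def by blast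
    have "y = F c a s"
    proof -
     have "y = - b (s1 ^ q) + s1 ^ p * Y" using Y by (simp add: algebra_simps)
     moreover have "Y = c + a (s ^ M c)" using a(2) by (simp add: s2_def algebra_simps)
     ultimately show ?thesis by (simp add: F_def s1(3)) (simp add: s1_def power_mult)
    qed
    thus ?thesis using a(1) c(1) by (auto simp: A_def)
   qed
  qed (use r pq N' in auto)
  moreover have "ALL a:A. a 0 = 0" using b0 pq N' Mpos by (auto simp: A_def F_def power_0_left)
  ultimately show ?thesis using r(5) by (intro exI[of _ "q * N'"] exI[of _ r] exI[of _ A]) auto
 qed
qed

section \<open>Holomorphic functions of several variables\<close>

definition hol_vec :: "(complex => complex ^ 'n) => complex set => bool" where
 "hol_vec g S \<longleftrightarrow> (ALL j. (%s. g s $ j) holomorphic_on S)"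

lemma hol_vec_subset: "hol_vec g S ==> T <= S ==> hol_vec g T" unfolding hol_vec_def using holomorphic_on_subset by blast

lemma hol_vec_continuous: "hol_vec g S ==> continuous_on S g"
proof -
 assume "hol_vec g S"
 hence "continuous_on S (%s. \<chi> j. g s $ j)"
  unfolding hol_vec_def by (intro continuous_on_vec_lambda holomorphic_on_imp_continuous_on) auto
 thus ?thesis by simp
qed

lemma hol_vec_compose: assumes "hol_vec c T" "g holomorphic_on S" "g ` S <= T" shows "hol_vec (%s. c (g s)) S"
 unfolding hol_vec_def
proof
 fix j
 show "(%s. c (g s) $ j) holomorphic_on S" using holomorphic_on_compose_gen[OF assms(2) _ assms(3), of "%s. c s $ j"] assms(1)
  by (simp add: hol_vec_def o_def)
qed

lemma bounded_linear_axis: "bounded_linear (axis j :: complex => complex ^ 'n)"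
proof -
 have "linear (axis j :: complex => complex ^ 'n)" by (rule linearI) (auto simp: vec_eq_iff axis_def)
 thus ?thesis by (simp add: linear_conv_bounded_linear)
qed

lemma has_derivative_vec:
 fixes g :: "complex => complex ^ 'n" assumes "ALL j. ((%s. g s $ j) has_field_derivative D $ j) (at s)"
 shows "(g has_derivative (%h. h *s D)) (at s)"
proof -
 have "((%s. \<Sum>j\<in>UNIV. axis j (g s $ j)) has_derivative (%h. \<Sum>j\<in>UNIV. axis j (D $ j * h))) (at s)"
  by (intro has_derivative_sum bounded_linear.has_derivative[OF bounded_linear_axis])
   (use assms in \<open>simp add: has_field_derivative_def\<close>)
 moreover have "(\<Sum>j\<in>UNIV. axis j (x $ j)) = x" for x :: "complex ^ 'n" by (simp add: vec_eq_iff axis_def sum.delta)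
 moreover have "(\<Sum>j\<in>UNIV. axis j (D $ j * h)) = h *s D" for h by (simp add: vec_eq_iff axis_def sum.delta mult.commute)
 ultimately show ?thesis by simp
qed

lemma holomorphic_several_compose: assumes f: "holomorphic_several f U" and g: "hol_vec g S" and S: "open S" "g ` S <= U"
 shows "(%s. f (g s)) holomorphic_on S"
proof (rule holomorphic_onI)
 fix s assume s: "s : S"
 hence "g s : U" using S by auto
 then obtain D where D: "(f has_derivative D) (at (g s))" "ALL c v. D (c *s v) = c * D v"
  using f unfolding holomorphic_several_def by blast
 define V where "V = (\<chi> j. deriv (%s. g s $ j) s)"
 have "(g has_derivative (%h. h *s V)) (at s)" by (rule has_derivative_vec)
   (use g s S in \<open>auto simp: V_def hol_vec_def intro: holomorphic_derivI\<close>)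
 from diff_chain_at[OF this D(1)]
 have "((%s. f (g s)) has_derivative (%h. D V * h)) (at s)" by (simp add: o_def D(2) mult.commute)
 hence "((%s. f (g s)) has_field_derivative D V) (at s)" by (simp add: has_field_derivative_def)
 thus "(%s. f (g s)) field_differentiable at s within S"
  using field_differentiable_at_within field_differentiable_def by blast
qed

lemma holomorphic_several_open: "holomorphic_several f U ==> open U" by (simp add: holomorphic_several_def)

lemma holomorphic_several_continuous: "holomorphic_several f U ==> continuous_on U f" unfolding holomorphic_several_def
 by (metis continuous_at_imp_continuous_on has_derivative_continuous)

lemma holomorphic_several_subset: "holomorphic_several f U ==> open V ==> V <= U ==> holomorphic_several f V"
 unfolding holomorphic_several_def by blast

lemma holomorphic_several_const: "open U ==> holomorphic_several (%z. c) U"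
 unfolding holomorphic_several_def by (auto intro!: exI[of _ "%_. 0"])

lemma holomorphic_several_nth: "open U ==> holomorphic_several (%z. z $ j) U" unfolding holomorphic_several_def
 by (auto intro!: exI[of _ "%v. v $ j"] bounded_linear_imp_has_derivative bounded_linear_vec_nth)

lemma holomorphic_several_add: assumes "holomorphic_several f U" "holomorphic_several g U"
 shows "holomorphic_several (%z. f z + g z) U" unfolding holomorphic_several_def
proof (intro conjI ballI)
 fix z assume "z : U"
 then obtain D E where "(f has_derivative D) (at z)" "ALL c v. D (c *s v) = c * D v"
  "(g has_derivative E) (at z)" "ALL c v. E (c *s v) = c * E v" using assms unfolding holomorphic_several_def by blast
 thus "EX D. ((%z. f z + g z) has_derivative D) (at z) & (ALL c v. D (c *s v) = c * D v)"
  by (intro exI[of _ "%v. D v + E v"]) (auto intro: has_derivative_add simp: distrib_left)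
qed (use assms holomorphic_several_open in blast)

lemma holomorphic_several_mult: assumes "holomorphic_several f U" "holomorphic_several g U"
 shows "holomorphic_several (%z. f z * g z) U" unfolding holomorphic_several_def
proof (intro conjI ballI)
 fix z assume "z : U"
 then obtain D E where "(f has_derivative D) (at z)" "ALL c v. D (c *s v) = c * D v"
  "(g has_derivative E) (at z)" "ALL c v. E (c *s v) = c * E v" using assms unfolding holomorphic_several_def by blast
 moreover from this have "((%z. f z * g z) has_derivative (%v. f z * E v + D v * g z)) (at z)" by (intro has_derivative_mult)
 ultimately show "EX D. ((%z. f z * g z) has_derivative D) (at z) & (ALL c v. D (c *s v) = c * D v)"
  by (intro exI[of _ "%v. f z * E v + D v * g z"]) (simp add: algebra_simps)
qed (use assms holomorphic_several_open in blast)

lemma holomorphic_several_power: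
 "open U ==> holomorphic_several f U ==> holomorphic_several (%z. f z ^ n) U"
 by (induction n) (auto intro: holomorphic_several_const holomorphic_several_mult)

lemma holomorphic_several_sum:
 "open U ==> (ALL a:A. holomorphic_several (f a) U) ==> holomorphic_several (%z. \<Sum>a\<in>A. f a z) U"
 by (induction A rule: infinite_finite_induct)
  (auto intro: holomorphic_several_const holomorphic_several_add)

lemma holomorphic_several_outer: assumes "holomorphic_several f U" "h holomorphic_on S" "open S" "f ` U <= S"
 shows "holomorphic_several (%z. h (f z)) U" unfolding holomorphic_several_def
proof (intro conjI ballI)
 fix z assume z: "z : U"
 then obtain D where D: "(f has_derivative D) (at z)" "ALL c v. D (c *s v) = c * D v"
  using assms unfolding holomorphic_several_def by blast
 have "(h has_field_derivative deriv h (f z)) (at (f z))" using assms z by (auto intro: holomorphic_derivI)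
 hence "(h has_derivative (%x. deriv h (f z) * x)) (at (f z))" by (simp add: has_field_derivative_def)
 from diff_chain_at[OF D(1) this]
 show "EX D. ((%z. h (f z)) has_derivative D) (at z) & (ALL c v. D (c *s v) = c * D v)"
  using D(2) by (intro exI[of _ "%v. deriv h (f z) * D v"]) (auto simp: o_def)
qed (use assms holomorphic_several_open in blast)

lemma holomorphic_several_newton: assumes "open U" "ALL k. holomorphic_several (p k) U"
 shows "holomorphic_several (%z. newton (%k. p k z) n) U"
proof (induction n rule: less_induct)
 case (less n)
 show ?case
 proof (cases n)
  case (Suc k)
  have "holomorphic_several (%z. - 1 / of_nat (Suc k) * (\<Sum>i\<le>k. newton (%k. p k z) (k - i) * p (Suc i) z)) U" using assms
   by (intro holomorphic_several_mult holomorphic_several_const holomorphic_several_sum ballI less)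
    (auto simp: Suc)
  thus ?thesis by (simp add: Suc)
 qed (simp add: holomorphic_several_const assms)
qed

lemma holomorphic_dichotomy: assumes "h holomorphic_on ball 0 r" "r > 0"
 shows "(ALL s:ball 0 r. h s = 0) | (EX a>0. ALL s. s ~= 0 --> norm s <= a --> h s ~= 0)"
proof (cases "ALL s:ball 0 r. h s = 0")
 case False
 then obtain d a where a: "0 < a" "a < r" "zero_order d r a h" using zero_order_exists[OF assms(1), of 1] by auto
 then obtain g where g: "ALL z:ball 0 r. h z = z ^ d * g z" "ALL z. norm z <= a --> g z ~= 0" unfolding zero_order_def by blast
 hence "ALL s. s ~= 0 --> norm s <= a --> h s ~= 0" using a by auto
 thus ?thesis using a(1) by blast
qed blast

lemma holomorphic_frequently_zero: assumes "h holomorphic_on ball 0 r" "r > 0" and "ALL d>0. EX s. s ~= 0 & norm s <= d & h s = 0"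
 shows "ALL s:ball 0 r. h s = 0" using holomorphic_dichotomy[OF assms(1,2)] assms(3) by blast

lemma complex_root_exists: assumes "n > 0"
 obtains s :: complex where "s ^ n = t"
proof (cases "t = 0")
 case True
 thus ?thesis using that[of 0] assms by (simp add: power_0_left)
next
 case False
 have "exp (Ln t / of_nat n) ^ n = exp (of_nat n * (Ln t / of_nat n))" by (rule exp_of_nat_mult[symmetric])
 also have "... = t" using False assms by simp
 finally show ?thesis using that by blast
qed

lemma norm_root_less: assumes "(s::complex) ^ n = t" "norm t < r ^ n" "r > 0" shows "norm s < r"
proof -
 have "norm s ^ n < r ^ n" using assms by (metis norm_power)
 thus ?thesis by (rule power_less_imp_less_base) (use assms in auto)
qed

text \<open>Invariance under a primitive \<open>e\<close>-th root of unity kills every Taylor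
  coefficient whose index is not divisible by \<open>e\<close>.\<close>

lemma rotation_invariant_factor:
 fixes f :: "complex => complex" assumes f: "f holomorphic_on ball 0 r" and e: "e > 0" and b: "b ^ e = 1" "ALL k. b ^ k = 1 --> e dvd k"
  and inv: "ALL s:ball 0 r. f (b * s) = f s" and r: "r > 0"
 shows "EX g. g holomorphic_on ball 0 (r ^ e) & (ALL s:ball 0 r. f s = g (s ^ e))"
proof -
 have nb: "norm b = 1"
 proof -
  have "norm b ^ e = 1" using b(1) by (metis norm_one norm_power)
  thus ?thesis using e power_eq_imp_eq_base[of "norm b" e 1] by simp
 qed
 define a where "a k = (deriv ^^ k) f 0 / fact k" for k
 have az: "a k = 0" if k: "~ e dvd k" for k
 proof -
  have "(deriv ^^ k) (%w. f (b * w)) 0 = b ^ k * (deriv ^^ k) f (b * 0)"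
   by (rule higher_deriv_compose_linear[OF f, of "ball 0 r"]) (use r nb in \<open>auto simp: norm_mult\<close>)
  moreover have "(deriv ^^ k) (%w. f (b * w)) 0 = (deriv ^^ k) f 0"
  proof (rule higher_deriv_transform_within_open[of _ "ball 0 r"])
   show "(%w. f (b * w)) holomorphic_on ball 0 r" by (rule holomorphic_transform[OF f]) (use inv in auto)
  qed (use f inv r in auto)
  ultimately have "(deriv ^^ k) f 0 * (b ^ k - 1) = 0" by (simp add: algebra_simps)
  moreover have "b ^ k ~= 1" using k b(2) by blast
  ultimately show ?thesis by (simp add: a_def)
 qed
 have sums: "(%k. a (e * k) * (s ^ e) ^ k) sums f s" if s: "s : ball 0 r" for s
 proof -
  have "(%k. a k * s ^ k) sums f s" using holomorphic_power_series[OF f s] by (simp add: a_def)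
  moreover have mono: "strict_mono (%k. e * k)" using e by (simp add: strict_mono_def)
  moreover have zero: "a n * s ^ n = 0" if "n ~: range (%k. e * k)" for n using az[of n] that by (auto simp: dvd_def)
  ultimately have "(%k. a (e * k) * s ^ (e * k)) sums f s" using sums_mono_reindex[OF mono, of "%k. a k * s ^ k" "f s"] by blast
  thus ?thesis by (simp add: power_mult)
 qed
 define g where "g t = (\<Sum>k. a (e * k) * t ^ k)" for t
 have gs: "(%k. a (e * k) * (t - 0) ^ k) sums g t" if t: "t : ball 0 (r ^ e)" for t
 proof -
  obtain s where s: "s ^ e = t" using complex_root_exists[OF e] by blast
  hence "s : ball 0 r" using norm_root_less[OF s, of r] t r by simp
  from sums[OF this] show ?thesis by (simp add: s g_def sums_iff)
 qed
 have "g holomorphic_on ball 0 (r ^ e)" by (rule power_series_holomorphic[of _ _ "%k. a (e * k)"]) (use gs in auto)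
 moreover have "f s = g (s ^ e)" if "s : ball 0 r" for s using sums[OF that] by (simp add: g_def sums_iff)
 ultimately show ?thesis by blast
qed

lemma primitive_root_exists: assumes "N > 0" shows "EX w::complex. w ^ N = 1 & (ALL k. w ^ k = 1 --> N dvd k)"
proof (intro exI[of _ "exp (2 * of_real pi * \<i> / of_nat N)"] conjI allI impI)
 show "exp (2 * of_real pi * \<i> / of_nat N) ^ N = 1" using assms complex_root_unity[of N 1] by (simp add: mult.commute)
 fix k assume "exp (2 * of_real pi * \<i> / of_nat N) ^ k = 1"
 hence "exp (2 * of_real pi * \<i> * of_nat k / of_nat N) = 1" by (simp add: exp_of_nat_mult[symmetric] mult_ac)
 also have "1 = exp (2 * of_real pi * \<i> * of_nat 0 / of_nat N)" by simp
 finally have "k mod N = 0 mod N" using complex_root_unity_eq[of N k 0] assms by simp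
 thus "N dvd k" by (simp add: mod_eq_0_iff_dvd)
qed

section \<open>Germs\<close>

lemma germ_eq_iff_ball: "germ_eq A B \<longleftrightarrow> (EX d>0. ALL z:ball 0 d. z : A \<longleftrightarrow> z : B)"
 unfolding germ_eq_def eventually_nhds_metric by (simp add: dist_norm ball_def Ball_def)

lemma germ_le_iff_ball: "germ_le A B \<longleftrightarrow> (EX d>0. ALL z:ball 0 d. z : A --> z : B)"
 unfolding germ_le_def eventually_nhds_metric by (simp add: dist_norm ball_def Ball_def)

lemma germ_eq_sym: "germ_eq A B ==> germ_eq B A" unfolding germ_eq_def by (simp add: eq_commute)

lemma germ_eq_trans: "germ_eq A B ==> germ_eq B C ==> germ_eq A C" unfolding germ_eq_def by (erule (1) eventually_elim2) auto

lemma germ_eq_UN: assumes "finite I" "ALL i:I. germ_eq (A i) (B i)" shows "germ_eq (\<Union>i\<in>I. A i) (\<Union>i\<in>I. B i)"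
proof -
 have "\<forall>\<^sub>F z in nhds 0. ALL i:I. z : A i \<longleftrightarrow> z : B i" using assms by (simp add: germ_eq_def eventually_ball_finite)
 thus ?thesis unfolding germ_eq_def by (rule eventually_mono) auto
qed

lemma germ_eq_refl [simp]: "germ_eq A A" by (simp add: germ_eq_def)

lemma analytic_germ_Un: assumes "analytic_germ A" "analytic_germ B" shows "analytic_germ (A Un B)"
proof -
 obtain U F where U: "0 : U" "open U" "finite F" "ALL f:F. holomorphic_several f U"
  "A Int U = {z : U. ALL f:F. f z = 0}" using assms(1) unfolding analytic_germ_def by blast
 obtain V G where V: "0 : V" "open V" "finite G" "ALL f:G. holomorphic_several f V"
  "B Int V = {z : V. ALL f:G. f z = 0}" using assms(2) unfolding analytic_germ_def by blast
 define H where "H = (%(f, g). %z. f z * g z) ` (F \<times> G)"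
 have "(A Un B) Int (U Int V) = {z : U Int V. ALL f:H. f z = 0}"
 proof (intro set_eqI iffI)
  fix z assume "z : {z : U Int V. ALL f:H. f z = 0}"
  hence z: "z : U" "z : V" "ALL f:F. ALL g:G. f z * g z = 0" by (auto simp: H_def)
  show "z : (A Un B) Int (U Int V)"
  proof (cases "ALL f:F. f z = 0")
   case True
   hence "z : A Int U" using U(5) z by blast
   thus ?thesis using z by blast
  next
   case False
   hence "ALL g:G. g z = 0" using z(3) by (metis mult_eq_0_iff)
   hence "z : B Int V" using V(5) z by blast
   thus ?thesis using z by blast
  qed
 next
  fix z assume z: "z : (A Un B) Int (U Int V)"
  hence "z : A Int U | z : B Int V" by blast
  hence "(ALL f:F. f z = 0) | (ALL g:G. g z = 0)" using U(5) V(5) by blast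
  thus "z : {z : U Int V. ALL f:H. f z = 0}" using z by (auto simp: H_def)
 qed
 moreover have "ALL h:H. holomorphic_several h (U Int V)"
 proof
  fix h assume "h : H"
  then obtain f g where fg: "f : F" "g : G" "h = (%z. f z * g z)" by (auto simp: H_def)
  have "open (U Int V)" using U V by auto
  hence "holomorphic_several f (U Int V)" "holomorphic_several g (U Int V)"
   using U(4) V(4) fg holomorphic_several_subset by (metis inf_le1 inf_le2)+
  thus "holomorphic_several h (U Int V)" unfolding fg(3) by (rule holomorphic_several_mult)
 qed
 moreover have "finite H" using U V by (auto simp: H_def)
 moreover have "0 : A Un B" using assms(1) by (auto simp: analytic_germ_def)
 ultimately show ?thesis unfolding analytic_germ_def using U(1,2) V(1,2) by (intro conjI exI[of _ "U Int V"] exI[of _ H]) auto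
qed

lemma analytic_germ_UN: assumes "finite I" "I ~= {}" "ALL i:I. analytic_germ (A i)" shows "analytic_germ (\<Union>i\<in>I. A i)"
 using assms by (induction I rule: finite_ne_induct) (auto intro: analytic_germ_Un)

lemma irreducible_germ_UN:
 assumes Z: "irreducible_germ Z" and I: "finite I" "I ~= {}" "ALL i:I. analytic_germ (A i)" "germ_eq Z (\<Union>i\<in>I. A i)"
 shows "EX i:I. germ_eq Z (A i)" using I
proof (induction I rule: finite_ne_induct)
 case (insert i I)
 have "analytic_germ (\<Union>i\<in>I. A i)" using insert by (intro analytic_germ_UN) auto
 moreover have "germ_eq Z (A i Un (\<Union>i\<in>I. A i))" using insert by simp
 ultimately have "germ_eq Z (A i) | germ_eq Z (\<Union>i\<in>I. A i)" using Z insert.prems(1) unfolding irreducible_germ_def by blast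
 thus ?case using insert by auto
qed auto

section \<open>Existence of a parametrization\<close>

text \<open>The coordinates show that the set defining the dimension is nonempty, so the minimum 1
  is attained by one function. For the germ of the origin the empty family would already do, and the
  dimension would be 0.\<close>

lemma germ_dim_1_function: assumes A: "0 : A" and d: "germ_dim A = 1"
 shows "EX f U. f 0 = 0 & 0 : U & holomorphic_several f U & germ_eq {z : A. f z = 0} {0}" and "~ germ_eq A {0}"
proof -
 define P where "P k \<longleftrightarrow> (EX F. finite F & card F = k &
  (ALL f:F. f 0 = 0 & (EX U. 0 : U & holomorphic_several f U)) &
  germ_eq {z : A. ALL f:F. f z = 0} {0})" for k
 have dim: "germ_dim A = (LEAST k. P k)" unfolding germ_dim_def P_def ..
 define F :: "(complex ^ 'a => complex) set" where "F = range (%j z. z $ j)"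
 have "{z : A. ALL f:F. f z = 0} = {0}" using A by (auto simp: F_def vec_eq_iff)
 moreover have "ALL f:F. f 0 = 0 & (EX U. 0 : U & holomorphic_several f U)"
  by (auto simp: F_def intro!: exI[of _ UNIV] holomorphic_several_nth)
 moreover have "finite F" by (simp add: F_def)
 ultimately have "P (card F)" unfolding P_def by (intro exI[of _ F]) simp
 hence "P 1" using LeastI[of P] d dim by metis
 then obtain F where F: "finite F" "card F = 1" "ALL f:F. f 0 = 0 & (EX U. 0 : U & holomorphic_several f U)"
  "germ_eq {z : A. ALL f:F. f z = 0} {0}" unfolding P_def by blast
 then obtain f where "F = {f}" using card_1_singletonE by blast
 thus "EX f U. f 0 = 0 & 0 : U & holomorphic_several f U & germ_eq {z : A. f z = 0} {0}" using F by auto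
 show "~ germ_eq A {0}"
 proof
  assume "germ_eq A {0}"
  hence "P 0" unfolding P_def by (intro exI[of _ "{}"]) auto
  thus False using not_less_Least[of 0 P] d dim by simp
 qed
qed

text \<open>The extra index \<open>None\<close> carries the value of a function \<open>f\<close>.
  Replacing a germ by the graph of \<open>f\<close> over it turns \<open>f\<close> into a
  coordinate, over which \<open>integral_coordinate\<close> applies.\<close>

definition proj :: "complex ^ 'n option => complex ^ 'n" where
 "proj z = (\<chi> j. z $ Some j)"

lemma proj_nth [simp]: "proj z $ j = z $ Some j" by (simp add: proj_def)

lemma proj_zero [simp]: "proj 0 = 0" by (simp add: vec_eq_iff)

lemma continuous_on_proj: "continuous_on S proj" unfolding proj_def[abs_def] by (intro continuous_intros)

lemma sep_hol_proj: assumes f: "holomorphic_several f U" and U: "ALL z:cube r. proj z : U" shows "sep_hol r (%z. f (proj z))"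
 unfolding sep_hol_def
proof (intro conjI ballI allI)
 show "continuous_on (cube r) (%z. f (proj z))"
  by (rule continuous_on_compose2[OF holomorphic_several_continuous[OF f] continuous_on_proj]) (use U in auto)
 fix z :: "complex ^ 'a option" and i assume z: "z : cube r"
 show "(%q. f (proj (upd z i q))) holomorphic_on ball 0 r"
 proof (rule holomorphic_several_compose[OF f])
  show "hol_vec (%q. proj (upd z i q)) (ball 0 r)" unfolding hol_vec_def
  proof
   fix j show "(%s. proj (upd z i s) $ j) holomorphic_on ball 0 r" by (cases "Some j = i") auto
  qed
  show "(%q. proj (upd z i q)) ` ball 0 r <= U" using U z by (auto intro!: upd_in_cube)
 qed auto
qed

lemma coordinates_integral:
 fixes Z :: "(complex ^ 'n) set"
 assumes Z: "analytic_germ Z" and f: "f 0 = 0" "0 : U" "holomorphic_several f U" "germ_eq {z : Z. f z = 0} {0}"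
 shows "EX r d e. r > 0 & d > 0 & (ALL k. e k holomorphic_on ball 0 r) & (ALL t. e 0 t = 1) &
  (ALL k>0. e k 0 = 0) & (\<forall>\<^sub>F z in nhds 0. z : Z --> (\<Sum>k\<le>d. e k (f z) * (z $ j) ^ (d - k)) = 0)"
proof -
 obtain V F where V: "0 : V" "open V" "finite F" "ALL f:F. holomorphic_several f V"
  "Z Int V = {z : V. ALL f:F. f z = 0}" and Z0: "0 : Z" using Z unfolding analytic_germ_def by blast
 obtain a where a: "a > 0" "ALL z:ball 0 a. z : {z : Z. f z = 0} \<longleftrightarrow> z : {0}" using f(4) unfolding germ_eq_iff_ball by blast
 define W where "W = U Int V Int ball 0 a"
 have W: "open W" "0 : W" "W <= U" "W <= V" "W <= ball 0 a" using V f(2) holomorphic_several_open[OF f(3)] a by (auto simp: W_def)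
 have "open (proj -` W)" by (rule open_vimage[OF W(1) continuous_on_proj])
 then obtain r where r: "r > 0" "cube r <= proj -` W" using cube_in_open[of "proj -` W"] W(2) by auto
 define G :: "(complex ^ 'n option => complex) set" where
  "G = insert (%z. f (proj z) + - (z $ None)) ((%h z. h (proj z)) ` F)"
 have "finite G" using V by (simp add: G_def)
 moreover have "ALL g:G. sep_hol r g & g 0 = 0"
 proof
  fix g assume "g : G"
  then consider "g = (%z. f (proj z) + - (z $ None))" | h where "h : F" "g = (%z. h (proj z))" by (auto simp: G_def)
  thus "sep_hol r g & g 0 = 0"
  proof cases
   case 1
   show ?thesis unfolding 1 using f(1) r(2) W(3) by (intro conjI sep_hol_add sep_hol_minus sep_hol_nth sep_hol_proj[OF f(3)]) auto
  next
   case 2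
   have "0 : Z Int V" using Z0 V by auto
   hence "h 0 = 0" using V(5) 2(1) by blast
   thus ?thesis unfolding 2(2) using V(4) 2(1) r(2) W(4) by (intro conjI sep_hol_proj[of h V]) auto
  qed
 qed
 moreover have zero: "proj z : Z & f (proj z) = z $ None" if "z : cube r" "ALL g:G. g z = 0" for z
 proof -
  have "proj z : V" using that r(2) W(4) by auto
  moreover have "ALL h:F. h (proj z) = 0" "f (proj z) = z $ None" using that(2) by (auto simp: G_def)
  ultimately show ?thesis using V(5) by blast
 qed
 have "ALL z:cube r. (ALL g:G. g z = 0) --> z $ None = 0 --> z = 0"
 proof (intro ballI impI)
  fix z :: "complex ^ 'n option" assume z: "z : cube r" "ALL g:G. g z = 0" "z $ None = 0"
  have "proj z : ball 0 a" using z(1) r(2) W(5) by auto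
  hence "proj z = 0" using a(2) zero[OF z(1,2)] z(3) by auto
  hence "z $ Some j = 0" for j by (metis proj_nth zero_index)
  hence "z $ i = 0" for i using z(3) by (cases i) auto
  thus "z = 0" by (simp add: vec_eq_iff)
 qed
 ultimately have "EX r' d e. 0 < r' & d > 0 & (ALL k. e k holomorphic_on ball 0 r') & (ALL t. e 0 t = 1) &
  (ALL k>0. e k 0 = 0) &
  (ALL z:cube r'. (ALL g:G. g z = 0) --> (\<Sum>k\<le>d. e k (z $ None) * (z $ Some j) ^ (d - k)) = 0)"
  using integral_coordinate[of G r "Some j" None] r(1) by blast
 then obtain r' d e where e: "0 < r'" "d > 0" "ALL k. e k holomorphic_on ball 0 r'" "ALL t. e 0 t = 1"
  "ALL k>0. e k 0 = 0"
  "ALL z:cube r'. (ALL g:G. g z = 0) --> (\<Sum>k\<le>d. e k (z $ None) * (z $ Some j) ^ (d - k)) = 0" by (elim exE conjE) (rule that)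
 define lift :: "complex ^ 'n => complex ^ 'n option" where
  "lift z = (\<chi> i. case i of None => f z | Some j => z $ j)" for z
 have lift: "lift z $ None = f z" "lift z $ Some j = z $ j" "proj (lift z) = z" for z j by (auto simp: lift_def vec_eq_iff)
 have "isCont f 0" using holomorphic_several_continuous[OF f(3)] f(2) holomorphic_several_open[OF f(3)]
  by (simp add: continuous_on_eq_continuous_at)
 hence "(f \<longlongrightarrow> 0) (nhds 0)" using f(1) tendsto_at_iff_tendsto_nhds[of f 0] by (simp add: isCont_def)
 hence "\<forall>\<^sub>F z in nhds 0. norm (f z) < r'" using e(1) by (auto dest!: tendstoD[of _ _ _ r'] simp: dist_norm)
 moreover have "\<forall>\<^sub>F z in nhds (0 :: complex ^ 'n). z : ball 0 r' Int V" using e(1) V by (intro eventually_nhds_in_open) auto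
 ultimately have "\<forall>\<^sub>F z in nhds 0. z : Z --> (\<Sum>k\<le>d. e k (f z) * (z $ j) ^ (d - k)) = 0"
 proof eventually_elim
  case (elim z)
  show ?case
  proof
   assume zZ: "z : Z"
   have "norm (lift z $ i) < r'" for i
   proof (cases i)
    case (Some j)
    have "norm (z $ j) <= norm z" by (rule Finite_Cartesian_Product.norm_nth_le)
    thus ?thesis using elim Some by (simp add: lift)
   qed (use elim in \<open>simp add: lift\<close>)
   hence "lift z : cube r'" by (simp add: cube_def)
   moreover have "ALL g:G. g (lift z) = 0" using zZ elim V(5) by (auto simp: G_def lift)
   ultimately have "(\<Sum>k\<le>d. e k (lift z $ None) * (lift z $ Some j) ^ (d - k)) = 0" using e(6) by blast
   thus "(\<Sum>k\<le>d. e k (f z) * (z $ j) ^ (d - k)) = 0" by (simp only: lift)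
  qed
 qed
 thus ?thesis using e(1-5) by blast
qed

lemma hol_vec_ball: "hol_vec g (ball 0 r) ==> r' <= r ==> hol_vec g (ball 0 r')" by (rule hol_vec_subset) auto

lemma small_preimage_ball:
 fixes g :: "complex => complex ^ 'n" assumes "hol_vec g (ball 0 r)" "r > 0" "open V" "g 0 : V"
 shows "EX r'>0. r' <= r & g ` ball 0 r' <= V"
proof -
 have "open (ball 0 r Int g -` V)" using hol_vec_continuous[OF assms(1)] assms(3) continuous_open_preimage[OF _ open_ball] by blast
 then obtain e where "e > 0" "ball 0 e <= ball 0 r Int g -` V" using assms(2,4) by (metis Int_iff centre_in_ball openE vimageI)
 thus ?thesis by (intro exI[of _ "min e r"]) (use assms(2) in \<open>auto simp: subset_eq\<close>)
qed

text \<open>Each defining function, pulled back to the disc, either vanishes identically or has at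
  most an isolated zero at 0.\<close>

lemma curve_in_analytic_germ:
 fixes g :: "complex => complex ^ 'n" assumes Z: "analytic_germ Z" and g: "hol_vec g (ball 0 r)" "r > 0" "g 0 = 0"
 shows "(EX d>0. ALL s:ball 0 d. g s : Z) | (EX d>0. ALL s. s ~= 0 --> norm s <= d --> g s ~: Z)"
proof -
 obtain V F where V: "0 : V" "open V" "finite F" "ALL f:F. holomorphic_several f V"
  "Z Int V = {z : V. ALL f:F. f z = 0}" using Z unfolding analytic_germ_def by blast
 obtain r' where r': "r' > 0" "r' <= r" "g ` ball 0 r' <= V" using small_preimage_ball[OF g(1,2) V(2)] g(3) V(1) by auto
 have hol: "(%s. h (g s)) holomorphic_on ball 0 r'" if "h : F" for h by (rule holomorphic_several_compose[of h V])
   (use V(4) that r' hol_vec_ball[OF g(1) r'(2)] in auto)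
 have mem: "g s : Z \<longleftrightarrow> (ALL h:F. h (g s) = 0)" if "s : ball 0 r'" for s
 proof -
  have "g s : V" using r'(3) that by blast
  thus ?thesis using V(5) by blast
 qed
 show ?thesis
 proof (cases "ALL h:F. ALL s:ball 0 r'. h (g s) = 0")
  case True
  hence "ALL s:ball 0 r'. g s : Z" using mem by blast
  thus ?thesis using r'(1) by blast
 next
  case False
  then obtain h where h: "h : F" "~ (ALL s:ball 0 r'. h (g s) = 0)" by blast
  then obtain d where d: "d > 0" "ALL s. s ~= 0 --> norm s <= d --> h (g s) ~= 0"
   using holomorphic_dichotomy[OF hol[OF h(1)] r'(1)] by blast
  have "ALL s. s ~= 0 --> norm s <= min d (r' / 2) --> g s ~: Z"
  proof (intro allI impI)
   fix s :: complex assume s: "s ~= 0" "norm s <= min d (r' / 2)"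
   hence "s : ball 0 r'" using r'(1) by auto
   thus "g s ~: Z" using mem h(1) d(2) s by auto
  qed
  moreover have "min d (r' / 2) > 0" using d(1) r'(1) by simp
  ultimately show ?thesis by blast
 qed
qed

lemma continuous_norm_small:
 fixes f :: "complex ^ 'n => complex" assumes "holomorphic_several f U" "0 : U" "f 0 = 0" "e > 0"
 shows "\<forall>\<^sub>F z in nhds 0. norm (f z) < e"
proof -
 have "isCont f 0" using holomorphic_several_continuous[OF assms(1)] assms(2) holomorphic_several_open[OF assms(1)]
  by (simp add: continuous_on_eq_continuous_at)
 hence "(f \<longlongrightarrow> 0) (nhds 0)" using assms(3) tendsto_at_iff_tendsto_nhds[of f 0] by (simp add: isCont_def)
 thus ?thesis using assms(4) by (auto dest!: tendstoD[of _ _ _ e] simp: dist_norm)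
qed

lemma coordinate_cover:
 fixes Z :: "(complex ^ 'n) set"
 assumes Z: "analytic_germ Z" and f: "f 0 = 0" "0 : U" "holomorphic_several f U" "germ_eq {z : Z. f z = 0} {0}"
 shows "EX N r A. N > 0 & r > 0 & r <= 1 & finite A & (ALL a:A. a holomorphic_on ball 0 r & a 0 = 0) &
  (\<forall>\<^sub>F z in nhds 0. z : Z --> (ALL s:ball 0 r. s ^ N = f z --> (EX a:A. z $ j = a s)))"
proof -
 obtain R d e where e: "R > 0" "d > 0" "ALL k. e k holomorphic_on ball 0 R" "ALL t. e 0 t = 1"
  "ALL k>0. e k 0 = 0" and ev: "\<forall>\<^sub>F z in nhds 0. z : Z --> (\<Sum>k\<le>d. e k (f z) * (z $ j) ^ (d - k)) = 0"
  using coordinates_integral[OF Z f, of j] by (elim exE conjE) (rule that)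
 obtain N r A where A: "r <= R" "ALL a:A. a 0 = 0"
  "ALL b. puiseux_cover (%t y. \<Sum>k\<le>d. e k t * y ^ (d - k)) N r b A"
  using puiseux_roots[OF e(2,1,3,4,5)] by (elim exE conjE) (rule that)
 have 1: "N > 0" "r > 0" "r <= 1" "finite A" "ALL a:A. a holomorphic_on ball 0 r"
  using spec[OF A(3), of 1] unfolding puiseux_cover_def by auto
 \<comment> \<open>The cover is available for every bound on the modulus; \<open>norm y + 1\<close>
   admits the given root.\<close>
 have cov: "EX a:A. y = a s" if "s : ball 0 r" "(\<Sum>k\<le>d. e k (s ^ N) * y ^ (d - k)) = 0" for s y
  using spec[OF A(3), of "norm y + 1"] that unfolding puiseux_cover_def by auto
 have "\<forall>\<^sub>F z in nhds 0. z : Z --> (ALL s:ball 0 r. s ^ N = f z --> (EX a:A. z $ j = a s))" using ev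
 proof eventually_elim
  case (elim z)
  show ?case
  proof (intro impI ballI)
   fix s :: complex assume "z : Z" "s : ball 0 r" "s ^ N = f z"
   thus "EX a:A. z $ j = a s" using elim by (intro cov) auto
  qed
 qed
 thus ?thesis using 1 A(2) by blast
qed

lemma curves_cover:
 fixes Z :: "(complex ^ 'n) set"
 assumes Z: "analytic_germ Z" and f: "f 0 = 0" "0 : U" "holomorphic_several f U" "germ_eq {z : Z. f z = 0} {0}"
 shows "EX N r G. N > 0 & r > 0 & r <= 1 & finite G & (ALL g:G. hol_vec g (ball 0 r) & g 0 = 0) &
  (ALL e>0. \<forall>\<^sub>F z in nhds 0. z : Z --> (EX s:ball 0 e. s ^ N = f z & (EX g:G. z = g s)))"
proof -
 have "ALL j. EX N r A. N > 0 & r > 0 & r <= 1 & finite A & (ALL a:A. a holomorphic_on ball 0 r & a 0 = 0) &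
  (\<forall>\<^sub>F z in nhds 0. z : Z --> (ALL s:ball 0 r. s ^ N = f z --> (EX a:A. z $ j = a s)))" using coordinate_cover[OF Z f] by blast
 then obtain Nf rf Af where cov: "ALL j. Nf j > 0 & rf j > 0 & rf j <= 1 & finite (Af j) &
  (ALL a:Af j. a holomorphic_on ball 0 (rf j) & a 0 = 0) &
  (\<forall>\<^sub>F z in nhds 0. z : Z --> (ALL s:ball 0 (rf j). s ^ Nf j = f z --> (EX a:Af j. z $ j = a s)))"
  unfolding choice_iff by (elim exE) (rule that)
 define N where "N = (\<Prod>j\<in>UNIV. Nf j)"
 define M where "M j = (\<Prod>j'\<in>UNIV - {j}. Nf j')" for j
 define r where "r = Min (range rf)"
 have N: "N > 0" unfolding N_def by (rule prod_pos) (use cov in blast)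
 have M: "M j > 0" for j unfolding M_def by (rule prod_pos) (use cov in blast)
 have NM: "N = M j * Nf j" for j unfolding N_def M_def using prod.remove[of UNIV j Nf] by (simp add: mult.commute)
 have r: "r > 0" "r <= rf j" for j unfolding r_def using cov by auto
 have r1: "r <= 1" using r(2)[of undefined] cov order_trans by blast
 \<comment> \<open>All choices of one root function for each coordinate. Such a curve need not lie
   on \<open>Z\<close>; the dichotomy for curves and analytic germs sorts them afterwards.\<close>
 define G where "G = (%b s. \<chi> j. b j (s ^ M j)) ` PiE UNIV Af"
 have "finite G" unfolding G_def by (intro finite_imageI finite_PiE) (use cov in auto)
 moreover have "ALL g:G. hol_vec g (ball 0 r) & g 0 = 0"
 proof
  fix g assume "g : G"
  then obtain b where b: "\<And>j. b j : Af j" "g = (%s. \<chi> j. b j (s ^ M j))" by (auto simp: G_def PiE_iff)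
  have "(%s. b j (s ^ M j)) holomorphic_on ball 0 r" for j
   by (rule holomorphic_on_power_comp[of _ "rf j"]) (use cov b(1) r r1 M in auto)
  moreover have "b j (0 ^ M j) = 0" for j using cov b(1)[of j] M[of j] by (simp add: power_0_left)
  ultimately show "hol_vec g (ball 0 r) & g 0 = 0" by (simp add: b(2) hol_vec_def vec_eq_iff)
 qed
 moreover have "ALL e>0. \<forall>\<^sub>F z in nhds 0. z : Z --> (EX s:ball 0 e. s ^ N = f z & (EX g:G. z = g s))"
 proof (intro allI impI)
  fix e :: real assume e: "e > 0"
  have "\<forall>\<^sub>F z in nhds 0. ALL j. z : Z --> (ALL s:ball 0 (rf j). s ^ Nf j = f z --> (EX a:Af j. z $ j = a s))"
   by (rule eventually_all_finite) (use cov in blast)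
  moreover have "\<forall>\<^sub>F z in nhds 0. norm (f z) < min e r ^ N" by (rule continuous_norm_small[OF f(3,2,1)]) (use e r in auto)
  ultimately show "\<forall>\<^sub>F z in nhds 0. z : Z --> (EX s:ball 0 e. s ^ N = f z & (EX g:G. z = g s))"
  proof eventually_elim
   case (elim z)
   show ?case
   proof
    assume zZ: "z : Z"
    obtain s where s: "s ^ N = f z" using complex_root_exists[OF N] by blast
    have sn: "norm s < min e r" by (rule norm_root_less[OF s elim(2)]) (use e r in auto)
    have "ALL j. EX a. a : Af j & z $ j = a (s ^ M j)"
    proof
     fix j
     have "s ^ M j : ball 0 (rf j)" by (rule power_in_ball[of s r]) (use sn r r1 M in auto)
     moreover have "(s ^ M j) ^ Nf j = f z" using s NM[of j] by (simp add: power_mult)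
     ultimately show "EX a. a : Af j & z $ j = a (s ^ M j)" using elim(1) zZ by blast
    qed
    then obtain b where b: "ALL j. b j : Af j & z $ j = b j (s ^ M j)" unfolding choice_iff by blast
    hence "(%s. \<chi> j. b j (s ^ M j)) : G" by (auto simp: G_def PiE_iff)
    moreover have "z = (%s. \<chi> j. b j (s ^ M j)) s" using b by (simp add: vec_eq_iff)
    ultimately show "EX s:ball 0 e. s ^ N = f z & (EX g:G. z = g s)" using s sn by (intro bexI[of _ s]) auto
   qed
  qed
 qed
 ultimately show ?thesis using N r(1) r1 by blast
qed

lemma roots_of_unity_norm: "(w::complex) ^ n = 1 ==> n > 0 ==> norm w = 1"
 using power_eq_imp_eq_base[of "norm w" n 1] by (metis norm_ge_zero norm_one norm_power power_one zero_le_one)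

text \<open>
 The image of \<open>d\<close> is cut out by the products of \<open>l (z - d (b s))\<close> over the roots of unity \<open>b\<close>, where
 \<open>s ^ N = f z\<close>, for sufficiently many linear forms \<open>l\<close> in general position.
\<close>

lemma curve_image_analytic:
 fixes d :: "complex => complex ^ 'n"
 assumes f: "holomorphic_several f U" "0 : U" and d: "hol_vec d (ball 0 r)" "r > 0" "d 0 = 0" and N: "N > 0"
  and fd: "ALL s:ball 0 r. d s : U & f (d s) = s ^ N" shows "EX A. analytic_germ A & (ALL e. 0 < e & e <= r --> germ_eq A (d ` ball 0 e))"
proof -
 define n where "n = CARD('n)"
 obtain h where h: "bij_betw h (UNIV :: 'n set) {0..<n}" unfolding n_def using ex_bij_betw_finite_nat[of "UNIV :: 'n set"] by auto
 define G where "G = {b::complex. b ^ N = 1}"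
 have G: "finite G" "card G = N" "1 : G" unfolding G_def using N finite_roots_unity[of N] card_roots_unity_eq[OF N] by auto
 obtain gs where gs: "set gs = G" "distinct gs" using finite_distinct_list[OF G(1)] by blast
 hence len: "length gs = N" using G(2) distinct_card by fastforce
 have nG: "norm b = 1" if "b : G" for b using that N roots_of_unity_norm by (auto simp: G_def)
 obtain b0 :: complex where b0: "b0 ^ N = 1" "ALL k. b0 ^ k = 1 --> N dvd k" using primitive_root_exists[OF N] by blast
 \<comment> \<open>Coefficient vectors on a moment curve: the value at a fixed vector is a
   polynomial in \<open>c\<close>, so finitely many of the forms separate a point from the points
   \<open>d (b * s)\<close>.\<close>
 define lam where "lam c z = (\<Sum>j\<in>UNIV. of_nat c ^ h j * z $ j)" for c :: nat and z :: "complex ^ 'n"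
 define L where "L c s = lam c (d s)" for c s
 have lam_diff: "lam c z - lam c w = (\<Sum>i<n. of_nat c ^ i * (z - w) $ inv_into UNIV h i)" for c z w
 proof -
  have "lam c z - lam c w = (\<Sum>j\<in>UNIV. of_nat c ^ h j * (z - w) $ inv_into UNIV h (h j))"
   using h by (simp add: lam_def sum_subtractf algebra_simps bij_betw_def inv_into_f_f)
  also have "... = (\<Sum>i\<in>{0..<n}. of_nat c ^ i * (z - w) $ inv_into UNIV h i)" by (rule sum.reindex_bij_betw[OF h])
  finally show ?thesis by (simp add: atLeast0LessThan)
 qed
 have hL: "L c holomorphic_on ball 0 r" for c
  unfolding L_def[abs_def] lam_def using d(1) by (auto simp: hol_vec_def intro!: holomorphic_intros)
 \<comment> \<open>These power sums are invariant under rotation of \<open>s\<close>, hence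
   functions of \<open>s ^ N\<close>. Replacing \<open>s ^ N\<close> by \<open>f z\<close> extends
   them holomorphically to the ambient space.\<close>
 define p where "p c k s = (\<Sum>b\<in>G. L c (b * s) ^ k)" for c k s
 have hp: "p c k holomorphic_on ball 0 r" for c k unfolding p_def[abs_def]
 proof (intro holomorphic_intros)
  fix b assume b: "b : G"
  have "(%s. b * s) ` ball 0 r <= ball 0 r" using nG[OF b] by (auto simp: norm_mult)
  moreover have "(%s. b * s) holomorphic_on ball 0 r" by (intro holomorphic_intros)
  ultimately show "(%s. L c (b * s)) holomorphic_on ball 0 r"
   using holomorphic_on_compose_gen[of "%s. b * s" "ball 0 r" "L c" "ball 0 r"] hL by (simp add: o_def)
 qed
 have bij: "bij_betw (%b. b * b0) G G"
 proof -
  have z: "b0 ~= 0" using b0(1) N by (auto simp: power_0_left)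
  have "inj_on (%b. b * b0) G" using z by (auto simp: inj_on_def)
  moreover have "(%b. b * b0) ` G <= G" using b0(1) by (auto simp: G_def power_mult_distrib)
  ultimately show ?thesis using endo_inj_surj[OF G(1)] by (simp add: bij_betw_def)
 qed
 have inv: "p c k (b0 * s) = p c k s" for c k s
  unfolding p_def using sum.reindex_bij_betw[OF bij, of "%b. L c (b * s) ^ k"] by (simp add: mult.assoc)
 have "ALL c k. EX g. g holomorphic_on ball 0 (r ^ N) & (ALL s:ball 0 r. p c k s = g (s ^ N))"
  using rotation_invariant_factor[OF hp N b0 _ d(2)] inv by blast
 then obtain ph where ph: "ALL c k. ph c k holomorphic_on ball 0 (r ^ N) & (ALL s:ball 0 r. p c k s = ph c k (s ^ N))"
  unfolding choice_iff by (elim exE) (rule that)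
 define U' where "U' = U Int f -` ball 0 (r ^ N)"
 have oU': "open U'" unfolding U'_def
  by (rule continuous_open_preimage[OF holomorphic_several_continuous[OF f(1)] holomorphic_several_open[OF f(1)] open_ball])
 have f0: "f 0 = 0" using bspec[OF fd, of 0] d N by (simp add: power_0_left)
 have U'0: "0 : U'" using f(2) f0 d(2) by (simp add: U'_def)
 define Hc where "Hc c z = (\<Sum>k\<le>N. newton (%k. ph c k (f z)) k * lam c z ^ (N - k))" for c z
 have fU': "holomorphic_several f U'" by (rule holomorphic_several_subset[OF f(1) oU']) (auto simp: U'_def)
 have hH: "holomorphic_several (Hc c) U'" for c
 proof -
  have "holomorphic_several (%z. ph c k (f z)) U'" for k
   by (rule holomorphic_several_outer[OF fU', of _ "ball 0 (r ^ N)"]) (use ph in \<open>auto simp: U'_def\<close>)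
  moreover have "holomorphic_several (lam c) U'" unfolding lam_def[abs_def]
   by (intro holomorphic_several_sum holomorphic_several_mult holomorphic_several_const holomorphic_several_nth ballI oU')
  ultimately show ?thesis unfolding Hc_def[abs_def]
   by (intro holomorphic_several_sum holomorphic_several_mult holomorphic_several_power
     holomorphic_several_newton ballI allI oU')
 qed
 have H0: "Hc c z = 0 \<longleftrightarrow> (EX b:G. lam c z = L c (b * s))" if s: "s : ball 0 r" "s ^ N = f z" for c z s
 proof -
  let ?as = "map (%b. L c (b * s)) gs"
  have "(\<Sum>a\<leftarrow>?as. a ^ k) = ph c k (f z)" for k
  proof -
   have "(\<Sum>a\<leftarrow>?as. a ^ k) = p c k s"
    unfolding p_def gs(1)[symmetric] using gs(2) by (simp add: sum_list_distinct_conv_sum_set o_def)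
   thus ?thesis using ph s by (metis)
  qed
  hence "Hc c z = (\<Prod>a\<leftarrow>?as. lam c z - a)" unfolding Hc_def prod_list_newton by (simp add: len)
  hence "Hc c z = 0 \<longleftrightarrow> 0 : set (map (%a. lam c z - a) ?as)" by (simp add: prod_list_zero_iff)
  also have "... \<longleftrightarrow> (EX b:G. lam c z = L c (b * s))" using gs(1) by (auto simp: image_iff)
  finally show ?thesis .
 qed
 define A where "A = {z : U'. ALL g:Hc ` {..<N * n + 1}. g z = 0}"
 have "Hc c 0 = 0" for c using H0[of 0 0 c] d f0 N G(3) by (force simp: L_def power_0_left)
 hence "analytic_germ A" unfolding analytic_germ_def
  using U'0 oU' hH by (intro conjI exI[of _ U'] exI[of _ "Hc ` {..<N * n + 1}"]) (auto simp: A_def)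
 moreover have "germ_eq A (d ` ball 0 e)" if e: "0 < e" "e <= r" for e unfolding germ_eq_def
 proof -
  have "\<forall>\<^sub>F z in nhds 0. norm (f z) < e ^ N" by (rule continuous_norm_small[OF f f0]) (use e in auto)
  moreover have "\<forall>\<^sub>F z in nhds 0. z : U'" using U'0 oU' by (rule eventually_nhds_in_open[rotated])
  ultimately show "\<forall>\<^sub>F z in nhds 0. (z : A) = (z : d ` ball 0 e)"
  proof eventually_elim
   case (elim z)
   obtain s where s: "s ^ N = f z" using complex_root_exists[OF N] by blast
   have sn: "norm s < e" by (rule norm_root_less[OF s elim(1) e(1)])
   hence sr: "s : ball 0 r" using e by simp
   show ?case
   proof
    assume zA: "z : A"
    obtain b where b: "b : G" "\<And>i. i < n ==> (z - d (b * s)) $ inv_into UNIV h i = 0"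
    proof (rule combination_pigeonhole[of G N n "%b i. (z - d (b * s)) $ inv_into UNIV h i"])
     fix c assume c: "c < N * n + 1"
     hence "Hc c z = 0" using zA by (auto simp: A_def)
     then obtain b where "b : G" "lam c z = lam c (d (b * s))" using H0[OF sr s] by (auto simp: L_def)
     thus "EX b:G. (\<Sum>i<n. of_nat c ^ i * (z - d (b * s)) $ inv_into UNIV h i) = 0"
      by (intro bexI[of _ b]) (simp_all only: lam_diff[symmetric], simp)
    qed (use G in auto)
    have "z $ j = d (b * s) $ j" for j
    proof -
     have "h j < n" "inv_into UNIV h (h j) = j" using h by (auto simp: bij_betw_def inv_into_f_f)
     thus ?thesis using b(2)[of "h j"] by simp
    qed
    hence "z = d (b * s)" by (simp add: vec_eq_iff)
    moreover have "b * s : ball 0 e" using nG[OF b(1)] sn by (simp add: norm_mult)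
    ultimately show "z : d ` ball 0 e" by blast
   next
    assume "z : d ` ball 0 e"
    then obtain s' where "norm s' < e" and zs': "z = d s'" by auto
    hence s': "s' : ball 0 r" "z = d s'" using e by auto
    hence "s' ^ N = f z" using fd by auto
    hence "Hc c z = 0" for c using H0[OF s'(1), of z c] G(3) s'(2) by (auto simp: L_def intro!: bexI[of _ 1])
    thus "z : A" using elim(2) by (auto simp: A_def)
   qed
  qed
 qed
 ultimately show ?thesis by blast
qed


text \<open>The exponent \<open>N\<close> of \<open>f\<close> along the curve measures how often the
  branch is traversed; minimizing it will give injectivity.\<close>

definition curve_over ::
  "(complex ^ 'n) set => (complex ^ 'n => complex) => nat => (complex => complex ^ 'n) => real => bool" where
 "curve_over Z f N g r \<longleftrightarrow> N > 0 & r > 0 & hol_vec g (ball 0 r) & g 0 = 0 &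
  (ALL s:ball 0 r. f (g s) = s ^ N) & (ALL e. 0 < e & e <= r --> germ_eq Z (g ` ball 0 e))"

text \<open>Of the finitely many candidate curves, the \<open>good\<close> ones lie on
  \<open>Z\<close> with the prescribed values of \<open>f\<close>, and the others meet these
  conditions near 0 at most at 0. So \<open>Z\<close> is the union of the images of the good curves.
  These images are analytic germs, and irreducibility makes \<open>Z\<close> equal to one of
  them.\<close>

lemma curve_over_exists:
 fixes Z :: "(complex ^ 'n) set"
 assumes Z: "irreducible_germ Z" and f: "f 0 = 0" "0 : U" "holomorphic_several f U" "germ_eq {z : Z. f z = 0} {0}"
  and ne: "~ germ_eq Z {0}" shows "EX N g r. curve_over Z f N g r"
proof -
 have Za: "analytic_germ Z" using Z by (simp add: irreducible_germ_def)
 hence Z0: "0 : Z" by (simp add: analytic_germ_def)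
 obtain N r G where N: "N > 0" and r: "r > 0" and G: "finite G" "ALL g:G. hol_vec g (ball 0 r) & g 0 = 0" and
  cov: "ALL e>0. \<forall>\<^sub>F z in nhds 0. z : Z --> (EX s:ball 0 e. s ^ N = f z & (EX g:G. z = g s))"
  using curves_cover[OF Za f] by (elim exE conjE) (rule that)
 define good where "good g d \<longleftrightarrow> (ALL s:ball 0 d. g s : Z & g s : U & f (g s) = s ^ N)" for g d
 have dich: "ALL g:G. EX d. 0 < d & d <= r & (good g d | (ALL s. s ~= 0 --> norm s < d --> ~ (g s : Z & f (g s) = s ^ N)))"
 proof
  fix g assume "g : G"
  hence g: "hol_vec g (ball 0 r)" "g 0 = 0" using G(2) by auto
  obtain r1 where r1: "r1 > 0" "r1 <= r" "g ` ball 0 r1 <= U"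
   using small_preimage_ball[OF g(1) r holomorphic_several_open[OF f(3)]] g(2) f(2) by auto
  have hol: "(%s. f (g s) - s ^ N) holomorphic_on ball 0 r1" by (intro holomorphic_intros holomorphic_several_compose[OF f(3)])
    (use r1 hol_vec_ball[OF g(1) r1(2)] in auto)
  consider "EX d>0. ALL s. s ~= 0 --> norm s <= d --> g s ~: Z"
   | "EX d>0. ALL s. s ~= 0 --> norm s <= d --> f (g s) - s ^ N ~= 0"
   | "EX d>0. ALL s:ball 0 d. g s : Z" "ALL s:ball 0 r1. f (g s) - s ^ N = 0"
   using curve_in_analytic_germ[OF Za g(1) r g(2)] holomorphic_dichotomy[OF hol r1(1)] by blast
  thus "EX d. 0 < d & d <= r & (good g d | (ALL s. s ~= 0 --> norm s < d --> ~ (g s : Z & f (g s) = s ^ N)))"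
  proof cases
   case 1
   then obtain d where d: "d > 0" "ALL s. s ~= 0 --> norm s <= d --> g s ~: Z" by blast
   thus ?thesis using r by (intro exI[of _ "min d r"]) auto
  next
   case 2
   then obtain d where d: "d > 0" "ALL s. s ~= 0 --> norm s <= d --> f (g s) - s ^ N ~= 0" by blast
   thus ?thesis using r by (intro exI[of _ "min d r"]) auto
  next
   case 3
   then obtain d where d: "d > 0" "ALL s:ball 0 d. g s : Z" by blast
   have "good g (min d r1)" unfolding good_def using d(2) 3(2) r1(3) by auto
   thus ?thesis using d(1) r1 by (intro exI[of _ "min d r1"]) auto
  qed
 qed
 then obtain df where df: "ALL g:G. 0 < df g & df g <= r & (good g (df g) |
  (ALL s. s ~= 0 --> norm s < df g --> ~ (g s : Z & f (g s) = s ^ N)))" unfolding bchoice_iff by (elim exE) (rule that)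
 define d where "d = Min (insert r (df ` G))"
 have d: "d > 0" "d <= r" "\<And>g. g : G ==> d <= df g" unfolding d_def using G(1) df r by auto
 define K where "K = {g : G. good g d}"
 have bad: "~ (g s : Z & f (g s) = s ^ N)" if "g : G - K" "s ~= 0" "norm s < d" for g s
 proof -
  have "~ good g (df g)" using that(1) d(3)[of g] unfolding K_def good_def by fastforce
  moreover have "norm s < df g" using that d(3)[of g] by auto
  ultimately show ?thesis using df that by blast
 qed
 have cover: "\<forall>\<^sub>F z in nhds 0. z : Z --> z = 0 | (EX g:K. z : g ` ball 0 e)" if e: "0 < e" "e <= d" for e
  using cov[rule_format, OF e(1)]
 proof eventually_elim
  case (elim z)
  show ?case
  proof
   assume "z : Z"
   then obtain s g where s: "s : ball 0 e" "s ^ N = f z" "g : G" "z = g s" using elim by blast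
   show "z = 0 | (EX g:K. z : g ` ball 0 e)"
   proof (cases "s = 0")
    case True
    thus ?thesis using s G(2) by simp
   next
    case False
    have "norm s < d" using s(1) e by simp
    hence "g : K" using bad[of g s] s \<open>z : Z\<close> False by auto
    thus ?thesis using s by blast
   qed
  qed
 qed
 have Kne: "K ~= {}"
 proof
  assume "K = {}"
  hence "\<forall>\<^sub>F z in nhds 0. z : Z --> z = 0" using cover[OF d(1) order_refl] by simp
  hence "germ_eq Z {0}" unfolding germ_eq_def by (rule eventually_mono) (use Z0 in auto)
  thus False using ne by simp
 qed
 have K: "finite K" "ALL g:K. hol_vec g (ball 0 d) & g 0 = 0 & good g d" using G d(2) hol_vec_ball[OF _ d(2)] by (auto simp: K_def)
 have union: "germ_eq Z (\<Union>g\<in>K. g ` ball 0 e)" if e: "0 < e" "e <= d" for e unfolding germ_eq_def using cover[OF e]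
 proof eventually_elim
  case (elim z)
  obtain g0 where "g0 : K" using Kne by blast
  hence "0 : g0 ` ball 0 e" using K(2) e by (auto simp: image_iff intro!: bexI[of _ 0])
  hence "z = 0 ==> EX g:K. z : g ` ball 0 e" using \<open>g0 : K\<close> by blast
  moreover have "g ` ball 0 e <= Z" if "g : K" for g using K(2) that e unfolding good_def by auto
  ultimately show ?case using elim by blast
 qed
 have "ALL g:K. EX A. analytic_germ A & (ALL e. 0 < e & e <= d --> germ_eq A (g ` ball 0 e))"
 proof
  fix g assume "g : K"
  thus "EX A. analytic_germ A & (ALL e. 0 < e & e <= d --> germ_eq A (g ` ball 0 e))"
   using K(2) by (intro curve_image_analytic[OF f(3,2) _ d(1) _ N]) (auto simp: good_def)
 qed
 then obtain A where A: "ALL g:K. analytic_germ (A g) & (ALL e. 0 < e & e <= d --> germ_eq (A g) (g ` ball 0 e))"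
  unfolding bchoice_iff by (elim exE) (rule that)
 have "germ_eq (\<Union>g\<in>K. A g) (\<Union>g\<in>K. g ` ball 0 d)" by (rule germ_eq_UN[OF K(1)]) (use A d(1) in auto)
 hence "germ_eq Z (\<Union>g\<in>K. A g)" using union[OF d(1) order_refl] germ_eq_sym germ_eq_trans by blast
 then obtain g where g: "g : K" "germ_eq Z (A g)" using irreducible_germ_UN[OF Z K(1) Kne] A by blast
 have "germ_eq Z (g ` ball 0 e)" if "0 < e" "e <= d" for e using germ_eq_trans[OF g(2)] A g(1) that by blast
 hence "curve_over Z f N g d" unfolding curve_over_def using N d(1) K(2) g(1) by (auto simp: good_def)
 thus ?thesis by blast
qed

text \<open>Every smaller disc must also have image germ \<open>Z\<close>, so that points near the
  origin come only from small parameters.\<close>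

definition branch_param :: "(complex ^ 'n) set => (complex => complex ^ 'n) => real => bool" where
 "branch_param Z f R \<longleftrightarrow> R > 0 & hol_vec f (ball 0 R) & f 0 = 0 & inj_on f (ball 0 R) &
  (ALL e. 0 < e & e <= R --> germ_eq Z (f ` ball 0 e))"

text \<open>A parametrization with minimal exponent \<open>N\<close> is injective, since otherwise it would factor through a power.\<close>

theorem branch_param_exists:
 fixes Z :: "(complex ^ 'n) set" assumes Z: "irreducible_germ Z" and dim: "germ_dim Z = 1" shows "EX h R. branch_param Z h R"
proof -
 have Z0: "0 : Z" using Z by (simp add: irreducible_germ_def analytic_germ_def)
 obtain f U where f: "f 0 = 0" "0 : U" "holomorphic_several f U" "germ_eq {z : Z. f z = 0} {0}"
  using germ_dim_1_function(1)[OF Z0 dim] by blast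
 have "EX N. EX c r. curve_over Z f N c r" using curve_over_exists[OF Z f germ_dim_1_function(2)[OF Z0 dim]] .
 then obtain N where N: "EX c r. curve_over Z f N c r" "ALL N'<N. ~ (EX c r. curve_over Z f N' c r)"
  using exists_least_iff[of "%N. EX c r. curve_over Z f N c r"] by blast
 then obtain c r where co: "curve_over Z f N c r" by blast
 hence c: "N > 0" "r > 0" "hol_vec c (ball 0 r)" "c 0 = 0" "ALL s:ball 0 r. f (c s) = s ^ N"
  "ALL y. 0 < y & y <= r --> germ_eq Z (c ` ball 0 y)" unfolding curve_over_def by auto
 define G where "G = {w::complex. w ^ N = 1} - {1}"
 have finG: "finite G" unfolding G_def using c(1) finite_roots_unity[of N] by auto
 have rot: "EX d>0. ALL s. s ~= 0 --> norm s <= d --> c (w * s) ~= c s" if w: "w : G" for w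
 proof (rule ccontr)
  assume not: "~ ?thesis"
  have wN: "w ^ N = 1" "w ~= 1" using w by (auto simp: G_def)
  have nw: "norm w = 1" using wN c(1) roots_of_unity_norm by blast
  have inv: "c (w * s) $ j = c s $ j" if "s : ball 0 r" for s j
  proof -
   have "(%s. w * s) ` ball 0 r <= ball 0 r" using nw by (auto simp: norm_mult)
   moreover have "(%s. w * s) holomorphic_on ball 0 r" by (intro holomorphic_intros)
   ultimately have "(%s. c (w * s) $ j) holomorphic_on ball 0 r"
    using hol_vec_compose[OF c(3), of "%s. w * s" "ball 0 r"] by (simp add: hol_vec_def)
   hence hol: "(%s. c (w * s) $ j - c s $ j) holomorphic_on ball 0 r"
    using c(3) by (auto simp: hol_vec_def intro!: holomorphic_intros)
   have "ALL d>0. EX s. s ~= 0 & norm s <= d & c (w * s) $ j - c s $ j = 0" using not by (metis eq_iff_diff_eq_0)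
   from holomorphic_frequently_zero[OF hol c(2) this] that show ?thesis by simp
  qed
  \<comment> \<open>The order of \<open>w\<close>; then \<open>w\<close> is a primitive
    \<open>e\<close>-th root of unity, and each coordinate is a function of
    \<open>s ^ e\<close>.\<close>
  define e where "e = (LEAST e. e > 0 & w ^ e = 1)"
  have e: "e > 0" "w ^ e = 1" unfolding e_def using LeastI[of "%e. e > 0 & w ^ e = 1" N] c(1) wN by auto
  have ediv: "e dvd k" if "w ^ k = 1" for k
  proof -
   have "w ^ k = (w ^ e) ^ (k div e) * w ^ (k mod e)" by (simp flip: power_mult power_add)
   hence "w ^ (k mod e) = 1" using that e by simp
   hence "~ k mod e > 0" using not_less_Least[of "k mod e" "%e. e > 0 & w ^ e = 1"] e by (auto simp: e_def[symmetric])
   thus ?thesis by (simp add: mod_eq_0_iff_dvd)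
  qed
  have e2: "e ~= 1" using e wN by auto
  have "ALL j. EX g. g holomorphic_on ball 0 (r ^ e) & (ALL s:ball 0 r. c s $ j = g (s ^ e))"
   using rotation_invariant_factor[OF _ e, of "%s. c s $ _"] c(2,3) ediv inv unfolding hol_vec_def by blast
  then obtain g where g: "ALL j. g j holomorphic_on ball 0 (r ^ e) & (ALL s:ball 0 r. c s $ j = g j (s ^ e))"
   unfolding choice_iff by (elim exE) (rule that)
  define c' where "c' t = (\<chi> j. g j t)" for t
  have c': "c s = c' (s ^ e)" if "s : ball 0 r" for s using g that by (simp add: c'_def vec_eq_iff)
  obtain M where M: "N = e * M" using ediv[OF wN(1)] by (auto elim: dvdE)
  have img: "c' ` ball 0 (y ^ e) = c ` ball 0 y" if "0 < y" "y <= r" for y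
  proof (intro set_eqI iffI)
   fix z assume "z : c' ` ball 0 (y ^ e)"
   then obtain t where t: "norm t < y ^ e" "z = c' t" by auto
   obtain s where s: "s ^ e = t" using complex_root_exists[OF e(1)] by blast
   have "norm s < y" by (rule norm_root_less[OF s t(1) that(1)])
   thus "z : c ` ball 0 y" using c'[of s] s t(2) that(2) by (intro image_eqI[of _ _ s]) auto
  next
   fix z assume "z : c ` ball 0 y"
   then obtain s where s: "norm s < y" "z = c s" by auto
   have "norm (s ^ e) < y ^ e" using s(1) e(1) by (simp add: norm_power power_strict_mono)
   thus "z : c' ` ball 0 (y ^ e)" using c'[of s] s that(2) by (intro image_eqI[of _ _ "s ^ e"]) auto
  qed
  have "curve_over Z f M c' (r ^ e)" unfolding curve_over_def
  proof (intro conjI allI ballI impI)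
   show "M > 0" using M c(1) by (cases M) auto
   show "r ^ e > 0" using c(2) by simp
   show "hol_vec c' (ball 0 (r ^ e))" using g by (simp add: hol_vec_def c'_def)
   show "c' 0 = 0" using c'[of 0] c(2,4) e(1) by (simp add: power_0_left)
  next
   fix t :: complex assume t: "t : ball 0 (r ^ e)"
   obtain s where s: "s ^ e = t" using complex_root_exists[OF e(1)] by blast
   hence sr: "s : ball 0 r" using norm_root_less[OF s, of r] t c(2) by simp
   show "f (c' t) = t ^ M" using c'[OF sr] c(5) sr s M by (metis power_mult)
  next
   fix y assume y: "0 < y & y <= r ^ e"
   define y' where "y' = root e y"
   have y': "y' > 0" "y' ^ e = y" using y e(1) by (auto simp: y'_def real_root_gt_zero)
   have "y' <= r" using y y' c(2) e(1) by (metis power_mono_iff less_eq_real_def)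
   thus "germ_eq Z (c' ` ball 0 y)" using img[of y'] y' c(6) by auto
  qed
  moreover have "M < N"
  proof -
   have "2 * M <= e * M" using e e2 by (intro mult_right_mono) auto
   moreover have "M > 0" using M c(1) by (cases M) auto
   ultimately show ?thesis using M by linarith
  qed
  ultimately show False using N(2) by blast
 qed
 then obtain df where df: "ALL w:G. df w > 0 & (ALL s. s ~= 0 --> norm s <= df w --> c (w * s) ~= c s)" by metis
 define R where "R = Min (insert r (df ` G))"
 have R: "R > 0" "R <= r" "\<And>w. w : G ==> R <= df w" unfolding R_def using finG df c(2) by auto
 have "inj_on c (ball 0 R)"
 proof (rule inj_onI)
  fix s s' assume s: "s : ball 0 R" "s' : ball 0 R" "c s = c s'"
  \<comment> \<open>Equal points have equal values of \<open>f\<close>, so their parameters differ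
    by an \<open>N\<close>-th root of unity.\<close>
  hence pow: "s ^ N = s' ^ N" using c(5) R(2) by (metis ball_subset_cball subset_ball subset_iff)
  show "s = s'"
  proof (cases "s = 0")
   case True
   thus ?thesis using pow c(1) by (simp add: power_0_left)
  next
   case False
   have "(s' / s) ^ N = 1" using False by (simp add: power_divide pow[symmetric])
   show ?thesis
   proof (rule ccontr)
    assume "s ~= s'"
    hence "s' / s : G" using \<open>(s' / s) ^ N = 1\<close> False by (auto simp: G_def)
    hence "c (s' / s * s) ~= c s" using df R(3) s(1) False by (metis dist_0_norm less_eq_real_def mem_ball order_trans)
    thus False using s(3) False by simp
   qed
  qed
 qed
 hence "branch_param Z c R" unfolding branch_param_def using R(1,2) c hol_vec_ball[OF c(3) R(2)] by auto
 thus ?thesis by blast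
qed

section \<open>Orders of vanishing and the invariants read from a parametrization\<close>

section \<open>Orders\<close>

lemma norm_smult: "norm (c *s (v :: complex ^ 'n)) = norm c * norm v"
 unfolding norm_vec_def by (simp add: norm_mult L2_set_right_distrib)

lemma ord0_zero: assumes "ALL u:ball 0 r. f u = 0" "r > 0" shows "ord0 f = \<infinity>"
proof -
 have "\<forall>\<^sub>F u in nhds 0. u : ball (0::complex) r" using assms(2) by (intro eventually_nhds_in_open) auto
 hence "\<forall>\<^sub>F u in nhds 0. f u = 0" by (rule eventually_mono) (use assms(1) in auto)
 hence "fps_expansion f 0 = 0" by (intro fps_expansion_eqI) (simp add: has_fps_expansion_0_iff)
 thus ?thesis by (simp add: ord0_def)
qed

lemma ord0_factor: assumes g: "g holomorphic_on ball 0 r" "r > 0" "g 0 ~= 0" and f: "ALL u:ball 0 r. f u = u ^ k * g u"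
 shows "ord0 f = enat k"
proof -
 have "g analytic_on {0}" using g(1,2) analytic_at_ball by (metis analytic_at open_ball centre_in_ball)
 hence "g has_fps_expansion fps_expansion g 0" by (rule analytic_at_imp_has_fps_expansion_0)
 hence ex: "(%u. u ^ k * g u) has_fps_expansion fps_X ^ k * fps_expansion g 0"
  by (intro has_fps_expansion_mult has_fps_expansion_fps_X_power)
 have "\<forall>\<^sub>F u in nhds 0. u : ball (0::complex) r" using g(2) by (intro eventually_nhds_in_open) auto
 hence "\<forall>\<^sub>F u in nhds 0. u ^ k * g u = f u" by (rule eventually_mono) (use f in auto)
 from has_fps_expansion_cong[OF this refl] ex
 have "f has_fps_expansion fps_X ^ k * fps_expansion g 0" by simp
 hence eq: "fps_expansion f 0 = fps_X ^ k * fps_expansion g 0" by (rule fps_expansion_eqI)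
 have g0: "fps_nth (fps_expansion g 0) 0 ~= 0" using g(3) by (simp add: fps_expansion_def)
 hence nz: "fps_expansion g 0 ~= 0" by auto
 have "subdegree (fps_expansion g 0) = 0" using g0 by simp
 hence "subdegree (fps_expansion f 0) = k" using nz unfolding eq by simp
 moreover have "fps_expansion f 0 ~= 0" using nz unfolding eq by simp
 ultimately show ?thesis by (simp add: ord0_def)
qed

lemma order_cases: assumes f: "f holomorphic_on ball 0 r" "r > 0" shows "(ALL u:ball 0 r. f u = 0) & ord0 f = \<infinity> |
  (EX k g. g holomorphic_on ball 0 r & g 0 ~= 0 & (ALL u:ball 0 r. f u = u ^ k * g u) & ord0 f = enat k)"
proof (cases "ALL u:ball 0 r. f u = 0")
 case True
 thus ?thesis using ord0_zero f(2) by blast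
next
 case False
 then obtain d a where a: "0 < a" "zero_order d r a f" using zero_order_exists[OF f(1), of 1] by auto
 then obtain g where g: "g holomorphic_on ball 0 r" "ALL z:ball 0 r. f z = z ^ d * g z"
  "ALL z. norm z <= a --> g z ~= 0" unfolding zero_order_def by blast
 have "g 0 ~= 0" using g(3) a(1) by simp
 thus ?thesis using g ord0_factor[OF g(1) f(2)] by blast
qed

definition vord :: "(complex => complex ^ 'n) => enat" where
 "vord F = Min (range (%j. ord0 (%u. F u $ j)))"

lemma vord_le: "vord F <= ord0 (%u. F u $ j)" unfolding vord_def by (rule Min_le) auto

lemma vord_attained: "EX j. vord F = ord0 (%u. F u $ j)"
proof -
 have "vord F : range (%j. ord0 (%u. F u $ j))" unfolding vord_def by (rule Min_in) auto
 thus ?thesis by auto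
qed

lemma vord_cases:
 fixes F :: "complex => complex ^ 'n" assumes F: "hol_vec F (ball 0 r)" "r > 0" shows "(ALL u:ball 0 r. F u = 0) & vord F = \<infinity> |
  (EX k G. hol_vec G (ball 0 r) & G 0 ~= 0 & (ALL u:ball 0 r. F u = u ^ k *s G u) & vord F = enat k)"
proof (cases "vord F")
 case infinity
 have "F u $ j = 0" if "u : ball 0 r" for u j
 proof -
  have "ord0 (%u. F u $ j) = \<infinity>" using vord_le[of F j] infinity by simp
  thus ?thesis using order_cases[of "%u. F u $ j" r] F that by (auto simp: hol_vec_def)
 qed
 thus ?thesis using infinity by (simp add: vec_eq_iff)
next
 case (enat k)
 have "EX g. g holomorphic_on ball 0 r & (ALL u:ball 0 r. F u $ j = u ^ k * g u) &
   (ord0 (%u. F u $ j) = enat k --> g 0 ~= 0)" for j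
 proof -
  have hj: "(%u. F u $ j) holomorphic_on ball 0 r" using F by (simp add: hol_vec_def)
  from order_cases[OF hj F(2)] show ?thesis
  proof (elim disjE exE conjE)
   assume "ALL u:ball 0 r. F u $ j = 0" "ord0 (%u. F u $ j) = \<infinity>"
   thus ?thesis by (intro exI[of _ "%_. 0"]) auto
  next
   fix l g assume g: "g holomorphic_on ball 0 r" "g 0 ~= 0" "ALL u:ball 0 r. F u $ j = u ^ l * g u"
    "ord0 (%u. F u $ j) = enat l"
   have kl: "k <= l" using vord_le[of F j] enat g(4) by simp
   have "u ^ l = u ^ k * u ^ (l - k)" for u :: complex using kl by (metis le_add_diff_inverse power_add)
   thus ?thesis using g kl by (intro exI[of _ "%u. u ^ (l - k) * g u"]) (auto intro!: holomorphic_intros simp: mult.assoc)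
  qed
 qed
 hence "ALL j. EX g. g holomorphic_on ball 0 r & (ALL u:ball 0 r. F u $ j = u ^ k * g u) &
   (ord0 (%u. F u $ j) = enat k --> g 0 ~= 0)" by blast
 then obtain g where g: "ALL j. g j holomorphic_on ball 0 r & (ALL u:ball 0 r. F u $ j = u ^ k * g j u) &
   (ord0 (%u. F u $ j) = enat k --> g j 0 ~= 0)" unfolding choice_iff by blast
 define G where "G u = (\<chi> j. g j u)" for u
 obtain j where "vord F = ord0 (%u. F u $ j)" using vord_attained by blast
 hence "g j 0 ~= 0" using g enat by simp
 hence "G 0 $ j ~= 0" by (simp add: G_def)
 hence "G 0 ~= 0" by auto
 moreover have "hol_vec G (ball 0 r)" using g by (simp add: hol_vec_def G_def)
 moreover have "ALL u:ball 0 r. F u = u ^ k *s G u" using g by (simp add: G_def vec_eq_iff)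
 ultimately show ?thesis using enat by blast
qed

lemma vec_factor_bounds:
 fixes F :: "complex => complex ^ 'n" assumes G: "hol_vec G (ball 0 r)" "r > 0" "G 0 ~= 0" and F: "ALL u:ball 0 r. F u = u ^ k *s G u"
 shows "EX a c C. 0 < a & a <= r & 0 < c & 0 < C & (ALL u:ball 0 a. c * norm u ^ k <= norm (F u) & norm (F u) <= C * norm u ^ k)"
proof -
 have "continuous_on (ball 0 r) G" by (rule hol_vec_continuous[OF G(1)])
 hence "isCont G 0" using G(2) by (simp add: continuous_on_eq_continuous_at)
 then obtain a where a: "a > 0" "ALL u. dist u 0 < a --> dist (G u) (G 0) < norm (G 0) / 2"
  using G(3) unfolding continuous_at_eps_delta by (metis half_gt_zero zero_less_norm_iff)
 have "norm (G 0) / 2 * norm u ^ k <= norm (F u) & norm (F u) <= (2 * norm (G 0)) * norm u ^ k" if u: "u : ball 0 (min a r)" for u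
 proof -
  have d: "norm (G u - G 0) < norm (G 0) / 2" using a(2) u by (simp add: dist_norm)
  have "norm (G 0) / 2 <= norm (G u)" using d norm_triangle_ineq2[of "G 0" "G u"] by (simp add: norm_minus_commute)
  moreover have "norm (G u) <= 2 * norm (G 0)" using d norm_triangle_ineq2[of "G u" "G 0"] norm_ge_zero[of "G 0"] by linarith
  moreover have "norm (F u) = norm (G u) * norm u ^ k" using F u by (simp add: norm_smult norm_power)
  ultimately show ?thesis using mult_right_mono[of "norm (G 0) / 2" "norm (G u)" "norm u ^ k"]
    mult_right_mono[of "norm (G u)" "2 * norm (G 0)" "norm u ^ k"] by simp
 qed
 thus ?thesis by (intro exI[of _ "min a r"] exI[of _ "norm (G 0) / 2"] exI[of _ "2 * norm (G 0)"])
   (use a G in auto)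
qed

lemma vord_bounds:
 fixes F :: "complex => complex ^ 'n" assumes "hol_vec F (ball 0 r)" "r > 0" "vord F = enat k"
 shows "EX d c C. 0 < d & d <= r & 0 < c & 0 < C & (ALL u:ball 0 d. c * norm u ^ k <= norm (F u) & norm (F u) <= C * norm u ^ k)"
 using vord_cases[OF assms(1,2)] assms(3) vec_factor_bounds[of _ r F k] assms(2) by auto

lemma power_dominates:
 fixes c C d :: real assumes "d > 0" "c > 0" and le: "ALL t. 0 < t & t < d --> c * t ^ k <= C * t ^ l" shows "l <= (k::nat)"
proof (rule ccontr)
 assume "~ l <= k"
 hence l: "l = k + Suc (l - k - 1)" by simp
 define m where "m = l - k - 1"
 have bound: "c <= \<bar>C\<bar> * t" if t: "0 < t" "t < d" "t < 1" for t
 proof -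
  have "c * t ^ k <= (C * t ^ Suc m) * t ^ k" using le t l by (metis m_def mult.commute mult.left_commute power_add)
  hence "c <= C * t ^ Suc m" using t by (simp add: mult_le_cancel_right)
  also have "... <= \<bar>C\<bar> * t ^ Suc m" using t by (intro mult_right_mono) auto
  also have "... <= \<bar>C\<bar> * t ^ 1" using t by (intro mult_left_mono power_decreasing) auto
  finally show ?thesis by simp
 qed
 define t where "t = min (d / 2) (min (1 / 2) (c / (2 * (\<bar>C\<bar> + 1))))"
 have t: "0 < t" "t < d" "t < 1" using assms(1,2) by (auto simp: t_def)
 have "c <= (\<bar>C\<bar> + 1) * t" using bound[OF t] t(1) by (simp add: distrib_right)
 also have "... <= (\<bar>C\<bar> + 1) * (c / (2 * (\<bar>C\<bar> + 1)))" by (rule mult_left_mono) (auto simp: t_def)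
 also have "... = c / 2" by (simp add: field_simps)
 finally show False using assms(2) by simp
qed

text \<open>With \<open>vord_upper\<close> this characterizes the order by the growth of the norm,
  so that inequalities between orders follow from the triangle inequality.\<close>

lemma vord_ge:
 fixes F :: "complex => complex ^ 'n"
 assumes F: "hol_vec F (ball 0 r)" "r > 0" and d: "d > 0" "ALL u:ball 0 d. norm (F u) <= C * norm u ^ k" shows "enat k <= vord F"
proof (cases "vord F")
 case (enat l)
 obtain d' c where d': "0 < d'" "0 < c" "ALL u:ball 0 d'. c * norm u ^ l <= norm (F u)" using vord_bounds[OF F enat] by blast
 have "k <= l"
 proof (rule power_dominates[of "min d d'" c])
  show "ALL t. 0 < t & t < min d d' --> c * t ^ l <= C * t ^ k"
  proof (intro allI impI)
   fix t assume "0 < t & t < min d d'"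
   thus "c * t ^ l <= C * t ^ k" using bspec[OF d(2), of "of_real t"] bspec[OF d'(3), of "of_real t"] by auto
  qed
 qed (use d d' in auto)
 thus ?thesis using enat by simp
qed auto

lemma vord_upper:
 fixes F :: "complex => complex ^ 'n" assumes F: "hol_vec F (ball 0 r)" "r > 0" and k: "enat k <= vord F"
 shows "EX d C. 0 < d & d <= r & 0 < C & (ALL u:ball 0 d. norm (F u) <= C * norm u ^ k)"
proof (cases "vord F")
 case infinity
 hence "ALL u:ball 0 r. F u = 0" using vord_cases[OF F] by auto
 thus ?thesis using F(2) by (intro exI[of _ r] exI[of _ 1]) auto
next
 case (enat l)
 obtain d C where d: "0 < d" "d <= r" "0 < C" "ALL u:ball 0 d. norm (F u) <= C * norm u ^ l" using vord_bounds[OF F enat] by blast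
 have "norm (F u) <= C * norm u ^ k" if "u : ball 0 (min d 1)" for u
 proof -
  have "norm u ^ l <= norm u ^ k" using that k enat by (intro power_decreasing) auto
  hence "C * norm u ^ l <= C * norm u ^ k" using d(3) by (intro mult_left_mono) auto
  moreover have "norm (F u) <= C * norm u ^ l" using d(4) that by auto
  ultimately show ?thesis by linarith
 qed
 thus ?thesis using d by (intro exI[of _ "min d 1"] exI[of _ C]) auto
qed

lemma hol_vec_add: "hol_vec F S ==> hol_vec G S ==> hol_vec (%u. F u + G u) S" by (auto simp: hol_vec_def intro!: holomorphic_intros)

lemma hol_vec_diff: "hol_vec F S ==> hol_vec G S ==> hol_vec (%u. F u - G u) S" by (auto simp: hol_vec_def intro!: holomorphic_intros)

lemma hol_vec_smult: "g holomorphic_on S ==> hol_vec G S ==> hol_vec (%u. g u *s G u) S"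
 by (auto simp: hol_vec_def intro!: holomorphic_intros)

lemma vord_add:
 fixes F G :: "complex => complex ^ 'n" assumes F: "hol_vec F (ball 0 r)" and G: "hol_vec G (ball 0 r)" and r: "r > 0"
  and k: "enat k <= vord F" "enat k <= vord G" shows "enat k <= vord (%u. F u + G u)"
proof -
 obtain d C where F': "0 < d" "ALL u:ball 0 d. norm (F u) <= C * norm u ^ k" using vord_upper[OF F r k(1)] by blast
 obtain d' C' where G': "0 < d'" "ALL u:ball 0 d'. norm (G u) <= C' * norm u ^ k" using vord_upper[OF G r k(2)] by blast
 have "norm (F u + G u) <= (C + C') * norm u ^ k" if "u : ball 0 (min d d')" for u
 proof -
  have "norm (F u) <= C * norm u ^ k" "norm (G u) <= C' * norm u ^ k" using F'(2) G'(2) that by auto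
  thus ?thesis using norm_triangle_ineq[of "F u" "G u"] unfolding distrib_right by linarith
 qed
 thus ?thesis using vord_ge[OF hol_vec_add[OF F G] r, of "min d d'" "C + C'" k] F'(1) G'(1) by simp
qed

lemma vord_mono_min:
 fixes F G :: "complex => complex ^ 'n" assumes "hol_vec F (ball 0 r)" "hol_vec G (ball 0 r)" "r > 0"
 shows "min (vord F) (vord G) <= vord (%u. F u + G u)"
proof (rule ccontr)
 assume not: "~ ?thesis"
 then obtain l where l: "vord (%u. F u + G u) = enat l" by (cases "vord (%u. F u + G u)") auto
 hence "enat (Suc l) <= vord F" "enat (Suc l) <= vord G" using not l by (simp_all add: Suc_ile_eq not_le)
 from vord_add[OF assms this] show False by (simp add: l)
qed

lemma vord_reparam:
 fixes F :: "complex => complex ^ 'n" assumes F: "hol_vec F (ball 0 r)" "r > 0" and k: "k > 0" and c: "c ~= 0"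
 shows "vord (%u. F (c * u ^ k)) = enat k * vord F"
proof -
 define r' where "r' = min 1 (r / norm c)"
 have r': "r' > 0" using F(2) c by (simp add: r'_def)
 have sub: "(%u. c * u ^ k) ` ball 0 r' <= ball 0 r"
 proof
  fix w assume "w : (%u. c * u ^ k) ` ball 0 r'"
  then obtain u where u: "norm u < r'" "w = c * u ^ k" by auto
  have "norm (u ^ k) <= norm u" using u by (intro norm_power_le_self) (auto simp: r'_def k)
  hence "norm w <= norm c * norm u" using u(2) by (simp add: norm_mult mult_left_mono)
  also have "... < norm c * (r / norm c)" using u(1) c by (intro mult_strict_left_mono) (auto simp: r'_def)
  finally show "w : ball 0 r" using c by simp
 qed
 have hol: "hol_vec (%u. F (c * u ^ k)) (ball 0 r')" by (rule hol_vec_compose[OF F(1) _ sub]) (intro holomorphic_intros)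
 show ?thesis
 proof (cases "vord F")
  case infinity
  hence "ALL u:ball 0 r. F u = 0" using vord_cases[OF F] by auto
  hence 0: "ALL u:ball 0 r'. F (c * u ^ k) = 0" using sub by blast
  have "vord (%u. F (c * u ^ k)) = \<infinity>"
  proof -
   obtain j where "vord (%u. F (c * u ^ k)) = ord0 (%u. F (c * u ^ k) $ j)" using vord_attained by blast
   also have "... = \<infinity>" by (rule ord0_zero[OF _ r']) (use 0 in simp)
   finally show ?thesis .
  qed
  thus ?thesis using infinity k by (simp add: enat_0_iff)
 next
  case (enat l)
  then obtain G where G: "hol_vec G (ball 0 r)" "G 0 ~= 0" "ALL u:ball 0 r. F u = u ^ l *s G u" using vord_cases[OF F] by auto
  define G' where "G' u = c ^ l *s G (c * u ^ k)" for u
  have hG': "hol_vec G' (ball 0 r')" unfolding G'_def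
   by (intro hol_vec_smult hol_vec_compose[OF G(1) _ sub]) (intro holomorphic_intros)+
  have G'0: "G' 0 ~= 0" using G(2) c k by (auto simp: G'_def power_0_left)
  have FG: "ALL u:ball 0 r'. F (c * u ^ k) = u ^ (k * l) *s G' u"
  proof
   fix u :: complex assume u: "u : ball 0 r'"
   have "c * u ^ k : ball 0 r" using sub u by blast
   hence "F (c * u ^ k) = (c * u ^ k) ^ l *s G (c * u ^ k)" using G(3) by blast
   thus "F (c * u ^ k) = u ^ (k * l) *s G' u"
    by (simp add: G'_def power_mult_distrib power_mult vector_smult_assoc mult.commute)
  qed
  have "enat (k * l) <= vord (%u. F (c * u ^ k))" using vec_factor_bounds[OF hG' r' G'0 FG] vord_ge[OF hol r'] by blast
  moreover have "vord (%u. F (c * u ^ k)) <= enat (k * l)"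
  proof (rule ccontr)
   assume "~ ?thesis"
   hence "enat (Suc (k * l)) <= vord (%u. F (c * u ^ k))" by (simp add: Suc_ile_eq)
   from vord_upper[OF hol r' this] obtain d C where d: "0 < d"
    "ALL u:ball 0 d. norm (F (c * u ^ k)) <= C * norm u ^ Suc (k * l)" by blast
   obtain d' c' where d': "0 < d'" "0 < c'" "ALL u:ball 0 d'. c' * norm u ^ (k * l) <= norm (F (c * u ^ k))"
    using vec_factor_bounds[OF hG' r' G'0 FG] by blast
   have "Suc (k * l) <= k * l"
   proof (rule power_dominates[of "min d d'" c'])
    show "ALL t. 0 < t & t < min d d' --> c' * t ^ (k * l) <= C * t ^ Suc (k * l)"
    proof (intro allI impI)
     fix t assume t: "0 < t & t < min d d'"
     have "c' * norm (of_real t :: complex) ^ (k * l) <= C * norm (of_real t :: complex) ^ Suc (k * l)"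
      by (rule order_trans[OF bspec[OF d'(3)] bspec[OF d(2)]]) (use t in auto)
     thus "c' * t ^ (k * l) <= C * t ^ Suc (k * l)" using t by (simp del: power_Suc)
    qed
   qed (use d d' in auto)
   thus False by simp
  qed
  ultimately show ?thesis using enat by simp
 qed
qed

lemma vord_minus: "vord (%u. F u - G u) = vord (%u. G u - F u)"
 if "hol_vec F (ball 0 r)" "hol_vec G (ball 0 r)" "r > 0" for F G :: "complex => complex ^ 'n"
proof -
 have le: "vord (%u. A u - B u) <= vord (%u. B u - A u)"
  if A: "hol_vec A (ball 0 r)" and B: "hol_vec B (ball 0 r)" for A B :: "complex => complex ^ 'n"
 proof (rule ccontr)
  assume not: "~ ?thesis"
  then obtain l where l: "vord (%u. B u - A u) = enat l" by (cases "vord (%u. B u - A u)") auto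
  hence "enat (Suc l) <= vord (%u. A u - B u)" using not by (simp add: Suc_ile_eq)
  from vord_upper[OF hol_vec_diff[OF A B] \<open>r > 0\<close> this] obtain d C where
   "0 < d" "ALL u:ball 0 d. norm (A u - B u) <= C * norm u ^ Suc l" by blast
  hence "enat (Suc l) <= vord (%u. B u - A u)"
   by (intro vord_ge[OF hol_vec_diff[OF B A] \<open>r > 0\<close>]) (auto simp: norm_minus_commute)
  thus False by (simp add: l)
 qed
 show ?thesis using le that by (intro antisym) auto
qed

section \<open>Local coordinates on a branch\<close>

lemma locally_injective: assumes "f holomorphic_on S" "x : S" "open S" "deriv f x ~= 0"
 shows "EX r>0. ball x r <= S & inj_on f (ball x r)"
proof -
 obtain r where "r > 0" "ball x r <= S" "inj_on f (ball x r)" by (rule has_complex_derivative_locally_injective[OF assms])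
 thus ?thesis by blast
qed

lemma holomorphic_inverse: assumes "f holomorphic_on S" "open S" "inj_on f S"
 shows "EX g. g holomorphic_on f ` S & (ALL z:S. g (f z) = z)"
proof (rule holomorphic_has_inverse[OF assms])
 fix g assume "g holomorphic_on f ` S" "\<And>z. z : S ==> g (f z) = z"
 thus ?thesis by (intro exI[of _ g] conjI ballI)
qed

text \<open>Near 0 the quotient \<open>h u / h 0\<close> has positive real part, where
  \<open>Ln\<close> is holomorphic. The product of \<open>u\<close> and a \<open>k\<close>-th root
  of \<open>h\<close> has nonzero derivative at 0.\<close>

lemma local_root: assumes h: "h holomorphic_on ball 0 r" "r > 0" "h 0 ~= 0" and k: "k > 0" and f: "ALL u:ball 0 r. f u = u ^ k * h u"
 shows "EX r' b. 0 < r' & r' <= r & b holomorphic_on ball 0 r' & inj_on b (ball 0 r') & b 0 = 0 &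
  (ALL u:ball 0 r'. f u = b u ^ k)"
proof -
 have "isCont h 0" using holomorphic_on_imp_continuous_on[OF h(1)] h(2) by (simp add: continuous_on_eq_continuous_at)
 then obtain d where d: "d > 0" "ALL u. dist u 0 < d --> dist (h u) (h 0) < norm (h 0)"
  using h(3) unfolding continuous_at_eps_delta by (metis zero_less_norm_iff)
 define r1 where "r1 = min d r"
 have r1: "r1 > 0" "r1 <= r" using d h by (auto simp: r1_def)
 have pos: "Re (h u / h 0) > 0" if "u : ball 0 r1" for u
 proof -
  have "norm (h u - h 0) < norm (h 0)" using d(2) that by (simp add: r1_def dist_norm)
  hence "norm (h u / h 0 - 1) < 1" using h(3) by (simp add: diff_divide_distrib[symmetric] norm_divide divide_simps)
  moreover have "\<bar>Re (h u / h 0 - 1)\<bar> <= norm (h u / h 0 - 1)" by (rule abs_Re_le_cmod)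
  ultimately show ?thesis by simp
 qed
 obtain c where c: "c ^ k = h 0" using complex_root_exists[OF k] by blast
 define L where "L u = Ln (h u / h 0)" for u
 define q where "q u = c * exp (L u / of_nat k)" for u
 have "h holomorphic_on ball 0 r1" using r1 by (intro holomorphic_on_subset[OF h(1)]) auto
 hence "(%u. h u / h 0) holomorphic_on ball 0 r1" using h(3) by (intro holomorphic_intros) auto
 moreover have "h u / h 0 ~: \<real>\<^sub>\<le>\<^sub>0" if "u : ball 0 r1" for u using pos[OF that] by (auto simp: complex_nonpos_Reals_iff)
 ultimately have "L holomorphic_on ball 0 r1" unfolding L_def[abs_def] by (rule holomorphic_on_Ln'[rotated])
 hence hq: "q holomorphic_on ball 0 r1" unfolding q_def[abs_def] using k by (intro holomorphic_intros) auto
 have qk: "q u ^ k = h u" if "u : ball 0 r1" for u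
 proof -
  have "h u / h 0 ~= 0" using pos[OF that] by auto
  have "exp (Ln (h u / h 0) / of_nat k) ^ k = exp (of_nat k * (Ln (h u / h 0) / of_nat k))" by (rule exp_of_nat_mult[symmetric])
  also have "... = h u / h 0" using k \<open>h u / h 0 ~= 0\<close> by simp
  finally show ?thesis using c h(3) by (simp add: q_def L_def power_mult_distrib)
 qed
 define b where "b u = u * q u" for u
 have hb: "b holomorphic_on ball 0 r1" unfolding b_def[abs_def] using hq by (intro holomorphic_intros)
 have q0: "q 0 ~= 0" using qk[of 0] r1 h(3) k by (auto simp: power_0_left)
 have "(q has_field_derivative deriv q 0) (at 0)" using hq r1 by (auto intro: holomorphic_derivI)
 hence "(b has_field_derivative 0 * deriv q 0 + 1 * q 0) (at 0)"
  unfolding b_def[abs_def] by (auto intro!: derivative_eq_intros)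
 hence "deriv b 0 ~= 0" using q0 by (simp add: DERIV_imp_deriv)
 then obtain r2 where r2: "r2 > 0" "ball (0::complex) r2 <= ball 0 r1" "inj_on b (ball 0 r2)"
  using locally_injective[OF hb _ open_ball, of 0] r1(1) by auto
 show ?thesis
 proof (intro exI[of _ r2] exI[of _ b] conjI ballI)
  have "r2 <= r1" using r2(1,2) r1(1) by (simp add: ball_subset_ball_iff)
  thus "r2 <= r" using r1(2) by simp
  show "b holomorphic_on ball 0 r2" by (rule holomorphic_on_subset[OF hb r2(2)])
  fix u :: complex assume "u : ball 0 r2"
  hence "u : ball 0 r1" using r2(2) by blast
  thus "f u = b u ^ k" using f qk r1 by (simp add: b_def power_mult_distrib)
 qed (use r2 in \<open>auto simp: b_def\<close>)
qed

text \<open>Away from 0 the map \<open>p\<close> is locally invertible and \<open>g\<close> is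
  locally a branch of its inverse composed with \<open>f\<close>. The singularity at 0 is removable
  by continuity.\<close>

lemma holomorphic_lift: assumes p: "p holomorphic_on ball 0 R" "ALL w:ball 0 R. w ~= 0 --> deriv p w ~= 0"
  and g: "continuous_on (ball 0 r) g" "g ` ball 0 r <= ball 0 R" "ALL u:ball 0 r. u ~= 0 --> g u ~= 0"
  and f: "f holomorphic_on ball 0 r" "ALL u:ball 0 r. p (g u) = f u" shows "g holomorphic_on ball 0 r"
proof -
 have "g holomorphic_on ball 0 r - {0}"
 proof (rule holomorphic_onI)
  fix u :: complex assume u: "u : ball 0 r - {0}"
  have gu: "g u : ball 0 R" "g u ~= 0" using u g(2,3) by blast+
  then obtain s where s: "s > 0" "ball (g u) s <= ball 0 R" "inj_on p (ball (g u) s)"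
   using locally_injective[OF p(1) gu(1) open_ball] p(2) gu by blast
  have hp: "p holomorphic_on ball (g u) s" using p(1) s(2) holomorphic_on_subset by blast
  from holomorphic_inverse[OF hp open_ball s(3)]
  obtain q where q: "q holomorphic_on p ` ball (g u) s" "ALL z:ball (g u) s. q (p z) = z" by blast
  have op: "open (p ` ball (g u) s)" by (rule open_mapping_thm3[OF hp open_ball s(3)])
  have "open (ball 0 r Int g -` ball (g u) s)" by (rule continuous_open_preimage[OF g(1) open_ball open_ball])
  moreover have "u : ball 0 r Int g -` ball (g u) s" using u s by auto
  ultimately obtain e where e: "e > 0" "ball u e <= ball 0 r Int g -` ball (g u) s" using open_contains_ball by blast
  have fu: "f x : p ` ball (g u) s" "q (f x) = g x" if xe: "x : ball u e" for x
  proof -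
   have "x : ball 0 r Int g -` ball (g u) s" using xe e(2) by blast
   hence x: "x : ball 0 r" "g x : ball (g u) s" by blast+
   hence px: "p (g x) = f x" using f(2) by blast
   show "f x : p ` ball (g u) s" using x(2) px by (metis imageI)
   show "q (f x) = g x" using x(2) q(2) px by metis
  qed
  have "ball u e <= ball 0 r" using e(2) by blast
  hence hf: "f holomorphic_on ball u e" by (rule holomorphic_on_subset[OF f(1)])
  have "(q \<circ> f) holomorphic_on ball u e" by (rule holomorphic_on_compose_gen[OF hf q(1)]) (use fu(1) in blast)
  hence "g holomorphic_on ball u e" by (rule holomorphic_transform) (simp add: fu(2))
  hence "g field_differentiable at u" using e(1) holomorphic_on_imp_differentiable_at by auto
  thus "g field_differentiable at u within ball 0 r - {0}" by (rule field_differentiable_at_within)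
 qed
 thus ?thesis using no_isolated_singularity[OF g(1)] by auto
qed

lemma hol_vec_analytic: "hol_vec F (ball 0 r) ==> r > 0 ==> (%u. F u $ j) analytic_on {0}"
 unfolding hol_vec_def analytic_at using open_ball centre_in_ball by blast

lemma analytic_hol_vec:
 fixes F :: "complex => complex ^ 'n" assumes "ALL j. (%u. F u $ j) analytic_on {0}" shows "EX r>0. hol_vec F (ball 0 r)"
proof -
 have "ALL j. EX e>0. (%u. F u $ j) holomorphic_on ball 0 e" using assms by (simp add: analytic_on_def)
 then obtain e where e: "ALL j. e j > 0 & (%u. F u $ j) holomorphic_on ball 0 (e j)" by metis
 have "(%u. F u $ j) holomorphic_on ball 0 (Min (range e))" for j
  by (rule holomorphic_on_subset[of _ "ball 0 (e j)"]) (use e in auto)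
 moreover have "Min (range e) > 0" using e by auto
 ultimately show ?thesis by (intro exI[of _ "Min (range e)"]) (auto simp: hol_vec_def)
qed

lemma injective_vord:
 fixes f :: "complex => complex ^ 'n" assumes "hol_vec f (ball 0 R)" "R > 0" "f 0 = 0" "inj_on f (ball 0 R)"
 shows "EX k>0. vord f = enat k"
proof -
 have "f (of_real (R / 2)) ~= f 0" using assms(2) inj_onD[OF assms(4), of "of_real (R / 2)" 0] by auto
 hence "~ (ALL u:ball 0 R. f u = 0)" using assms(2,3) by (auto intro!: bexI[of _ "of_real (R / 2)"])
 then obtain k G where G: "hol_vec G (ball 0 R)" "G 0 ~= 0" "ALL u:ball 0 R. f u = u ^ k *s G u" "vord f = enat k"
  using vord_cases[OF assms(1,2)] by blast
 have "k ~= 0" using bspec[OF G(3), of 0] G(2) assms(2,3) by auto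
 thus ?thesis using G(4) by blast
qed

lemma branch_homeomorphism: assumes "branch_param Z f R" "0 < r" "r < R" shows "EX g. homeomorphism (cball 0 r) (f ` cball 0 r) f g"
proof (rule homeomorphism_compact)
 have sub: "cball 0 r <= ball (0::complex) R" using assms by auto
 have f: "hol_vec f (ball 0 R)" "inj_on f (ball 0 R)" using assms(1) by (auto simp: branch_param_def)
 show "continuous_on (cball 0 r) f" by (rule continuous_on_subset[OF hol_vec_continuous[OF f(1)] sub])
 show "inj_on f (cball 0 r)" by (rule inj_on_subset[OF f(2) sub])
qed auto

text \<open>On a compact disc an injective continuous map is a homeomorphism onto its image. The
  lift of a merely continuous map serves for holomorphic curves and for bi-Lipschitz maps
  alike.\<close>

lemma branch_lift:
 fixes h :: "'a::metric_space => complex ^ 'n" assumes f: "branch_param Z f R" and e: "0 < e" "e < R" and cont: "continuous_on S h"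
  and im: "h ` S <= f ` ball 0 e" shows "EX g. continuous_on S g & g ` S <= ball 0 e & (ALL u:S. f (g u) = h u)"
proof -
 obtain p where p: "homeomorphism (cball 0 e) (f ` cball 0 e) f p" using branch_homeomorphism[OF f e] by blast
 have im': "h ` S <= f ` cball 0 e" using im by auto
 show ?thesis
 proof (intro exI[of _ "%u. p (h u)"] conjI ballI)
  show "continuous_on S (%u. p (h u))" by (rule continuous_on_compose2[OF _ cont im']) (use p in \<open>simp add: homeomorphism_def\<close>)
  have pm: "p (h u) : ball 0 e & f (p (h u)) = h u" if uS: "u : S" for u
  proof -
   have "h u : f ` ball 0 e" using im uS by blast
   then obtain w where w: "w : ball 0 e" "h u = f w" by blast
   hence "p (h u) = w" using p by (simp add: homeomorphism_def)
   thus ?thesis using w by simp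
  qed
  thus "(%u. p (h u)) ` S <= ball 0 e" "\<And>u. u : S ==> f (p (h u)) = h u" by auto
 qed
qed

lemma branch_param_finite: "branch_param Z f R ==> finite_param Z f" unfolding finite_param_def
proof (intro conjI allI)
 assume b: "branch_param Z f R"
 hence R: "R > 0" and h: "hol_vec f (ball 0 R)" and inj: "inj_on f (ball 0 R)" and z: "f 0 = 0"
  by (auto simp: branch_param_def)
 show "(%u. f u $ j) analytic_on {0}" for j by (rule hol_vec_analytic[OF h R])
 show "f 0 = 0" by (rule z)
 have "\<forall>\<^sub>F u in at 0. u : ball 0 R - {0}" unfolding eventually_at using R by (intro exI[of _ R]) (auto simp: dist_commute)
 thus "\<forall>\<^sub>F u in at 0. f u ~= 0"
 proof eventually_elim
  case (elim u)
  thus ?case using inj_onD[OF inj, of u 0] z R by auto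
 qed
 show "EX R>0. ALL e. 0 < e & e < R --> germ_eq (f ` ball 0 e) Z"
 proof (intro exI[of _ R] conjI allI impI)
  fix e assume "0 < e & e < R"
  thus "germ_eq (f ` ball 0 e) Z" using b germ_eq_sym[of Z] by (auto simp: branch_param_def)
 qed (rule R)
qed

text \<open>The continuous lift of \<open>q\<close> exists by injectivity. A coordinate of
  \<open>f\<close> of finite order is nonconstant, so its derivative has no zero near 0 except
  possibly 0, and \<open>holomorphic_lift\<close> applies with it.\<close>

lemma branch_param_factor:
 fixes f :: "complex => complex ^ 'n" assumes f: "branch_param Z f R" and q: "finite_param Z q"
 shows "EX g. factorization_through f q g"
proof -
 have R: "R > 0" and h: "hol_vec f (ball 0 R)" and inj: "inj_on f (ball 0 R)" and z: "f 0 = 0"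
  and germ: "\<And>e. 0 < e ==> e <= R ==> germ_eq Z (f ` ball 0 e)" using f by (auto simp: branch_param_def)
 obtain r1 where r1: "r1 > 0" "hol_vec q (ball 0 r1)" using q analytic_hol_vec unfolding finite_param_def by blast
 have q0: "q 0 = 0" "\<forall>\<^sub>F u in at 0. q u ~= 0" using q by (auto simp: finite_param_def)
 obtain r2 where r2: "r2 > 0" "ALL a. 0 < a & a < r2 --> germ_eq (q ` ball 0 a) Z" using q unfolding finite_param_def by blast
 obtain k where k: "k > 0" "vord f = enat k" using injective_vord[OF h R z inj] by blast
 obtain j where j: "ord0 (%u. f u $ j) = enat k" using vord_attained[of f] k(2) by auto
 have hj: "(%u. f u $ j) holomorphic_on ball 0 R" using h by (simp add: hol_vec_def)
 define D where "D = deriv (%u. f u $ j)"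
 have hD: "D holomorphic_on ball 0 R" unfolding D_def by (rule holomorphic_deriv[OF hj]) simp
 have "~ (ALL u:ball 0 R. D u = 0)"
 proof
  assume D0: "ALL u:ball 0 R. D u = 0"
  have "f u $ j = f 0 $ j" if u: "u : ball 0 R" for u
  proof (rule has_derivative_zero_unique[OF convex_ball[of 0 R] _ u])
   fix x :: complex assume "x : ball 0 R"
   hence "((%u. f u $ j) has_field_derivative 0) (at x)" using holomorphic_derivI[OF hj open_ball] D0 by (metis D_def)
   thus "((%u. f u $ j) has_derivative (%h. 0)) (at x within ball 0 R)"
    unfolding has_field_derivative_def lambda_zero by (rule has_derivative_at_withinI)
  qed (use R in auto)
  hence "ALL u:ball 0 R. f u $ j = 0" using z by simp
  hence "ord0 (%u. f u $ j) = \<infinity>" using R by (rule ord0_zero)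
  thus False using j by simp
 qed
 then obtain e0 where e0: "e0 > 0" "ALL w. w ~= 0 --> norm w <= e0 --> D w ~= 0" using holomorphic_dichotomy[OF hD R] by blast
 define e where "e = min e0 (R / 2)"
 have e: "0 < e" "e < R" using e0 R by (auto simp: e_def)
 have "germ_eq (q ` ball 0 (r2 / 2)) (f ` ball 0 e)" using r2 germ[of e] e germ_eq_trans[of "q ` ball 0 (r2 / 2)" Z] by auto
 then obtain d where d: "d > 0" "ALL z:ball 0 d. z : q ` ball 0 (r2 / 2) \<longleftrightarrow> z : f ` ball 0 e" unfolding germ_eq_iff_ball by blast
 obtain r3 where r3: "r3 > 0" "r3 <= r1" "q ` ball 0 r3 <= ball 0 d"
  using small_preimage_ball[OF r1(2,1) open_ball, of 0 d] q0(1) d(1) by auto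
 obtain r4 where r4: "r4 > 0" "ALL u. u ~= 0 --> dist u 0 < r4 --> q u ~= 0" using q0(2) unfolding eventually_at by auto
 define r where "r = min (min r3 r4) (r2 / 2)"
 have r: "r > 0" "r <= r3" "r <= r4" "r <= r2 / 2" "r <= r1" using r2 r3 r4 by (auto simp: r_def)
 have im: "q ` ball 0 r <= f ` ball 0 e"
 proof
  fix y assume "y : q ` ball 0 r"
  then obtain u where u: "u : ball 0 r" "y = q u" by blast
  have "u : ball 0 r3" "u : ball 0 (r2 / 2)" using u r by auto
  hence "y : ball 0 d" "y : q ` ball 0 (r2 / 2)" using r3(3) u(2) by blast+
  thus "y : f ` ball 0 e" using d(2) by blast
 qed
 have cont: "continuous_on (ball 0 r) q" using hol_vec_continuous[OF hol_vec_ball[OF r1(2) r(5)]] .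
 obtain g where g: "continuous_on (ball 0 r) g" "g ` ball 0 r <= ball 0 e" "ALL u:ball 0 r. f (g u) = q u"
  using branch_lift[OF f e cont im] by (elim exE conjE) (rule that)
 have g0: "g u = 0 \<longleftrightarrow> u = 0" if u: "u : ball 0 r" for u
 proof
  assume "g u = 0"
  hence "q u = 0" using g(3) u z by metis
  thus "u = 0" using r4(2) u r(3) by (auto simp: dist_norm)
 next
  assume "u = 0"
  hence "f (g u) = f 0" using g(3) u q0(1) z by simp
  moreover have "g u : ball 0 e" using g(2) u by blast
  hence "g u : ball 0 R" using e by simp
  ultimately show "g u = 0" using inj_onD[OF inj, of "g u" 0] R by simp
 qed
 have "g holomorphic_on ball 0 r"
 proof (rule holomorphic_lift[of "%u. f u $ j" e r g "%u. q u $ j"])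
  show "(%u. f u $ j) holomorphic_on ball 0 e" by (rule holomorphic_on_subset[OF hj]) (use e in auto)
  show "ALL w:ball 0 e. w ~= 0 --> deriv (%u. f u $ j) w ~= 0" using e0(2) by (auto simp: e_def D_def)
  show "(%u. q u $ j) holomorphic_on ball 0 r" using hol_vec_ball[OF r1(2) r(5)] by (simp add: hol_vec_def)
 qed (use g g0 in auto)
 hence "g analytic_on {0}" using r(1) by (auto simp: analytic_at intro!: exI[of _ "ball 0 r"])
 moreover have "\<forall>\<^sub>F u in nhds 0. u : ball (0::complex) r" using r(1) by (intro eventually_nhds_in_open) auto
 hence "\<forall>\<^sub>F u in nhds 0. q u = f (g u)" by (rule eventually_mono) (use g(3) in auto)
 ultimately have "factorization_through f q g" using g0[of 0] r(1) by (simp add: factorization_through_def)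
 thus ?thesis by blast
qed

lemma analytic_tendsto_0: "g analytic_on {0} ==> g 0 = 0 ==> (g \<longlongrightarrow> (0::complex)) (nhds 0)"
 using analytic_at_imp_isCont[of g 0] tendsto_at_iff_tendsto_nhds[of g 0] by (simp add: isCont_def)

lemma branch_param_primitive: assumes h: "branch_param Z h R" shows "primitive_param Z h" unfolding primitive_param_def
proof (intro conjI allI impI)
 show "finite_param Z h" by (rule branch_param_finite[OF h])
 fix q assume "finite_param Z q"
 thus "EX g. factorization_through h q g" by (rule branch_param_factor[OF h])
next
 fix q g1 g2 assume f: "factorization_through h q g1 & factorization_through h q g2"
 have R: "R > 0" "inj_on h (ball 0 R)" using h by (auto simp: branch_param_def)
 have "\<forall>\<^sub>F u in nhds 0. g1 u : ball 0 R" "\<forall>\<^sub>F u in nhds 0. g2 u : ball 0 R"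
 proof -
  have "(g1 \<longlongrightarrow> 0) (nhds 0)" "(g2 \<longlongrightarrow> 0) (nhds 0)" using f by (auto simp: factorization_through_def intro: analytic_tendsto_0)
  from this[THEN tendstoD[OF _ R(1)]]
  show "\<forall>\<^sub>F u in nhds 0. g1 u : ball 0 R" "\<forall>\<^sub>F u in nhds 0. g2 u : ball 0 R" by simp_all
 qed
 moreover have "\<forall>\<^sub>F u in nhds 0. q u = h (g1 u)" "\<forall>\<^sub>F u in nhds 0. q u = h (g2 u)"
  using f by (auto simp: factorization_through_def)
 ultimately show "\<forall>\<^sub>F u in nhds 0. g1 u = g2 u"
 proof eventually_elim
  case (elim u)
  thus ?case using inj_onD[OF R(2), of "g1 u" "g2 u"] by simp
 qed
qed

text \<open>The two factorizations satisfy \<open>g' (g u) = u\<close>, so \<open>g'\<close> has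
  nonzero derivative at 0, and \<open>h\<close> is near 0 the injective \<open>f\<close> composed
  with the locally injective \<open>g'\<close>.\<close>

lemma primitive_param_injective:
 fixes h :: "complex => complex ^ 'n" assumes f: "branch_param Z f R" and h: "primitive_param Z h" shows "EX R'. branch_param Z h R'"
proof -
 have fin: "finite_param Z h" "finite_param Z f" using h branch_param_finite[OF f] by (auto simp: primitive_param_def)
 obtain g where g: "factorization_through h f g" using h fin(2) unfolding primitive_param_def by blast
 obtain g' where g': "factorization_through f h g'" using branch_param_factor[OF f fin(1)] by blast
 have R: "R > 0" "inj_on f (ball 0 R)" using f by (auto simp: branch_param_def)
 have lim: "(g \<longlongrightarrow> 0) (nhds 0)" "(g' \<longlongrightarrow> 0) (nhds 0)" using g g' by (auto simp: factorization_through_def intro: analytic_tendsto_0)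
 have "((%u. g' (g u)) \<longlongrightarrow> 0) (nhds 0)" by (rule filterlim_compose[OF lim(2,1)])
 from tendstoD[OF this R(1)] have "\<forall>\<^sub>F u in nhds 0. g' (g u) : ball 0 R" by simp
 moreover have "\<forall>\<^sub>F u in nhds 0. u : ball (0::complex) R" using R(1) by (intro eventually_nhds_in_open) auto
 moreover have "\<forall>\<^sub>F u in nhds 0. f u = h (g u)" using g by (simp add: factorization_through_def)
 moreover have "\<forall>\<^sub>F u in nhds 0. h (g u) = f (g' (g u))"
  using eventually_compose_filterlim[OF _ lim(1), of "%u. h u = f (g' u)"] g' by (simp add: factorization_through_def)
 ultimately have id: "\<forall>\<^sub>F u in nhds 0. g' (g u) = u"
 proof eventually_elim
  case (elim u)
  thus ?case using inj_onD[OF R(2), of "g' (g u)" u] by simp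
 qed
 have an: "g analytic_on {0}" "g' analytic_on {0}" "g 0 = 0" "g' 0 = 0" using g g' by (auto simp: factorization_through_def)
 have "(g has_field_derivative deriv g 0) (at 0)" "(g' has_field_derivative deriv g' 0) (at (g 0))"
  using an by (auto intro!: DERIV_deriv_iff_field_differentiable[THEN iffD2] analytic_on_imp_differentiable_at)
 hence "((%u. g' (g u)) has_field_derivative deriv g' 0 * deriv g 0) (at 0)" using DERIV_chain2 by blast
 moreover have "((%u. g' (g u)) has_field_derivative 1) (at 0)" using DERIV_cong_ev[OF refl id refl] DERIV_ident by blast
 ultimately have "deriv g' 0 * deriv g 0 = 1" using DERIV_unique by blast
 hence d: "deriv g' 0 ~= 0" by auto
 obtain s where s: "s > 0" "g' holomorphic_on ball 0 s" using an(2) by (auto simp: analytic_on_def)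
 obtain s1 where s1: "s1 > 0" "ball (0::complex) s1 <= ball 0 s" "inj_on g' (ball 0 s1)"
  using locally_injective[OF s(2) _ open_ball d] s(1) by auto
 have ev: "\<forall>\<^sub>F u in nhds 0. h u = f (g' u)" using g' by (simp add: factorization_through_def)
 obtain s2 where s2: "s2 > 0" "ALL u. dist u 0 < s2 --> h u = f (g' u) & g' u : ball 0 R"
 proof -
  have "\<forall>\<^sub>F u in nhds 0. g' u : ball 0 R" using tendstoD[OF lim(2) R(1)] by simp
  from eventually_conj[OF ev this] show ?thesis using that unfolding eventually_nhds_metric by blast
 qed
 obtain s3 where s3: "s3 > 0" "hol_vec h (ball 0 s3)" using fin(1) analytic_hol_vec unfolding finite_param_def by blast
 obtain s4 where s4: "s4 > 0" "ALL a. 0 < a & a < s4 --> germ_eq (h ` ball 0 a) Z" using fin(1) unfolding finite_param_def by blast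
 define R' where "R' = min (min s1 s2) (min s3 (s4 / 2))"
 have R': "R' > 0" "R' <= s1" "R' <= s2" "R' <= s3" "R' < s4" using s1 s2 s3 s4 by (auto simp: R'_def)
 have "inj_on h (ball 0 R')"
 proof (rule inj_onI)
  fix u v assume uv: "u : ball 0 R'" "v : ball 0 R'" "h u = h v"
  hence "f (g' u) = f (g' v)" "g' u : ball 0 R" "g' v : ball 0 R" using s2(2) R'(3) by (auto simp: dist_commute)
  hence "g' u = g' v" using inj_onD[OF R(2)] by blast
  thus "u = v" using inj_onD[OF s1(3)] uv R'(2) by auto
 qed
 moreover have "germ_eq Z (h ` ball 0 e)" if "0 < e & e <= R'" for e
  by (rule germ_eq_sym, rule s4(2)[rule_format]) (use that R'(5) in auto)
 ultimately have "branch_param Z h R'" unfolding branch_param_def using R'(1) hol_vec_ball[OF s3(2) R'(4)] fin(1)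
  by (simp add: finite_param_def)
 thus ?thesis by blast
qed

section \<open>Multiplicity\<close>

abbreviation mlt :: "(complex ^ 'n) set => nat" where
 "mlt \<equiv> multiplicity_germ"

lemma branch_near: assumes "branch_param Z f R" "0 < e" "e <= R" shows "EX d>0. ALL z:ball 0 d. z : Z \<longleftrightarrow> z : f ` ball 0 e"
proof -
 have "germ_eq Z (f ` ball 0 e)" using assms by (simp add: branch_param_def)
 thus ?thesis unfolding germ_eq_iff_ball .
qed

lemma branch_param_shrink: assumes "branch_param Z f R" "0 < R'" "R' <= R" shows "branch_param Z f R'"
proof -
 have sub: "ball 0 R' <= ball (0::complex) R" using assms by auto
 have "inj_on f (ball 0 R)" "hol_vec f (ball 0 R)" using assms(1) by (auto simp: branch_param_def)
 hence "inj_on f (ball 0 R')" "hol_vec f (ball 0 R')" using inj_on_subset[OF _ sub] hol_vec_subset[OF _ sub] by auto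
 thus ?thesis using assms unfolding branch_param_def by auto
qed

lemma branch_param_open: assumes f: "branch_param Z f R" and W: "open W" "0 : W" "W <= ball 0 R" shows "germ_eq Z (f ` W)"
proof -
 have R: "R > 0" using f by (simp add: branch_param_def)
 obtain e where e: "e > 0" "ball 0 e <= W" using W open_contains_ball by blast
 define y where "y = min e R"
 obtain d1 where d1: "d1 > 0" "ALL z:ball 0 d1. z : Z \<longleftrightarrow> z : f ` ball 0 y" using branch_near[OF f, of y] e R by (auto simp: y_def)
 obtain d2 where d2: "d2 > 0" "ALL z:ball 0 d2. z : Z \<longleftrightarrow> z : f ` ball 0 R" using branch_near[OF f, of R] R by auto
 have sub: "ball 0 y <= W" using e by (auto simp: y_def)
 have "ALL z:ball 0 (min d1 d2). z : Z \<longleftrightarrow> z : f ` W"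
 proof
  fix z :: "complex ^ 'a" assume "z : ball 0 (min d1 d2)"
  hence "z : ball 0 d1" "z : ball 0 d2" by auto
  thus "z : Z \<longleftrightarrow> z : f ` W" using d1(2) d2(2) sub W(3) by blast
 qed
 thus ?thesis unfolding germ_eq_iff_ball using d1 d2 by (intro exI[of _ "min d1 d2"]) auto
qed

lemma hol_vec_linear_form:
 "hol_vec f S ==> (%u. linear_form a (f u)) holomorphic_on S"
 unfolding linear_form_def hol_vec_def by (intro holomorphic_on_sum holomorphic_on_mult holomorphic_on_const) blast

text \<open>In the local coordinate \<open>b\<close> the form is \<open>b ^ k\<close>, so its fibre
  over a small nonzero \<open>c\<close> corresponds to the \<open>k\<close>-th roots of
  \<open>c\<close>.\<close>

lemma sheet_number_order: assumes d: "branch_param Z d R" and g: "g holomorphic_on ball 0 R" "g 0 ~= 0" and k: "k > 0"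
  and f: "ALL u:ball 0 R. linear_form a (d u) = u ^ k * g u" shows "sheet_number Z a k"
proof -
 have R: "R > 0" and h: "hol_vec d (ball 0 R)" and inj: "inj_on d (ball 0 R)" and z: "d 0 = 0"
  using d by (auto simp: branch_param_def)
 obtain r b where b: "0 < r" "r <= R" "b holomorphic_on ball 0 r" "inj_on b (ball 0 r)" "b 0 = 0"
  "ALL u:ball 0 r. linear_form a (d u) = b u ^ k" using local_root[OF g(1) R g(2) k f] by (elim exE conjE) (rule that)
 obtain i where i: "i > 0" "ALL z:ball 0 i. z : Z \<longleftrightarrow> z : d ` ball 0 r" using branch_near[OF d b(1,2)] by blast
 have "{z : Z Int ball 0 e. linear_form a z = 0} = {0} &
    (\<forall>\<^sub>F c in at 0. finite {z : Z Int ball 0 e. linear_form a z = c} &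
           card {z : Z Int ball 0 e. linear_form a z = c} = k)" if e: "0 < e" "e < i" for e
 proof -
  define W where "W = ball 0 r Int d -` ball 0 e"
  have W: "open W" unfolding W_def
   by (rule continuous_open_preimage[OF hol_vec_continuous[OF hol_vec_ball[OF h b(2)]] open_ball open_ball])
  have W0: "0 : W" "W <= ball 0 r" using e b(1) z by (auto simp: W_def)
  have "W <= ball (0::complex) R" using W0(2) b(2) by force
  hence injW: "inj_on d W" "inj_on b W" using inj_on_subset[OF inj] inj_on_subset[OF b(4) W0(2)] by auto
  have sl: "{z : Z Int ball 0 e. linear_form a z = c} = d ` {u : W. b u ^ k = c}" for c
  proof (intro set_eqI iffI)
   fix z assume zz: "z : {z : Z Int ball 0 e. linear_form a z = c}"
   hence "z : ball 0 i" using e by auto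
   then obtain u where u: "u : ball 0 r" "z = d u" using zz i(2) by blast
   hence "u : W" using zz by (simp add: W_def)
   moreover have "b u ^ k = c" using zz u b(6) by auto
   ultimately show "z : d ` {u : W. b u ^ k = c}" using u by blast
  next
   fix z assume "z : d ` {u : W. b u ^ k = c}"
   then obtain u where u: "u : W" "b u ^ k = c" "z = d u" by blast
   hence "u : ball 0 r" "z : ball 0 e" by (auto simp: W_def)
   moreover have "z : ball 0 i" using \<open>z : ball 0 e\<close> e by auto
   ultimately show "z : {z : Z Int ball 0 e. linear_form a z = c}" using i(2) b(6) u by auto
  qed
  have "{u : W. b u ^ k = 0} = {0}" using W0 b(5) k inj_onD[OF injW(2), of _ 0] by (auto simp: power_0_left)
  hence 1: "{z : Z Int ball 0 e. linear_form a z = 0} = {0}" unfolding sl by (simp add: z)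
  have hbW: "b holomorphic_on W" using b(3) W0(2) by (rule holomorphic_on_subset)
  have "open (b ` W)" by (rule open_mapping_thm3[OF hbW W injW(2)])
  moreover have "0 : b ` W" using W0(1) b(5) by force
  ultimately obtain t where t: "t > 0" "ball 0 t <= b ` W" using open_contains_ball by blast
  have 2: "finite {u : W. b u ^ k = c} & card {u : W. b u ^ k = c} = k" if c: "c ~= 0" "norm c < t ^ k" for c
  proof -
   have "bij_betw b {u : W. b u ^ k = c} {w. w ^ k = c}"
   proof (rule bij_betw_imageI)
    show "inj_on b {u : W. b u ^ k = c}" by (rule inj_on_subset[OF injW(2)]) auto
    show "b ` {u : W. b u ^ k = c} = {w. w ^ k = c}"
    proof (intro set_eqI iffI)
     fix w assume "w : {w. w ^ k = c}"
     hence wk: "w ^ k = c" by simp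
     hence "norm w < t" by (rule norm_root_less[OF _ c(2) t(1)])
     then obtain u where "u : W" "b u = w" using t(2) by force
     thus "w : b ` {u : W. b u ^ k = c}" using wk by blast
    qed auto
   qed
   note bij = this
   have "finite {w. w ^ k = c}" "card {w. w ^ k = c} = k" using finite_nth_roots[OF k] card_nth_roots[OF c(1) k] by auto
   thus ?thesis using bij_betw_finite[OF bij] bij_betw_same_card[OF bij] by simp
  qed
  have "\<forall>\<^sub>F c in at 0. c ~= 0 & norm c < t ^ k" unfolding eventually_at using t(1) by (intro exI[of _ "t ^ k"]) auto
  hence "\<forall>\<^sub>F c in at 0. finite {z : Z Int ball 0 e. linear_form a z = c} &
           card {z : Z Int ball 0 e. linear_form a z = c} = k"
  proof eventually_elim
   case (elim c)
   have "inj_on d {u : W. b u ^ k = c}" by (rule inj_on_subset[OF injW(1)]) auto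
   thus ?case unfolding sl using 2[of c] elim by (simp add: card_image)
  qed
  with 1 show ?thesis by blast
 qed
 thus ?thesis unfolding sheet_number_def using i(1) by blast
qed

lemma sheet_number_unique: assumes "sheet_number Z a k" "sheet_number Z a k'" shows "k = k'"
proof -
 have *: "EX R>0. ALL b. 0 < b & b < R --> (\<forall>\<^sub>F c in at 0. card {z : Z Int ball 0 b. linear_form a z = c} = k)"
  if sn: "sheet_number Z a k" for k
 proof -
  obtain R where R: "R > 0" "ALL b. 0 < b & b < R -->
    {z : Z Int ball 0 b. linear_form a z = 0} = {0} &
    (\<forall>\<^sub>F c in at 0. finite {z : Z Int ball 0 b. linear_form a z = c} &
           card {z : Z Int ball 0 b. linear_form a z = c} = k)" using sn unfolding sheet_number_def by blast
  have "\<forall>\<^sub>F c in at 0. card {z : Z Int ball 0 b. linear_form a z = c} = k" if e: "0 < b & b < R" for b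
  proof -
   have "\<forall>\<^sub>F c in at 0. finite {z : Z Int ball 0 b. linear_form a z = c} &
           card {z : Z Int ball 0 b. linear_form a z = c} = k" using R(2) e by blast
   thus ?thesis by (rule eventually_mono) blast
  qed
  thus ?thesis using R(1) by blast
 qed
 obtain R where R: "R > 0" "ALL b. 0 < b & b < R --> (\<forall>\<^sub>F c in at 0. card {z : Z Int ball 0 b. linear_form a z = c} = k)"
  using *[OF assms(1)] by (elim exE conjE) (rule that)
 obtain R' where R': "R' > 0" "ALL b. 0 < b & b < R' --> (\<forall>\<^sub>F c in at 0. card {z : Z Int ball 0 b. linear_form a z = c} = k')"
  using *[OF assms(2)] by (elim exE conjE) (rule that)
 define b where "b = min R R' / 2"
 have e: "0 < b" "b < R" "b < R'" using R(1) R'(1) by (auto simp: b_def)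
 have "\<forall>\<^sub>F c in at 0. card {z : Z Int ball 0 b. linear_form a z = c} = k" using R(2) e by blast
 moreover have "\<forall>\<^sub>F c in at 0. card {z : Z Int ball 0 b. linear_form a z = c} = k'" using R'(2) e by blast
 ultimately have "\<forall>\<^sub>F c in at (0::complex). k = k'" by eventually_elim simp
 thus ?thesis by simp
qed

text \<open>A coordinate of least order has \<open>m\<close> sheets. Any other admissible form is
  bounded by a multiple of the norm of \<open>b u\<close>, hence has order at least \<open>m\<close>
  along the branch.\<close>

lemma multiplicity_germ_eq:
 fixes b :: "complex => complex ^ 'n" assumes b: "branch_param Z b R" and m: "vord b = enat m" shows "mlt Z = m" "m > 0"
proof -
 have R: "R > 0" and h: "hol_vec b (ball 0 R)" and inj: "inj_on b (ball 0 R)" and z: "b 0 = 0"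
  using b by (auto simp: branch_param_def)
 show m0: "m > 0" using injective_vord[OF h R z inj] m by auto
 obtain j where j: "ord0 (%u. b u $ j) = enat m" using vord_attained[of b] m by auto
 have lf: "linear_form (axis j 1) v = v $ j" for v :: "complex ^ 'n"
  by (simp add: linear_form_def axis_def if_distrib[of "%x. x * _"] cong: if_cong)
 have hj: "(%u. b u $ j) holomorphic_on ball 0 R" using h by (simp add: hol_vec_def)
 obtain g where g: "g holomorphic_on ball 0 R" "g 0 ~= 0" "ALL u:ball 0 R. b u $ j = u ^ m * g u" using order_cases[OF hj R] j by auto
 have att: "EX a. sheet_number Z a m" using sheet_number_order[OF b g(1,2) m0, of "axis j 1"] g(3) by (auto simp: lf)
 have least: "m <= k" if sn: "EX a. sheet_number Z a k" for k
 proof -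
  obtain a where a: "sheet_number Z a k" using sn by blast
  define f where "f u = linear_form a (b u)" for u
  have hf: "f holomorphic_on ball 0 R" unfolding f_def[abs_def] by (rule hol_vec_linear_form[OF h])
  \<comment> \<open>A form vanishing along the branch would have kernel points on \<open>Z\<close>
    other than the origin, arbitrarily close to it.\<close>
  have nz: "~ (ALL u:ball 0 R. f u = 0)"
  proof
   assume f0: "ALL u:ball 0 R. f u = 0"
   obtain Rs where Rs: "Rs > 0" "ALL e. 0 < e & e < Rs --> {z : Z Int ball 0 e. linear_form a z = 0} = {0}"
    using a unfolding sheet_number_def by blast
   obtain d where d: "d > 0" "ALL z:ball 0 d. z : Z \<longleftrightarrow> z : b ` ball 0 R" using branch_near[OF b R order_refl] by blast
   define e where "e = min Rs d / 2"
   have e: "0 < e" "e < Rs" "e < d" using Rs d by (auto simp: e_def)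
   obtain r where r: "r > 0" "r <= R" "b ` ball 0 r <= ball 0 e" using small_preimage_ball[OF h R open_ball, of 0 e] z e(1) by auto
   define u :: complex where "u = of_real (r / 2)"
   have u: "u : ball 0 r" "u ~= 0" using r by (auto simp: u_def)
   have pu: "b u : ball 0 e" using r(3) u(1) by blast
   have uR: "u : ball 0 R" using u r by auto
   have "b u : ball 0 d" using pu e by auto
   hence "b u : Z" using d(2) uR by blast
   moreover have "linear_form a (b u) = 0" using f0 uR by (simp add: f_def)
   ultimately have "b u : {z : Z Int ball 0 e. linear_form a z = 0}" using pu by blast
   hence "b u = b 0" using Rs e z by auto
   thus False using inj_onD[OF inj, of u 0] uR u(2) R by auto
  qed
  obtain k' q where q: "q holomorphic_on ball 0 R" "q 0 ~= 0" "ALL u:ball 0 R. f u = u ^ k' * q u"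
   "ord0 f = enat k'" using order_cases[OF hf R] nz by blast
  have f0: "f 0 = 0" by (simp add: f_def z linear_form_def)
  have "k' > 0" using bspec[OF q(3), of 0] f0 q(2) R by (cases k') auto
  hence "sheet_number Z a k'" using sheet_number_order[OF b q(1,2)] q(3) by (simp add: f_def)
  hence kk: "k' = k" using sheet_number_unique a by blast
  \<comment> \<open>The scalar function repeated in every coordinate, so that the estimates for
    \<open>vord\<close> apply to it.\<close>
  define F where "F u = (\<chi> i::'n. f u)" for u
  have hF: "hol_vec F (ball 0 R)" using hf by (simp add: hol_vec_def F_def eta_contract_eq)
  have vF: "vord F = enat k" using q(4) kk by (simp add: vord_def F_def)
  obtain d C where d: "0 < d" "0 < C" "ALL u:ball 0 d. norm (b u) <= C * norm u ^ m" using vord_upper[OF h R, of m] m by auto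
  define A where "A = (\<Sum>i\<in>UNIV. norm (a $ i))"
  have bf: "norm (f u) <= A * norm (b u)" for u
  proof -
   have "norm (f u) <= (\<Sum>i\<in>UNIV. norm (a $ i * b u $ i))" unfolding f_def linear_form_def by (rule norm_sum)
   also have "... <= (\<Sum>i\<in>UNIV. norm (a $ i) * norm (b u))"
    by (rule sum_mono) (simp add: norm_mult mult_left_mono Finite_Cartesian_Product.norm_nth_le)
   finally show ?thesis by (simp add: A_def sum_distrib_right)
  qed
  have A0: "A >= 0" by (auto simp: A_def intro: sum_nonneg)
  have "norm (F u) <= (real CARD('n) * A * C) * norm u ^ m" if u: "u : ball 0 d" for u
  proof -
   have "norm (F u) <= (\<Sum>i\<in>UNIV. norm (F u $ i))" unfolding norm_vec_def by (rule L2_set_le_sum) simp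
   also have "... = real CARD('n) * norm (f u)" by (simp add: F_def)
   also have "... <= real CARD('n) * (A * (C * norm u ^ m))"
    using bf[of u] d(3) u A0 by (intro mult_left_mono order_trans[OF bf] ) auto
   finally show ?thesis by (simp add: mult_ac)
  qed
  hence "enat m <= vord F" by (intro vord_ge[OF hF R d(1)]) auto
  thus "m <= k" by (simp add: vF)
 qed
 show "mlt Z = m" unfolding multiplicity_germ_def by (rule Least_equality) (use att least in auto)
qed

section \<open>Puiseux parametrizations\<close>

text \<open>Working form of a Puiseux parametrization: primitivity is replaced by injectivity, and
  the radius and the special coordinate are explicit.\<close>

definition pparam :: "(complex ^ 'n) set => nat => (complex => complex ^ 'n) => 'n => real => bool" where
 "pparam Z m g j R \<longleftrightarrow> branch_param Z g R & vord g = enat m & (ALL u:ball 0 R. g u $ j = u ^ m)"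

lemma branch_vord: assumes "branch_param Z f R" shows "vord f = enat (mlt Z)" "mlt Z > 0"
proof -
 obtain k where "vord f = enat k" using assms injective_vord unfolding branch_param_def by blast
 thus "vord f = enat (mlt Z)" "mlt Z > 0" using multiplicity_germ_eq[OF assms] by auto
qed

lemma puiseux_param_pparam: assumes f: "branch_param Z f R" and g: "puiseux_param Z g" and j: "special_coordinate Z g j"
 shows "EX R'. pparam Z (mlt Z) g j R'"
proof -
 obtain R1 where R1: "branch_param Z g R1" using primitive_param_injective[OF f] g by (auto simp: puiseux_param_def)
 obtain e where e: "e > 0" "ALL u. dist u 0 < e --> g u $ j = u ^ mlt Z"
  using j unfolding special_coordinate_def eventually_nhds_metric by blast
 have R10: "R1 > 0" using R1 by (simp add: branch_param_def)
 have "pparam Z (mlt Z) g j (min R1 e)"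
  unfolding pparam_def using branch_param_shrink[OF R1, of "min R1 e"] branch_vord[OF R1] e R10 by auto
 thus ?thesis by blast
qed

lemma pparam_puiseux: assumes g: "pparam Z m g j R" shows "mlt Z = m" "m > 0" "puiseux_param Z g" "special_coordinate Z g j"
proof -
 have b: "branch_param Z g R" "vord g = enat m" "ALL u:ball 0 R. g u $ j = u ^ m" using g by (auto simp: pparam_def)
 show m: "mlt Z = m" "m > 0" using multiplicity_germ_eq[OF b(1,2)] by auto
 have "R > 0" using b(1) by (simp add: branch_param_def)
 hence "\<forall>\<^sub>F u in nhds 0. u : ball (0::complex) R" by (intro eventually_nhds_in_open) auto
 thus sc: "special_coordinate Z g j" unfolding special_coordinate_def m(1) by (rule eventually_mono) (use b(3) in auto)
 have "enat m <= ord0 (%u. g u $ i)" for i using vord_le[of g i] b(2) by simp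
 thus "puiseux_param Z g" unfolding puiseux_param_def m(1) using branch_param_primitive[OF b(1)] sc by blast
qed

lemma pparamD:
 fixes g :: "complex => complex ^ 'n" assumes "pparam Z m g j R"
 shows "R > 0" "hol_vec g (ball 0 R)" "g 0 = 0" "inj_on g (ball 0 R)" "vord g = enat m" "m > 0"
  "ALL u:ball 0 R. g u $ j = u ^ m" "branch_param Z g R"
 using assms pparam_puiseux(2)[OF assms] by (auto simp: pparam_def branch_param_def)

text \<open>The \<open>j\<close>-th coordinate is the \<open>m\<close>-th power of a local
  coordinate \<open>b\<close>; taking \<open>b\<close> as the new parameter makes it exactly a
  power.\<close>

lemma pparam_exists:
 fixes f :: "complex => complex ^ 'n" assumes f: "branch_param Z f R" and j: "ord0 (%u. f u $ j) = enat (mlt Z)"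
 shows "EX a R'. pparam Z (mlt Z) a j R'"
proof -
 have R: "R > 0" and h: "hol_vec f (ball 0 R)" and inj: "inj_on f (ball 0 R)" and z: "f 0 = 0"
  using f by (auto simp: branch_param_def)
 define m where "m = mlt Z"
 have m0: "m > 0" using branch_vord[OF f] by (simp add: m_def)
 have hj: "(%u. f u $ j) holomorphic_on ball 0 R" using h by (simp add: hol_vec_def)
 obtain g where g: "g holomorphic_on ball 0 R" "g 0 ~= 0" "ALL u:ball 0 R. f u $ j = u ^ m * g u"
  using order_cases[OF hj R] j by (auto simp: m_def)
 obtain r b where b: "0 < r" "r <= R" "b holomorphic_on ball 0 r" "inj_on b (ball 0 r)" "b 0 = 0"
  "ALL u:ball 0 r. f u $ j = b u ^ m" using local_root[OF g(1) R g(2) m0 g(3)] by (elim exE conjE) (rule that)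
 obtain q where q: "q holomorphic_on b ` ball 0 r" "ALL z:ball 0 r. q (b z) = z"
  using holomorphic_inverse[OF b(3) open_ball b(4)] by (elim exE conjE) (rule that)
 have "open (b ` ball 0 r)" by (rule open_mapping_thm3[OF b(3) open_ball b(4)])
 moreover have "0 : b ` ball 0 r" using b(1,5) by force
 ultimately obtain R' where R': "R' > 0" "ball 0 R' <= b ` ball 0 r" using open_contains_ball by blast
 define a where "a w = f (q w)" for w
 have qb: "q w : ball 0 r & b (q w) = w" if w: "w : ball 0 R'" for w
 proof -
  obtain u where "u : ball 0 r" "w = b u" using R'(2) w by blast
  thus ?thesis using q(2) by auto
 qed
 have q0: "q 0 = 0" using bspec[OF q(2), of 0] b(1,5) by simp
 have hq: "q holomorphic_on ball 0 R'" by (rule holomorphic_on_subset[OF q(1) R'(2)])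
 have "branch_param Z a R'" unfolding branch_param_def
 proof (intro conjI allI impI)
  show "hol_vec a (ball 0 R')" unfolding a_def[abs_def] by (rule hol_vec_compose[OF h hq]) (use qb b(2) in force)
  show "inj_on a (ball 0 R')"
  proof (rule inj_onI)
   fix w w' assume w: "w : ball 0 R'" "w' : ball 0 R'" "a w = a w'"
   have "q w = q w'" by (rule inj_onD[OF inj]) (use w qb[of w] qb[of w'] b(2) in \<open>auto simp: a_def\<close>)
   thus "w = w'" using qb[OF w(1)] qb[OF w(2)] by metis
  qed
 next
  fix e assume e: "0 < e & e <= R'"
  define W where "W = ball 0 r Int b -` ball 0 e"
  have "open W" unfolding W_def
   by (rule continuous_open_preimage[OF holomorphic_on_imp_continuous_on[OF b(3)] open_ball open_ball])
  moreover have "0 : W" "W <= ball 0 R" using b e by (auto simp: W_def)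
  ultimately have "germ_eq Z (f ` W)" by (rule branch_param_open[OF f])
  moreover have "f ` W = a ` ball 0 e"
  proof (intro set_eqI iffI)
   fix y assume "y : f ` W"
   then obtain u where u: "u : W" "y = f u" by blast
   hence "q (b u) = u" "b u : ball 0 e" using q(2) by (auto simp: W_def)
   thus "y : a ` ball 0 e" using u(2) by (intro image_eqI[of _ _ "b u"]) (auto simp: a_def)
  next
   fix y assume "y : a ` ball 0 e"
   then obtain w where w: "w : ball 0 e" "y = a w" by blast
   have "w : ball 0 R'" using w(1) e by auto
   from qb[OF this] have "q w : W" using w(1) by (simp add: W_def)
   thus "y : f ` W" using w(2) by (auto simp: a_def)
  qed
  ultimately show "germ_eq Z (a ` ball 0 e)" by simp
 qed (use R'(1) z q0 in \<open>auto simp: a_def\<close>)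
 moreover have "a w $ j = w ^ m" if "w : ball 0 R'" for w using qb[OF that] b(6) by (simp add: a_def)
 ultimately have "pparam Z m a j R'" unfolding pparam_def using branch_vord by (auto simp: m_def)
 thus ?thesis by (auto simp: m_def)
qed

section \<open>Tangents\<close>

lemma pparam_leading:
 fixes g :: "complex => complex ^ 'n" assumes "pparam Z m g j R"
 shows "EX G :: complex => complex ^ 'n. hol_vec G (ball 0 R) & (ALL u:ball 0 R. g u = u ^ m *s G u) & G 0 $ j = 1"
proof -
 have R: "R > 0" "hol_vec g (ball 0 R)" "vord g = enat m" "ALL u:ball 0 R. g u $ j = u ^ m"
  using assms by (auto simp: pparam_def branch_param_def)
 obtain G where G: "hol_vec G (ball 0 R)" "ALL u:ball 0 R. g u = u ^ m *s G u" using vord_cases[OF R(2,1)] R(3) by auto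
 have hj: "(%u. G u $ j - 1) holomorphic_on ball 0 R" using G(1) by (auto simp: hol_vec_def intro!: holomorphic_intros)
 have eq: "G u $ j - 1 = 0" if u: "u : ball 0 R" "u ~= 0" for u
 proof -
  have "u ^ m * G u $ j = u ^ m" using G(2) R(4) u(1) by (metis vector_smult_component)
  thus ?thesis using u(2) by simp
 qed
 have "ALL d>0. EX s. s ~= 0 & norm s <= d & G s $ j - 1 = 0"
 proof (intro allI impI)
  fix d :: real assume "d > 0"
  define s :: complex where "s = of_real (min d (R / 2))"
  have "norm s = min d (R / 2)" using \<open>d > 0\<close> R(1) by (simp add: s_def)
  hence "s ~= 0" "norm s <= d" "s : ball 0 R" using \<open>d > 0\<close> R(1) by (auto simp: min_def split: if_splits)
  thus "EX s. s ~= 0 & norm s <= d & G s $ j - 1 = 0" using eq by blast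
 qed
 from holomorphic_frequently_zero[OF hj R(1) this] have "G 0 $ j = 1" using R(1) by auto
 thus ?thesis using G by blast
qed

text \<open>The leading coefficient \<open>G 0\<close> spans the tangent. Normalizing its
  \<open>j\<close>-th coordinate to 1 lets the other coordinates of a limit be read off from the
  \<open>j\<close>-th.\<close>

lemma tangent_cone_eq:
 fixes G :: "complex => complex ^ 'n"
 assumes f: "pparam Z m f j R" and G: "hol_vec G (ball 0 R)" "ALL u:ball 0 R. f u = u ^ m *s G u" "G 0 $ j = 1"
 shows "tangent_cone Z = range (%c. c *s G 0)"
proof -
 note p = pparamD[OF f]
 have contG: "isCont G 0" "isCont f 0" using hol_vec_continuous G(1) p(1,2) by (auto intro!: continuous_on_interior)
 obtain d where d: "d > 0" "ALL z:ball 0 d. z : Z \<longleftrightarrow> z : f ` ball 0 R" using branch_near[OF p(8,1)] by blast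
 show ?thesis
 proof (intro set_eqI iffI)
  fix v assume "v : range (%c. c *s G 0)"
  then obtain c where c: "v = c *s G 0" by blast
  obtain r where r: "r > 0" "r <= R" "f ` ball 0 r <= ball 0 d"
   using small_preimage_ball[OF p(2,1) open_ball, of 0 d] p(3) d(1) by auto
  define u :: "nat => complex" where "u n = of_real (r / (real n + 2))" for n
  have u: "u n ~= 0" "u n : ball 0 r" for n
  proof -
   have "norm (u n) = r / (real n + 2)" unfolding u_def norm_of_real using r(1) by simp
   moreover have "0 < r / (real n + 2)" "r / (real n + 2) < r" using r(1) by (auto simp: divide_less_eq)
   ultimately show "u n ~= 0" "u n : ball 0 r" by auto
  qed
  have "(%n. r / (real n + 2)) \<longlonglongrightarrow> 0" by real_asymp
  hence ulim: "u \<longlonglongrightarrow> 0" unfolding u_def by (metis (mono_tags) of_real_0 tendsto_of_real)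
  have uR: "u n : ball 0 R" for n using u(2)[of n] r(2) by auto
  have "ALL n. f (u n) : Z" using d(2) r(3) u(2) uR by blast
  moreover have "(%n. f (u n)) \<longlonglongrightarrow> 0" using isCont_tendsto_compose[OF contG(2) ulim] p(3) by simp
  moreover have eq: "(c / u n ^ m) *s f (u n) = c *s G (u n)" for n using bspec[OF G(2) uR] u(1) by (simp add: vector_smult_assoc)
  have "(%n. (c / u n ^ m) *s f (u n)) \<longlonglongrightarrow> v" unfolding eq c
   by (rule vec_tendstoI) (auto intro!: tendsto_intros isCont_tendsto_compose[OF contG(1) ulim])
  ultimately show "v : tangent_cone Z" unfolding tangent_cone_def
   by (intro CollectI exI[of _ "%n. f (u n)"] exI[of _ "%n. c / u n ^ m"] conjI)
 next
  fix v assume "v : tangent_cone Z"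
  then obtain z t where z: "ALL k. z k : Z" "z \<longlonglongrightarrow> 0" "(%k. t k *s z k) \<longlonglongrightarrow> v" unfolding tangent_cone_def by blast
  define u where "u k = (SOME u. u : ball 0 R & z k = f u)" for k
  have u: "\<forall>\<^sub>F k in sequentially. u k : ball 0 R & z k = f (u k)" using tendstoD[OF z(2) d(1)]
  proof eventually_elim
   case (elim k)
   hence "z k : ball 0 d" by simp
   hence "EX u. u : ball 0 R & z k = f u" using z(1) d(2) by blast
   thus ?case unfolding u_def by (rule someI_ex)
  qed
  have zj: "(%k. z k $ j) \<longlonglongrightarrow> 0" using tendsto_vec_nth[OF z(2), of j] by simp
  have "(%k. root m (norm (z k $ j))) \<longlonglongrightarrow> 0" using tendsto_real_root[OF tendsto_norm[OF zj], of m] p(6) by simp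
  moreover have "\<forall>\<^sub>F k in sequentially. root m (norm (z k $ j)) = norm (u k)" using u
   by eventually_elim (use p(6,7) in \<open>simp add: norm_power real_root_power_cancel\<close>)
  ultimately have "(%k. norm (u k)) \<longlonglongrightarrow> 0" by (rule Lim_transform_eventually)
  hence ulim: "u \<longlonglongrightarrow> 0" by (rule tendsto_norm_zero_cancel)
  \<comment> \<open>The \<open>j\<close>-th coordinate of \<open>t k *s z k\<close> is the scalar by
    which \<open>G (u k)\<close> is multiplied, so its convergence controls the remaining
    coordinates.\<close>
  have "v $ i = v $ j * G 0 $ i" for i
  proof (rule LIMSEQ_unique[OF tendsto_vec_nth[OF z(3)]])
   have "(%k. (t k *s z k) $ j * G (u k) $ i) \<longlonglongrightarrow> v $ j * G 0 $ i"
    by (intro tendsto_intros z(3) isCont_tendsto_compose[OF contG(1) ulim])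
   moreover have "\<forall>\<^sub>F k in sequentially. (t k *s z k) $ j * G (u k) $ i = (t k *s z k) $ i" using u
   proof eventually_elim
    case (elim k)
    hence "f (u k) = u k ^ m *s G (u k)" "f (u k) $ j = u k ^ m" using G(2) p(7) by blast+
    thus ?case using elim by simp
   qed
   ultimately show "(%k. (t k *s z k) $ i) \<longlonglongrightarrow> v $ j * G 0 $ i" by (rule Lim_transform_eventually)
  qed
  hence "v = (v $ j) *s G 0" unfolding vec_eq_iff vector_smult_component by blast
  thus "v : range (%c. c *s G 0)" by (rule range_eqI)
 qed
qed

section \<open>Smooth branches\<close>

text \<open>In multiplicity 1 the branch is a graph over its special coordinate, and the shear
  subtracting this graph straightens it.\<close>

lemma smooth_germ_if:
 fixes g :: "complex => complex ^ 'n" assumes "pparam Z 1 g j R" shows "smooth_germ Z"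
proof -
 have R: "R > 0" and g: "branch_param Z g R" and hg: "hol_vec g (ball 0 R)" and sp: "ALL u:ball 0 R. g u $ j = u" and g0: "g 0 = 0"
  using assms by (auto simp: pparam_def branch_param_def)
 obtain d where d: "d > 0" "ALL z:ball 0 d. z : Z \<longleftrightarrow> z : g ` ball 0 R" using branch_near[OF g R order_refl] by blast
 define h where "h z = (\<chi> i. z $ i + (if i = j then 0 else - 1) * g (z $ j) $ i)" for z :: "complex ^ 'n"
 define k where "k z = (\<chi> i. z $ i + (if i = j then 0 else 1) * g (z $ j) $ i)" for z :: "complex ^ 'n"
 define W where "W = (%z :: complex ^ 'n. z $ j) -` ball 0 R"
 have W: "open W" unfolding W_def by (intro open_vimage open_ball continuous_intros)
 have hol: "holomorphic_several (%z. (\<chi> i. z $ i + a i * g (z $ j) $ i) $ i) W" for a i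
 proof -
  have "(%u. g u $ i) holomorphic_on ball 0 R" using hg by (simp add: hol_vec_def)
  moreover have "(%z :: complex ^ 'n. z $ j) ` W <= ball 0 R" by (auto simp: W_def)
  ultimately have "holomorphic_several (%z. g (z $ j) $ i) W"
   using holomorphic_several_outer[OF holomorphic_several_nth[OF W]] by blast
  hence "holomorphic_several (%z. z $ i + a i * g (z $ j) $ i) W"
   by (intro holomorphic_several_add holomorphic_several_nth holomorphic_several_mult holomorphic_several_const W)
  thus ?thesis by simp
 qed
 have hh: "holomorphic_several (%z. h z $ i) W" and hk: "holomorphic_several (%z. k z $ i) W" for i
  unfolding h_def k_def by (rule hol)+
 have "continuous_on W (%z. \<chi> i. h z $ i)" "continuous_on W (%z. \<chi> i. k z $ i)"
  by (intro continuous_on_vec_lambda holomorphic_several_continuous hh hk)+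
 hence ch: "continuous_on W h" and ck: "continuous_on W k" by simp_all
 have hk_inv: "h (k z) = z" "k (h z) = z" "h z $ j = z $ j" "k z $ j = z $ j" for z by (simp_all add: h_def k_def vec_eq_iff)
 define U where "U = W Int ball 0 d"
 define V where "V = W Int k -` ball 0 d"
 have U: "open U" "U <= W" unfolding U_def using W by auto
 have V: "open V" "V <= W" unfolding V_def using continuous_open_preimage[OF ck W open_ball] by auto
 have W_iff: "h z : W \<longleftrightarrow> z : W" "k z : W \<longleftrightarrow> z : W" for z by (simp_all add: W_def hk_inv)
 have hU: "h ` U = V"
 proof (intro set_eqI iffI)
  fix w assume "w : V"
  thus "w : h ` U" using hk_inv(1)[of w] W_iff by (intro image_eqI[of _ _ "k w"]) (auto simp: U_def V_def)
 qed (auto simp: U_def V_def W_iff hk_inv)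
 have kV: "k ` V = U" unfolding hU[symmetric] by (simp add: image_image hk_inv)
 have homeo: "homeomorphism U V h k" using hU kV continuous_on_subset[OF ch U(2)] continuous_on_subset[OF ck V(2)]
  by (auto simp: homeomorphism_def hk_inv)
 define S where "S = {z :: complex ^ 'n. ALL i. i ~= j --> z $ i = 0}"
 have S: "vec.subspace S" by (auto simp: S_def vec.subspace_def)
 have "h ` (Z Int U) = S Int V"
 proof (intro set_eqI iffI)
  fix w assume "w : h ` (Z Int U)"
  then obtain z where z: "z : Z" "z : U" "w = h z" by blast
  then obtain u where u: "u : ball 0 R" "z = g u" using d(2) by (auto simp: U_def)
  have "z $ j = u" using u sp by simp
  hence "w : S" using u z(3) by (auto simp: S_def h_def)
  thus "w : S Int V" using hU z by blast
 next
  fix w assume w: "w : S Int V"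
  have kU: "k w : U" using kV w by blast
  have wj: "w $ j : ball 0 R" using w V(2) by (auto simp: W_def)
  have "k w $ i = g (w $ j) $ i" for i
  proof (cases "i = j")
   case True
   thus ?thesis using sp wj by (simp add: k_def)
  next
   case False
   thus ?thesis using w by (simp add: k_def S_def)
  qed
  hence "k w = g (w $ j)" by (simp add: vec_eq_iff)
  hence "k w : Z" using d(2) kU wj by (auto simp: U_def)
  thus "w : h ` (Z Int U)" using kU hk_inv(1)[of w] by (metis IntI image_eqI)
 qed
 moreover have "ALL i. holomorphic_several (%z. h z $ i) U" "ALL i. holomorphic_several (%z. k z $ i) V"
  using holomorphic_several_subset[OF hh U] holomorphic_several_subset[OF hk V] by auto
 moreover have "0 : U" "h 0 = 0" using R d(1) by (auto simp: U_def W_def h_def vec_eq_iff g0)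
 ultimately show ?thesis unfolding smooth_germ_def using homeo S by blast
qed

lemma branch_nontrivial: assumes f: "branch_param Z f R" shows "~ (\<forall>\<^sub>F z in nhds 0. z : Z --> z = 0)"
proof
 assume "\<forall>\<^sub>F z in nhds 0. z : Z --> z = 0"
 then obtain d where d: "d > 0" "ALL z. dist z 0 < d --> z : Z --> z = 0" unfolding eventually_nhds_metric by blast
 have R: "R > 0" "hol_vec f (ball 0 R)" "f 0 = 0" "inj_on f (ball 0 R)" using f by (auto simp: branch_param_def)
 obtain d' where d': "d' > 0" "ALL z:ball 0 d'. z : Z \<longleftrightarrow> z : f ` ball 0 R" using branch_near[OF f R(1)] by blast
 have "f 0 : ball 0 (min d d')" using R(3) d(1) d'(1) by simp
 from small_preimage_ball[OF R(2,1) open_ball this] obtain r where r: "r > 0" "r <= R" "f ` ball 0 r <= ball 0 (min d d')"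
  by (elim exE conjE) (rule that)
 define u :: complex where "u = of_real (r / 2)"
 have u: "u : ball 0 r" "u ~= 0" using r(1) by (auto simp: u_def)
 have fu: "f u : ball 0 (min d d')" using r(3) u(1) by blast
 have uR: "u : ball 0 R" using u r(2) by auto
 have "f u : Z" using d'(2) fu uR by auto
 hence "f u = f 0" using d(2) fu R(3) by auto
 thus False using inj_onD[OF R(4)] uR u(2) R(1) by force
qed

lemma pparam_exists':
 fixes Z :: "(complex ^ 'n) set" assumes "branch_param Z f R" shows "EX g j R'. pparam Z (mlt Z) g j R'"
proof -
 obtain j where "ord0 (%u. f u $ j) = enat (mlt Z)" using vord_attained[of f] branch_vord[OF assms] by auto
 thus ?thesis using pparam_exists[OF assms] by blast
qed

text \<open>If the multiplicity were at least 2, \<open>f\<close> would have derivative 0 at 0. A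
  line in the straightened branch lifts holomorphically through \<open>f\<close>; in the chart its
  derivative would then vanish, although it is the direction \<open>a\<close> of the line.\<close>

lemma smooth_germ_multiplicity:
 fixes f0 :: "complex => complex ^ 'n" assumes f0: "branch_param Z f0 R0" and smooth: "smooth_germ Z" shows "mlt Z = 1"
proof (rule ccontr)
 obtain f j R where f: "pparam Z (mlt Z) f j R" using pparam_exists'[OF f0] by (elim exE) (rule that)
 note p = pparamD[OF f]
 define m where "m = mlt Z"
 assume "mlt Z ~= 1"
 hence m2: "enat 2 <= vord f" using p(5,6) by simp
 obtain U and V :: "(complex ^ 'n) set" and h k :: "complex ^ 'n => complex ^ 'n" and S where UV: "0 : U" "homeomorphism U V h k" "h 0 = 0"
  "ALL j. holomorphic_several (%z. h z $ j) U" "ALL j. holomorphic_several (%z. k z $ j) V"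
  "vec.subspace S" "h ` (Z Int U) = S Int V" using smooth unfolding smooth_germ_def by (elim exE conjE) (rule that)
 have oU: "open U" and oV: "open V" using UV(4,5) holomorphic_several_open by blast+
 have hom: "continuous_on V k" "h ` U = V" "ALL x:U. k (h x) = x" "ALL x:V. h (k x) = x" using UV(2) by (auto simp: homeomorphism_def)
 have V0: "0 : V" "k 0 = 0" using hom(2,3) UV(1,3) by (metis image_eqI, metis)
 have "\<forall>\<^sub>F z in nhds 0. z : U" using oU UV(1) by (rule eventually_nhds_in_open)
 hence "EX z. z : Z Int U & z ~= 0" using branch_nontrivial[OF f0] by (metis (mono_tags, lifting) IntI eventually_mono)
 then obtain z0 where z0: "z0 : Z Int U" "z0 ~= 0" by blast
 \<comment> \<open>A nonzero direction in the linear space \<open>S\<close>, available because a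
   branch is not just the origin.\<close>
 define a where "a = h z0"
 have a: "a : S" "a ~= 0" using z0 UV(7) hom(3) V0(2) unfolding a_def by (blast, metis IntD2)
 obtain d where d: "d > 0" "ALL z:ball 0 d. z : Z \<longleftrightarrow> z : f ` ball 0 (R/2)" using branch_near[OF p(8), of "R/2"] p(1) by auto
 have "open (V Int k -` ball 0 d)" by (rule continuous_open_preimage[OF hom(1) oV open_ball])
 moreover have "0 *s a : V Int k -` ball 0 d" using V0 d(1) by simp
 moreover have ha: "hol_vec (%t. t *s a) T" for T by (auto simp: hol_vec_def intro!: holomorphic_intros)
 ultimately obtain r where r: "r > 0" "(%t. t *s a) ` ball 0 r <= V Int k -` ball 0 d"
  using small_preimage_ball[OF ha zero_less_one] by blast
 define c where "c t = k (t *s a)" for t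
 have tV: "t *s a : V" "c t : ball 0 d" if "t : ball 0 r" for t using r(2) that unfolding c_def by blast+
 have hc: "h (c t) = t *s a" if "t : ball 0 r" for t using hom(4) tV(1)[OF that] by (simp add: c_def)
 have cZ: "c t : f ` ball 0 (R/2)" if t: "t : ball 0 r" for t
 proof -
  have "t *s a : h ` (Z Int U)" unfolding UV(7) using vec.subspace_scale[OF UV(6) a(1)] tV(1)[OF t] by blast
  hence "c t : Z" using hom(3) unfolding c_def by auto
  thus ?thesis using d(2) tV(2)[OF t] by blast
 qed
 have "(%t. t *s a) ` ball 0 r <= V" using r(2) by blast
 from holomorphic_several_compose[OF spec[OF UV(5)] ha open_ball this]
 have hol: "hol_vec c (ball 0 r)" unfolding hol_vec_def c_def by blast
 have "0 < R/2" "R/2 < R" using p(1) by auto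
 moreover have "c ` ball 0 r <= f ` ball 0 (R/2)" using cZ by blast
 ultimately have "EX g. continuous_on (ball 0 r) g & g ` ball 0 r <= ball 0 (R/2) & (ALL t:ball 0 r. f (g t) = c t)"
  using branch_lift[OF p(8) _ _ hol_vec_continuous[OF hol]] by blast
 then
 obtain g where g: "continuous_on (ball 0 r) g" "g ` ball 0 r <= ball 0 (R/2)" "ALL t:ball 0 r. f (g t) = c t"
  by (elim exE conjE) (rule that)
 have gR: "g t : ball 0 R" if "t : ball 0 r" for t using g(2) that p(1) by fastforce
 have gnz: "g t ~= 0" if t: "t : ball 0 r" "t ~= 0" for t
 proof
  assume "g t = 0"
  hence "c t = 0" using bspec[OF g(3) t(1)] p(3) by simp
  hence "t *s a = 0" using hc[OF t(1)] UV(3) by simp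
  thus False using t(2) a(2) by (simp add: vector_mul_eq_0)
 qed
 have c0: "c 0 = 0" using V0(2) by (simp add: c_def)

 have "g 0 = 0" by (rule inj_onD[OF p(4)]) (use g(3) gR r(1) p(1,3) c0 in auto)
 have "g holomorphic_on ball 0 r"
 proof (rule holomorphic_lift[of "%w. w ^ m" R _ _ "%t. c t $ j"])
  have "deriv (%w. w ^ m) w = of_nat m * w ^ (m - 1)" for w :: complex
   by (rule DERIV_imp_deriv) (auto intro!: derivative_eq_intros)
  thus "ALL w:ball (0::complex) R. w ~= 0 --> deriv (%w. w ^ m) w ~= 0" using p(6) by (simp add: m_def)
  show "ALL t:ball 0 r. (g t) ^ m = c t $ j" using g(3) gR p(7) by (metis m_def)
 qed (use g(1) gR gnz hol in \<open>auto simp: hol_vec_def intro!: holomorphic_intros\<close>)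
 then obtain g' where g': "(g has_derivative g') (at 0)"
  using r(1) by (metis centre_in_ball holomorphic_on_imp_differentiable_at open_ball field_differentiable_imp_differentiable differentiable_def)
 obtain d1 C where dC: "0 < d1" "d1 <= R" "0 < C" "ALL u:ball 0 d1. norm (f u) <= C * norm u ^ 2"
  using vord_upper[OF p(2,1) m2] by (elim exE conjE) (rule that)
 have "(f has_derivative (%_. 0)) (at 0 within UNIV)"
 proof (rule has_derivativeI_sandwich[of d1 _ _ _ _ "%u. C * norm u"])
  show "((%u::complex. C * norm u) \<longlongrightarrow> 0) (at 0 within UNIV)" by (auto intro!: tendsto_eq_intros)
  fix u :: complex assume "u : UNIV" "u ~= 0" "dist u 0 < d1"
  thus "norm (f u - f 0 - 0) / norm (u - 0) <= C * norm u"
   using dC(4) by (simp add: p(3) divide_le_eq power2_eq_square mult.assoc)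
 qed (use dC(1) in auto)
 hence fg: "((%t. f (g t)) has_derivative (%_. 0)) (at 0)"
  using diff_chain_at[OF g', of f "%_. 0"] \<open>g 0 = 0\<close> by (simp add: o_def)
 obtain i where i: "a $ i ~= 0" using a(2) by (auto simp: vec_eq_iff)
 obtain D where D: "((%z. h z $ i) has_derivative D) (at 0)" using UV(1,4) unfolding holomorphic_several_def by blast
 have "D 0 = 0" using D by (simp add: has_derivative_def bounded_linear_def linear_simps linear_0)
 hence "((%t. h (f (g t)) $ i) has_derivative (%_. 0)) (at 0)"
  using diff_chain_at[OF fg, of "%z. h z $ i" D] D \<open>g 0 = 0\<close> p(3) by (simp add: o_def)
 hence "((%t. t * a $ i) has_derivative (%_. 0)) (at 0)"
  by (rule has_derivative_transform_within_open[of _ _ _ _ "ball 0 r"]) (use r(1) g(3) hc in auto)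
 hence "((%t. t * a $ i) has_field_derivative 0) (at 0)" by (simp add: has_field_derivative_def mult_zero_left[abs_def])
 moreover have "((%t. t * a $ i) has_field_derivative a $ i) (at 0)" by (auto intro!: derivative_eq_intros)
 ultimately show False using DERIV_unique i by blast
qed

lemma smooth_germ_iff: assumes "branch_param Z f R" shows "smooth_germ Z \<longleftrightarrow> mlt Z = 1"
proof
 assume m: "mlt Z = 1"
 obtain g j R' where "pparam Z (mlt Z) g j R'" using pparam_exists'[OF assms] by (elim exE) (rule that)
 thus "smooth_germ Z" unfolding m by (rule smooth_germ_if)
qed (rule smooth_germ_multiplicity[OF assms])

section \<open>Arithmetic of the auxiliary multiplicities\<close>

lemma char_mult_vord: "char_mult f t = vord (%u. f u - f (t * u))" by (simp add: char_mult_def vord_def)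

lemma contact_mult_vord: "contact_mult m1 m2 f1 f2 t = vord (%u. f1 (u ^ m2) - f2 (t * u ^ m1))"
 by (simp add: contact_mult_def vord_def)

lemma vord_ultra:
 fixes F G H :: "complex => complex ^ 'n" assumes "hol_vec F (ball 0 r)" "hol_vec G (ball 0 r)" "hol_vec H (ball 0 r)" "r > 0"
 shows "min (vord (%u. F u - G u)) (vord (%u. G u - H u)) <= vord (%u. F u - H u)"
 using vord_mono_min[of "%u. F u - G u" r "%u. G u - H u"] assms by (simp add: hol_vec_diff)

lemma hol_vec_power:
 fixes F :: "complex => complex ^ 'n" assumes F: "hol_vec F (ball 0 R)" "R > 0"
 shows "EX r>0. r <= 1 & r <= R & (ALL c n. norm c = 1 & n > 0 --> hol_vec (%u. F (c * u ^ n)) (ball 0 r) &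
  (ALL u:ball 0 r. c * u ^ n : ball 0 r))"
proof (intro exI[of _ "min 1 R"] conjI allI impI)
 fix c :: complex and n :: nat assume c: "norm c = 1 & n > 0"
 show st: "ALL u:ball 0 (min 1 R). c * u ^ n : ball 0 (min 1 R)"
 proof
  fix u :: complex assume u: "u : ball 0 (min 1 R)"
  have "norm u ^ n <= norm u ^ 1" by (rule power_decreasing) (use u c in auto)
  thus "c * u ^ n : ball 0 (min 1 R)" using u c by (auto simp: norm_mult norm_power)
 qed
 show "hol_vec (%u. F (c * u ^ n)) (ball 0 (min 1 R))"
  by (rule hol_vec_compose[OF F(1)]) (use st in \<open>auto intro!: holomorphic_intros\<close>)
qed (use F(2) in auto)

lemma hol_vec_rotate:
 fixes F :: "complex => complex ^ 'n" assumes "hol_vec F (ball 0 R)" "norm t = 1" shows "hol_vec (%u. F (t * u)) (ball 0 R)"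
proof (rule hol_vec_compose[OF assms(1)])
 show "(%u. t * u) holomorphic_on ball 0 R" by (intro holomorphic_intros)
 show "(%u. t * u) ` ball 0 R <= ball 0 R" using assms(2) by (auto simp: norm_mult)
qed

definition cf :: "(complex => complex ^ 'n) => nat => 'n => complex" where
 "cf f k j = fps_nth (fps_expansion (%u. f u $ j) 0) k"

lemma vord_ge_iff: "enat n <= vord h \<longleftrightarrow> (ALL k<n. ALL j. cf h k j = 0)"
proof -
 have "enat n <= ord0 f \<longleftrightarrow> (ALL k<n. fps_nth (fps_expansion f 0) k = 0)" for f
 proof (cases "fps_expansion f 0 = 0")
  case False
  have "n <= subdegree (fps_expansion f 0)" if "ALL k<n. fps_nth (fps_expansion f 0) k = 0"
   by (rule subdegree_geI[OF False]) (use that in blast)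
  moreover have "fps_nth (fps_expansion f 0) k = 0" if "n <= subdegree (fps_expansion f 0)" "k < n" for k
   by (rule nth_less_subdegree_zero) (use that in simp)
  ultimately show ?thesis using False unfolding ord0_def by (simp only: if_False enat_ord_simps) blast
 qed (simp add: ord0_def)
 hence "(ALL j. enat n <= ord0 (%u. h u $ j)) \<longleftrightarrow> (ALL k<n. ALL j. cf h k j = 0)" unfolding cf_def by blast
 moreover have "enat n <= vord h \<longleftrightarrow> (ALL j. enat n <= ord0 (%u. h u $ j))" unfolding vord_def by (subst Min_ge_iff) auto
 ultimately show ?thesis by simp
qed

text \<open>The \<open>k\<close>-th Taylor coefficient of \<open>f u - f (t * u)\<close> is
  \<open>1 - t ^ k\<close> times that of \<open>f\<close>.\<close>

lemma char_mult_ge_iff: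
 fixes f :: "complex => complex ^ 'n" assumes h: "hol_vec f (ball 0 R)" "R > 0" and t: "norm t = 1"
 shows "enat n <= char_mult f t \<longleftrightarrow> (ALL k<n. t ^ k = 1 | (ALL j. cf f k j = 0))"
proof -
 have "cf (%u. f u - f (t * u)) k j = (1 - t ^ k) * cf f k j" for k j
 proof -
  have hj: "(%u. f u $ j) holomorphic_on ball 0 R" using h by (simp add: hol_vec_def)
  have st: "t * w : ball 0 R" if "w : ball 0 R" for w using that t by (simp add: norm_mult)
  have ht: "(%u. f (t * u) $ j) holomorphic_on ball 0 R" using hol_vec_rotate[OF h(1) t] by (simp add: hol_vec_def)
  have "(deriv ^^ k) (%u. f (t * u) $ j) 0 = t ^ k * (deriv ^^ k) (%u. f u $ j) (t * 0)"
   by (rule higher_deriv_compose_linear[OF hj open_ball[of 0 R] open_ball[of 0 R]]) (use h(2) st in auto)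
  moreover have "(deriv ^^ k) (%u. f u $ j - f (t * u) $ j) 0 =
    (deriv ^^ k) (%u. f u $ j) 0 - (deriv ^^ k) (%u. f (t * u) $ j) 0"
   by (rule higher_deriv_diff[OF hj ht open_ball[of 0 R]]) (use h(2) in auto)
  ultimately show ?thesis by (simp add: cf_def fps_expansion_def left_diff_distrib diff_divide_distrib)
 qed
 thus ?thesis unfolding char_mult_vord vord_ge_iff by auto
qed

lemma unity_norm: "t : roots_of_unity m ==> m > 0 ==> norm t = 1" using roots_of_unity_norm by (auto simp: roots_of_unity_def)

lemma finite_unity: "m > 0 ==> finite (roots_of_unity m)" unfolding roots_of_unity_def by (rule finite_nth_roots)

lemma char_mult_one: assumes "pparam Z m f j R" shows "char_mult f 1 = \<infinity>"
 unfolding char_mult_vord vord_def by (simp add: ord0_zero[of 1])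

text \<open>Finiteness is injectivity of \<open>f\<close>. The first surviving exponent
  \<open>k\<close> needs a nonzero factor \<open>1 - t ^ k\<close>, and it exceeds \<open>m\<close>
  because lower coefficients of \<open>f\<close> vanish and \<open>t ^ m = 1\<close>.\<close>

lemma char_mult_finite: assumes f: "pparam Z m f j R" and t: "t : roots_of_unity m - {1}"
 shows "EX k>m. char_mult f t = enat k & t ^ k ~= 1"
proof -
 note p = pparamD[OF f]
 have n1: "norm t = 1" using unity_norm t p(6) by auto
 have st: "t * u : ball 0 R" if "u : ball 0 R" for u using that n1 by (simp add: norm_mult)
 have ht: "hol_vec (%u. f (t * u)) (ball 0 R)" by (rule hol_vec_rotate[OF p(2) n1])
 have "char_mult f t ~= \<infinity>"
 proof
  assume inf: "char_mult f t = \<infinity>"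
  have eq: "ALL u:ball 0 R. f u - f (t * u) = 0"
   using vord_cases[OF hol_vec_diff[OF p(2) ht] p(1)] inf by (auto simp: char_mult_vord)
  define u :: complex where "u = of_real (R / 2)"
  have u: "u : ball 0 R" "u ~= 0" using p(1) by (auto simp: u_def)
  have "u = t * u" by (rule inj_onD[OF p(4)]) (use eq u st in auto)
  thus False using u(2) t by simp
 qed
 then obtain k where k: "char_mult f t = enat k" by auto
 note iff = char_mult_ge_iff[OF p(2,1) n1]
 have "t ^ k ~= 1" using iff[of k] iff[of "Suc k"] k less_Suc_eq by auto
 moreover have "k > m"
 proof -
  have "ALL k<m. ALL j. cf f k j = 0" using vord_ge_iff[of m f] p(5) by simp
  hence "enat (Suc m) <= char_mult f t" unfolding iff using t by (auto simp: less_Suc_eq roots_of_unity_def)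
  thus ?thesis using k by simp
 qed
 ultimately show ?thesis using k by blast
qed

text \<open>Why the mere set of values suffices: if \<open>char_mult f\<close> has value
  \<open>k\<close> at \<open>t\<close>, equality of the sets gives \<open>f'\<close> a nonzero
  coefficient at \<open>k\<close>. As \<open>t ^ k\<close> is not 1, the value of
  \<open>char_mult f'\<close> at \<open>t\<close> is at most \<open>k\<close>; the roles are then
  exchanged.\<close>

lemma char_mult_determined: assumes f: "pparam Z m f j R" and f': "pparam Z' m f' j' R'"
  and eq: "char_mult f ` (roots_of_unity m - {1}) = char_mult f' ` (roots_of_unity m - {1})" and t: "t : roots_of_unity m"
 shows "char_mult f t = char_mult f' t"
proof (cases "t = 1")
 case True
 thus ?thesis using char_mult_one[OF f] char_mult_one[OF f'] by simp
next
 case False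
 hence t1: "t : roots_of_unity m - {1}" using t by blast
 have key: "char_mult f' t <= char_mult f t" if f: "pparam Z m f j R" and f': "pparam Z' m f' j' R'"
   and eq: "char_mult f ` (roots_of_unity m - {1}) = char_mult f' ` (roots_of_unity m - {1})"
  for f :: "complex => complex ^ 'c" and f' :: "complex => complex ^ 'd" and Z Z' j j' R R'
 proof (rule ccontr)
  assume "~ ?thesis"
  hence lt: "char_mult f t < char_mult f' t" by simp
  obtain k where k: "char_mult f t = enat k" "t ^ k ~= 1" using char_mult_finite[OF f t1] by blast
  hence "enat k : char_mult f' ` (roots_of_unity m - {1})" using eq t1 by (metis image_eqI)
  then obtain t' where t': "t' : roots_of_unity m - {1}" "char_mult f' t' = enat k" by (metis imageE)
  note p = pparamD[OF f']
  have n: "norm t = 1" "norm t' = 1" using unity_norm t1 t'(1) p(6) by auto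
  have "EX i. cf f' k i ~= 0"
   using char_mult_ge_iff[OF p(2,1) n(2), of k] char_mult_ge_iff[OF p(2,1) n(2), of "Suc k"] t'(2) less_Suc_eq by auto
  moreover have "enat (Suc k) <= char_mult f' t" using lt k(1) by (simp add: Suc_ile_eq)
  ultimately show False using char_mult_ge_iff[OF p(2,1) n(1), of "Suc k"] k(2) by auto
 qed
 show ?thesis by (rule antisym[OF key[OF f' f eq[symmetric]] key[OF f f' eq]])
qed

text \<open>For a primitive \<open>m\<close>-th root of unity \<open>z\<close>, if
  \<open>z ^ m'\<close> were not 1, its characteristic exponent \<open>k\<close> would satisfy
  \<open>(z ^ m') ^ k\<close> unequal to 1. But \<open>m' * k\<close> is a multiple of
  \<open>m\<close>.\<close>

lemma multiplicity_dvd: assumes f: "pparam Z m f j R"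
  and eq: "ALL a:roots_of_unity m - {1}. EX b'. enat m' * char_mult f a = enat (m * b')" shows "m dvd m'"
proof -
 obtain z :: complex where z: "z ^ m = 1" "ALL k. z ^ k = 1 --> m dvd k"
  using primitive_root_exists[OF pparamD(6)[OF f]] by (elim exE conjE) (rule that)
 show ?thesis
 proof (cases "z ^ m' = 1")
  case False
  have "(z ^ m') ^ m = 1" using z(1) by (metis power_mult mult.commute power_one)
  hence t: "z ^ m' : roots_of_unity m - {1}" using False by (simp add: roots_of_unity_def)
  obtain k where k: "char_mult f (z ^ m') = enat k" "(z ^ m') ^ k ~= 1" using char_mult_finite[OF f t] by blast
  obtain b where "m' * k = m * b" using bspec[OF eq t] k(1) by auto
  hence "(z ^ m') ^ k = (z ^ m) ^ b" by (simp add: power_mult[symmetric])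
  thus ?thesis using k(2) z(1) by simp
 qed (use z(2) in blast)
qed

definition max_contact :: "nat => nat => (complex => complex ^ 'n) => (complex => complex ^ 'n) => enat" where
 "max_contact m1 m2 f1 f2 = Max (contact_mult m1 m2 f1 f2 ` roots_of_unity m2)"

lemma max_contact_attained: assumes "m2 > 0" shows "EX t:roots_of_unity m2. contact_mult m1 m2 f1 f2 t = max_contact m1 m2 f1 f2"
  and "ALL t:roots_of_unity m2. contact_mult m1 m2 f1 f2 t <= max_contact m1 m2 f1 f2"
proof -
 let ?A = "contact_mult m1 m2 f1 f2 ` roots_of_unity m2"
 have fin: "finite ?A" using finite_unity[OF assms] by simp
 have "1 : roots_of_unity m2" by (simp add: roots_of_unity_def)
 hence "?A ~= {}" by blast
 from Max_in[OF fin this] show "EX t:roots_of_unity m2. contact_mult m1 m2 f1 f2 t = max_contact m1 m2 f1 f2"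
  by (auto simp: max_contact_def)
 show "ALL t:roots_of_unity m2. contact_mult m1 m2 f1 f2 t <= max_contact m1 m2 f1 f2"
  using Max_ge[OF fin] by (simp add: max_contact_def)
qed

text \<open>The contact with the rotations of the second branch is governed by its self-contact, by the ultrametric inequality.\<close>

lemma contact_mult_formula: assumes f1: "pparam Z1 m1 f1 j1 R1" and f2: "pparam Z2 m2 f2 j2 R2"
  and a0: "a0 : roots_of_unity m2" "contact_mult m1 m2 f1 f2 a0 = max_contact m1 m2 f1 f2" and a: "a : roots_of_unity m2"
 shows "contact_mult m1 m2 f1 f2 a = min (max_contact m1 m2 f1 f2) (enat m1 * char_mult f2 (a / a0))"
proof -
 note p1 = pparamD[OF f1] and p2 = pparamD[OF f2]
 obtain r1 where r1: "0 < r1" "hol_vec (%u. f1 (1 * u ^ m2)) (ball 0 r1)"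
  using hol_vec_power[OF p1(2,1)] p2(6) by (metis norm_one)
 obtain r2 where r2: "0 < r2" "ALL c n. norm c = 1 & n > 0 --> hol_vec (%u. f2 (c * u ^ n)) (ball 0 r2)"
  using hol_vec_power[OF p2(2,1)] by blast
 have n: "norm a = 1" "norm a0 = 1" using unity_norm a a0(1) p2(6) by auto
 define r where "r = min r1 r2"
 have r: "r > 0" using r1 r2 by (simp add: r_def)
 have A: "hol_vec (%u. f1 (u ^ m2)) (ball 0 r)" using hol_vec_ball[OF r1(2), of r] by (simp add: r_def)
 have B: "hol_vec (%u. f2 (a * u ^ m1)) (ball 0 r)" "hol_vec (%u. f2 (a0 * u ^ m1)) (ball 0 r)"
  using r2(2) n p1(6) by (auto intro: hol_vec_ball[where r = r2] simp: r_def)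
 have t0: "a0 ~= 0" using n(2) by auto
 have st: "norm (a / a0) = 1" using n by (simp add: norm_divide)
 have "hol_vec (%v. f2 (a / a0 * v)) (ball 0 R2)" by (rule hol_vec_rotate[OF p2(2) st])
 from vord_reparam[OF hol_vec_diff[OF p2(2) this] p2(1) p1(6) t0]
 have rep: "vord (%u. f2 (a0 * u ^ m1) - f2 (a * u ^ m1)) = enat m1 * char_mult f2 (a / a0)"
  using t0 by (simp add: char_mult_vord)
 have 1: "min (max_contact m1 m2 f1 f2) (enat m1 * char_mult f2 (a / a0)) <= contact_mult m1 m2 f1 f2 a"
  using vord_ultra[OF A B(2,1) r] unfolding rep contact_mult_vord[symmetric] a0(2) .
 have 2: "contact_mult m1 m2 f1 f2 a <= max_contact m1 m2 f1 f2" using max_contact_attained(2)[OF p2(6)] a by blast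
 have "vord (%u. f2 (a0 * u ^ m1) - f1 (u ^ m2)) = max_contact m1 m2 f1 f2"
  unfolding a0(2)[symmetric] contact_mult_vord by (rule vord_minus[OF B(2) A r])
 hence "contact_mult m1 m2 f1 f2 a <= enat m1 * char_mult f2 (a / a0)"
  using vord_ultra[OF B(2) A B(1) r] 2 unfolding rep contact_mult_vord[symmetric] by (simp add: min_def split: if_splits)
 thus ?thesis using 1 2 by (simp add: min_def split: if_splits)
qed

text \<open>Division by a rotation of maximal contact permutes the roots of unity, so the multiset
  depends only on the maximum and on the self-contacts of the second branch.\<close>

lemma contact_mset: assumes f1: "pparam Z1 m1 f1 j1 R1" and f2: "pparam Z2 m2 f2 j2 R2"
 shows "image_mset (contact_mult m1 m2 f1 f2) (mset_set (roots_of_unity m2)) =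
  image_mset (%t. min (max_contact m1 m2 f1 f2) (enat m1 * char_mult f2 t)) (mset_set (roots_of_unity m2))"
proof -
 note p2 = pparamD[OF f2]
 obtain t0 where t0: "t0 : roots_of_unity m2" "contact_mult m1 m2 f1 f2 t0 = max_contact m1 m2 f1 f2"
  using max_contact_attained(1)[OF p2(6)] by blast
 let ?f = "%t. min (max_contact m1 m2 f1 f2) (enat m1 * char_mult f2 t)"
 have n0: "t0 ~= 0" using unity_norm[OF t0(1) p2(6)] by auto
 have inj: "inj_on (%t. t / t0) (roots_of_unity m2)" using n0 by (auto simp: inj_on_def)
 have im: "(%t. t / t0) ` roots_of_unity m2 = roots_of_unity m2"
 proof (intro set_eqI iffI)
  fix x assume "x : roots_of_unity m2"
  thus "x : (%t. t / t0) ` roots_of_unity m2"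
   using t0(1) n0 by (intro image_eqI[of _ _ "x * t0"]) (auto simp: roots_of_unity_def power_mult_distrib)
 qed (use t0(1) in \<open>auto simp: roots_of_unity_def power_divide\<close>)
 have "image_mset (contact_mult m1 m2 f1 f2) (mset_set (roots_of_unity m2)) =
   image_mset (%t. ?f (t / t0)) (mset_set (roots_of_unity m2))"
  by (rule image_mset_cong) (use contact_mult_formula[OF f1 f2 t0] finite_unity[OF p2(6)] in auto)
 also have "... = image_mset ?f (image_mset (%t. t / t0) (mset_set (roots_of_unity m2)))" by (simp add: multiset.map_comp o_def)
 also have "... = image_mset ?f (mset_set (roots_of_unity m2))" unfolding image_mset_mset_set[OF inj] im ..
 finally show ?thesis .
qed

section \<open>The outer metric near the origin in terms of orders of contact\<close>

section \<open>Distances between points of two branches\<close>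

text \<open>By homogeneity only the quotient of \<open>s'\<close> and \<open>s\<close> matters.
  Quotients of modulus at most 2 away from the roots of unity form a compact set; for larger ones
  the \<open>N\<close>-th power dominates 1.\<close>

lemma roots_gap: assumes N: "N > 0" and e: "e > 0"
 shows "EX c>0. ALL s s' :: complex. (ALL w. w ^ N = 1 --> e * norm s <= norm (s' - w * s)) -->
  c * (norm s ^ N + norm s' ^ N) <= norm (s ^ N - s' ^ N)"
proof -
 define K where "K = cball (0::complex) 2 Int (\<Inter>w\<in>{w. w ^ N = 1}. {x. e <= norm (x - w)})"
 have "compact K" unfolding K_def by (intro compact_Int_closed compact_cball closed_INT ballI closed_Collect_le continuous_intros)
 have c0: "EX c0>0. ALL x:K. c0 <= norm (1 - x ^ N)"
 proof (cases "K = {}")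
  case False
  have "continuous_on K (%x. norm (1 - x ^ N))" by (intro continuous_intros)
  from continuous_attains_inf[OF \<open>compact K\<close> False this] obtain x where x: "x : K" "ALL y:K. norm (1 - x ^ N) <= norm (1 - y ^ N)"
   by blast
  have "x ^ N ~= 1"
  proof
   assume "x ^ N = 1"
   hence "e <= norm (x - x)" using x(1) by (auto simp: K_def)
   thus False using e by simp
  qed
  thus ?thesis using x(2) by (intro exI[of _ "norm (1 - x ^ N)"]) auto
 qed (auto intro: exI[of _ 1])
 then obtain c0 where c0: "c0 > 0" "ALL x:K. c0 <= norm (1 - x ^ N)" by blast
 \<comment> \<open>On \<open>K\<close> the modulus is at most 2, whence \<open>1 + 2 ^ N\<close>.
   Outside the disc of radius 2 the \<open>N\<close>-th power has modulus at least 2, and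
   \<open>1/4\<close> suffices.\<close>
 define c where "c = min (1/4) (c0 / (1 + 2 ^ N))"
 have c: "0 < c" "c <= 1/4" "c * (1 + 2 ^ N) <= c0"
 proof -
  have "c <= c0 / (1 + 2 ^ N)" by (simp add: c_def)
  moreover have "(0::real) < 1 + 2 ^ N" by (simp add: add_pos_pos)
  ultimately show "c * (1 + 2 ^ N) <= c0" by (simp only: pos_le_divide_eq)
  show "c <= 1/4" unfolding c_def by (rule min.cobounded1)
 qed (use c0(1) in \<open>auto simp: c_def add_pos_pos\<close>)
 have "c * (norm s ^ N + norm s' ^ N) <= norm (s ^ N - s' ^ N)"
  if far: "ALL w. w ^ N = 1 --> e * norm s <= norm (s' - w * s)" for s s' :: complex
 proof (cases "s = 0")
  case True
  have "c * norm s' ^ N <= 1 * norm s' ^ N" by (rule mult_right_mono) (use c in auto)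
  thus ?thesis using True N by (simp add: norm_power power_0_left)
 next
  case False
  define x where "x = s' / s"
  have s': "s' = x * s" using False by (simp add: x_def)
  have fx: "e <= norm (x - w)" if "w ^ N = 1" for w
  proof -
   have "s' - w * s = (x - w) * s" by (simp add: s' left_diff_distrib)
   hence "norm (s' - w * s) = norm (x - w) * norm s" by (simp only: norm_mult)
   hence "e * norm s <= norm (x - w) * norm s" using far that by metis
   thus ?thesis using False by simp
  qed
  have "c * (1 + norm x ^ N) <= norm (1 - x ^ N)"
  proof (cases "norm x <= 2")
   case True
   hence "x : K" using fx by (auto simp: K_def)
   have "norm x ^ N <= 2 ^ N" using True by (intro power_mono) auto
   hence "c * (1 + norm x ^ N) <= c * (1 + 2 ^ N)" using c(1) by (intro mult_left_mono) auto
   also have "... <= norm (1 - x ^ N)" using c(3) c0(2) \<open>x : K\<close> by force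
   finally show ?thesis .
  next
   case False
   have "norm x ^ 1 <= norm x ^ N" by (rule power_increasing) (use N False in auto)
   hence 2: "2 <= norm x ^ N" using False by simp
   have "c * (1 + norm x ^ N) <= 1/4 * (1 + norm x ^ N)" using c by (intro mult_right_mono) auto
   also have "... <= norm x ^ N - 1" using 2 by simp
   also have "... <= norm (1 - x ^ N)" using norm_triangle_ineq2[of "x ^ N" 1] by (simp add: norm_power norm_minus_commute)
   finally show ?thesis .
  qed
  hence "(c * (1 + norm x ^ N)) * norm s ^ N <= norm (1 - x ^ N) * norm s ^ N" by (rule mult_right_mono) simp
  moreover have "norm (1 - x ^ N) * norm s ^ N = norm (s ^ N - s' ^ N)"
   unfolding s' norm_power[symmetric] norm_mult[symmetric] by (simp add: algebra_simps)
  ultimately show ?thesis by (simp add: s' norm_mult power_mult_distrib algebra_simps)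
 qed
 thus ?thesis using c(1) by blast
qed

text \<open>With \<open>s' = a * s * x\<close> the difference of the powers contains
  \<open>x - 1\<close> times a geometric sum. For \<open>x\<close> near 1 the sum is close to
  \<open>N\<close>, so its modulus is at least 1/2.\<close>

lemma roots_near: assumes N: "N > 0" shows "EX e>0. e <= 1/2 & (ALL s s' a :: complex. a ^ N = 1 & norm (s' - a * s) <= e * norm s -->
  norm s ^ N * norm (s' - a * s) <= 2 * norm s * norm (s ^ N - s' ^ N))"
proof -
 define f where "f x = (\<Sum>k<N. x ^ k)" for x :: complex
 have cont: "isCont f 1" unfolding f_def[abs_def] by (intro continuous_intros)
 have "EX d>0. ALL x. dist x 1 < d --> dist (f x) (f 1) < 1/2"
  using cont[unfolded continuous_at_eps_delta, THEN spec[of _ "1/2"]] by (rule mp) simp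
 then obtain d where d: "d > 0" "ALL x. dist x 1 < d --> dist (f x) (f 1) < 1/2" by (elim exE conjE) (rule that)
 define e where "e = min (1/2) (d/2)"
 have "norm s ^ N * norm (s' - a * s) <= 2 * norm s * norm (s ^ N - s' ^ N)"
  if h: "a ^ N = 1 & norm (s' - a * s) <= e * norm s" for s s' a :: complex
 proof (cases "s = 0")
  case False
  have w: "norm a = 1" using roots_of_unity_norm h N by blast
  hence w0: "a ~= 0" by auto
  define x where "x = s' / (a * s)"
  have s': "s' = a * s * x" using False w0 by (simp add: x_def)
  have "s' - a * s = a * s * (x - 1)" by (simp add: s' algebra_simps)
  hence n1: "norm (s' - a * s) = norm s * norm (x - 1)" using w by (simp add: norm_mult)
  hence "norm (x - 1) <= e" using h False by (simp add: mult.commute)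
  hence "dist x 1 < d" using d(1) by (simp add: dist_norm e_def min_def split: if_splits)
  hence "dist (\<Sum>k<N. x ^ k) (of_nat N) < 1/2" using d(2) by (simp add: f_def)
  hence "norm (of_nat N :: complex) - norm (\<Sum>k<N. x ^ k) < 1/2"
   unfolding dist_norm using norm_triangle_ineq2[of "of_nat N" "\<Sum>k<N. x ^ k"] by (simp add: norm_minus_commute)
  hence S: "1/2 <= norm (\<Sum>k<N. x ^ k)" using N by simp
  have "s ^ N - s' ^ N = - (s ^ N * (x ^ N - 1))" using h by (simp add: s' power_mult_distrib algebra_simps)
  also have "x ^ N - 1 = (x - 1) * (\<Sum>k<N. x ^ k)" by (rule power_diff_1_eq)
  finally have "norm (s ^ N - s' ^ N) = norm s ^ N * (norm (x - 1) * norm (\<Sum>k<N. x ^ k))"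
   by (simp only: norm_minus_cancel norm_mult norm_power)
  moreover have "norm s ^ N * (norm s * norm (x - 1)) * (1/2) <= norm s ^ N * (norm s * norm (x - 1)) * norm (\<Sum>k<N. x ^ k)"
   by (rule mult_left_mono[OF S]) simp
  ultimately show ?thesis unfolding n1 by (simp add: mult_ac)
 qed (use N in \<open>simp add: power_0_left\<close>)
 moreover have "e > 0" "e <= 1/2" using d(1) by (auto simp: e_def)
 ultimately show ?thesis by blast
qed

text \<open>Estimates survive a smaller radius and a larger constant; finitely many of them can thus
  be given the least radius and the greatest constant.\<close>

lemma finite_uniform: assumes "finite A" and "ALL a:A. EX d>0. EX C>0. P a d (C::real)"
  and "ALL a d C d' C'. P a d C & 0 < d' & d' <= (d::real) & C <= C' --> P a d' C'" shows "EX d>0. EX C>0. ALL a:A. P a d C" using assms(1,2)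
proof (induction A)
 case (insert x A)
 then obtain d1 C1 d2 C2 where h: "d1 > 0" "C1 > 0" "ALL a:A. P a d1 C1" "d2 > 0" "C2 > 0" "P x d2 C2" by blast
 have p: "0 < min d1 d2" "0 < max C1 C2" using h by auto
 have "P x (min d1 d2) (max C1 C2)" by (rule assms(3)[rule_format, OF conjI[OF h(6)]]) (use p in simp)
 moreover have "P a (min d1 d2) (max C1 C2)" if a: "a : A" for a
  by (rule assms(3)[rule_format, OF conjI[OF bspec[OF h(3) a]]]) (use p in simp)
 ultimately show ?case using p by blast
qed (auto intro: exI[of _ 1])

lemma norm_vec_le_sum: "norm (v :: complex ^ 'n) <= (\<Sum>i\<in>UNIV. norm (v $ i))" unfolding norm_vec_def by (rule L2_set_le_sum) simp

lemma hol_vec_lipschitz: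
 fixes G :: "complex => complex ^ 'n" assumes G: "hol_vec G (ball 0 r)" "r > 0"
 shows "EX C>0. ALL s:ball 0 (r/2). ALL s':ball 0 (r/2). norm (G s) <= C & norm (G s - G s') <= C * norm (s - s')"
proof -
 have sub: "cball 0 (r/2) <= ball (0::complex) r" using G(2) by auto
 have "EX C. 0 <= C & (ALL s:ball 0 (r/2). ALL s':ball 0 (r/2). norm (G s $ i) <= C & norm (G s $ i - G s' $ i) <= C * norm (s - s'))" for i
 proof -
  have h: "(%s. G s $ i) holomorphic_on ball 0 r" using G by (simp add: hol_vec_def)
  have c: "continuous_on (cball 0 (r/2)) (%s. G s $ i)" "continuous_on (cball 0 (r/2)) (deriv (%s. G s $ i))"
   using holomorphic_on_imp_continuous_on[OF h] holomorphic_on_imp_continuous_on[OF holomorphic_deriv[OF h open_ball]]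
    continuous_on_subset sub by blast+
  obtain B where B: "ALL s:cball 0 (r/2). norm (G s $ i) <= B"
   using compact_imp_bounded[OF compact_continuous_image[OF c(1) compact_cball]] by (auto simp: bounded_iff)
  obtain B' where B': "ALL s:cball 0 (r/2). norm (deriv (%s. G s $ i) s) <= B'"
   using compact_imp_bounded[OF compact_continuous_image[OF c(2) compact_cball]] by (auto simp: bounded_iff)
  define C where "C = max 0 (max B B')"
  have "norm (G s $ i - G s' $ i) <= C * norm (s - s')" if "s : ball 0 (r/2)" "s' : ball 0 (r/2)" for s s'
  proof (rule field_differentiable_bound[OF convex_cball[of 0 "r/2"]])
   fix z :: complex assume z: "z : cball 0 (r/2)"
   hence "z : ball 0 r" using sub by blast
   thus "((%s. G s $ i) has_field_derivative deriv (%s. G s $ i) z) (at z within cball 0 (r/2))"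
    by (rule holomorphic_derivI[OF h open_ball])
   show "norm (deriv (%s. G s $ i) z) <= C" using B' z by (force simp: C_def)
  qed (use that in auto)
  moreover have "norm (G s $ i) <= C" if "s : ball 0 (r/2)" for s
  proof -
   have "s : cball 0 (r/2)" using that by simp
   thus ?thesis using B by (fastforce simp: C_def)
  qed
  moreover have "0 <= C" by (simp add: C_def)
  ultimately show ?thesis by blast
 qed
 then obtain C where C: "ALL i. 0 <= C i & (ALL s:ball 0 (r/2). ALL s':ball 0 (r/2). norm (G s $ i) <= C i & norm (G s $ i - G s' $ i) <= C i * norm (s - s'))"
  unfolding choice_iff[symmetric] by metis
 define D where "D = (\<Sum>i\<in>UNIV. C i) + 1"
 have D: "D > 0" "(\<Sum>i\<in>UNIV. C i) <= D" using C by (auto simp: D_def add_nonneg_pos sum_nonneg)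
 have "norm (G s) <= D & norm (G s - G s') <= D * norm (s - s')" if s: "s : ball 0 (r/2)" "s' : ball 0 (r/2)" for s s'
 proof
  have "(\<Sum>i\<in>UNIV. norm (G s $ i)) <= (\<Sum>i\<in>UNIV. C i)" by (rule sum_mono) (use C s in blast)
  thus "norm (G s) <= D" using norm_vec_le_sum[of "G s"] D(2) by linarith
  have "(\<Sum>i\<in>UNIV. norm ((G s - G s') $ i)) <= (\<Sum>i\<in>UNIV. C i * norm (s - s'))" by (rule sum_mono) (use C s in \<open>simp\<close>)
  also have "... <= D * norm (s - s')" unfolding sum_distrib_right[symmetric] by (rule mult_right_mono[OF D(2)]) simp
  finally show "norm (G s - G s') <= D * norm (s - s')" using norm_vec_le_sum[of "G s - G s'"] by linarith
 qed
 thus ?thesis using D(1) by blast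
qed

lemma vord_factor:
 fixes F :: "complex => complex ^ 'n" assumes F: "hol_vec F (ball 0 r)" "r > 0" and N: "enat N <= vord F"
 shows "EX G. hol_vec G (ball 0 r) & (ALL u:ball 0 r. F u = u ^ N *s G u)"
proof (cases "ALL u:ball 0 r. F u = 0")
 case True
 thus ?thesis by (intro exI[of _ "%_. 0"]) (simp add: hol_vec_def)
next
 case False
 then obtain k G where G: "hol_vec G (ball 0 r)" "ALL u:ball 0 r. F u = u ^ k *s G u" "vord F = enat k"
  using vord_cases[OF F] by blast
 hence k: "k = N + (k - N)" using N by simp
 have "hol_vec (%u. u ^ (k - N) *s G u) (ball 0 r)" by (intro hol_vec_smult holomorphic_intros G)
 moreover have "F u = u ^ N *s (u ^ (k - N) *s G u)" if "u : ball 0 r" for u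
  using G(2) that k by (simp add: vector_smult_assoc power_add[symmetric])
 ultimately show ?thesis by blast
qed

text \<open>The increment of a product \<open>s ^ N *s G s\<close> splits into one term for the
  power and one for the Lipschitz factor.\<close>

lemma vord_lipschitz:
 fixes F :: "complex => complex ^ 'n" assumes F: "hol_vec F (ball 0 r)" "r > 0" and N: "enat N <= vord F"
 shows "EX C>0. ALL s:ball 0 (r/2). ALL s':ball 0 (r/2). norm (F s) <= C * norm s ^ N &
  norm (F s - F s') <= C * (norm (s ^ N - s' ^ N) + norm s' ^ N * norm (s - s'))"
proof -
 obtain G where G: "hol_vec G (ball 0 r)" "ALL u:ball 0 r. F u = u ^ N *s G u" using vord_factor[OF assms] by blast
 obtain C where C: "C > 0" "ALL s:ball 0 (r/2). ALL s':ball 0 (r/2). norm (G s) <= C & norm (G s - G s') <= C * norm (s - s')"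
  using hol_vec_lipschitz[OF G(1) F(2)] by blast
 have "norm (F s) <= C * norm s ^ N & norm (F s - F s') <= C * (norm (s ^ N - s' ^ N) + norm s' ^ N * norm (s - s'))"
  if s: "s : ball 0 (r/2)" "s' : ball 0 (r/2)" for s s'
 proof
  have F2: "F s = s ^ N *s G s" "F s' = s' ^ N *s G s'" using G(2) s F(2) by auto
  have b: "norm (G s) <= C" "norm (G s - G s') <= C * norm (s - s')" using C(2) s by blast+
  show "norm (F s) <= C * norm s ^ N" unfolding F2 norm_smult norm_power
   using mult_left_mono[OF b(1), of "norm s ^ N"] by (simp add: mult.commute)
  have "F s - F s' = (s ^ N - s' ^ N) *s G s + s' ^ N *s (G s - G s')" by (simp add: F2 vec_eq_iff algebra_simps)
  hence "norm (F s - F s') <= norm ((s ^ N - s' ^ N) *s G s) + norm (s' ^ N *s (G s - G s'))"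
   by (simp only: norm_triangle_ineq)
  also have "... <= norm (s ^ N - s' ^ N) * C + norm s' ^ N * (C * norm (s - s'))"
   unfolding norm_smult norm_power by (intro add_mono mult_left_mono b) auto
  finally show "norm (F s - F s') <= C * (norm (s ^ N - s' ^ N) + norm s' ^ N * norm (s - s'))" by (simp add: algebra_simps)
 qed
 thus ?thesis using C(1) by blast
qed

text \<open>The power \<open>t ^ k\<close> with \<open>t ^ \<infinity> = 0\<close>: infinite order
  means that the two curves coincide and contribute no distance.\<close>

definition pw :: "enat => real => real" where
 "pw k t = (case k of enat n => t ^ n | \<infinity> => 0)"

lemma pw_nonneg: "0 <= t ==> 0 <= pw k t" by (auto simp: pw_def split: enat.split)

lemma pw_antimono: "0 <= t ==> t <= 1 ==> k <= enat n ==> t ^ n <= pw k t" by (cases k) (auto simp: pw_def intro: power_decreasing)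

lemma vord_pw:
 fixes F :: "complex => complex ^ 'n" assumes F: "hol_vec F (ball 0 r)" "r > 0"
 shows "EX d>0. EX C>0. d <= r & (ALL u:ball 0 d. pw (vord F) (norm u) <= C * norm (F u) & norm (F u) <= C * pw (vord F) (norm u))"
proof (cases "vord F")
 case (enat k)
 obtain d c C where h: "0 < d" "d <= r" "0 < c" "0 < C" "ALL u:ball 0 d. c * norm u ^ k <= norm (F u) & norm (F u) <= C * norm u ^ k"
  using vord_bounds[OF F enat] by (elim exE conjE) (rule that)
 have "pw (vord F) (norm u) <= (C + 1 / c) * norm (F u) & norm (F u) <= (C + 1 / c) * pw (vord F) (norm u)" if "u : ball 0 d" for u
 proof
  have b: "c * norm u ^ k <= norm (F u)" "norm (F u) <= C * norm u ^ k" using h(5) that by blast+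
  have "norm u ^ k <= 1 / c * norm (F u)" using b(1) h(3) by (simp add: field_simps)
  also have "... <= (C + 1 / c) * norm (F u)" using h(4) by (intro mult_right_mono) auto
  finally show "pw (vord F) (norm u) <= (C + 1 / c) * norm (F u)" by (simp add: pw_def enat)
  have "C * norm u ^ k <= (C + 1 / c) * norm u ^ k" using h(3) by (intro mult_right_mono) auto
  thus "norm (F u) <= (C + 1 / c) * pw (vord F) (norm u)" using b(2) by (simp add: pw_def enat)
 qed
 moreover have "C + 1 / c > 0" using h by (simp add: add_pos_pos)
 ultimately show ?thesis using h by blast
next
 case infinity
 hence "ALL u:ball 0 r. F u = 0" using vord_cases[OF F] by auto
 thus ?thesis using F(2) infinity by (intro exI[of _ r] conjI exI[of _ 1]) (auto simp: pw_def)
qed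

definition ram :: "nat => (complex => complex ^ 'n) => real => bool" where
 "ram N F R \<longleftrightarrow> R > 0 & N > 0 & hol_vec F (ball 0 R) & enat N <= vord F"

lemma ram_shrink: "ram N F R ==> 0 < R' ==> R' <= R ==> ram N F R'" using hol_vec_ball unfolding ram_def by blast

definition kap :: "(complex => complex ^ 'n) => (complex => complex ^ 'n) => complex => enat" where
 "kap F F' w = vord (%s. F s - F' (w * s))"

text \<open>The substitute for \<open>common\<close> when the tangents differ: the distance of two
  points is at least comparable to their distances from the origin.\<close>

definition separated :: "nat => (complex => complex ^ 'n) => (complex => complex ^ 'n) => bool" where
 "separated N F F' \<longleftrightarrow> (EX d>0. EX C>0. ALL s:ball 0 d. ALL s':ball 0 d. norm s ^ N + norm s' ^ N <= C * norm (F s - F' s'))"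

definition common :: "nat => (complex => complex ^ 'n) => (complex => complex ^ 'n) => bool" where
 "common N F F' \<longleftrightarrow> (EX R>0. EX j. ALL s:ball 0 R. F s $ j = s ^ N & F' s $ j = s ^ N)"

definition nearP :: "nat => real => bool" where
 "nearP N e \<longleftrightarrow> 0 < e & e <= 1/2 & (ALL s s' w :: complex. w ^ N = 1 & norm (s' - w * s) <= e * norm s -->
  norm s ^ N * norm (s' - w * s) <= 2 * norm s * norm (s ^ N - s' ^ N))"

definition near1 :: "nat => real => (complex => complex ^ 'n) => (complex => complex ^ 'n) => real => real => complex => bool" where
 "near1 N e F G d C w \<longleftrightarrow> (ALL s:ball 0 d. ALL s':ball 0 d. norm (s' - w * s) <= e * norm s -->
  norm (s ^ N - s' ^ N) + pw (kap F G w) (norm s) <= C * norm (F s - G s') &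
  norm (F s - G s') <= C * (norm (s ^ N - s' ^ N) + pw (kap F G w) (norm s)))"

definition near_est :: "nat => real => (complex => complex ^ 'n) => (complex => complex ^ 'n) => real => real => bool" where
 "near_est N e F G d C \<longleftrightarrow> (ALL w:{w. w ^ N = 1}. near1 N e F G d C w)"

definition far_est :: "nat => real => (complex => complex ^ 'n) => (complex => complex ^ 'n) => real => real => bool" where
 "far_est N e F G d C \<longleftrightarrow> (ALL s:ball 0 d. ALL s':ball 0 d. (ALL w. w ^ N = 1 --> e * norm s <= norm (s' - w * s)) -->
  norm s ^ N + norm s' ^ N <= C * norm (F s - G s'))"

lemma mult_le_mono: "a <= C * b ==> C <= C' ==> 0 <= b ==> a <= C' * (b::real)" using mult_right_mono[of C C' b] by linarith

lemma near1_mono: assumes h: "near1 N e F G d C w" "d' <= d" "C <= C'" shows "near1 N e F G d' C' w" unfolding near1_def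
proof (intro ballI impI)
 fix s s' :: complex assume a: "s : ball 0 d'" "s' : ball 0 d'" "norm (s' - w * s) <= e * norm s"
 hence "s : ball 0 d" "s' : ball 0 d" using h(2) by auto
 hence *: "norm (s ^ N - s' ^ N) + pw (kap F G w) (norm s) <= C * norm (F s - G s')"
  "norm (F s - G s') <= C * (norm (s ^ N - s' ^ N) + pw (kap F G w) (norm s))" using h(1) a(3) unfolding near1_def by blast+
 have "0 <= norm (s ^ N - s' ^ N) + pw (kap F G w) (norm s)" by (simp add: pw_nonneg)
 thus "norm (s ^ N - s' ^ N) + pw (kap F G w) (norm s) <= C' * norm (F s - G s') &
  norm (F s - G s') <= C' * (norm (s ^ N - s' ^ N) + pw (kap F G w) (norm s))"
  using mult_le_mono[OF *(1) h(3)] mult_le_mono[OF *(2) h(3)] by simp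
qed

lemma far_est_mono: assumes h: "far_est N e F G d C" "d' <= d" "C <= C'" shows "far_est N e F G d' C'" unfolding far_est_def
proof (intro ballI impI)
 fix s s' :: complex assume a: "s : ball 0 d'" "s' : ball 0 d'" "ALL w. w ^ N = 1 --> e * norm s <= norm (s' - w * s)"
 hence "s : ball 0 d" "s' : ball 0 d" using h(2) by auto
 hence "norm s ^ N + norm s' ^ N <= C * norm (F s - G s')" using h(1) a(3) unfolding far_est_def by blast
 thus "norm s ^ N + norm s' ^ N <= C' * norm (F s - G s')" by (rule mult_le_mono[OF _ h(3)]) simp
qed

lemma near_estD: assumes "near_est N e F G d C" "w ^ N = 1" "s : ball 0 d" "s' : ball 0 d" "norm (s' - w * s) <= e * norm s"
 shows "norm (s ^ N - s' ^ N) + pw (kap F G w) (norm s) <= C * norm (F s - G s')"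
  "norm (F s - G s') <= C * (norm (s ^ N - s' ^ N) + pw (kap F G w) (norm s))"
 using assms unfolding near_est_def near1_def by blast+

lemma far_estD: assumes "far_est N e F G d C" "s : ball 0 d" "s' : ball 0 d" "ALL w. w ^ N = 1 --> e * norm s <= norm (s' - w * s)"
 shows "norm s ^ N + norm s' ^ N <= C * norm (F s - G s')" using assms unfolding far_est_def by blast

lemma common_le:
 fixes F F' :: "complex => complex ^ 'n" assumes "common N F F'"
 shows "EX d>0. ALL s:ball 0 d. ALL s':ball 0 d. norm (s ^ N - s' ^ N) <= norm (F s - F' s')"
proof -
 obtain R j where R: "R > 0" "ALL s:ball 0 R. F s $ j = s ^ N & F' s $ j = s ^ N" using assms unfolding common_def by blast
 have "norm (s ^ N - s' ^ N) <= norm (F s - F' s')" if "s : ball 0 R" "s' : ball 0 R" for s s'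
  using Finite_Cartesian_Product.norm_nth_le[of "F s - F' s'" j] R(2) that by simp
 thus ?thesis using R(1) by blast
qed

text \<open>The point \<open>F' (c * s)\<close> is inserted. Its distance from \<open>F s\<close> is
  comparable to the power given by \<open>kap\<close>; its distance from \<open>F' s'\<close> is at
  most a multiple of the difference of \<open>N\<close>-th powers, and that difference is at most
  the distance sought, by the common coordinate.\<close>

lemma pair_near:
 fixes F F' :: "complex => complex ^ 'n" assumes F: "ram N F R" and F': "ram N F' R" and com: "common N F F'" and np: "nearP N f"
 shows "EX e>0. EX C>0. near_est N f F F' e C" unfolding near_est_def
proof (rule finite_uniform)
 have N: "N > 0" and R: "R > 0" using F by (auto simp: ram_def)
 show "finite {c::complex. c ^ N = 1}" by (rule finite_nth_roots[OF N])
 show "ALL c:{c. c ^ N = 1}. EX e>0. EX C>0. near1 N f F F' e C c"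
 proof
  fix c :: complex assume "c : {c. c ^ N = 1}"
  hence w: "c ^ N = 1" by simp
  have w1: "norm c = 1" using roots_of_unity_norm w N by blast
  have "hol_vec (%s. F s - F' (c * s)) (ball 0 R)" using F F' w1 by (intro hol_vec_diff hol_vec_rotate) (auto simp: ram_def)
  from vord_pw[OF this R] obtain e1 C1 where 1: "e1 > 0" "C1 > 0" "ALL u:ball 0 e1.
    pw (kap F F' c) (norm u) <= C1 * norm (F u - F' (c * u)) & norm (F u - F' (c * u)) <= C1 * pw (kap F F' c) (norm u)"
   unfolding kap_def by blast
  obtain C2 where 2: "C2 > 0" "ALL s:ball 0 (R/2). ALL s':ball 0 (R/2). norm (F' s) <= C2 * norm s ^ N &
    norm (F' s - F' s') <= C2 * (norm (s ^ N - s' ^ N) + norm s' ^ N * norm (s - s'))"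
   using vord_lipschitz[of F' R N] F' by (auto simp: ram_def)
  obtain e3 where 3: "e3 > 0" "ALL s:ball 0 e3. ALL s':ball 0 e3. norm (s ^ N - s' ^ N) <= norm (F s - F' s')"
   using common_le[OF com] by blast
  define e where "e = min 1 (min e1 (min (R/2) e3))"
  \<comment> \<open>\<open>2 ^ N\<close> comes from \<open>norm s' <= 2 * norm s\<close>, the last
    factor 2 from \<open>nearP\<close> together with \<open>norm s <= 1\<close>.\<close>
  define A where "A = C2 * (1 + 2 ^ N * 2)"
  define C where "C = 1 + C1 * (1 + A) + C1 + A"
  have A: "A > 0" using 2(1) by (simp add: A_def add_pos_pos)
  have e: "e > 0" using 1(1) 3(1) R by (simp add: e_def)
  have C: "C > 0" "1 + C1 * (1 + A) <= C" "C1 <= C" "A <= C"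
   using 1(2) A by (auto simp: C_def intro!: add_pos_pos mult_pos_pos add_nonneg_nonneg)
  have "norm (s ^ N - s' ^ N) + pw (kap F F' c) (norm s) <= C * norm (F s - F' s') &
   norm (F s - F' s') <= C * (norm (s ^ N - s' ^ N) + pw (kap F F' c) (norm s))"
   if s: "s : ball 0 e" "s' : ball 0 e" and near: "norm (s' - c * s) <= f * norm s" for s s'
  proof -
   define d where "d = norm (s ^ N - s' ^ N)"
   define p where "p = pw (kap F F' c) (norm s)"
   define x where "x = norm (F s - F' s')"
   define y where "y = norm (F s - F' (c * s))"
   define z where "z = norm (F' (c * s) - F' s')"
   have y: "p <= C1 * y" "y <= C1 * p" using 1(3) s(1) by (auto simp: p_def y_def e_def)
   have dx: "d <= x" using 3(2) s by (auto simp: d_def x_def e_def)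
   have "norm s' <= norm (c * s) + norm (s' - c * s)" by (rule norm_triangle_sub)
   also have "... <= norm s + f * norm s" using near by (simp add: norm_mult w1)
   also have "... <= 2 * norm s" using np mult_right_mono[of f 1 "norm s"] by (simp add: nearP_def)
   finally have "norm s' ^ N <= 2 ^ N * norm s ^ N" unfolding power_mult_distrib[symmetric] by (intro power_mono) auto
   hence "norm s' ^ N * norm (s' - c * s) <= 2 ^ N * (norm s ^ N * norm (s' - c * s))"
    unfolding mult.assoc[symmetric] by (rule mult_right_mono) simp
   also have "norm s ^ N * norm (s' - c * s) <= 2 * norm s * d" using np w near unfolding nearP_def d_def by blast
   also have "... <= 2 * d" using s(1) mult_right_mono[of "norm s" 1 d] by (simp add: e_def d_def)
   finally have near': "norm s' ^ N * norm (s' - c * s) <= 2 ^ N * (2 * d)" by simp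
   have "z <= C2 * (norm ((c * s) ^ N - s' ^ N) + norm s' ^ N * norm (c * s - s'))"
    using 2(2) s w1 by (simp add: z_def e_def norm_mult)
   also have "... = C2 * (d + norm s' ^ N * norm (s' - c * s))" by (simp add: power_mult_distrib w d_def norm_minus_commute)
   also have "... <= C2 * (d + 2 ^ N * (2 * d))" using near' 2(1) by (intro mult_left_mono add_left_mono) auto
   also have "... = A * d" by (simp add: A_def algebra_simps)
   finally have z: "z <= A * d" .
   have "y <= x + z" "x <= y + z" unfolding x_def y_def z_def
    using dist_triangle[of "F s" "F' (c * s)" "F' s'"] dist_triangle[of "F s" "F' s'" "F' (c * s)"]
    by (simp_all add: dist_norm norm_minus_commute)
   have Ad: "A * d <= A * x" by (rule mult_left_mono[OF dx]) (use A in simp)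
   have "C1 * y <= C1 * (x + A * x)" using \<open>y <= x + z\<close> z Ad 1(2) by (intro mult_left_mono) auto
   hence "d + p <= (1 + C1 * (1 + A)) * x" using dx y(1) by (simp add: algebra_simps)
   also have "... <= C * x" by (rule mult_right_mono[OF C(2)]) (simp add: x_def)
   finally have a: "d + p <= C * x" .
   have "C1 * p <= C * p" "A * d <= C * d" using C(3,4) pw_nonneg by (auto intro!: mult_right_mono simp: p_def d_def)
   hence b: "x <= C * (d + p)" using \<open>x <= y + z\<close> y(2) z by (simp add: algebra_simps)
   show ?thesis using a b unfolding d_def p_def x_def by blast
  qed
  thus "EX e>0. EX C>0. near1 N f F F' e C c" unfolding near1_def using e C(1) by blast
 qed
qed (use near1_mono in blast)

lemma pair_far:
 fixes F F' :: "complex => complex ^ 'n" assumes com: "common N F F'" and N: "N > 0" and e: "e > 0"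
 shows "EX d>0. EX C>0. far_est N e F F' d C"
proof -
 obtain c where c: "c > 0" "ALL s s' :: complex. (ALL w. w ^ N = 1 --> e * norm s <= norm (s' - w * s)) -->
  c * (norm s ^ N + norm s' ^ N) <= norm (s ^ N - s' ^ N)" using roots_gap[OF N e] by blast
 obtain d where d: "d > 0" "ALL s:ball 0 d. ALL s':ball 0 d. norm (s ^ N - s' ^ N) <= norm (F s - F' s')"
  using common_le[OF com] by blast
 have "norm s ^ N + norm s' ^ N <= (1 / c) * norm (F s - F' s')"
  if "s : ball 0 d" "s' : ball 0 d" "ALL w. w ^ N = 1 --> e * norm s <= norm (s' - w * s)" for s s'
 proof -
  have "c * (norm s ^ N + norm s' ^ N) <= norm (s ^ N - s' ^ N)" using c(2) that(3) by blast
  also have "... <= norm (F s - F' s')" using d(2) that by blast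
  finally show ?thesis using c(1) by (simp add: field_simps)
 qed
 moreover have "1 / c > 0" using c(1) by simp
 ultimately show ?thesis unfolding far_est_def using d(1) by blast
qed

lemma pair_upper:
 fixes F F' :: "complex => complex ^ 'n" assumes "ram N F R" "ram N F' R"
 shows "EX a>0. EX C>0. ALL s:ball 0 a. ALL s':ball 0 a. norm (F s - F' s') <= C * (norm s ^ N + norm s' ^ N)"
proof -
 obtain d C where 1: "0 < d" "d <= R" "0 < C" "ALL u:ball 0 d. norm (F u) <= C * norm u ^ N"
  using vord_upper[of F R N] assms unfolding ram_def by blast
 obtain d' C' where 2: "0 < d'" "d' <= R" "0 < C'" "ALL u:ball 0 d'. norm (F' u) <= C' * norm u ^ N"
  using vord_upper[of F' R N] assms unfolding ram_def by blast
 have "norm (F s - F' s') <= (C + C') * (norm s ^ N + norm s' ^ N)" if "s : ball 0 (min d d')" "s' : ball 0 (min d d')" for s s'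
 proof -
  have "norm (F s) <= C * norm s ^ N" "norm (F' s') <= C' * norm s' ^ N" using 1(4) 2(4) that by auto
  moreover have "0 <= C' * norm s ^ N" "0 <= C * norm s' ^ N" using 1(3) 2(3) by auto
  ultimately show ?thesis using norm_triangle_ineq4[of "F s" "F' s'"] by (simp add: algebra_simps)
 qed
 moreover have "min d d' > 0" "C + C' > 0" using 1 2 by auto
 ultimately show ?thesis by blast
qed

lemma near_norm_le:
 fixes s s' w :: complex assumes "w ^ N = 1" "N > 0" "nearP N e" "norm (s' - w * s) <= e * norm s" shows "norm s' <= 2 * norm s"
proof -
 have "norm s' <= norm (w * s) + norm (s' - w * s)" by (rule norm_triangle_sub)
 moreover have "norm (w * s) = norm s" using roots_of_unity_norm[OF assms(1,2)] by (simp add: norm_mult)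
 moreover have "e * norm s <= 1 * norm s" using assms(3) by (intro mult_right_mono) (auto simp: nearP_def)
 ultimately show ?thesis using assms(4) by linarith
qed

text \<open>Orders at most \<open>N\<close> make the term given by \<open>kap\<close> at least
  \<open>norm s ^ N\<close> near a rotation; elsewhere \<open>far_est\<close> applies. With
  \<open>kap_le_if_separated\<close> this means that for pairs with a common coordinate the orders
  alone decide separation.\<close>

lemma separated_if_kap:
 fixes F F' :: "complex => complex ^ 'n"
 assumes F: "ram N F R" "ram N F' R" and com: "common N F F'" and k: "ALL a. a ^ N = 1 --> kap F F' a <= enat N"
 shows "separated N F F'"
proof -
 have N: "N > 0" using F by (simp add: ram_def)
 obtain b where b: "nearP N b" using roots_near[OF N] unfolding nearP_def by blast
 obtain d C where n: "d > 0" "C > 0" "near_est N b F F' d C" using pair_near[OF F com b] by blast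
 obtain d' C' where f: "d' > 0" "C' > 0" "far_est N b F F' d' C'" using pair_far[OF com N] b unfolding nearP_def by blast
 define D where "D = C' + (1 + 2 ^ N) * C"
 define e where "e = min 1 (min d d')"
 have D: "D > 0" "C' <= D" "(1 + 2 ^ N) * C <= D" using n(2) f(2) by (auto simp: D_def add_pos_pos)
 have "norm s ^ N + norm s' ^ N <= D * norm (F s - F' s')" if s: "s : ball 0 e" "s' : ball 0 e" for s s'
 proof (cases "ALL a. a ^ N = 1 --> b * norm s <= norm (s' - a * s)")
  case True
  have "s : ball 0 d'" "s' : ball 0 d'" using s by (auto simp: e_def)
  hence "norm s ^ N + norm s' ^ N <= C' * norm (F s - F' s')" using far_estD[OF f(3)] True by blast
  thus ?thesis using mult_right_mono[OF D(2), of "norm (F s - F' s')"] by simp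
 next
  case False
  then obtain a where w: "a ^ N = 1" "norm (s' - a * s) <= b * norm s" by fastforce
  have "s : ball 0 d" "s' : ball 0 d" using s by (auto simp: e_def)
  hence "norm (s ^ N - s' ^ N) + pw (kap F F' a) (norm s) <= C * norm (F s - F' s')" using near_estD(1)[OF n(3) w(1)] w(2) by blast
  hence "pw (kap F F' a) (norm s) <= C * norm (F s - F' s')" using norm_ge_zero[of "s ^ N - s' ^ N"] by linarith
  moreover have "norm s ^ N <= pw (kap F F' a) (norm s)" by (rule pw_antimono) (use k w s in \<open>auto simp: e_def\<close>)
  moreover have "norm s' ^ N <= 2 ^ N * norm s ^ N" unfolding power_mult_distrib[symmetric]
   by (intro power_mono near_norm_le[OF w(1) N b w(2)]) simp
  ultimately have "norm s ^ N + norm s' ^ N <= (1 + 2 ^ N) * (C * norm (F s - F' s'))"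
   using mult_left_mono[of "norm s ^ N" "C * norm (F s - F' s')" "1 + 2 ^ N"] by (simp add: algebra_simps)
  thus ?thesis using mult_right_mono[OF D(3), of "norm (F s - F' s')"] by (simp add: mult.assoc)
 qed
 moreover have "e > 0" using n(1) f(1) by (simp add: e_def)
 ultimately show ?thesis unfolding separated_def using D(1) by blast
qed

lemma kap_hol_vec: assumes "ram N F R" "ram N F' R" "w ^ N = 1" shows "hol_vec (%s. F s - F' (w * s)) (ball 0 R)"
 using assms roots_of_unity_norm[of w N] unfolding ram_def by (intro hol_vec_diff hol_vec_rotate) auto

lemma kap_le_if_separated:
 fixes F F' :: "complex => complex ^ 'n" assumes F: "ram N F R" "ram N F' R" and sep: "separated N F F'" and w: "a ^ N = 1"
 shows "kap F F' a <= enat N"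
proof (rule ccontr)
 assume "~ ?thesis"
 hence k: "enat (Suc N) <= vord (%s. F s - F' (a * s))" by (simp add: kap_def Suc_ile_eq)
 have R: "R > 0" "N > 0" using F by (auto simp: ram_def)
 obtain d C where 1: "0 < d" "d <= R" "0 < C" "ALL u:ball 0 d. norm (F u - F' (a * u)) <= C * norm u ^ Suc N"
  using vord_upper[OF kap_hol_vec[OF F w] R(1) k] by (elim exE conjE) (rule that)
 obtain d' C' where 2: "d' > 0" "C' > 0" "ALL s:ball 0 d'. ALL s':ball 0 d'. norm s ^ N + norm s' ^ N <= C' * norm (F s - F' s')"
  using sep unfolding separated_def by blast
 have w1: "norm a = 1" using roots_of_unity_norm w R by blast
 have "ALL t. 0 < t & t < min d d' --> 1 * t ^ N <= (C' * C) * t ^ Suc N"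
 proof (intro allI impI)
  fix t :: real assume t: "0 < t & t < min d d'"
  have "complex_of_real t : ball 0 d'" "a * of_real t : ball 0 d'" "complex_of_real t : ball 0 d"
   using t w1 by (auto simp: norm_mult)
  hence "norm (complex_of_real t) ^ N + norm (a * of_real t) ^ N <= C' * norm (F (of_real t) - F' (a * of_real t))"
   "norm (F (of_real t) - F' (a * of_real t)) <= C * norm (complex_of_real t) ^ Suc N" using 1(4) 2(3) by blast+
  hence "t ^ N + t ^ N <= C' * norm (F (of_real t) - F' (a * of_real t))"
   "C' * norm (F (of_real t) - F' (a * of_real t)) <= C' * (C * t ^ Suc N)" using t w1 2(2) by (auto simp: norm_mult)
  moreover have "0 <= t ^ N" using t by simp
  ultimately show "1 * t ^ N <= (C' * C) * t ^ Suc N" by (simp only: mult.assoc mult_1)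
 qed
 hence "Suc N <= N" by (rule power_dominates[rotated 2]) (use 1 2 in auto)
 thus False by simp
qed

lemma kap_ge:
 fixes F F' :: "complex => complex ^ 'n" assumes F: "ram N F R" "ram N F' R" and w: "a ^ N = 1" shows "enat N <= kap F F' a"
proof -
 have R: "R > 0" "N > 0" "hol_vec F (ball 0 R)" using F by (auto simp: ram_def)
 have w1: "norm a = 1" using roots_of_unity_norm w R by blast
 have h: "hol_vec (%s. F' (a * s)) (ball 0 R)" using F w1 by (intro hol_vec_rotate) (auto simp: ram_def)
 have z: "hol_vec (%s. 0 :: complex ^ 'n) (ball 0 R)" by (simp add: hol_vec_def)
 have "w ~= 0" if "norm (w::complex) = 1" for w using that by auto
 hence "vord (%s. F' (a * s ^ 1)) = enat 1 * vord F'" using F(2) w1 R by (intro vord_reparam) (auto simp: ram_def)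
 hence "vord (%s. F' (a * s)) = vord F'" unfolding one_enat_def[symmetric] by simp
 hence "enat N <= vord (%s. F' (a * s) - 0)" using F(2) by (simp add: ram_def)
 hence "enat N <= vord (%s. 0 - F' (a * s))" using vord_minus[OF h z R(1)] by simp
 moreover have "enat N <= vord (%s. F s - 0)" using F by (simp add: ram_def)
 ultimately show ?thesis using vord_ultra[OF R(3) z h R(1)] unfolding kap_def by (meson min.boundedI order_trans)
qed

text \<open>If \<open>F\<close> and \<open>F'\<close> are separated, their distance dominates every
  distance between \<open>G\<close> and \<open>G'\<close>. Otherwise both pairs have a common
  coordinate, and the two distances are comparable to the same expression in the orders.\<close>

lemma pair_compare:
 fixes F F' :: "complex => complex ^ 'n" and G G' :: "complex => complex ^ 'm"
 assumes F: "ram N F R" "ram N F' R" and G: "ram N G R'" "ram N G' R'"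
  and A: "common N F F' | separated N F F'" and B: "common N G G' | separated N G G'"
  and k: "ALL a. a ^ N = 1 --> kap F F' a = kap G G' a"
 shows "EX d>0. EX C>0. ALL s:ball 0 d. ALL s':ball 0 d. norm (G s - G' s') <= C * norm (F s - F' s')"
proof -
 have N: "N > 0" using F by (simp add: ram_def)
 obtain d1 C1 where u: "d1 > 0" "C1 > 0" "ALL s:ball 0 d1. ALL s':ball 0 d1. norm (G s - G' s') <= C1 * (norm s ^ N + norm s' ^ N)"
  using pair_upper[OF G] by blast
 show ?thesis
 proof (cases "separated N F F'")
  case True
  then obtain d2 C2 where 2: "d2 > 0" "C2 > 0" "ALL s:ball 0 d2. ALL s':ball 0 d2. norm s ^ N + norm s' ^ N <= C2 * norm (F s - F' s')"
   unfolding separated_def by blast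
  have "norm (G s - G' s') <= (C1 * C2) * norm (F s - F' s')" if "s : ball 0 (min d1 d2)" "s' : ball 0 (min d1 d2)" for s s'
  proof -
   have s: "s : ball 0 d1" "s' : ball 0 d1" "s : ball 0 d2" "s' : ball 0 d2" using that by auto
   have "norm (G s - G' s') <= C1 * (norm s ^ N + norm s' ^ N)" using u(3) s by blast
   also have "... <= C1 * (C2 * norm (F s - F' s'))" using 2(3) s u(2) by (intro mult_left_mono) auto
   finally show ?thesis by (simp add: mult.assoc)
  qed
  moreover have "min d1 d2 > 0" "C1 * C2 > 0" using u 2 by auto
  ultimately show ?thesis by blast
 next
  case False
  hence cF: "common N F F'" using A by blast
  \<comment> \<open>Separation of \<open>G\<close> and \<open>G'\<close> would bound their orders by
    \<open>N\<close>; these are also the orders of \<open>F\<close> and \<open>F'\<close>, which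
    would then be separated.\<close>
  have cG: "common N G G'"
  proof (rule ccontr)
   assume "~ ?thesis"
   hence "separated N G G'" using B by blast
   hence "ALL a. a ^ N = 1 --> kap F F' a <= enat N" using kap_le_if_separated[OF G] k by simp
   thus False using separated_if_kap[OF F cF] False by blast
  qed
  obtain b where b: "nearP N b" using roots_near[OF N] unfolding nearP_def by blast
  obtain d2 C2 where 2: "d2 > 0" "C2 > 0" "near_est N b F F' d2 C2" using pair_near[OF F cF b] by blast
  obtain d3 C3 where 3: "d3 > 0" "C3 > 0" "near_est N b G G' d3 C3" using pair_near[OF G cG b] by blast
  obtain d4 C4 where 4: "d4 > 0" "C4 > 0" "far_est N b F F' d4 C4" using pair_far[OF cF N] b unfolding nearP_def by blast
  define e where "e = min (min d1 d2) (min d3 d4)"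
  define D where "D = C1 * C4 + C3 * C2"
  have D: "D > 0" using u 2 3 4 by (simp add: D_def add_pos_pos)
  have "norm (G s - G' s') <= D * norm (F s - F' s')" if "s : ball 0 e" "s' : ball 0 e" for s s'
  proof -
   have s: "s : ball 0 d1" "s' : ball 0 d1" "s : ball 0 d2" "s' : ball 0 d2" "s : ball 0 d3" "s' : ball 0 d3"
    "s : ball 0 d4" "s' : ball 0 d4" using that by (auto simp: e_def)
   have mono: "C1 * C4 * norm (F s - F' s') <= D * norm (F s - F' s')" "C3 * C2 * norm (F s - F' s') <= D * norm (F s - F' s')"
    using u 2 3 4 by (auto simp: D_def intro!: mult_right_mono)
   show ?thesis
   proof (cases "ALL a. a ^ N = 1 --> b * norm s <= norm (s' - a * s)")
    case True
    have "norm (G s - G' s') <= C1 * (norm s ^ N + norm s' ^ N)" using u(3) s by blast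
    also have "... <= C1 * (C4 * norm (F s - F' s'))" using far_estD[OF 4(3) s(7,8) True] u(2) by (intro mult_left_mono) auto
    finally show ?thesis using mono(1) by (simp add: mult.assoc)
   next
    case False
    then obtain a where w: "a ^ N = 1" "norm (s' - a * s) <= b * norm s" by fastforce
    have "norm (s ^ N - s' ^ N) + pw (kap F F' a) (norm s) <= C2 * norm (F s - F' s')" using near_estD(1)[OF 2(3) w(1) s(3,4) w(2)] .
    hence "C3 * (norm (s ^ N - s' ^ N) + pw (kap F F' a) (norm s)) <= C3 * (C2 * norm (F s - F' s'))"
     using 3(2) by (intro mult_left_mono) auto
    moreover have "norm (G s - G' s') <= C3 * (norm (s ^ N - s' ^ N) + pw (kap G G' a) (norm s))" using near_estD(2)[OF 3(3) w(1) s(5,6) w(2)] .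
    moreover have "kap F F' a = kap G G' a" using k w by blast
    ultimately show ?thesis using mono(2) by (simp add: mult.assoc)
   qed
  qed
  moreover have "e > 0" using u 2 3 4 by (simp add: e_def)
  ultimately show ?thesis using D by blast
 qed
qed

section \<open>Pairs of branches\<close>

text \<open>A linear form \<open>L\<close> kills the direction of the second branch but not that of
  the first. The factors \<open>3 * D / 4\<close> and \<open>D / 4\<close> produce the coefficients
  3 and 1, chosen so that the sum with the exchanged inequality has positive coefficients.\<close>

lemma branch_separated_half:
 fixes f1 f2 G1 G2 :: "complex => complex ^ 'n" assumes f: "pparam Z1 m1 f1 j1 R1" "pparam Z2 m2 f2 j2 R2"
  and G1: "hol_vec G1 (ball 0 R1)" "ALL u:ball 0 R1. f1 u = u ^ m1 *s G1 u"
  and G2: "hol_vec G2 (ball 0 R2)" "ALL u:ball 0 R2. f2 u = u ^ m2 *s G2 u" and ab: "G1 0 $ a * G2 0 $ b ~= G1 0 $ b * G2 0 $ a"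
 shows "EX d>0. EX C>0. ALL x:ball 0 d. ALL y:ball 0 d. 3 * norm x ^ m1 - norm y ^ m2 <= C * norm (f1 x - f2 y)"
proof -
 define L where "L x = x $ a * G2 0 $ b - x $ b * G2 0 $ a" for x :: "complex ^ 'n"
 define D where "D = norm (L (G1 0))"
 have D: "D > 0" using ab by (simp add: D_def L_def)
 define K where "K = norm (G2 0 $ a) + norm (G2 0 $ b)"
 have K0: "K >= 0" by (simp add: K_def)
 have LK: "norm (L x) <= K * norm x" for x
 proof -
  have "norm (L x) <= norm (x $ a) * norm (G2 0 $ b) + norm (x $ b) * norm (G2 0 $ a)"
   unfolding L_def norm_mult[symmetric] by (rule norm_triangle_ineq4)
  also have "... <= norm x * norm (G2 0 $ b) + norm x * norm (G2 0 $ a)"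
   by (intro add_mono mult_right_mono Finite_Cartesian_Product.norm_nth_le) auto
  finally show ?thesis by (simp add: K_def algebra_simps)
 qed
 have cont: "EX d>0. ALL u. norm u < d --> norm (L (G u) - L (G 0)) < D / 4" if G: "hol_vec G (ball 0 r)" "r > 0" for G r
 proof -
  have "(%u. L (G u)) holomorphic_on ball 0 r" using G(1) unfolding L_def hol_vec_def by (auto intro!: holomorphic_intros)
  hence "isCont (%u. L (G u)) 0" using G(2) by (intro continuous_on_interior[OF holomorphic_on_imp_continuous_on]) auto
  moreover have "D / 4 > 0" using D by simp
  ultimately show ?thesis unfolding continuous_at_eps_delta dist_norm diff_zero by blast
 qed
 obtain d1 where d1: "d1 > 0" "ALL u. norm u < d1 --> norm (L (G1 u) - L (G1 0)) < D / 4" using cont[OF G1(1) pparamD(1)[OF f(1)]] by blast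
 obtain d2 where d2: "d2 > 0" "ALL u. norm u < d2 --> norm (L (G2 u) - L (G2 0)) < D / 4" using cont[OF G2(1) pparamD(1)[OF f(2)]] by blast
 define d where "d = min (min R1 R2) (min d1 d2)"
 have "3 * norm x ^ m1 - norm y ^ m2 <= (4 * K / D + 1) * norm (f1 x - f2 y)" if xy: "x : ball 0 d" "y : ball 0 d" for x y
 proof -
  have e: "f1 x = x ^ m1 *s G1 x" "f2 y = y ^ m2 *s G2 y" using G1(2) G2(2) xy by (auto simp: d_def)
  have b1: "norm (L (G1 x)) >= 3 * D / 4" using d1(2)[rule_format, of x] xy norm_triangle_ineq2[of "L (G1 0)" "L (G1 x)"]
   by (simp add: d_def D_def norm_minus_commute)
  have b2: "norm (L (G2 y)) <= D / 4" using d2(2)[rule_format, of y] xy by (simp add: d_def L_def[of "G2 0"])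
  have "L (f1 x - f2 y) = x ^ m1 * L (G1 x) - y ^ m2 * L (G2 y)" unfolding e by (simp add: L_def algebra_simps)
  hence "norm x ^ m1 * norm (L (G1 x)) - norm y ^ m2 * norm (L (G2 y)) <= K * norm (f1 x - f2 y)"
   using LK[of "f1 x - f2 y"] norm_triangle_ineq2[of "x ^ m1 * L (G1 x)" "y ^ m2 * L (G2 y)"] by (simp add: norm_mult norm_power)
  hence "norm x ^ m1 * (3 * D / 4) - norm y ^ m2 * (D / 4) <= K * norm (f1 x - f2 y)"
   using mult_left_mono[OF b1, of "norm x ^ m1"] mult_left_mono[OF b2, of "norm y ^ m2"] by simp
  hence "(3 * norm x ^ m1 - norm y ^ m2) * (D / 4) <= K * norm (f1 x - f2 y)" by (simp add: algebra_simps)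
  hence "3 * norm x ^ m1 - norm y ^ m2 <= 4 * K / D * norm (f1 x - f2 y)" using D by (simp add: field_simps)
  thus ?thesis using norm_ge_zero[of "f1 x - f2 y"] unfolding distrib_right mult_1 by linarith
 qed
 moreover have "d > 0" "4 * K / D + 1 > 0" using d1 d2 pparamD(1)[OF f(1)] pparamD(1)[OF f(2)] K0 D by (auto simp: d_def add_nonneg_pos)
 ultimately show ?thesis by blast
qed

lemma branch_separated:
 fixes f1 f2 :: "complex => complex ^ 'n"
 assumes f: "pparam Z1 m1 f1 j1 R1" "pparam Z2 m2 f2 j2 R2" and nt: "tangent_cone Z1 ~= tangent_cone Z2"
 shows "EX d>0. EX C>0. ALL u:ball 0 d. ALL v:ball 0 d. norm u ^ m1 + norm v ^ m2 <= C * norm (f1 u - f2 v)"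
proof -
 obtain G1 where G1: "hol_vec G1 (ball 0 R1)" "ALL u:ball 0 R1. f1 u = u ^ m1 *s G1 u" "G1 0 $ j1 = 1"
  using pparam_leading[OF f(1)] by blast
 obtain G2 where G2: "hol_vec G2 (ball 0 R2)" "ALL u:ball 0 R2. f2 u = u ^ m2 *s G2 u" "G2 0 $ j2 = 1"
  using pparam_leading[OF f(2)] by blast
 have "EX a b. G1 0 $ a * G2 0 $ b ~= G1 0 $ b * G2 0 $ a"
 proof (rule ccontr)
  assume "~ ?thesis"
  hence eq: "G1 0 $ a * G2 0 $ b = G1 0 $ b * G2 0 $ a" for a b by blast
  have "G1 0 $ a = G1 0 $ j2 * G2 0 $ a" "G2 0 $ a = G2 0 $ j1 * G1 0 $ a" for a
   using eq[of a j2] eq[of j1 a] unfolding G1(3) G2(3) by (simp_all only: mult_1_right mult_1_left mult.commute)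
  hence "G1 0 = G1 0 $ j2 *s G2 0" "G2 0 = G2 0 $ j1 *s G1 0" unfolding vec_eq_iff vector_smult_component by blast+
  hence "c *s G1 0 = (c * G1 0 $ j2) *s G2 0" "c *s G2 0 = (c * G2 0 $ j1) *s G1 0" for c
   unfolding vector_smult_assoc[symmetric] by simp_all
  hence "range (%c. c *s G1 0) = range (%c. c *s G2 0)" by (metis (no_types, lifting) image_subsetI rangeI subset_antisym)
  thus False using nt tangent_cone_eq[OF f(1) G1] tangent_cone_eq[OF f(2) G2] by simp
 qed
 then obtain a b where ab: "G1 0 $ a * G2 0 $ b ~= G1 0 $ b * G2 0 $ a" by blast
 obtain d1 C1 where 1: "d1 > 0" "C1 > 0" "ALL x:ball 0 d1. ALL y:ball 0 d1. 3 * norm x ^ m1 - norm y ^ m2 <= C1 * norm (f1 x - f2 y)"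
  using branch_separated_half[OF f G1(1,2) G2(1,2) ab] by blast
 have "G2 0 $ a * G1 0 $ b ~= G2 0 $ b * G1 0 $ a" using ab by (simp add: mult.commute)
 then obtain d2 C2 where 2: "d2 > 0" "C2 > 0" "ALL x:ball 0 d2. ALL y:ball 0 d2. 3 * norm x ^ m2 - norm y ^ m1 <= C2 * norm (f2 x - f1 y)"
  using branch_separated_half[OF f(2,1) G2(1,2) G1(1,2)] by blast
 have "norm u ^ m1 + norm v ^ m2 <= (C1 + C2) * norm (f1 u - f2 v)" if "u : ball 0 (min d1 d2)" "v : ball 0 (min d1 d2)" for u v
 proof -
  have "3 * norm u ^ m1 - norm v ^ m2 <= C1 * norm (f1 u - f2 v)" "3 * norm v ^ m2 - norm u ^ m1 <= C2 * norm (f2 v - f1 u)"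
   using 1(3) 2(3) that by auto
  moreover have "0 <= norm u ^ m1" "0 <= norm v ^ m2" by auto
  ultimately show ?thesis unfolding distrib_right norm_minus_commute[of "f2 v"] by linarith
 qed
 moreover have "min d1 d2 > 0" "C1 + C2 > 0" using 1 2 by auto
 ultimately show ?thesis by blast
qed

text \<open>Intended for \<open>c\<close> an \<open>N\<close>-th root of unity with
  \<open>N = n * m\<close>: then the special coordinate stays \<open>s ^ N\<close> after the
  rotation.\<close>

definition rp :: "(complex => complex ^ 'n) => nat => complex => complex => complex ^ 'n" where
 "rp f n c s = f ((c * s) ^ n)"

lemma rp_ball:
 fixes c s :: complex assumes "norm c = 1" "n > 0" "0 < d" "s : ball 0 (min 1 d)" shows "(c * s) ^ n : ball 0 d"
proof -
 have "norm s ^ n <= norm s ^ 1" by (rule power_decreasing) (use assms in auto)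
 thus ?thesis using assms by (simp add: norm_power norm_mult)
qed

lemma rp_ram:
 fixes f :: "complex => complex ^ 'n" assumes f: "pparam Z m f j R" and n: "n > 0" and c: "c ^ (n * m) = 1"
 shows "ram (n * m) (rp f n c) (min 1 R)" "ALL s:ball 0 (min 1 R). rp f n c s $ j = s ^ (n * m)"
proof -
 note p = pparamD[OF f]
 have c1: "norm c = 1" using roots_of_unity_norm[OF c] n p(6) by simp
 have st: "(c * s) ^ n : ball 0 R" if "s : ball 0 (min 1 R)" for s by (rule rp_ball[OF c1 n p(1) that])
 have "hol_vec (%s. f ((c * s) ^ n)) (ball 0 (min 1 R))"
  by (rule hol_vec_compose[OF p(2)]) (use st in \<open>auto intro!: holomorphic_intros\<close>)
 moreover have "vord (%s. f (c ^ n * s ^ n)) = enat n * vord f" using c1 n by (intro vord_reparam[OF p(2,1)]) auto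
 ultimately show "ram (n * m) (rp f n c) (min 1 R)" unfolding ram_def rp_def[abs_def] using p n by (simp add: power_mult_distrib)
 show "ALL s:ball 0 (min 1 R). rp f n c s $ j = s ^ (n * m)"
  using p(7) st by (simp add: rp_def power_mult[symmetric] power_mult_distrib c del: mem_ball)
qed

lemma rp_pair:
 fixes f1 f2 :: "complex => complex ^ 'n"
 assumes f1: "pparam Z1 m1 f1 j1 R1" and f2: "pparam Z2 m2 f2 j2 R2" and j: "tangent_cone Z1 = tangent_cone Z2 --> j1 = j2"
  and N: "N = n1 * m1" "N = n2 * m2" "n1 > 0" "n2 > 0" and c: "c1 ^ N = 1" "c2 ^ N = 1"
 shows "common N (rp f1 n1 c1) (rp f2 n2 c2) | separated N (rp f1 n1 c1) (rp f2 n2 c2)"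
proof (cases "tangent_cone Z1 = tangent_cone Z2")
 case True
 have "ALL s:ball 0 (min (min 1 R1) (min 1 R2)). rp f1 n1 c1 s $ j1 = s ^ N & rp f2 n2 c2 s $ j1 = s ^ N"
  using rp_ram(2)[OF f1 N(3), of c1] rp_ram(2)[OF f2 N(4), of c2] N(1,2)[symmetric] c True j by auto
 moreover have "min (min 1 R1) (min 1 R2) > 0" using pparamD(1)[OF f1] pparamD(1)[OF f2] by simp
 ultimately show ?thesis unfolding common_def by blast
next
 case False
 obtain a C where d: "a > 0" "C > 0" "ALL u:ball 0 a. ALL v:ball 0 a. norm u ^ m1 + norm v ^ m2 <= C * norm (f1 u - f2 v)"
  using branch_separated[OF f1 f2 False] by blast
 have N0: "N > 0" using N pparamD(6)[OF f1] by simp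
 have n: "norm c1 = 1" "norm c2 = 1" using roots_of_unity_norm c N0 by auto
 have "norm s ^ N + norm s' ^ N <= C * norm (rp f1 n1 c1 s - rp f2 n2 c2 s')"
  if s: "s : ball 0 (min 1 a)" "s' : ball 0 (min 1 a)" for s s'
 proof -
  have "norm ((c1 * s) ^ n1) ^ m1 = norm s ^ N" unfolding N(1) by (simp add: norm_power norm_mult n power_mult[symmetric])
  moreover have "norm ((c2 * s') ^ n2) ^ m2 = norm s' ^ N" unfolding N(2) by (simp add: norm_power norm_mult n power_mult[symmetric])
  moreover have "(c1 * s) ^ n1 : ball 0 a" "(c2 * s') ^ n2 : ball 0 a"
   using rp_ball[OF n(1) N(3) d(1) s(1)] rp_ball[OF n(2) N(4) d(1) s(2)] by auto
  ultimately show ?thesis using d(3) unfolding rp_def by metis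
 qed
 moreover have "min 1 a > 0" using d(1) by simp
 ultimately show ?thesis unfolding separated_def using d(2) by blast
qed

lemma kap_sym:
 fixes F F' :: "complex => complex ^ 'n" assumes F: "ram N F R" "ram N F' R" and w: "a ^ N = 1"
 shows "kap F' F (1 / a) = kap F F' a"
proof -
 have R: "R > 0" "N > 0" using F by (auto simp: ram_def)
 have n: "norm a = 1" using roots_of_unity_norm w R by blast
 hence w0: "a ~= 0" by auto
 have w': "(1 / a) ^ N = 1" using w by (simp add: power_divide)
 have "vord (%s. F (1 / a * s ^ 1) - F' (a * (1 / a * s ^ 1))) = enat 1 * kap F F' a"
  unfolding kap_def by (rule vord_reparam[OF kap_hol_vec[OF F w] R(1)]) (use w0 in auto)
 hence 1: "vord (%s. F (1 / a * s) - F' s) = kap F F' a" unfolding one_enat_def[symmetric] using w0 by simp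
 have "norm (1 / a) = 1" using n by (simp add: norm_divide)
 hence h: "hol_vec (%s. F (1 / a * s)) (ball 0 R)" "hol_vec F' (ball 0 R)"
  using F hol_vec_rotate[of F R "1 / a"] unfolding ram_def by blast+
 have "vord (%s. F' s - F (1 / a * s)) = vord (%s. F (1 / a * s) - F' s)" by (rule vord_minus[OF h(2,1) R(1)])
 thus ?thesis using 1 by (simp add: kap_def)
qed

lemma contact_hol_vec: assumes f1: "pparam Z1 m1 f1 j1 R1" and f2: "pparam Z2 m2 f2 j2 R2" and t: "t : roots_of_unity m2"
 shows "EX r>0. r <= 1 & hol_vec (%u. f1 (u ^ m2) - f2 (t * u ^ m1)) (ball 0 r)"
proof -
 note p1 = pparamD[OF f1] and p2 = pparamD[OF f2]
 obtain r1 where r1: "0 < r1" "ALL c n. norm c = 1 & n > 0 --> hol_vec (%u. f1 (c * u ^ n)) (ball 0 r1)"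
  using hol_vec_power[OF p1(2,1)] by blast
 obtain r2 where r2: "0 < r2" "r2 <= 1" "ALL c n. norm c = 1 & n > 0 --> hol_vec (%u. f2 (c * u ^ n)) (ball 0 r2)"
  using hol_vec_power[OF p2(2,1)] by blast
 have "hol_vec (%u. f1 (1 * u ^ m2)) (ball 0 r1)" using r1(2) p2(6) norm_one by blast
 moreover have "hol_vec (%u. f2 (t * u ^ m1)) (ball 0 r2)" using r2(3) p1(6) unity_norm[OF t p2(6)] by blast
 ultimately have "hol_vec (%u. f1 (u ^ m2) - f2 (t * u ^ m1)) (ball 0 (min r1 r2))"
  by (intro hol_vec_diff hol_vec_ball[of _ r1 "min r1 r2"] hol_vec_ball[of _ r2 "min r1 r2"]) auto
 moreover have "0 < min r1 r2" "min r1 r2 <= 1" using r1 r2 by auto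
 ultimately show ?thesis by blast
qed

text \<open>The substitution is \<open>u = s ^ e\<close>. The free factor \<open>e\<close> permits
  one ramification \<open>e * m1 * m2\<close> to serve all pairs of branches.\<close>

lemma kap_contact: assumes f1: "pparam Z1 m1 f1 j1 R1" and f2: "pparam Z2 m2 f2 j2 R2"
  and e: "e > 0" and w: "a ^ (e * m1 * m2) = 1"
 shows "kap (rp f1 (e * m2) 1) (rp f2 (e * m1) 1) a = enat e * contact_mult m1 m2 f1 f2 (a ^ (e * m1))"
proof -
 have t: "a ^ (e * m1) : roots_of_unity m2" using w by (simp add: roots_of_unity_def power_mult)
 obtain r where r: "r > 0" "hol_vec (%u. f1 (u ^ m2) - f2 (a ^ (e * m1) * u ^ m1)) (ball 0 r)"
  using contact_hol_vec[OF f1 f2 t] by blast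
 have "vord (%s. f1 ((1 * s ^ e) ^ m2) - f2 (a ^ (e * m1) * (1 * s ^ e) ^ m1)) = enat e * contact_mult m1 m2 f1 f2 (a ^ (e * m1))"
  unfolding contact_mult_vord by (rule vord_reparam[OF r(2,1) e]) simp
 thus ?thesis by (simp add: kap_def rp_def power_mult[symmetric] power_mult_distrib)
qed

lemma kap_max: assumes f1: "pparam Z1 m1 f1 j1 R1" and f2: "pparam Z2 m2 f2 j2 R2" and e: "e > 0"
 shows "EX a. a ^ (e * m1 * m2) = 1 & kap (rp f1 (e * m2) 1) (rp f2 (e * m1) 1) a = enat e * max_contact m1 m2 f1 f2"
  and "ALL a. a ^ (e * m1 * m2) = 1 --> kap (rp f1 (e * m2) 1) (rp f2 (e * m1) 1) a <= enat e * max_contact m1 m2 f1 f2"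
proof -
 note p1 = pparamD[OF f1] and p2 = pparamD[OF f2]
 obtain t where t: "t : roots_of_unity m2" "contact_mult m1 m2 f1 f2 t = max_contact m1 m2 f1 f2"
  using max_contact_attained(1)[OF p2(6)] by blast
 have "e * m1 > 0" using e p1(6) by simp
 then obtain a :: complex where w: "a ^ (e * m1) = t" by (rule complex_root_exists)
 hence "a ^ (e * m1 * m2) = 1" using t(1) by (simp add: power_mult roots_of_unity_def)
 thus "EX a. a ^ (e * m1 * m2) = 1 & kap (rp f1 (e * m2) 1) (rp f2 (e * m1) 1) a = enat e * max_contact m1 m2 f1 f2"
  using kap_contact[OF f1 f2 e] w t(2) by (intro exI[of _ a]) simp
 show "ALL a. a ^ (e * m1 * m2) = 1 --> kap (rp f1 (e * m2) 1) (rp f2 (e * m1) 1) a <= enat e * max_contact m1 m2 f1 f2"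
 proof (intro allI impI)
  fix a :: complex assume w: "a ^ (e * m1 * m2) = 1"
  hence "a ^ (e * m1) : roots_of_unity m2" by (simp add: roots_of_unity_def power_mult)
  hence "contact_mult m1 m2 f1 f2 (a ^ (e * m1)) <= max_contact m1 m2 f1 f2" using max_contact_attained(2)[OF p2(6)] by blast
  thus "kap (rp f1 (e * m2) 1) (rp f2 (e * m1) 1) a <= enat e * max_contact m1 m2 f1 f2"
   unfolding kap_contact[OF f1 f2 e w] by (rule mult_left_mono) simp
 qed
qed

text \<open>At a common ramification exchanging the branches only inverts the rotation, so the
  maxima over all rotations agree.\<close>

lemma max_contact_sym: assumes f1: "pparam Z1 m1 f1 j1 R1" and f2: "pparam Z2 m2 f2 j2 R2"
 shows "max_contact m1 m2 f1 f2 = max_contact m2 m1 f2 f1"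
proof -
 have le: "max_contact m1 m2 f1 f2 <= max_contact m2 m1 f2 f1" if f1: "pparam Z1 m1 f1 j1 R1" and f2: "pparam Z2 m2 f2 j2 R2"
  for Z1 Z2 m1 m2 j1 j2 R1 R2 and f1 f2 :: "complex => complex ^ 'c"
 proof -
  have p: "m1 > 0" "m2 > 0" "R1 > 0" "R2 > 0" using pparamD[OF f1] pparamD[OF f2] by auto
  have ra: "ram (m2 * m1) (rp f1 m2 1) (min 1 R1)" "ram (m1 * m2) (rp f2 m1 1) (min 1 R2)"
   by (rule rp_ram(1)[OF f1 p(2)], simp, rule rp_ram(1)[OF f2 p(1)], simp)
  define R where "R = min (min 1 R1) (min 1 R2)"
  have R: "R > 0" "R <= min 1 R1" "R <= min 1 R2" using p by (auto simp: R_def)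
  have r: "ram (m1 * m2) (rp f1 m2 1) R" "ram (m1 * m2) (rp f2 m1 1) R"
   using ram_shrink[OF ra(1) R(1,2)] ram_shrink[OF ra(2) R(1,3)] by (simp_all add: mult.commute)
  obtain a where w: "a ^ (m1 * m2) = 1" "kap (rp f1 m2 1) (rp f2 m1 1) a = max_contact m1 m2 f1 f2"
   using kap_max(1)[OF f1 f2, of 1] by (auto simp: one_enat_def[symmetric] simp del: One_nat_def)
  have "(1 / a) ^ (1 * m2 * m1) = 1" using w(1) by (simp add: power_divide mult.commute)
  hence "kap (rp f2 m1 1) (rp f1 m2 1) (1 / a) <= max_contact m2 m1 f2 f1"
   using kap_max(2)[OF f2 f1, of 1] by (auto simp: one_enat_def[symmetric] simp del: One_nat_def)
  thus ?thesis using kap_sym[OF r w(1)] w(2) by simp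
 qed
 show ?thesis by (rule antisym[OF le[OF f1 f2] le[OF f2 f1]])
qed

text \<open>Infinite contact at one rotation identifies the images of two small discs, hence the
  branches.\<close>

lemma max_contact_finite: assumes f1: "pparam Z1 m1 f1 j1 R1" and f2: "pparam Z2 m2 f2 j2 R2" and ne: "~ germ_eq Z1 Z2"
 shows "max_contact m1 m2 f1 f2 ~= \<infinity>"
proof
 assume inf: "max_contact m1 m2 f1 f2 = \<infinity>"
 note p1 = pparamD[OF f1] and p2 = pparamD[OF f2]
 obtain t where t: "t : roots_of_unity m2" "contact_mult m1 m2 f1 f2 t = \<infinity>"
  using max_contact_attained(1)[OF p2(6), of m1 f1 f2] inf by auto
 have n: "norm t = 1" "t ~= 0" using unity_norm[OF t(1) p2(6)] by auto
 obtain r where r: "r > 0" "r <= 1" "hol_vec (%u. f1 (u ^ m2) - f2 (t * u ^ m1)) (ball 0 r)"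
  using contact_hol_vec[OF f1 f2 t(1)] by blast
 have eq: "f1 (u ^ m2) = f2 (t * u ^ m1)" if "u : ball 0 r" for u
  using vord_cases[OF r(3,1)] t(2) that by (auto simp: contact_mult_vord)
 define d where "d = min r (min R1 R2)"
 have d: "0 < d" "d <= r" "d <= R1" "d <= R2" "d <= 1" using r p1(1) p2(1) by (auto simp: d_def)
 have pw: "0 < d ^ m & d ^ m <= d" if "m > 0" for m using power_decreasing[of 1 m d] that d by auto
 have "f1 ` ball 0 (d ^ m2) = f2 ` ball 0 (d ^ m1)"
 proof (intro set_eqI iffI)
  fix z assume "z : f1 ` ball 0 (d ^ m2)"
  then obtain v where v: "norm v < d ^ m2" "z = f1 v" by auto
  obtain u :: complex where u: "u ^ m2 = v" using complex_root_exists[OF p2(6)] by blast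
  have un: "norm u < d" by (rule norm_root_less[OF u v(1) d(1)])
  hence "z = f2 (t * u ^ m1)" using eq[of u] u v(2) d(2) by simp
  moreover have "norm u ^ m1 < d ^ m1" using un p1(6) by (intro power_strict_mono) auto
  ultimately show "z : f2 ` ball 0 (d ^ m1)" using n(1) by (auto simp: norm_mult norm_power)
 next
  fix z assume "z : f2 ` ball 0 (d ^ m1)"
  then obtain v where v: "norm v < d ^ m1" "z = f2 v" by auto
  obtain u :: complex where u: "u ^ m1 = v / t" using complex_root_exists[OF p1(6)] by blast
  have un: "norm u < d" by (rule norm_root_less[OF u _ d(1)]) (use v n in \<open>simp add: norm_divide\<close>)
  hence "z = f1 (u ^ m2)" using eq[of u] u v(2) d(2) n(2) by simp
  moreover have "norm u ^ m2 < d ^ m2" using un p2(6) by (intro power_strict_mono) auto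
  ultimately show "z : f1 ` ball 0 (d ^ m2)" by (auto simp: norm_power)
 qed
 moreover have "germ_eq Z1 (f1 ` ball 0 (d ^ m2))" "germ_eq Z2 (f2 ` ball 0 (d ^ m1))"
  using p1(8) p2(8) pw[OF p1(6)] pw[OF p2(6)] d unfolding branch_param_def by fastforce+
 ultimately have "germ_eq Z1 Z2" using germ_eq_trans[OF _ germ_eq_sym] by metis
 thus False using ne by blast
qed

text \<open>The maximal contact bounds the distance to the whole second branch from below: near a
  rotation an order at most \<open>M\<close> occurs, and away from all rotations the order is
  \<open>N <= M\<close>.\<close>

lemma dist_lower:
 assumes f1: "pparam Z1 m1 f1 j1 R1" and f2: "pparam Z2 m2 f2 j2 R2" and j: "tangent_cone Z1 = tangent_cone Z2 --> j1 = j2"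
  and M: "max_contact m1 m2 f1 f2 = enat M"
 shows "EX a>0. EX C>0. ALL x:ball 0 a. ALL y:ball 0 a. norm x ^ M <= C * norm (f1 (x ^ m2) - f2 y)"
proof -
 note p1 = pparamD[OF f1] and p2 = pparamD[OF f2]
 define N where "N = m1 * m2"
 define F1 where "F1 = rp f1 m2 1"
 define F2 where "F2 = rp f2 m1 1"
 define R where "R = min (min 1 R1) (min 1 R2)"
 have R: "R > 0" "R <= min 1 R1" "R <= min 1 R2" using p1 p2 by (auto simp: R_def)
 have ra: "ram (m2 * m1) F1 (min 1 R1)" "ram (m1 * m2) F2 (min 1 R2)"
  unfolding F1_def F2_def by (rule rp_ram(1)[OF f1 p2(6)], simp, rule rp_ram(1)[OF f2 p1(6)], simp)
 have r: "ram N F1 R" "ram N F2 R"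
  using ram_shrink[OF ra(1) R(1,2)] ram_shrink[OF ra(2) R(1,3)] by (simp_all add: mult.commute N_def)
 have N0: "N > 0" using p1(6) p2(6) by (simp add: N_def)
 have kM: "kap F1 F2 b <= enat M" if "b ^ N = 1" for b using kap_max(2)[OF f1 f2, of 1] that M unfolding F1_def F2_def N_def
  by (auto simp: one_enat_def[symmetric] simp del: One_nat_def)
 have NM: "N <= M" using order_trans[OF kap_ge[OF r, of 1] kM[of 1]] by simp
 have key: "EX a>0. EX C>0. ALL s:ball 0 a. ALL s':ball 0 a. norm s ^ M <= C * norm (F1 s - F2 s')"
 proof (cases "separated N F1 F2")
  case True
  then obtain a C where d: "a > 0" "C > 0" "ALL s:ball 0 a. ALL s':ball 0 a. norm s ^ N + norm s' ^ N <= C * norm (F1 s - F2 s')"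
   unfolding separated_def by blast
  have "norm s ^ M <= C * norm (F1 s - F2 s')" if s: "s : ball 0 (min 1 a)" "s' : ball 0 (min 1 a)" for s s'
  proof -
   have "norm s ^ M <= norm s ^ N" using s NM by (intro power_decreasing) auto
   moreover have "norm s ^ N + norm s' ^ N <= C * norm (F1 s - F2 s')" using d(3) s by auto
   moreover have "0 <= norm s' ^ N" by simp
   ultimately show ?thesis by linarith
  qed
  moreover have "min 1 a > 0" using d by simp
  ultimately show ?thesis using d(2) by blast
 next
  case False
  have "common N F1 F2 | separated N F1 F2" unfolding F1_def F2_def
   by (rule rp_pair[OF f1 f2 j]) (use p1(6) p2(6) in \<open>auto simp: N_def\<close>)
  hence com: "common N F1 F2" using False by blast
  obtain e where e: "nearP N e" using roots_near[OF N0] unfolding nearP_def by blast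
  obtain d2 C2 where 2: "d2 > 0" "C2 > 0" "near_est N e F1 F2 d2 C2" using pair_near[OF r com e] by blast
  obtain d3 C3 where 3: "d3 > 0" "C3 > 0" "far_est N e F1 F2 d3 C3" using pair_far[OF com N0] e unfolding nearP_def by blast
  define d where "d = min 1 (min d2 d3)"
  have "norm s ^ M <= (C2 + C3) * norm (F1 s - F2 s')" if "s : ball 0 d" "s' : ball 0 d" for s s'
  proof -
   have s: "s : ball 0 d2" "s' : ball 0 d2" "s : ball 0 d3" "s' : ball 0 d3" "norm s <= 1" using that by (auto simp: d_def)
   have nn: "0 <= C2 * norm (F1 s - F2 s')" "0 <= C3 * norm (F1 s - F2 s')" using 2 3 by auto
   show ?thesis
   proof (cases "ALL b. b ^ N = 1 --> e * norm s <= norm (s' - b * s)")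
    case True
    have "norm s ^ M <= norm s ^ N" using s NM by (intro power_decreasing) auto
    moreover have "norm s ^ N + norm s' ^ N <= C3 * norm (F1 s - F2 s')" using far_estD[OF 3(3) s(3,4) True] .
    moreover have "0 <= norm s' ^ N" by simp
    ultimately show ?thesis using nn unfolding distrib_right by linarith
   next
    case False
    then obtain b where w: "b ^ N = 1" "norm (s' - b * s) <= e * norm s" by fastforce
    have "norm (s ^ N - s' ^ N) + pw (kap F1 F2 b) (norm s) <= C2 * norm (F1 s - F2 s')" using near_estD(1)[OF 2(3) w(1) s(1,2) w(2)] .
    moreover have "norm s ^ M <= pw (kap F1 F2 b) (norm s)" by (rule pw_antimono[OF _ s(5) kM[OF w(1)]]) simp
    moreover have "0 <= norm (s ^ N - s' ^ N)" by simp
    ultimately show ?thesis using nn unfolding distrib_right by linarith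
   qed
  qed
  moreover have "d > 0" "C2 + C3 > 0" using 2 3 by (auto simp: d_def)
  ultimately show ?thesis by blast
 qed
 then obtain a C where d: "a > 0" "C > 0" "ALL s:ball 0 a. ALL s':ball 0 a. norm s ^ M <= C * norm (F1 s - F2 s')" by blast
 have "norm x ^ M <= C * norm (f1 (x ^ m2) - f2 y)" if xy: "x : ball 0 (min a (a ^ m1))" "y : ball 0 (min a (a ^ m1))" for x y
 proof -
  obtain z :: complex where z: "z ^ m1 = y" using complex_root_exists[OF p1(6)] by blast
  have "norm z < a" by (rule norm_root_less[OF z _ d(1)]) (use xy in simp)
  hence "norm x ^ M <= C * norm (F1 x - F2 z)" using d(3) xy by simp
  thus ?thesis by (simp add: F1_def F2_def rp_def z)
 qed
 moreover have "min a (a ^ m1) > 0" using d by simp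
 ultimately show ?thesis using d(2) by blast
qed

text \<open>If the contact exceeded \<open>M\<close>, points at distance at most of order
  \<open>t ^ Suc M\<close> would be mapped to points at distance at least of order
  \<open>t ^ M\<close> by \<open>dist_lower\<close>. Here \<open>low\<close> keeps the image of the
  first point at a comparable distance from the origin.\<close>

lemma contact_transfer:
 fixes f1 f2 :: "complex => complex ^ 'n" and h1 h2 :: "complex => complex ^ 'm"
 assumes f1: "pparam Z1 m1 f1 j1 R1" and f2: "pparam Z2 m2 f2 j2 R2"
  and h1: "pparam Z1' m1 h1 j1' R1'" and h2: "pparam Z2' m2 h2 j2' R2'" and j: "tangent_cone Z1' = tangent_cone Z2' --> j1' = j2'"
  and ne: "~ germ_eq Z1' Z2'" and r: "r > 0" and g: "isCont g1 0" "g1 0 = 0" "isCont g2 0" "g2 0 = 0"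
  and lip: "ALL u:ball 0 r. ALL v:ball 0 r. norm (h1 (g1 u) - h2 (g2 v)) <= L * norm (f1 u - f2 v)"
  and low: "ALL u:ball 0 r. norm (f1 u) <= L * norm (h1 (g1 u))" and L: "L > 0"
 shows "max_contact m1 m2 f1 f2 <= max_contact m1 m2 h1 h2"
proof (rule ccontr)
 assume no: "~ ?thesis"
 note p1 = pparamD[OF f1] and p2 = pparamD[OF f2] and q1 = pparamD[OF h1]
 obtain M where M: "max_contact m1 m2 h1 h2 = enat M" using max_contact_finite[OF h1 h2 ne] by auto
 obtain b where b: "b : roots_of_unity m2" "contact_mult m1 m2 f1 f2 b = max_contact m1 m2 f1 f2"
  using max_contact_attained(1)[OF p2(6)] by blast
 have n: "norm b = 1" using unity_norm[OF b(1) p2(6)] .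
 have big: "enat (Suc M) <= vord (%u. f1 (u ^ m2) - f2 (b * u ^ m1))"
  unfolding contact_mult_vord[symmetric] b(2) using no M by (simp add: Suc_ile_eq)
 obtain r0 where r0: "r0 > 0" "hol_vec (%u. f1 (u ^ m2) - f2 (b * u ^ m1)) (ball 0 r0)"
  using contact_hol_vec[OF f1 f2 b(1)] by blast
 obtain d1 C1 where 1: "0 < d1" "0 < C1" "ALL u:ball 0 d1. norm (f1 (u ^ m2) - f2 (b * u ^ m1)) <= C1 * norm u ^ Suc M"
  using vord_upper[OF r0(2,1) big] by blast
 obtain d2 C2 where 2: "d2 > 0" "C2 > 0" "ALL x:ball 0 d2. ALL y:ball 0 d2. norm x ^ M <= C2 * norm (h1 (x ^ m2) - h2 y)"
  using dist_lower[OF h1 h2 j M] by blast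
 obtain d3 c3 C3 where 3: "0 < d3" "0 < c3" "ALL u:ball 0 d3. c3 * norm u ^ m1 <= norm (f1 u) & norm (f1 u) <= C3 * norm u ^ m1"
  using vord_bounds[OF p1(2,1,5)] by blast
 obtain d4 C4 where 4: "0 < d4" "0 < C4" "ALL u:ball 0 d4. norm (h1 u) <= C4 * norm u ^ m1"
  using vord_upper[OF q1(2,1), of m1] q1(5) by auto
 define e where "e = min (min d2 (d2 ^ m2)) d4"
 have e: "e > 0" using 2 4 by (simp add: e_def)
 obtain r1 where r1: "r1 > 0" "ALL u. dist u 0 < r1 --> dist (g1 u) (g1 0) < e" using g(1) e unfolding continuous_at_eps_delta by blast
 obtain r2 where r2: "r2 > 0" "ALL u. dist u 0 < r2 --> dist (g2 u) (g2 0) < e" using g(3) e unfolding continuous_at_eps_delta by blast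
 define d where "d = min (min 1 r) (min (min d1 d3) (min r1 r2))"
 have d: "d > 0" using r 1 3 r1 r2 by (simp add: d_def)
 define N where "N = m1 * m2"
 have N: "N > 0" using p1(6) p2(6) by (simp add: N_def)
 define K where "K = L * C4 / c3"
 have K: "K > 0" using L 3 4 by (simp add: K_def)
 define A where "A = C2 * (L * C1)"
 have A: "A > 0" using L 1 2 by (simp add: A_def)
 have "ALL t. 0 < t & t < d --> 1 * t ^ (N * M) <= (K ^ M * A ^ N) * t ^ (Suc M * N)"
 proof (intro allI impI)
  fix t :: real assume t: "0 < t & t < d"
  define u where "u = complex_of_real t ^ m2"
  define v where "v = b * complex_of_real t ^ m1"
  have tp: "t ^ k < d" if "k > 0" for k using power_decreasing[of 1 k t] t that by (simp add: d_def)
  have nu: "norm u = t ^ m2" "norm v = t ^ m1" "norm (complex_of_real t) = t" using t n by (auto simp: u_def v_def norm_mult norm_power)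
  hence uv: "norm u < d" "norm v < d" using tp p1(6) p2(6) by auto
  have w: "norm (g1 u) < e" "norm (g2 v) < e" using r1(2)[rule_format, of u] r2(2)[rule_format, of v] uv g by (auto simp: d_def)
  obtain x :: complex where x: "x ^ m2 = g1 u" using complex_root_exists[OF p2(6)] by blast
  have xd: "norm x < d2" by (rule norm_root_less[OF x _ 2(1)]) (use w(1) in \<open>simp add: e_def\<close>)
  have "norm x ^ M <= C2 * norm (h1 (x ^ m2) - h2 (g2 v))" using 2(3) xd w(2) by (simp add: e_def)
  also have "... <= C2 * (L * norm (f1 u - f2 v))" unfolding x using lip uv 2(2) by (intro mult_left_mono) (auto simp: d_def)
  also have "norm (f1 u - f2 v) <= C1 * t ^ Suc M" using 1(3)[rule_format, of "of_real t"] t unfolding u_def v_def nu(3) by (simp add: d_def)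
  finally have a: "norm x ^ M <= A * t ^ Suc M" using 2(2) L by (simp add: A_def mult.assoc)
  have "c3 * t ^ N <= norm (f1 u)" using 3(3)[rule_format, of u] uv nu(1) by (simp add: d_def N_def power_mult[symmetric] mult.commute)
  also have "... <= L * norm (h1 (g1 u))" using low uv by (simp add: d_def)
  also have "... <= L * (C4 * norm (g1 u) ^ m1)" using 4(3) w(1) L by (intro mult_left_mono) (auto simp: e_def)
  also have "norm (g1 u) ^ m1 = norm x ^ N" unfolding x[symmetric] by (simp add: norm_power N_def power_mult[symmetric] mult.commute)
  finally have "t ^ N <= K * norm x ^ N" using 3(2) by (simp add: K_def field_simps)
  \<comment> \<open>One estimate concerns the \<open>N\<close>-th power of \<open>norm x\<close>,
    the other its \<open>M\<close>-th power; both are raised to the exponent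
    \<open>N * M\<close>.\<close>
  hence "(t ^ N) ^ M <= (K * norm x ^ N) ^ M" using t by (intro power_mono) auto
  also have "... = K ^ M * (norm x ^ M) ^ N" by (simp add: power_mult_distrib power_mult[symmetric] mult.commute)
  also have "... <= K ^ M * (A * t ^ Suc M) ^ N" using a K by (intro mult_left_mono power_mono) auto
  also have "... = (K ^ M * A ^ N) * t ^ (Suc M * N)" by (simp only: power_mult_distrib power_mult mult.assoc)
  finally show "1 * t ^ (N * M) <= (K ^ M * A ^ N) * t ^ (Suc M * N)" by (simp only: power_mult mult_1)
 qed
 hence "Suc M * N <= N * M" by (rule power_dominates[OF d zero_less_one])
 thus False using N by simp
qed

section \<open>From a bi-Lipschitz map to the auxiliary multiplicities\<close>

section \<open>Bi-Lipschitz invariance of the characteristic multiplicities\<close>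

text \<open>Half of \<open>e\<close> is used in the far estimate: a point that is not far then lies
  within \<open>(e/2) * norm s\<close> of a rotation of \<open>s\<close>, and such discs around
  different rotations are disjoint by the second clause.\<close>

definition metricP :: "(complex => complex ^ 'n) => nat => real => real => real => bool" where
 "metricP f m e d C \<longleftrightarrow> nearP m e & (ALL t::complex. t ^ m = 1 & t ~= 1 --> e <= norm (1 - t)) &
  near_est m e f f d C & far_est m (e/2) f f d C & (ALL s:ball 0 d. norm s ^ m <= C * norm (f s) & norm (f s) <= C * norm s ^ m)"

lemma metricP_mono: assumes h: "metricP f m e d C" and d: "d' <= d" "C <= C'" shows "metricP f m e d' C'"
proof -
 have "norm s ^ m <= C' * norm (f s) & norm (f s) <= C' * norm s ^ m" if s: "s : ball 0 d'" for s
 proof -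
  have "s : ball 0 d" using s d(1) by auto
  hence "norm s ^ m <= C * norm (f s)" "norm (f s) <= C * norm s ^ m" using h unfolding metricP_def by blast+
  thus ?thesis using mult_le_mono[OF _ d(2)] by simp
 qed
 moreover have "near_est m e f f d' C'" using h near1_mono[OF _ d] unfolding metricP_def near_est_def by meson
 moreover have "far_est m (e/2) f f d' C'" using h unfolding metricP_def by (elim conjE) (rule far_est_mono[OF _ d])
 ultimately show ?thesis using h unfolding metricP_def by simp
qed

lemma metricPD:
 fixes f :: "complex => complex ^ 'n" and s :: complex assumes P: "metricP f m e d C" and s: "norm s < d"
 shows "norm s ^ m <= C * norm (f s)" "norm (f s) <= C * norm s ^ m"
  "[|t ^ m = 1; norm s' < d; norm (s' - t * s) <= e * norm s|] ==> norm (s ^ m - s' ^ m) + pw (char_mult f t) (norm s) <= C * norm (f s - f s')"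
  "[|t ^ m = 1; norm s' < d; norm (s' - t * s) <= e * norm s|] ==> norm (f s - f s') <= C * (norm (s ^ m - s' ^ m) + pw (char_mult f t) (norm s))"
  "[|norm s' < d; ALL t. t ^ m = 1 --> (e/2) * norm s <= norm (s' - t * s)|] ==> norm s ^ m <= C * norm (f s - f s')"
proof -
 have kc: "kap f f = char_mult f" by (simp add: kap_def char_mult_vord fun_eq_iff)
 note Q = P[unfolded metricP_def]
 show "norm s ^ m <= C * norm (f s)" "norm (f s) <= C * norm s ^ m" using Q s by auto
 show "norm (s ^ m - s' ^ m) + pw (char_mult f t) (norm s) <= C * norm (f s - f s')"
  "norm (f s - f s') <= C * (norm (s ^ m - s' ^ m) + pw (char_mult f t) (norm s))"
  if "t ^ m = 1" "norm s' < d" "norm (s' - t * s) <= e * norm s"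
  using near_estD[of m e f f d C t s s'] Q s that unfolding kc by auto
 show "norm s ^ m <= C * norm (f s - f s')" if "norm s' < d" "ALL t. t ^ m = 1 --> (e/2) * norm s <= norm (s' - t * s)"
  using far_estD[OF _ _ _ that(2), of f f d C] Q s that(1) zero_le_power[of "norm s'" m] by (smt (verit) mem_ball_0 norm_ge_zero)
qed

lemma metricP_exists:
 fixes f :: "complex => complex ^ 'n" assumes f: "pparam Z m f j R" shows "EX e b C. b > 0 & metricP f m e b C"
proof -
 note p = pparamD[OF f]
 obtain e0 where e0: "nearP m e0" using roots_near[OF p(6)] unfolding nearP_def by blast
 obtain d where d: "d > 0" "ALL x:{t::complex. t ^ m = 1}. x ~= 1 --> d <= dist 1 x"
  using finite_set_avoid[OF finite_nth_roots[OF p(6)], of 1] by blast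
 define e where "e = min e0 d"
 have e: "nearP m e" unfolding nearP_def
 proof (intro conjI allI impI)
  fix s s' w :: complex assume a: "w ^ m = 1 & norm (s' - w * s) <= e * norm s"
  have "e * norm s <= e0 * norm s" by (rule mult_right_mono) (auto simp: e_def)
  hence "norm (s' - w * s) <= e0 * norm s" using a by linarith
  thus "norm s ^ m * norm (s' - w * s) <= 2 * norm s * norm (s ^ m - s' ^ m)" using a e0 unfolding nearP_def by blast
 qed (use e0 d in \<open>auto simp: e_def nearP_def\<close>)
 have g: "ALL t::complex. t ^ m = 1 & t ~= 1 --> e <= norm (1 - t)"
 proof (intro allI impI)
  fix t :: complex assume "t ^ m = 1 & t ~= 1"
  hence "d <= norm (1 - t)" using d(2) by (simp add: dist_norm)
  thus "e <= norm (1 - t)" unfolding e_def by linarith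
 qed
 have ram: "ram m f R" using p by (simp add: ram_def)
 have com: "common m f f" unfolding common_def using p(1,7) by blast
 obtain d1 C1 where 1: "d1 > 0" "C1 > 0" "near_est m e f f d1 C1" using pair_near[OF ram ram com e] by blast
 have "e/2 > 0" using e by (simp add: nearP_def)
 from pair_far[OF com p(6) this] obtain d2 C2 where 2: "d2 > 0" "C2 > 0" "far_est m (e/2) f f d2 C2" by (elim exE conjE) (rule that)
 obtain d3 C3 where 3: "d3 > 0" "C3 > 0" "ALL s:ball 0 d3. norm s ^ m <= C3 * norm (f s) & norm (f s) <= C3 * norm s ^ m"
  using vord_pw[OF p(2,1)] unfolding p(5) pw_def enat.simps by blast
 define b where "b = min d1 (min d2 d3)"
 define C where "C = C1 + C2 + C3"
 have C: "C1 <= C" "C2 <= C" "C3 <= C" and le: "b <= d1" "b <= d2" "ball 0 b <= ball (0::complex) d3"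
  using 1(2) 2(2) 3(2) by (auto simp: C_def b_def)
 have "norm s ^ m <= C * norm (f s) & norm (f s) <= C * norm s ^ m" if "s : ball 0 b" for s
  using mult_le_mono[OF _ C(3)] 3(3) that le(3) by (meson norm_ge_zero zero_le_power subsetD)
 hence "metricP f m e b C" unfolding metricP_def
  using g e near1_mono[OF _ le(1) C(1)] far_est_mono[OF 2(3) le(2) C(2)] 1(3) unfolding near_est_def by blast
 moreover have "b > 0" using 1 2 3 by (simp add: b_def)
 ultimately show ?thesis by blast
qed

text \<open>Division by \<open>2 * norm w\<close> moves both points into the unit disc, where the
  \<open>m\<close>-th power has Lipschitz constant \<open>m\<close>.\<close>

lemma power_diff_bound:
 fixes z w :: complex assumes "norm z <= 2 * norm w" "w ~= 0"
 shows "norm w * norm (w ^ m - z ^ m) <= 2 ^ m * real m * (norm w ^ m * norm (z - w))"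
proof -
 define c where "c = 2 * norm w"
 have c: "c > 0" using assms by (simp add: c_def)
 have cc: "norm (complex_of_real c) = c" using c by simp
 define z1 where "z1 = z / of_real c"
 define w1 where "w1 = w / of_real c"
 have zw: "z = of_real c * z1" "w = of_real c * w1" using c by (auto simp: z1_def w1_def)
 have "norm z1 <= 1" "norm w1 <= 1" using assms c by (auto simp: z1_def w1_def norm_divide c_def)
 hence "norm (w1 ^ m - z1 ^ m) <= real m * norm (w1 - z1)" by (intro norm_power_diff) auto
 moreover have "w ^ m - z ^ m = of_real c ^ m * (w1 ^ m - z1 ^ m)" unfolding zw by (simp add: power_mult_distrib algebra_simps)
 hence "norm (w ^ m - z ^ m) = c ^ m * norm (w1 ^ m - z1 ^ m)" by (simp only: norm_mult norm_power cc)
 moreover have "z - w = of_real c * (z1 - w1)" unfolding zw by (simp add: algebra_simps)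
 hence "norm (z - w) = c * norm (w1 - z1)" by (simp only: norm_mult cc norm_minus_commute)
 ultimately have "c * norm (w ^ m - z ^ m) <= c ^ m * (real m * norm (z - w))"
  using mult_left_mono[of "norm (w1 ^ m - z1 ^ m)" "real m * norm (w1 - z1)" "c * c ^ m"] c by (simp add: mult_ac)
 moreover have "0 <= norm w * norm (w ^ m - z ^ m)" by simp
 moreover have "c ^ m * (real m * norm (z - w)) = 2 ^ m * real m * (norm w ^ m * norm (z - w))"
  by (simp add: c_def power_mult_distrib)
 moreover have "c * norm (w ^ m - z ^ m) = 2 * (norm w * norm (w ^ m - z ^ m))" by (simp add: c_def)
 ultimately show ?thesis by linarith
qed

text \<open>
 Two points \<open>E u\<close>, \<open>E (c * u)\<close> at distance \<open>t\<^sup>b\<close>, with \<open>b\<close> the multiplicity of \<open>c\<close>, lie on different local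
 sheets at that scale: a connected piece of the branch through \<open>E u\<close> of size comparable to \<open>t\<^sup>b\<close> does not
 come near \<open>E (c * u)\<close>. This property is preserved by bi-Lipschitz maps, and read off in the other
 parametrization it shows that the sheets there are exchanged by some root of unity \<open>e \<noteq> 1\<close>.
\<close>

lemma char_transfer_scale:
 fixes E :: "complex => complex ^ 'n" and h :: "complex => complex ^ 'm"
 assumes E: "pparam Z m E j R" and h: "pparam Z' m' h j' R'" and r: "r > 0"
  and g: "continuous_on (ball 0 r) g" "g 0 = 0" and k: "continuous_on (ball 0 r) k" "k 0 = 0"
  and kg: "ALL u:ball 0 r. g u : ball 0 r --> k (g u) = u"
  and lg: "ALL u:ball 0 r. ALL v:ball 0 r. norm (h (g u) - h (g v)) <= L * norm (E u - E v)"
  and lk: "ALL u:ball 0 r. ALL v:ball 0 r. norm (E (k u) - E (k v)) <= L * norm (h u - h v)"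
  and c: "c : roots_of_unity m - {1}" and b: "char_mult E c = enat b"
 shows "EX K>=1::real. EX G>0. ALL t. 0 < t & t < G --> (EX e b' H. e : roots_of_unity m' - {1} & char_mult h e = enat b' & 0 < H &
  t ^ m <= K * H ^ m' & H ^ m' <= K * t ^ m & t ^ b <= K * H ^ b' & H ^ b' <= K * t ^ b)"
proof -
 note p = pparamD[OF E] and q = pparamD[OF h]
 have bm: "m < b" using char_mult_finite[OF E c] b by auto
 have cm: "c ^ m = 1" using c by (simp add: roots_of_unity_def)
 have nc: "norm c = 1" using roots_of_unity_norm cm p(6) by blast
 obtain l f1 C1 where 1: "f1 > 0" "metricP E m l f1 C1" using metricP_exists[OF E] by blast
 obtain l' f2 C2 where 2: "f2 > 0" "metricP h m' l' f2 C2" using metricP_exists[OF h] by blast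
 define f where "f = min (min 1 r) (min f1 f2)"
 \<comment> \<open>One constant for everything: the two metric estimates, the Lipschitz constant,
   \<open>power_diff_bound\<close>, and the factor \<open>2 ^ b\<close> from the later bound
   \<open>t / 2 <= norm u2\<close>. The losses of the argument are then powers of \<open>C\<close>,
   up to the seventh.\<close>
 define C where "C = Max {1, C1, C2, L, 2 * (2 ^ m' * real m'), 2 ^ b}"
 have f: "f > 0" "f <= r" "f <= 1" using 1 2 r by (auto simp: f_def)
 have C: "1 <= C" "C1 <= C" "C2 <= C" "L <= C" "2 * (2 ^ m' * real m') <= C" "2 ^ b <= C" unfolding C_def by (rule Max_ge; simp)+
 have C0: "0 <= C" using C(1) by simp
 have P: "metricP E m l f C" "metricP h m' l' f C"
  using metricP_mono[OF 1(2), of f C] metricP_mono[OF 2(2), of f C] C by (auto simp: f_def)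
 have l: "0 < l" "l <= 1/2" "0 < l'" "l' <= 1/2" "nearP m' l'" using P unfolding metricP_def by (auto simp: nearP_def)
 have gap: "l <= norm (1 - c)" if "c ^ m = 1" "c ~= 1" for c :: complex using P(1) that unfolding metricP_def by blast
 have lg': "norm (h (g u) - h (g v)) <= C * norm (E u - E v)" if "norm u < f" "norm v < f" for u v
  using lg[rule_format, of u v] that f mult_right_mono[OF C(4), of "norm (E u - E v)"] by auto
 have lk': "norm (E (k u) - E (k v)) <= C * norm (h u - h v)" if "norm u < f" "norm v < f" for u v
  using lk[rule_format, of u v] that f mult_right_mono[OF C(4), of "norm (h u - h v)"] by auto
 have "isCont k 0" "isCont g 0" using k(1) g(1) r by (auto intro!: continuous_on_interior)
 obtain F0 where F0: "F0 > 0" "ALL u. dist u 0 < F0 --> dist (k u) (k 0) < f"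
  using \<open>isCont k 0\<close> f(1) unfolding continuous_at_eps_delta by blast
 define F where "F = min F0 f"
 have F: "F > 0" "F <= f" "\<And>u. norm u < F ==> norm (k u) < f" using F0 f(1) k(2) by (auto simp: F_def)
 obtain G0 where G0: "G0 > 0" "ALL u. dist u 0 < G0 --> dist (g u) (g 0) < F"
  using \<open>isCont g 0\<close> F(1) unfolding continuous_at_eps_delta by blast
 define G where "G = min (min G0 f) (1 / C ^ 7)"
 have C7: "C ^ 7 > 0" using C(1) by simp
 have G: "G > 0" "G <= f" "\<And>u. norm u < G ==> norm (g u) < F" "G <= 1 / C ^ 7" using G0 f(1) g(2) C7 by (auto simp: G_def)
 have "EX e b' H. e : roots_of_unity m' - {1} & char_mult h e = enat b' & 0 < H &
  t ^ m <= C ^ 7 * H ^ m' & H ^ m' <= C ^ 7 * t ^ m & t ^ b <= C ^ 7 * H ^ b' & H ^ b' <= C ^ 7 * t ^ b" if t: "0 < t" "t < G" for t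
 proof -
  \<comment> \<open>As \<open>b > m\<close>, the choice of \<open>G\<close> gives
    \<open>C ^ 7 * t < 1\<close>: a distance of order \<open>t ^ b\<close> is negligible against
    \<open>t ^ m\<close>.\<close>
  have small: "~ t ^ m <= C ^ i * t ^ b" if "i <= 7" for i
  proof
   assume a: "t ^ m <= C ^ i * t ^ b"
   have t1: "t < 1" using t G(2) f(3) by simp
   have "C ^ i * t ^ b <= C ^ 7 * t ^ Suc m" using C(1) t t1 bm that by (intro mult_mono power_increasing power_decreasing) auto
   also have "... = (C ^ 7 * t) * t ^ m" by simp
   also have "C ^ 7 * t < 1"
   proof -
    have "C ^ 7 * t < C ^ 7 * G" using t(2) C7 by (rule mult_strict_left_mono)
    also have "... <= 1" using G(4) C7 by (simp add: field_simps)
    finally show ?thesis .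
   qed
   hence "(C ^ 7 * t) * t ^ m < 1 * t ^ m" using t(1) by (intro mult_strict_right_mono) auto
   finally show False using a by simp
  qed
  define u where "u = complex_of_real t"
  define u' where "u' = c * u"
  have nu: "norm u = t" "norm u' = t" using t by (auto simp: u_def u'_def norm_mult nc)
  have ud: "norm u < f" "norm u' < f" using nu t G(2) by auto
  have duu: "norm (E u - E u') <= C * t ^ b"
   using metricPD(4)[OF P(1) ud(1) cm ud(2)] l(1) t(1) by (simp add: u'_def power_mult_distrib cm b pw_def nu)
  define w where "w = g u"
  define w' where "w' = g u'"
  have ws: "norm w < F" "norm w' < F" using G(3) nu t by (auto simp: w_def w'_def)
  have wd: "norm w < f" "norm w' < f" using ws F(2) by auto
  have kw: "k w = u" "k w' = u'" using kg ud wd f(2) unfolding w_def w'_def by auto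
  have dww: "norm (h w - h w') <= C ^ 2 * t ^ b"
  proof -
   have "norm (h w - h w') <= C * norm (E u - E u')" unfolding w_def w'_def by (rule lg'[OF ud])
   also have "... <= C * (C * t ^ b)" by (rule mult_left_mono[OF duu C0])
   finally show ?thesis by (simp add: power2_eq_square mult.assoc)
  qed
  have size: "t ^ m <= C ^ 3 * norm y ^ m' & norm y ^ m' <= C ^ 3 * t ^ m"
   if y: "norm y < f" "k y = x" "y = g x" "norm x = t" for x y
  proof
   have xd: "norm x < f" using y(4) t G(2) by simp
   have "norm (E x) <= C * norm (h y)" using lk'[OF y(1), of 0] f(1) y(2) k(2) p(3) q(3) by simp
   from order_trans[OF this mult_left_mono[OF metricPD(2)[OF P(2), OF y(1)] C0]]
   show "t ^ m <= C ^ 3 * norm y ^ m'"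
    using order_trans[OF metricPD(1)[OF P(1), OF xd] mult_left_mono[OF _ C0]] y(4) by (simp add: power3_eq_cube mult.assoc)
   have "norm (h y) <= C * norm (E x)" using lg'[OF xd, of 0] f(1) g(2) p(3) q(3) y(3) by simp
   from order_trans[OF this mult_left_mono[OF metricPD(2)[OF P(1), OF xd] C0]]
   show "norm y ^ m' <= C ^ 3 * t ^ m"
    using order_trans[OF metricPD(1)[OF P(2), OF y(1)] mult_left_mono[OF _ C0]] y(4) by (simp add: power3_eq_cube mult.assoc)
  qed
  have tw: "t ^ m <= C ^ 3 * norm w ^ m'" using size[OF wd(1) kw(1) w_def nu(1)] by blast
  have w0: "w ~= 0"
  proof
   assume "w = 0"
   hence "t ^ m <= 0" using tw q(6) by (simp add: power_0_left)
   thus False using zero_less_power[OF t(1), of m] by linarith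
  qed
  \<comment> \<open>If \<open>w'\<close> were far from all rotations of \<open>w\<close>, the
    distance of \<open>h w\<close> and \<open>h w'\<close> would be at least of order
    \<open>t ^ m\<close>, against \<open>dww\<close>.\<close>
  have "~ (ALL e. e ^ m' = 1 --> (l'/2) * norm w <= norm (w' - e * w))"
  proof
   assume "ALL e. e ^ m' = 1 --> (l'/2) * norm w <= norm (w' - e * w)"
   hence "norm w ^ m' <= C * norm (h w - h w')" by (rule metricPD(5)[OF P(2) wd])
   also have "... <= C * (C ^ 2 * t ^ b)" by (rule mult_left_mono[OF dww C0])
   finally have "C ^ 3 * norm w ^ m' <= C ^ 3 * (C * (C ^ 2 * t ^ b))" using C0 by (intro mult_left_mono) auto
   also have "... = C ^ 6 * t ^ b" by (simp add: power_numeral_reduce)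
   finally show False using tw small[of 6] by simp
  qed
  then obtain e where e: "e ^ m' = 1" "norm (w' - e * w) < (l'/2) * norm w" by fastforce
  have ne: "norm e = 1" using roots_of_unity_norm e(1) q(6) by blast
  hence e0: "e ~= 0" by auto
  have nearw: "norm (w' - e * w) <= l' * norm w"
  proof -
   have "(l'/2) * norm w <= l' * norm w" by (rule mult_right_mono) (use l in auto)
   thus ?thesis using e(2) by linarith
  qed
  \<comment> \<open>\<open>w'\<close> rotated back to the vicinity of \<open>w\<close>. As
    \<open>v\<close> and \<open>w'\<close> have the same \<open>m'\<close>-th power, the distance of
    \<open>h v\<close> and \<open>h w'\<close> is governed by \<open>char_mult h e\<close>
    alone.\<close>
  define v where "v = w' / e"
  have w'v: "w' = e * v" using e0 by (simp add: v_def)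
  have nv: "norm v = norm w'" using ne by (simp add: v_def norm_divide)
  have "w' - e * w = e * (v - w)" by (simp add: w'v algebra_simps)
  hence vw: "norm (v - w) = norm (w' - e * w)" by (simp add: norm_mult ne)
  define D where "D = norm (w ^ m' - w' ^ m')"
  have Db: "D + pw (char_mult h e) (norm w) <= C ^ 3 * t ^ b"
   using metricPD(3)[OF P(2) wd(1) e(1) wd(2) nearw] mult_left_mono[OF dww C0] by (simp add: D_def power3_eq_cube power2_eq_square mult.assoc)
  have D0: "0 <= pw (char_mult h e) (norm w)" by (simp add: pw_nonneg)
  have nvw: "norm w ^ m' * norm (v - w) <= 2 * norm w * D" using l(5) e(1) nearw unfolding nearP_def D_def vw by blast
  \<comment> \<open>The segment stays near \<open>w\<close> itself, that is, near the rotation 1,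
    whose order is infinite; only the difference of the \<open>m'\<close>-th powers contributes, and
    it is bounded by a multiple of \<open>D\<close>.\<close>
  have seg: "norm z < F & norm (h w - h z) <= C ^ 5 * t ^ b" if z: "z : closed_segment w v" for z
  proof
   have "closed_segment w v <= ball 0 F" using ws nv by (intro closed_segment_subset) auto
   thus zs: "norm z < F" using z by auto
   have zw: "norm (z - w) <= norm (v - w)" using segment_bound(1)[OF z] by simp
   hence zw': "norm (z - 1 * w) <= l' * norm w" using nearw vw by simp
   have "norm z <= 2 * norm w" by (rule near_norm_le[OF _ q(6) l(5) zw']) simp
   from power_diff_bound[OF this w0]
   have "norm w * norm (w ^ m' - z ^ m') <= 2 ^ m' * real m' * (norm w ^ m' * norm (z - w))" .
   also have "... <= 2 ^ m' * real m' * (2 * norm w * D)"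
    using order_trans[OF mult_left_mono[OF zw, of "norm w ^ m'"] nvw] by (intro mult_left_mono) auto
   finally have "norm w * norm (w ^ m' - z ^ m') <= norm w * (2 * (2 ^ m' * real m') * D)" by (simp add: mult_ac)
   hence "norm (w ^ m' - z ^ m') <= 2 * (2 ^ m' * real m') * D" using w0 by simp
   also have "... <= C * D" by (rule mult_right_mono[OF C(5)]) (simp add: D_def)
   also have "... <= C * (C ^ 3 * t ^ b)" using Db D0 C0 by (intro mult_left_mono) auto
   finally have d: "norm (w ^ m' - z ^ m') <= C * (C ^ 3 * t ^ b)" .
   have "norm (h w - h z) <= C * (norm (w ^ m' - z ^ m') + pw (char_mult h 1) (norm w))"
    by (rule metricPD(4)[OF P(2) wd(1) _ _ zw']) (use zs F(2) in auto)
   also have "pw (char_mult h 1) (norm w) = 0" by (simp add: char_mult_one[OF h] pw_def)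
   finally have "norm (h w - h z) <= C * (C * (C ^ 3 * t ^ b))" using mult_left_mono[OF d C0] by simp
   thus "norm (h w - h z) <= C ^ 5 * t ^ b" by (simp add: power_numeral_reduce)
  qed
  define S where "S = k ` closed_segment w v"
  have segr: "closed_segment w v <= ball 0 r" using seg F(2) f(2) by fastforce
  have conS: "connected S" unfolding S_def by (intro connected_continuous_image continuous_on_subset[OF k(1) segr]) auto
  define A where "A = ball u ((l/2) * t)"
  define B where "B = (\<Union>c\<in>{c. c ^ m = 1 & c ~= 1}. ball (c * u) ((l/2) * t))"
  \<comment> \<open>Points of \<open>S\<close> have images under \<open>E\<close> at distance of
    order \<open>t ^ b\<close> from \<open>E u\<close>, so they cannot be far from all rotations of
    \<open>u\<close>.\<close>
  have SAB: "S <= A Un B"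
  proof
   fix s assume "s : S"
   then obtain z where z: "z : closed_segment w v" "s = k z" by (auto simp: S_def)
   have zd: "norm z < f" "norm s < f" using seg[OF z(1)] F(2,3) z(2) by auto
   have dus: "norm (E u - E s) <= C * norm (h w - h z)" using lk'[OF wd(1) zd(1)] kw(1) z(2) by simp
   have "~ (ALL c. c ^ m = 1 --> (l/2) * norm u <= norm (s - c * u))"
   proof
    assume "ALL c. c ^ m = 1 --> (l/2) * norm u <= norm (s - c * u)"
    hence "t ^ m <= C * norm (E u - E s)" using metricPD(5)[OF P(1) ud(1) zd(2)] nu by simp
    also have "... <= C * (C * (C ^ 5 * t ^ b))"
     using order_trans[OF dus mult_left_mono[OF conjunct2[OF seg[OF z(1)]] C0]] C0 by (intro mult_left_mono) auto
    also have "... = C ^ 7 * t ^ b" by (simp add: power_numeral_reduce)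
    finally show False using small[of 7] by simp
   qed
   then obtain c' where "c' ^ m = 1" "norm (s - c' * u) < (l/2) * t" using nu(1) by fastforce
   thus "s : A Un B" by (cases "c' = 1") (auto simp: A_def B_def dist_norm norm_minus_commute)
  qed
  have AB: "A Int B = {}"
  proof (rule ccontr)
   assume "A Int B ~= {}"
   then obtain s c' where s: "c' ^ m = 1" "c' ~= 1" "norm (u - s) < (l/2) * t" "norm (c' * u - s) < (l/2) * t"
    by (auto simp: A_def B_def dist_norm)
   have "norm (u - c' * u) <= norm (u - s) + norm (c' * u - s)" using norm_triangle_ineq4[of "u - s" "c' * u - s"] by simp
   also have "... < (l/2) * t + (l/2) * t" by (rule add_strict_mono[OF s(3,4)])
   finally have "norm (u - c' * u) < l * t" by simp
   moreover have "u - c' * u = (1 - c') * u" by (simp add: algebra_simps)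
   hence "norm (u - c' * u) = norm (1 - c') * t" by (simp only: norm_mult nu)
   ultimately show False using mult_right_mono[OF gap[OF s(1,2)], of t] t(1) by linarith
  qed
  have uS: "u : A Int S" unfolding S_def A_def using l(1) t(1) kw(1)[symmetric] by auto
  have oAB: "open A" "open B" by (auto simp: A_def B_def)
  have "B Int S = {}" using connectedD[OF conS oAB] AB SAB uS by blast
  moreover have "k v : S" by (simp add: S_def)
  ultimately have "k v : A" using SAB by blast
  \<comment> \<open>Connectedness keeps \<open>u2\<close> in the disc around \<open>u\<close>. Hence
    \<open>u'\<close> lies near the rotation of \<open>u2\<close> by \<open>c\<close>, and the
    distance of \<open>E u2\<close> and \<open>E u'\<close> is at least of order
    \<open>t ^ b\<close>.\<close>
  define u2 where "u2 = k v"
  have u2: "norm (u - u2) < (l/2) * t" using \<open>k v : A\<close> by (simp add: A_def u2_def dist_norm)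
  have vs: "norm v < F" using seg[of v] by simp
  have u2d: "norm u2 < f" using F(3)[OF vs] by (simp add: u2_def)
  have u2n: "t / 2 <= norm u2"
  proof -
   have "t <= norm u2 + norm (u - u2)" using norm_triangle_sub[of u u2] nu by simp
   moreover have "(l/2) * t <= (1/2) * t" using l t by (intro mult_right_mono) auto
   ultimately show ?thesis using u2 by simp
  qed
  have "u' - c * u2 = c * (u - u2)" by (simp add: u'_def algebra_simps)
  hence "norm (u' - c * u2) = norm (u - u2)" by (simp add: norm_mult nc)
  also have "... <= l * (t / 2)" using u2 by simp
  also have "... <= l * norm u2" by (rule mult_left_mono[OF u2n]) (use l in simp)
  finally have "norm (u2 ^ m - u' ^ m) + pw (char_mult E c) (norm u2) <= C * norm (E u2 - E u')"
   by (rule metricPD(3)[OF P(1) u2d cm ud(2)])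
  hence "norm u2 ^ b <= C * norm (E u2 - E u')" unfolding b pw_def enat.simps using norm_ge_zero[of "u2 ^ m - u' ^ m"] by linarith
  moreover have "(t / 2) ^ b <= norm u2 ^ b" using u2n t by (intro power_mono) auto
  moreover have "norm (E u2 - E u') <= C * norm (h v - h w')" using lk'[of v w'] vs F(2) wd kw(2) by (simp add: u2_def)
  ultimately have "(t / 2) ^ b <= C * (C * norm (h v - h w'))" using mult_left_mono[OF _ C0] by (meson order_trans)
  hence "t ^ b <= 2 ^ b * (C * (C * norm (h v - h w')))" by (simp add: power_divide field_simps)
  also have "... <= C * (C * (C * norm (h v - h w')))" using C0 by (intro mult_right_mono[OF C(6)]) auto
  finally have tb: "t ^ b <= C * (C * (C * norm (h v - h w')))" .
  \<comment> \<open>Otherwise \<open>v = w'\<close>, against the positive lower bound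
    \<open>tb\<close>.\<close>
  have "e ~= 1"
  proof
   assume "e = 1"
   hence "t ^ b <= 0" using tb w'v by simp
   thus False using zero_less_power[OF t(1), of b] by linarith
  qed
  hence e1: "e : roots_of_unity m' - {1}" using e(1) by (simp add: roots_of_unity_def)
  obtain b' where b': "char_mult h e = enat b'" using char_mult_finite[OF h e1] by blast
  have "norm (h v - h w') <= C * (norm (v ^ m' - w' ^ m') + pw (char_mult h e) (norm v))"
   by (rule metricPD(4)[OF P(2) _ e(1)]) (use vs wd F(2) l in \<open>auto simp: w'v\<close>)
  also have "v ^ m' - w' ^ m' = 0" by (simp add: w'v power_mult_distrib e(1))
  finally have "norm (h v - h w') <= C * norm v ^ b'" by (simp add: b' pw_def)
  hence "C * (C * (C * norm (h v - h w'))) <= C * (C * (C * (C * norm v ^ b')))" using C0 by (intro mult_left_mono) auto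
  hence tb2: "t ^ b <= C ^ 4 * norm v ^ b'" using tb by (simp add: power_numeral_reduce)
  have le7: "C ^ i <= C ^ 7" if "i <= 7" for i using C(1) that by (rule power_increasing[rotated])
  have v0: "norm v > 0"
  proof -
   have "norm (h v - h w') ~= 0"
   proof
    assume "norm (h v - h w') = 0"
    thus False using tb zero_less_power[OF t(1), of b] by simp
   qed
   thus ?thesis using w'v by auto
  qed
  have "norm (v ^ m' - w' ^ m') + pw (char_mult h e) (norm v) <= C * norm (h v - h w')"
   by (rule metricPD(3)[OF P(2) _ e(1)]) (use vs wd F(2) l in \<open>auto simp: w'v\<close>)
  hence "norm v ^ b' <= C * norm (h v - h w')" unfolding b' pw_def enat.simps using norm_ge_zero[of "v ^ m' - w' ^ m'"] by linarith
  also have "norm (h v - h w') <= norm (h w - h v) + norm (h w - h w')"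
   using dist_triangle[of "h v" "h w'" "h w"] by (simp add: dist_norm norm_minus_commute)
  also have "... <= C ^ 5 * t ^ b + C ^ 2 * t ^ b" using seg[of v] dww by auto
  also have "... <= C * (C ^ 5 * t ^ b)"
  proof -
   have "C ^ 2 <= C ^ 5" using C(1) by (intro power_increasing) auto
   hence "C ^ 2 * t ^ b <= C ^ 5 * t ^ b" using t by (intro mult_right_mono) auto
   moreover have "(2::real) ^ 1 <= 2 ^ b" using bm by (intro power_increasing) auto
   hence "2 * (C ^ 5 * t ^ b) <= C * (C ^ 5 * t ^ b)" using C(6) C0 t by (intro mult_right_mono) auto
   ultimately show ?thesis by simp
  qed
  finally have "norm v ^ b' <= C * (C * (C ^ 5 * t ^ b))" using C0 by (simp add: mult_left_mono)
  hence tb3: "norm v ^ b' <= C ^ 7 * t ^ b" by (simp add: power_numeral_reduce)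
  have up: "C ^ i * y <= C ^ 7 * y" if "i <= 7" "0 <= y" for i y using le7[OF that(1)] that(2) by (rule mult_right_mono)
  have "t ^ m <= C ^ 7 * norm v ^ m'" "norm v ^ m' <= C ^ 7 * t ^ m" "t ^ b <= C ^ 7 * norm v ^ b'"
  proof -
   have s: "t ^ m <= C ^ 3 * norm v ^ m'" "norm v ^ m' <= C ^ 3 * t ^ m"
    using size[OF wd(2) kw(2) w'_def nu(2)] unfolding nv by blast+
   show "t ^ m <= C ^ 7 * norm v ^ m'" by (rule order_trans[OF s(1) up]) auto
   show "norm v ^ m' <= C ^ 7 * t ^ m" by (rule order_trans[OF s(2) up]) (use t in auto)
   show "t ^ b <= C ^ 7 * norm v ^ b'" by (rule order_trans[OF tb2 up]) auto
  qed
  thus ?thesis using e1 b' v0 tb3 by blast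
 qed
 hence main: "ALL t. 0 < t & t < G --> (EX e b' H. e : roots_of_unity m' - {1} & char_mult h e = enat b' & 0 < H &
  t ^ m <= C ^ 7 * H ^ m' & H ^ m' <= C ^ 7 * t ^ m & t ^ b <= C ^ 7 * H ^ b' & H ^ b' <= C ^ 7 * t ^ b)" by blast
 have K1: "1 <= C ^ 7" using C(1) by (rule one_le_power)
 show ?thesis by (rule exI[of _ "C ^ 7"], rule conjI[OF K1], rule exI[of _ G], rule conjI[OF G(1) main])
qed

text \<open>Eliminating \<open>H\<close> from the two comparisons of the scale lemma makes
  \<open>t ^ (m' * b)\<close> and \<open>t ^ (m * b')\<close> comparable; for small \<open>t\<close>
  the exponents must agree.\<close>

lemma char_transfer:
 fixes f :: "complex => complex ^ 'n" and h :: "complex => complex ^ 'm"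
 assumes f: "pparam Z m f j R" and h: "pparam Z' m' h j' R'" and r: "r > 0"
  and g: "continuous_on (ball 0 r) g" "g 0 = 0" and k: "continuous_on (ball 0 r) k" "k 0 = 0"
  and kg: "ALL u:ball 0 r. g u : ball 0 r --> k (g u) = u"
  and lg: "ALL u:ball 0 r. ALL v:ball 0 r. norm (h (g u) - h (g v)) <= L * norm (f u - f v)"
  and lk: "ALL u:ball 0 r. ALL v:ball 0 r. norm (f (k u) - f (k v)) <= L * norm (h u - h v)" and d: "d : roots_of_unity m - {1}"
 shows "EX c:roots_of_unity m' - {1}. EX b b'. char_mult f d = enat b & char_mult h c = enat b' & m' * b = m * b'"
proof -
 obtain b where b: "char_mult f d = enat b" using char_mult_finite[OF f d] by blast
 obtain K e :: real where K: "K >= 1" "e > 0" "ALL t. 0 < t & t < e --> (EX c b' a. c : roots_of_unity m' - {1} & char_mult h c = enat b' & 0 < a &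
  t ^ m <= K * a ^ m' & a ^ m' <= K * t ^ m & t ^ b <= K * a ^ b' & a ^ b' <= K * t ^ b)"
  using char_transfer_scale[OF f h r g k kg lg lk d b] by (elim exE conjE) (rule that)
 define F where "F = (%c. the_enat (char_mult h c)) ` roots_of_unity m'"
 have F: "finite F" unfolding F_def using finite_unity[OF pparamD(6)[OF h]] by blast
 \<comment> \<open>The order \<open>b'\<close> may vary with \<open>t\<close> but lies in the finite
   set \<open>F\<close>. So one constant is fixed beforehand, and \<open>t\<close> is chosen with
   \<open>E * t < 1\<close>, which lets a single value of \<open>t\<close> decide the
   equality.\<close>
 define E where "E = K ^ (m' + Max F)"
 have E: "E >= 1" unfolding E_def using K(1) by (rule one_le_power)
 define t where "t = min (e / 2) (1 / (2 * E))"
 have t: "0 < t" "t < e" "E * t < 1"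
 proof -
  have "E * t <= E * (1 / (2 * E))" using E by (intro mult_left_mono) (auto simp: t_def)
  thus "E * t < 1" using E by simp
 qed (use K(2) E in \<open>auto simp: t_def\<close>)
 have "1 * t <= E * t" using t by (intro mult_right_mono[OF E]) simp
 hence t1: "t < 1" using t(3) by linarith
 obtain c b' a where w: "c : roots_of_unity m' - {1}" "char_mult h c = enat b'" "0 < a"
  "t ^ m <= K * a ^ m'" "a ^ m' <= K * t ^ m" "t ^ b <= K * a ^ b'" "a ^ b' <= K * t ^ b" using K(3) t by blast
 have "b' : F" unfolding F_def using w by (intro image_eqI[of _ _ c]) auto
 hence "b' <= Max F" using F by simp
 hence KE: "K ^ (m' + b') <= E" unfolding E_def using K(1) by (intro power_increasing) auto
 have K0: "0 <= K" using K(1) by simp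
 have chain: "x ^ p <= K ^ (q + p) * y ^ q" if "x <= K * z" "z ^ p <= (K * y) ^ q" "0 <= x" for x y z :: real and p q
 proof -
  have "x ^ p <= K ^ p * z ^ p" using power_mono[OF that(1,3), of p] by (simp add: power_mult_distrib)
  also have "... <= K ^ p * (K * y) ^ q" using that(2) K0 by (intro mult_left_mono) auto
  finally show ?thesis by (simp add: power_mult_distrib power_add mult_ac)
 qed
 have "(a ^ b') ^ m' <= (K * t ^ m) ^ b'" using power_mono[OF w(5), of b'] w(3) by (simp add: power_mult[symmetric] mult.commute)
 from chain[OF w(6) this] have "(t ^ b) ^ m' <= K ^ (b' + m') * (t ^ m) ^ b'" using t by simp
 also have "... <= E * (t ^ m) ^ b'" using KE t by (intro mult_right_mono) (auto simp: add.commute)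
 finally have 1: "t ^ (m' * b) <= E * t ^ (m * b')" by (simp add: power_mult[symmetric] mult.commute)
 have "(a ^ m') ^ b' <= (K * t ^ b) ^ m'" using power_mono[OF w(7), of m'] w(3) by (simp add: power_mult[symmetric] mult.commute)
 from chain[OF w(4) this] have "(t ^ m) ^ b' <= K ^ (m' + b') * (t ^ b) ^ m'" using t by simp
 also have "... <= E * (t ^ b) ^ m'" using KE t by (intro mult_right_mono) auto
 finally have 2: "t ^ (m * b') <= E * t ^ (m' * b)" by (simp add: power_mult[symmetric] mult.commute)
 have no: "~ i < k" if "t ^ i <= E * t ^ k" for i k
 proof
  assume "i < k"
  hence "t ^ k <= t ^ Suc i" using t t1 by (intro power_decreasing) auto
  hence "t ^ i <= E * t ^ Suc i" using that E mult_left_mono[of "t ^ k" "t ^ Suc i" E] by linarith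
  also have "... = (E * t) * t ^ i" by simp
  also have "... < 1 * t ^ i" using t by (intro mult_strict_right_mono) auto
  finally show False by simp
 qed
 have "m' * b = m * b'" using no[OF 1] no[OF 2] by simp
 thus ?thesis using w(1,2) b by blast
qed

section \<open>Independence of the parametrizations\<close>

text \<open>Germ form of the equivalence, with estimates on balls; the image of the ball under
  \<open>h\<close> is not asked to lie in the ball.\<close>

definition bil :: "(complex ^ 'n) set => (complex ^ 'm) set => (complex ^ 'n => complex ^ 'm) =>
  (complex ^ 'm => complex ^ 'n) => real => real => bool" where
 "bil X Y h k L e \<longleftrightarrow> e > 0 & L > 0 & h 0 = 0 & k 0 = 0 &
  (ALL p:X Int ball 0 e. h p : Y & k (h p) = p & (ALL q:X Int ball 0 e. norm (h p - h q) <= L * norm (p - q))) &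
  (ALL p:Y Int ball 0 e. k p : X & h (k p) = p & (ALL q:Y Int ball 0 e. norm (k p - k q) <= L * norm (p - q)))"

lemma bil_sym: "bil X Y h k L e ==> bil Y X k h L e" unfolding bil_def by blast

lemma bil_id: "bil X X (%p. p) (%p. p) 1 1" unfolding bil_def by auto

lemma bil_continuous: "bil X Y h k L e ==> continuous_on (X Int ball 0 e) h"
 unfolding bil_def by (intro lipschitz_on_continuous_on[of L] lipschitz_onI) (auto simp: dist_norm)

text \<open>The map between branches read in the parameters. Near 0 the images fall into a compact
  part of the second branch, where its parametrization has a continuous inverse.\<close>

lemma lift_exists:
 fixes h :: "complex ^ 'n => complex ^ 'm" assumes f: "branch_param Z f R" and f': "branch_param Z' f' R'" and e: "e > 0"
  and hZ: "ALL p:Z Int ball 0 e. h p : Z'" and cont: "continuous_on (Z Int ball 0 e) h" and h0: "h 0 = 0"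
 shows "EX r g. r > 0 & r <= R & continuous_on (ball 0 r) g & g 0 = 0 &
  (ALL u:ball 0 r. f u : Z Int ball 0 e & g u : ball 0 R' & f' (g u) = h (f u))"
proof -
 have R: "R > 0" "hol_vec f (ball 0 R)" "f 0 = 0" and R': "R' > 0" "f' 0 = 0" "inj_on f' (ball 0 R')"
  using f f' by (auto simp: branch_param_def)
 obtain d1 where d1: "d1 > 0" "ALL z:ball 0 d1. z : Z' \<longleftrightarrow> z : f' ` ball 0 (R'/2)" using branch_near[OF f', of "R'/2"] R'(1) by auto
 obtain d2 where d2: "d2 > 0" "ALL z:ball 0 d2. z : Z \<longleftrightarrow> z : f ` ball 0 R" using branch_near[OF f R(1)] by blast
 have "f 0 : ball 0 (min e d2)" using R(3) e d2(1) by simp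
 from small_preimage_ball[OF R(2,1) open_ball this] obtain r1 where r1: "r1 > 0" "r1 <= R" "f ` ball 0 r1 <= ball 0 (min e d2)"
  by (elim exE conjE) (rule that)
 have fZ: "f u : Z Int ball 0 e" if "u : ball 0 r1" for u
 proof -
  have "f u : ball 0 (min e d2)" using that r1(3) by blast
  moreover have "u : ball 0 R" using that r1(2) by auto
  ultimately show ?thesis using d2(2) by auto
 qed
 have "continuous_on (ball 0 r1) f" using r1(2) by (intro continuous_on_subset[OF hol_vec_continuous[OF R(2)]]) auto
 hence c: "continuous_on (ball 0 r1) (%u. h (f u))" using continuous_on_compose2[OF cont] fZ by (metis image_subsetI)
 hence "isCont (%u. h (f u)) 0" using r1(1) by (auto intro!: continuous_on_interior)
 then obtain r2 where r2: "r2 > 0" "ALL u. dist u 0 < r2 --> dist (h (f u)) (h (f 0)) < d1"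
  using d1(1) unfolding continuous_at_eps_delta by blast
 define r where "r = min r1 r2"
 have r: "r > 0" "r <= R" "ball 0 r <= ball (0::complex) r1" using r1 r2 by (auto simp: r_def)
 have im: "(%u. h (f u)) ` ball 0 r <= f' ` ball 0 (R'/2)"
 proof
  fix y assume "y : (%u. h (f u)) ` ball 0 r"
  then obtain u where u: "u : ball 0 r" "y = h (f u)" by blast
  have "y : Z'" using hZ fZ u r(3) by blast
  moreover have "y : ball 0 d1" using r2(2) u R(3) h0 by (auto simp: r_def)
  ultimately show "y : f' ` ball 0 (R'/2)" using d1(2) by blast
 qed
 have "0 < R'/2" "R'/2 < R'" using R' by auto
 from branch_lift[OF f' this continuous_on_subset[OF c r(3)] im]
 obtain g where g: "continuous_on (ball 0 r) g" "g ` ball 0 r <= ball 0 (R'/2)" "ALL u:ball 0 r. f' (g u) = h (f u)"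
  by (elim exE conjE) (rule that)
 have gR: "g u : ball 0 R'" if "u : ball 0 r" for u using g(2) that R'(1) by fastforce
 have z: "0 : ball (0::complex) r" using r(1) by simp
 have "g 0 = 0" by (rule inj_onD[OF R'(3)]) (use g(3) gR z R(3) h0 R' in auto)
 thus ?thesis using r g gR fZ by (intro exI[of _ r] exI[of _ g]) blast
qed

definition bil2 :: "(complex ^ 'n) set => (complex ^ 'n) set => (complex ^ 'm) set => (complex ^ 'm) set =>
  (complex ^ 'n => complex ^ 'm) => (complex ^ 'm => complex ^ 'n) => real => real => bool" where
 "bil2 Z1 Z2 Z1' Z2' h k L e \<longleftrightarrow> bil (Z1 Un Z2) (Z1' Un Z2') h k L e &
  (ALL p:ball 0 e. (p : Z1 --> h p : Z1') & (p : Z2 --> h p : Z2')) &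
  (ALL p:ball 0 e. (p : Z1' --> k p : Z1) & (p : Z2' --> k p : Z2))"

lemma bil2_sym: "bil2 Z1 Z2 Z1' Z2' h k L e ==> bil2 Z1' Z2' Z1 Z2 k h L e" unfolding bil2_def using bil_sym by blast

lemma bil2_id: "bil2 Z1 Z2 Z1 Z2 (%p. p) (%p. p) 1 1" unfolding bil2_def using bil_id by blast

lemma bil2_single: "bil2 Z1 Z2 Z1' Z2' h k L e ==> bil Z1 Z1' h k L e" unfolding bil2_def bil_def by blast

lemma char_equation:
 fixes f :: "complex => complex ^ 'n" and f' :: "complex => complex ^ 'm"
 assumes f: "pparam Z m f j R" and f': "pparam Z' m' f' j' R'" and b: "bil Z Z' h k L e" and t: "t : roots_of_unity m - {1}"
 shows "EX w:roots_of_unity m' - {1}. EX b b'. char_mult f t = enat b & char_mult f' w = enat b' & m' * b = m * b'"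
proof -
 note p = pparamD[OF f] and q = pparamD[OF f']
 note B = b[unfolded bil_def]
 have e: "e > 0" "h 0 = 0" "k 0 = 0" using B by auto
 have hZ: "ALL p:Z Int ball 0 e. h p : Z'" "ALL p:Z' Int ball 0 e. k p : Z" using B by blast+
 obtain r g where g: "r > 0" "r <= R" "continuous_on (ball 0 r) g" "g 0 = 0"
  "ALL u:ball 0 r. f u : Z Int ball 0 e & g u : ball 0 R' & f' (g u) = h (f u)"
  using lift_exists[OF p(8) q(8) e(1) hZ(1) bil_continuous[OF b] e(2)] by (elim exE conjE) (rule that)
 obtain r' g' where g': "r' > 0" "r' <= R'" "continuous_on (ball 0 r') g'" "g' 0 = 0"
  "ALL u:ball 0 r'. f' u : Z' Int ball 0 e & g' u : ball 0 R & f (g' u) = k (f' u)"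
  using lift_exists[OF q(8) p(8) e(1) hZ(2) bil_continuous[OF bil_sym[OF b]] e(3)] by (elim exE conjE) (rule that)
 define d where "d = min r r'"
 have d: "d > 0" "d <= R" "ball 0 d <= ball (0::complex) r" "ball 0 d <= ball (0::complex) r'" using g g' by (auto simp: d_def)
 have gd: "f u : Z Int ball 0 e" "f' (g u) = h (f u)" if "u : ball 0 d" for u using g(5) that d(3) by blast+
 have gd': "f' u : Z' Int ball 0 e" "f (g' u) = k (f' u)" "g' u : ball 0 R" if "u : ball 0 d" for u using g'(5) that d(4) by blast+
 show ?thesis
 proof (rule char_transfer[OF f f' d(1) continuous_on_subset[OF g(3) d(3)] g(4) continuous_on_subset[OF g'(3) d(4)] g'(4) _ _ _ t])
  show "ALL u:ball 0 d. g u : ball 0 d --> g' (g u) = u"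
  proof (intro ballI impI)
   fix u assume u: "u : ball 0 d" "g u : ball 0 d"
   have "f (g' (g u)) = f u" using gd[OF u(1)] gd'(2)[OF u(2)] B by metis
   thus "g' (g u) = u" using inj_onD[OF p(4)] gd'(3)[OF u(2)] u(1) d(2) by force
  qed
  show "ALL u:ball 0 d. ALL v:ball 0 d. norm (f' (g u) - f' (g v)) <= L * norm (f u - f v)" using gd B by metis
  show "ALL u:ball 0 d. ALL v:ball 0 d. norm (f (g' u) - f (g' v)) <= L * norm (f' u - f' v)" using gd' B by metis
 qed
qed

text \<open>The proportions \<open>m' * b = m * b'\<close> give divisibility of the multiplicities
  in both directions by \<open>multiplicity_dvd\<close>. With \<open>m = m'\<close> they turn into
  equality of the sets of orders, and the set determines the order of each root of unity.\<close>

lemma char_invariant: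
 fixes f :: "complex => complex ^ 'n" and f' :: "complex => complex ^ 'm"
 assumes f: "pparam Z m f j R" and f': "pparam Z' m' f' j' R'" and b: "bil Z Z' h k L e"
 shows "m = m'" "ALL t:roots_of_unity m. char_mult f t = char_mult f' t"
proof -
 have dvd: "a dvd a'" if g: "pparam W a g i S" and g': "pparam W' a' g' i' S'" and b: "bil W W' h k L e"
  for W W' a a' i i' S S' h k L e and g :: "complex => complex ^ 'c" and g' :: "complex => complex ^ 'd"
  by (rule multiplicity_dvd[OF g]) (use char_equation[OF g g' b] in force)
 show m: "m = m'" by (rule dvd_antisym[OF dvd[OF f f' b] dvd[OF f' f bil_sym[OF b]]])
 have sub: "char_mult g ` (roots_of_unity m - {1}) <= char_mult g' ` (roots_of_unity m - {1})"
  if g: "pparam W m g i S" and g': "pparam W' m g' i' S'" and b: "bil W W' h k L e"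
  for W W' i i' S S' h k L e and g :: "complex => complex ^ 'c" and g' :: "complex => complex ^ 'd"
 proof
  fix x assume "x : char_mult g ` (roots_of_unity m - {1})"
  then obtain t where t: "t : roots_of_unity m - {1}" "x = char_mult g t" by blast
  from char_equation[OF g g' b t(1)] obtain w b b' where "w : roots_of_unity m - {1}" "char_mult g t = enat b"
   "char_mult g' w = enat b'" "m * b = m * b'" by blast
  thus "x : char_mult g' ` (roots_of_unity m - {1})" using t(2) pparamD(6)[OF g] by (metis image_eqI mult_left_cancel less_not_refl)
 qed
 have f2: "pparam Z' m f' j' R'" using f' m by simp
 have "char_mult f ` (roots_of_unity m - {1}) = char_mult f' ` (roots_of_unity m - {1})"
  using sub[OF f f2 b] sub[OF f2 f bil_sym[OF b]] by blast
 thus "ALL t:roots_of_unity m. char_mult f t = char_mult f' t" using char_mult_determined[OF f f2] by blast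
qed

lemma contact_le:
 fixes f1 f2 :: "complex => complex ^ 'n" and g1 g2 :: "complex => complex ^ 'm"
 assumes f: "pparam Z1 m1 f1 i1 R1" "pparam Z2 m2 f2 i2 R2" and g: "pparam Z1' m1 g1 j1 S1" "pparam Z2' m2 g2 j2 S2"
  and j: "tangent_cone Z1' = tangent_cone Z2' --> j1 = j2" and ne: "~ germ_eq Z1' Z2'" and b: "bil2 Z1 Z2 Z1' Z2' h k L e"
 shows "max_contact m1 m2 f1 f2 <= max_contact m1 m2 g1 g2"
proof -
 note p1 = pparamD[OF f(1)] and p2 = pparamD[OF f(2)] and q1 = pparamD[OF g(1)] and q2 = pparamD[OF g(2)]
 have bb: "bil (Z1 Un Z2) (Z1' Un Z2') h k L e" using b by (simp add: bil2_def)
 note B = bb[unfolded bil_def]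
 have e: "e > 0" "h 0 = 0" "k 0 = 0" "L > 0" using B by auto
 have hZ: "ALL p:Z1 Int ball 0 e. h p : Z1'" "ALL p:Z2 Int ball 0 e. h p : Z2'" using b unfolding bil2_def by blast+
 have c: "continuous_on (Z1 Int ball 0 e) h" "continuous_on (Z2 Int ball 0 e) h"
  by (rule continuous_on_subset[OF bil_continuous[OF bb]], blast)+
 obtain r1 k1 where 1: "r1 > 0" "r1 <= R1" "continuous_on (ball 0 r1) k1" "k1 0 = 0"
  "ALL u:ball 0 r1. f1 u : Z1 Int ball 0 e & k1 u : ball 0 S1 & g1 (k1 u) = h (f1 u)"
  using lift_exists[OF p1(8) q1(8) e(1) hZ(1) c(1) e(2)] by (elim exE conjE) (rule that)
 obtain r2 k2 where 2: "r2 > 0" "r2 <= R2" "continuous_on (ball 0 r2) k2" "k2 0 = 0"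
  "ALL u:ball 0 r2. f2 u : Z2 Int ball 0 e & k2 u : ball 0 S2 & g2 (k2 u) = h (f2 u)"
  using lift_exists[OF p2(8) q2(8) e(1) hZ(2) c(2) e(2)] by (elim exE conjE) (rule that)
 define r where "r = min r1 r2"
 obtain r3 where r3: "r3 > 0" "r3 <= r1" "(%u. h (f1 u)) ` ball 0 r3 <= ball 0 e"
 proof -
  have "continuous_on (ball 0 r1) (%u. h (f1 u))"
   using continuous_on_compose2[OF c(1) continuous_on_subset[OF hol_vec_continuous[OF p1(2)]], of "ball 0 r1"] 1(2,5) by force
  hence "isCont (%u. h (f1 u)) 0" using 1(1) by (auto intro!: continuous_on_interior)
  then obtain d where d: "d > 0" "ALL u. dist u 0 < d --> dist (h (f1 u)) (h (f1 0)) < e"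
   using e(1) unfolding continuous_at_eps_delta by blast
  show ?thesis by (rule that[of "min d r1"]) (use d 1(1) e p1(3) in auto)
 qed
 define r where "r = min r3 r2"
 have r: "r > 0" "ball 0 r <= ball (0::complex) r1" "ball 0 r <= ball (0::complex) r2" "ball 0 r <= ball (0::complex) r3"
  using 1(1) 2(1) r3 by (auto simp: r_def)
 have cont: "isCont k1 0" "isCont k2 0" using 1(1,3) 2(1,3) by (auto intro!: continuous_on_interior)
 have lip: "ALL u:ball 0 r. ALL v:ball 0 r. norm (g1 (k1 u) - g2 (k2 v)) <= L * norm (f1 u - f2 v)"
 proof (intro ballI)
  fix u v :: complex assume uv: "u : ball 0 r" "v : ball 0 r"
  have "f1 u : Z1 Int ball 0 e" "g1 (k1 u) = h (f1 u)" "f2 v : Z2 Int ball 0 e" "g2 (k2 v) = h (f2 v)" using 1(5) 2(5) uv r by blast+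
  thus "norm (g1 (k1 u) - g2 (k2 v)) <= L * norm (f1 u - f2 v)" using B by simp
 qed
 have low: "ALL u:ball 0 r. norm (f1 u) <= L * norm (g1 (k1 u))"
 proof
  fix u :: complex assume u: "u : ball 0 r"
  have f: "f1 u : Z1 Int ball 0 e" "g1 (k1 u) = h (f1 u)" using 1(5) u r by blast+
  have he: "h (f1 u) : ball 0 e" using r3(3) u r(4) by blast
  have z: "0 : Z1 Int ball 0 e" using bspec[OF 1(5), of 0] 1(1) p1(3) by simp
  have z': "0 : Z1' Int ball 0 e" "h (f1 u) : Z1' Int ball 0 e" using hZ(1) z e he f(1) by force+
  hence "norm (k (h (f1 u)) - k 0) <= L * norm (h (f1 u) - 0)" using B by blast
  moreover have "k (h (f1 u)) = f1 u" using B f(1) by blast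
  ultimately show "norm (f1 u) <= L * norm (g1 (k1 u))" using e f(2) by simp
 qed
 show ?thesis by (rule contact_transfer[OF f g j ne r(1) cont(1) 1(4) cont(2) 2(4) lip low e(4)])
qed

section \<open>Intrinsic form of the auxiliary multiplicities\<close>

text \<open>A coordinate chosen from the tangent cone alone: tangent branches automatically receive
  the same special coordinate, so the parametrizations \<open>ap\<close> are compatible.\<close>

definition spc :: "(complex ^ 'n) set => 'n" where
 "spc T = (SOME j. EX v:T. v $ j ~= 0)"

abbreviation tj :: "(complex ^ 'n) set => 'n" where
 "tj Z \<equiv> spc (tangent_cone Z)"

definition ap :: "(complex ^ 'n) set => complex => complex ^ 'n" where
 "ap Z = (SOME f. EX R. pparam Z (mlt Z) f (tj Z) R)"

abbreviation brn :: "(complex ^ 'n) set => bool" where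
 "brn Z \<equiv> pparam Z (mlt Z) (ap Z) (tj Z) (SOME R. pparam Z (mlt Z) (ap Z) (tj Z) R)"

definition chr :: "(complex ^ 'n) set => complex => enat" where
 "chr Z = char_mult (ap Z)"

definition con :: "(complex ^ 'n) set => (complex ^ 'n) set => enat" where
 "con Z1 Z2 = max_contact (mlt Z1) (mlt Z2) (ap Z1) (ap Z2)"

lemma ap_pparam:
 fixes Z :: "(complex ^ 'n) set" assumes Z: "branch_param Z f R" shows "brn Z"
proof -
 obtain g j S where g: "pparam Z (mlt Z) g j S" using pparam_exists'[OF Z] by (elim exE) (rule that)
 note p = pparamD[OF g]
 obtain G where G: "hol_vec G (ball 0 S)" "ALL u:ball 0 S. g u = u ^ mlt Z *s G u" "G 0 $ j = 1" using pparam_leading[OF g] by blast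
 have tc: "tangent_cone Z = range (%c. c *s G 0)" by (rule tangent_cone_eq[OF g G])
 define i where "i = tj Z"
 have "G 0 = 1 *s G 0" by simp
 hence "G 0 : tangent_cone Z" unfolding tc by (rule range_eqI)
 hence "EX j. EX v:tangent_cone Z. v $ j ~= 0" using G(3) by (metis one_neq_zero)
 hence "EX v:tangent_cone Z. v $ i ~= 0" unfolding i_def spc_def by (rule someI_ex)
 hence Gi: "G 0 $ i ~= 0" unfolding tc by auto
 have "ord0 (%u. g u $ i) = enat (mlt Z)"
  by (rule ord0_factor[of "%u. G u $ i" S]) (use G(1,2) p(1) Gi in \<open>auto simp: hol_vec_def\<close>)
 from pparam_exists[OF p(8) this] have "EX f R. pparam Z (mlt Z) f i R" .
 hence "EX R. pparam Z (mlt Z) (ap Z) (tj Z) R" unfolding ap_def i_def by (rule someI_ex)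
 thus ?thesis by (rule someI_ex)
qed

text \<open>Two choices of parametrizations are compared by applying the bi-Lipschitz inequality for
  contacts to the identity map, in both directions.\<close>

lemma con_eq: assumes f: "pparam Z1 m1 f1 j1 R1" "pparam Z2 m2 f2 j2 R2" and j: "tangent_cone Z1 = tangent_cone Z2 --> j1 = j2"
  and ne: "~ germ_eq Z1 Z2" shows "max_contact m1 m2 f1 f2 = con Z1 Z2"
proof -
 note m = pparam_puiseux(1)[OF f(1)] pparam_puiseux(1)[OF f(2)]
 note g1 = ap_pparam[OF pparamD(8)[OF f(1)], unfolded m] and g2 = ap_pparam[OF pparamD(8)[OF f(2)], unfolded m]
 show ?thesis unfolding con_def m
  by (rule antisym[OF contact_le[OF f g1 g2 _ ne bil2_id] contact_le[OF g1 g2 f j ne bil2_id]]) simp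
qed

lemma chr_eq: "pparam Z m f j R ==> ALL t:roots_of_unity m. char_mult f t = chr Z t"
 using ap_pparam[OF pparamD(8)] char_invariant(2)[OF _ _ bil_id] unfolding chr_def by blast

lemma ChAM_chr: assumes Z: "brn Z" shows "ChAM Z = {enat (mlt Z)} Un chr Z ` (roots_of_unity (mlt Z) - {1})"
proof -
 define g where "g = (SOME f. puiseux_param Z f)"
 have "puiseux_param Z g" unfolding g_def using pparam_puiseux(3)[OF Z] by (metis someI_ex)
 then obtain j R' where "pparam Z (mlt Z) g j R'"
  using puiseux_param_pparam[OF pparamD(8)[OF Z]] unfolding puiseux_param_def by blast
 from chr_eq[OF this] have "char_mult g ` (roots_of_unity (mlt Z) - {1}) = chr Z ` (roots_of_unity (mlt Z) - {1})"
  by (intro image_cong) auto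
 thus ?thesis by (simp add: ChAM_def Let_def g_def)
qed

text \<open>Whatever compatible pair the choice operator returns, its special coordinates agree for
  tangent branches, which is the condition under which \<open>con_eq\<close> identifies the maximal
  contact.\<close>

lemma CoAM_ordered_con: assumes Z: "brn Z1" "brn Z2" and ne: "~ germ_eq Z1 Z2"
 shows "CoAM_ordered Z1 Z2 = sorted_list_of_multiset (image_mset (%t. min (con Z1 Z2) (enat (mlt Z1) * chr Z2 t))
  (mset_set (roots_of_unity (mlt Z2))))"
proof -
 define q where "q = (SOME (g1, g2). compatible_params Z1 Z2 g1 g2)"
 obtain g1 g2 where g: "q = (g1, g2)" by fastforce
 note b = pparamD(8)[OF Z(1)] pparamD(8)[OF Z(2)]
 have "compatible_params Z1 Z2 (ap Z1) (ap Z2)" unfolding compatible_params_def tangent_branches_def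
  using pparam_puiseux(3,4)[OF Z(1)] pparam_puiseux(3,4)[OF Z(2)] by metis
 hence "EX p. case p of (g1, g2) => compatible_params Z1 Z2 g1 g2" by (intro exI[of _ "(ap Z1, ap Z2)"]) simp
 hence "case q of (g1, g2) => compatible_params Z1 Z2 g1 g2" unfolding q_def by (rule someI_ex)
 hence c: "compatible_params Z1 Z2 g1 g2" by (simp add: g)
 have "EX j1 j2. special_coordinate Z1 g1 j1 & special_coordinate Z2 g2 j2 & (tangent_cone Z1 = tangent_cone Z2 --> j1 = j2)"
  using c unfolding compatible_params_def puiseux_param_def tangent_branches_def by metis
 then obtain j1 j2 where j: "special_coordinate Z1 g1 j1" "special_coordinate Z2 g2 j2" "tangent_cone Z1 = tangent_cone Z2 --> j1 = j2" by blast
 obtain T1 where p1: "pparam Z1 (mlt Z1) g1 j1 T1" using puiseux_param_pparam[OF b(1) _ j(1)] c unfolding compatible_params_def by blast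
 obtain T2 where p2: "pparam Z2 (mlt Z2) g2 j2 T2" using puiseux_param_pparam[OF b(2) _ j(2)] c unfolding compatible_params_def by blast
 have "image_mset (contact_mult (mlt Z1) (mlt Z2) g1 g2) (mset_set (roots_of_unity (mlt Z2))) =
  image_mset (%t. min (con Z1 Z2) (enat (mlt Z1) * chr Z2 t)) (mset_set (roots_of_unity (mlt Z2)))"
  unfolding contact_mset[OF p1 p2] con_eq[OF p1 p2 j(3) ne]
  by (rule image_mset_cong) (use chr_eq[OF p2] finite_unity[OF pparamD(6)[OF p2]] in auto)
 thus ?thesis unfolding CoAM_ordered_def Let_def q_def[symmetric] g by simp
qed

lemma chr_one: "brn Z ==> chr Z 1 = \<infinity>" using char_mult_one unfolding chr_def by blast

lemma con_sym: assumes "brn Z1" "brn Z2" shows "con Z1 Z2 = con Z2 Z1" using max_contact_sym[OF assms] unfolding con_def .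

text \<open>At the rotation 1 the self-contact is infinite, so the maximal contact itself occurs in
  the sequence and can be recovered from it.\<close>

lemma con_Max: assumes Z: "brn Z1" "brn Z2" and ne: "~ germ_eq Z1 Z2" shows "con Z1 Z2 = Max (set (CoAM_ordered Z1 Z2))"
proof -
 have m: "mlt Z1 > 0" "mlt Z2 > 0" using pparamD(6) Z by blast+
 have fin: "finite (roots_of_unity (mlt Z2))" by (rule finite_unity[OF m(2)])
 have s: "set (CoAM_ordered Z1 Z2) = (%t. min (con Z1 Z2) (enat (mlt Z1) * chr Z2 t)) ` roots_of_unity (mlt Z2)"
  unfolding CoAM_ordered_con[OF assms] using fin by simp
 have "enat (mlt Z1) * chr Z2 1 = \<infinity>" using chr_one[OF Z(2)] m(1) by (simp add: imult_is_infinity)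
 hence "con Z1 Z2 : set (CoAM_ordered Z1 Z2)" unfolding s by (intro image_eqI[of _ _ 1]) (auto simp: roots_of_unity_def)
 thus ?thesis by (intro Max_eqI[symmetric]) (auto simp: s fin)
qed

text \<open>The sets and sequences carry the same information as the multiplicities, the
  self-contacts \<open>chr\<close> and the maximal contacts \<open>con\<close>. Once multiplicities
  agree, both sides order each pair of branches alike, or the symmetry of \<open>con\<close>
  compensates.\<close>

lemma preserves_iff:
 fixes XB :: "nat => (complex ^ 'n) set" and YB :: "nat => (complex ^ 'm) set" assumes B: "ALL i:{1..r}. brn (XB i) & brn (YB (s i))"
  and N: "ALL i:{1..r}. ALL j:{1..r}. i ~= j --> ~ germ_eq (XB i) (XB j) & ~ germ_eq (YB (s i)) (YB (s j))"
 shows "preserves_auxiliary_multiplicities r XB YB s \<longleftrightarrow>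
  (ALL i:{1..r}. mlt (YB (s i)) = mlt (XB i) &
   (ALL t:roots_of_unity (mlt (XB i)). chr (XB i) t = chr (YB (s i)) t)) &
  (ALL i:{1..r}. ALL j:{1..r}. i ~= j --> con (XB i) (XB j) = con (YB (s i)) (YB (s j)))" (is "?P \<longleftrightarrow> ?M & ?C")
proof
 have b: "brn (XB i)" "brn (YB (s i))" if "i : {1..r}" for i using B that by blast+
 assume P: ?P
 have M: ?M
 proof
  fix i assume i: "i : {1..r}"
  define A where "A = chr (XB i) ` (roots_of_unity (mlt (XB i)) - {1})"
  define A' where "A' = chr (YB (s i)) ` (roots_of_unity (mlt (YB (s i))) - {1})"
  note g = b[OF i] and sg = b[OF i, THEN pparamD(8), THEN smooth_germ_iff]
  \<comment> \<open>The multiplicity is the strict minimum of \<open>ChAM\<close> and so is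
    recovered from the set. For smooth branches it is 1, and no root of unity other than 1
    remains.\<close>
  have gt: "ALL x:A. enat (mlt (XB i)) < x" "ALL x:A'. enat (mlt (YB (s i))) < x"
   using char_mult_finite[OF g(1)] char_mult_finite[OF g(2)] unfolding A_def A'_def chr_def by fastforce+
  have sm: "smooth_germ (XB i) \<longleftrightarrow> smooth_germ (YB (s i))" using P i by (simp add: preserves_auxiliary_multiplicities_def)
  have "mlt (YB (s i)) = mlt (XB i) & A = A'"
  proof (cases "smooth_germ (XB i)")
   case True
   thus ?thesis using sm sg by (simp add: roots_of_unity_def A_def A'_def)
  next
   case False
   hence "ChAM (XB i) = ChAM (YB (s i))" using P i by (simp add: preserves_auxiliary_multiplicities_def singular_indices_def)
   hence eq: "insert (enat (mlt (XB i))) A = insert (enat (mlt (YB (s i)))) A'"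
    unfolding ChAM_chr[OF g(1)] ChAM_chr[OF g(2)] A_def A'_def by simp
   hence m: "mlt (XB i) = mlt (YB (s i))" using gt by (metis enat.inject insert_iff less_asym)
   moreover have "enat (mlt (XB i)) ~: A" "enat (mlt (XB i)) ~: A'" using gt m by force+
   ultimately show ?thesis using eq by (metis insert_ident)
  qed
  thus "mlt (YB (s i)) = mlt (XB i) & (ALL t:roots_of_unity (mlt (XB i)). chr (XB i) t = chr (YB (s i)) t)"
   using char_mult_determined[OF g(1)] g(2) unfolding chr_def A_def A'_def by metis
 qed
 have key: "con (XB i) (XB j) = con (YB (s i)) (YB (s j))" if ij: "i : {1..r}" "j : {1..r}" "i < j" for i j
 proof -
  note f = b(1)[OF ij(1)] b(1)[OF ij(2)] and g = b(2)[OF ij(1)] b(2)[OF ij(2)]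
  have ne: "~ germ_eq (XB i) (XB j)" "~ germ_eq (XB j) (XB i)" "~ germ_eq (YB (s i)) (YB (s j))" "~ germ_eq (YB (s j)) (YB (s i))"
   using N ij by auto
  have "(i, j) : tangent_pairs r XB Un nontangent_pairs r XB" using ij by (auto simp: tangent_pairs_def nontangent_pairs_def)
  hence co: "CoAM (XB i) (XB j) = CoAM (YB (s i)) (YB (s j))" using P unfolding preserves_auxiliary_multiplicities_def by blast
  have m: "mlt (XB i) = mlt (YB (s i))" "mlt (XB j) = mlt (YB (s j))" using M ij by auto
  show ?thesis using co con_Max[OF f ne(1)] con_Max[OF f(2,1) ne(2)] con_Max[OF g ne(3)] con_Max[OF g(2,1) ne(4)] con_sym[OF f] con_sym[OF g] m
   unfolding CoAM_def by (auto split: if_splits)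
 qed
 have ?C
 proof (intro ballI impI)
  fix i j assume ij: "i : {1..r}" "j : {1..r}" "i ~= j"
  show "con (XB i) (XB j) = con (YB (s i)) (YB (s j))"
   using key[of i j] key[of j i] ij con_sym[OF b(1)[OF ij(1)] b(1)[OF ij(2)]] con_sym[OF b(2)[OF ij(1)] b(2)[OF ij(2)]] by (cases "i < j") auto
 qed
 thus "?M & ?C" using M by blast
next
 have b: "brn (XB i)" "brn (YB (s i))" if "i : {1..r}" for i using B that by blast+
 assume MC: "?M & ?C"
 have "smooth_germ (XB i) \<longleftrightarrow> smooth_germ (YB (s i))" if i: "i : {1..r}" for i
  using MC i b[OF i, THEN pparamD(8), THEN smooth_germ_iff] by simp
 moreover have "ChAM (XB i) = ChAM (YB (s i))" if i: "i : {1..r}" for i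
  using MC i image_cong[OF refl, of "roots_of_unity (mlt (XB i)) - {1}" "chr (XB i)" "chr (YB (s i))"]
  unfolding ChAM_chr[OF b(1)[OF i]] ChAM_chr[OF b(2)[OF i]] by simp
 moreover have "CoAM (XB i) (XB j) = CoAM (YB (s i)) (YB (s j))" if ij: "i : {1..r}" "j : {1..r}" "i < j" for i j
 proof -
  have co: "CoAM_ordered (XB a) (XB b) = CoAM_ordered (YB (s a)) (YB (s b))" if ab: "a : {1..r}" "b : {1..r}" "a ~= b" for a b
  proof -
   note f = b[OF ab(1)] b[OF ab(2)]
   have ne: "~ germ_eq (XB a) (XB b)" "~ germ_eq (YB (s a)) (YB (s b))" using N ab by auto
   have m: "mlt (YB (s a)) = mlt (XB a)" "mlt (YB (s b)) = mlt (XB b)"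
    "con (YB (s a)) (YB (s b)) = con (XB a) (XB b)" using MC ab by auto
   have "image_mset (%t. min (con (XB a) (XB b)) (enat (mlt (XB a)) * chr (XB b) t)) (mset_set (roots_of_unity (mlt (XB b)))) =
    image_mset (%t. min (con (XB a) (XB b)) (enat (mlt (XB a)) * chr (YB (s b)) t)) (mset_set (roots_of_unity (mlt (XB b))))"
    by (rule image_mset_cong) (use MC ab finite_unity[OF pparamD(6)[OF f(3)]] in auto)
   thus ?thesis unfolding CoAM_ordered_con[OF f(1,3) ne(1)] CoAM_ordered_con[OF f(2,4) ne(2)] m by simp
  qed
  have "mlt (XB i) = mlt (YB (s i))" "mlt (XB j) = mlt (YB (s j))" using MC ij by auto
  thus ?thesis using co[of i j] co[of j i] ij unfolding CoAM_def by simp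
 qed
 ultimately show ?P unfolding preserves_auxiliary_multiplicities_def singular_indices_def tangent_pairs_def nontangent_pairs_def by auto
qed

section \<open>Bi-Lipschitz maps permute the branches\<close>

lemma branch_zero: assumes f: "branch_param Z f R" shows "0 : Z"
proof -
 have R: "R > 0" "f 0 = 0" using f by (auto simp: branch_param_def)
 obtain d where d: "d > 0" "ALL z:ball 0 d. z : Z \<longleftrightarrow> z : f ` ball 0 R" using branch_near[OF f R(1)] by blast
 have "f 0 : f ` ball 0 R" using R(1) by (intro imageI) simp
 thus ?thesis using d R(2) by simp
qed

text \<open>Two branches meet only at the origin: by the dichotomy for curves and analytic germs,
  one would otherwise be contained in the other, and maximality of components would make them
  equal.\<close>

lemma decomposition_facts:
 fixes X :: "(complex ^ 'n) set" assumes X: "curve_germ X" and B: "branch_decomposition X r XB"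
 shows "ALL i:{1..r}. EX f R. branch_param (XB i) f R"
  "ALL i:{1..r}. ALL j:{1..r}. i ~= j --> ~ germ_eq (XB i) (XB j)"
  "\<forall>\<^sub>F z in nhds 0. z : X \<longleftrightarrow> (EX i:{1..r}. z : XB i)"
  "\<forall>\<^sub>F z in nhds 0. ALL i:{1..r}. ALL j:{1..r}. i ~= j & z : XB i & z : XB j --> z = 0"
  "0 : X"
proof -
 have irr: "ALL i:{1..r}. irreducible_component (XB i) X" using B by (simp add: branch_decomposition_def)
 show bp: "ALL i:{1..r}. EX f R. branch_param (XB i) f R"
  using irr X branch_param_exists unfolding curve_germ_def irreducible_component_def by metis
 show ne: "ALL i:{1..r}. ALL j:{1..r}. i ~= j --> ~ germ_eq (XB i) (XB j)" using B by (simp add: branch_decomposition_def)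
 show "0 : X" using X by (simp add: curve_germ_def analytic_germ_def)
 have "germ_eq X (\<Union>i\<in>{1..r}. XB i)" using B by (simp add: branch_decomposition_def)
 thus "\<forall>\<^sub>F z in nhds 0. z : X \<longleftrightarrow> (EX i:{1..r}. z : XB i)" unfolding germ_eq_def by (rule eventually_mono) blast
 have "\<forall>\<^sub>F z in nhds 0. i ~= j & z : XB i & z : XB j --> z = 0" if ij: "i : {1..r}" "j : {1..r}" for i j
 proof (cases "i = j")
  case False
  obtain f R where f: "branch_param (XB i) f R" using bp ij by blast
  have R: "R > 0" "hol_vec f (ball 0 R)" "f 0 = 0" using f by (auto simp: branch_param_def)
  have an: "analytic_germ (XB j)" using irr ij by (auto simp: irreducible_component_def irreducible_germ_def)
  from curve_in_analytic_germ[OF an R(2,1,3)] show ?thesis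
  proof (elim disjE exE conjE)
   fix d assume d: "d > 0" "ALL s:ball 0 d. f s : XB j"
   obtain e where e: "e > 0" "ALL z:ball 0 e. z : XB i \<longleftrightarrow> z : f ` ball 0 (min d R)"
    using branch_near[OF f, of "min d R"] d(1) R(1) by auto
   have "ALL z:ball 0 e. z : XB i --> z : XB j" using e(2) d(2) by auto
   hence "germ_le (XB i) (XB j)" unfolding germ_le_iff_ball using e(1) by blast
   hence "germ_eq (XB i) (XB j)" using irr ij unfolding irreducible_component_def by blast
   thus ?thesis using ne ij False by blast
  next
   fix d assume d: "d > 0" "ALL s. s ~= 0 --> norm s <= d --> f s ~: XB j"
   obtain e where e: "e > 0" "ALL z:ball 0 e. z : XB i \<longleftrightarrow> z : f ` ball 0 (min d R)"
    using branch_near[OF f, of "min d R"] d(1) R(1) by auto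
   have "z = 0" if z: "dist z 0 < e" "z : XB i" "z : XB j" for z
   proof -
    obtain s where s: "s : ball 0 (min d R)" "z = f s" using e(2) z(1,2) by (auto simp: dist_commute)
    hence "s = 0" using d(2) z(3) by force
    thus ?thesis using s(2) R(3) by simp
   qed
   thus ?thesis unfolding eventually_nhds_metric using e(1) by blast
  qed
 qed simp
 thus "\<forall>\<^sub>F z in nhds 0. ALL i:{1..r}. ALL j:{1..r}. i ~= j & z : XB i & z : XB j --> z = 0"
  by (intro eventually_ball_finite ballI finite_atLeastAtMost)
qed

text \<open>A representative of a branch need not be closed. The compact piece contains its points
  near 0, and preimages of it under continuous maps are relatively closed.\<close>

lemma branch_compact:
 fixes f :: "complex => complex ^ 'n" assumes f: "branch_param Z f R" and d: "d > 0"
 shows "EX K. compact K & K <= Z Int ball 0 d & (\<forall>\<^sub>F z in nhds 0. z : Z --> z : K)"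
proof -
 have R: "R > 0" "hol_vec f (ball 0 R)" "f 0 = 0" using f by (auto simp: branch_param_def)
 obtain e where e: "e > 0" "ALL z:ball 0 e. z : Z \<longleftrightarrow> z : f ` ball 0 R" using branch_near[OF f R(1)] by blast
 have "f 0 : ball 0 (min d e)" using R(3) d e(1) by simp
 from small_preimage_ball[OF R(2,1) open_ball this] obtain r where r: "r > 0" "r <= R" "f ` ball 0 r <= ball 0 (min d e)"
  by (elim exE conjE) (rule that)
 have sub: "cball 0 (r/2) <= ball (0::complex) r" "ball 0 r <= ball (0::complex) R" using r(1,2) by auto
 have "compact (f ` cball 0 (r/2))"
  by (intro compact_continuous_image compact_cball continuous_on_subset[OF hol_vec_continuous[OF R(2)]]) (use sub in blast)
 moreover have "f ` cball 0 (r/2) <= Z Int ball 0 d"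
 proof
  fix y assume "y : f ` cball 0 (r/2)"
  hence "y : f ` ball 0 R" "y : ball 0 (min d e)" using sub r(3) by blast+
  thus "y : Z Int ball 0 d" using e(2) by auto
 qed
 moreover have "\<forall>\<^sub>F z in nhds 0. z : Z --> z : f ` cball 0 (r/2)"
 proof -
  have "germ_eq Z (f ` ball 0 (r/2))" using f r by (auto simp: branch_param_def)
  thus ?thesis unfolding germ_eq_def
  proof (rule eventually_mono)
   fix z assume "z : Z \<longleftrightarrow> z : f ` ball 0 (r/2)"
   thus "z : Z --> z : f ` cball 0 (r/2)" using ball_subset_cball by blast
  qed
 qed
 ultimately show ?thesis by blast
qed

text \<open>The punctured disc is connected. Its points are distributed by \<open>h (f u)\<close>
  over the branches of \<open>Y\<close>; these parts are relatively closed, and they are disjoint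
  because \<open>h (f u)\<close> is not 0 there. Hence only one part is nonempty.\<close>

lemma image_branch:
 fixes X Z :: "(complex ^ 'n) set" and Y :: "(complex ^ 'm) set"
 assumes b: "bil X Y h k L e" and J: "finite J" "ALL j:J. EX f R. branch_param (YB j) f R"
  and Y: "\<forall>\<^sub>F z in nhds 0. z : Y --> (EX j:J. z : YB j)" and D: "\<forall>\<^sub>F z in nhds 0. ALL i:J. ALL j:J. i ~= j & z : YB i & z : YB j --> z = 0"
  and f: "branch_param Z f R" and ZX: "\<forall>\<^sub>F z in nhds 0. z : Z --> z : X" shows "EX j:J. \<forall>\<^sub>F z in nhds 0. z : Z --> h z : YB j"
proof -
 note B = b[unfolded bil_def]
 have e: "e > 0" "L > 0" "h 0 = 0" "k 0 = 0" using B by auto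
 have R: "R > 0" "hol_vec f (ball 0 R)" "f 0 = 0" "inj_on f (ball 0 R)" using f by (auto simp: branch_param_def)
 obtain d0 where d0: "d0 > 0" "ALL z. dist z 0 < d0 --> (ALL i:J. ALL j:J. i ~= j & z : YB i & z : YB j --> z = 0)"
  using D unfolding eventually_nhds_metric by blast
 have "ALL j:J. EX K. compact K & K <= YB j Int ball 0 d0 & (\<forall>\<^sub>F z in nhds 0. z : YB j --> z : K)"
  using J(2) branch_compact[OF _ d0(1)] by blast
 from bchoice[OF this] obtain K where K: "ALL j:J. compact (K j) & K j <= YB j Int ball 0 d0 & (\<forall>\<^sub>F z in nhds 0. z : YB j --> z : K j)"
  by blast
 have "\<forall>\<^sub>F z in nhds 0. ALL j:J. z : YB j --> z : K j" using K by (intro eventually_ball_finite J(1)) blast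
 with Y have "\<forall>\<^sub>F z in nhds 0. z : Y --> (EX j:J. z : K j)" by eventually_elim blast
 then obtain d1 where d1: "d1 > 0" "ALL z. dist z 0 < d1 --> z : Y --> (EX j:J. z : K j)" unfolding eventually_nhds_metric by blast
 obtain d2 where d2: "d2 > 0" "ALL z:ball 0 d2. z : Z \<longleftrightarrow> z : f ` ball 0 R" using branch_near[OF f R(1)] by blast
 obtain d3 where d3: "d3 > 0" "ALL z. dist z 0 < d3 --> z : Z --> z : X" using ZX unfolding eventually_nhds_metric by blast
 define d where "d = min (min d2 d3) (min e (d1 / L))"
 have "d > 0" using d1 d2 d3 e by (simp add: d_def)
 hence "f 0 : ball 0 d" using R(3) by simp
 from small_preimage_ball[OF R(2,1) open_ball this] obtain r where r: "r > 0" "r <= R" "f ` ball 0 r <= ball 0 d"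
  by (elim exE conjE) (rule that)
 have rR: "ball 0 r <= ball (0::complex) R" using r(2) by auto
 have X0: "0 : X" using d3 branch_zero[OF f] by simp
 have fX: "f u : X Int ball 0 e" "h (f u) : Y Int ball 0 d1" if u: "u : ball 0 r" for u
 proof -
  have fd: "f u : ball 0 d" using r(3) u by blast
  have "f u : f ` ball 0 R" using u rR by blast
  hence "f u : Z" using d2(2) fd by (simp add: d_def)
  thus 1: "f u : X Int ball 0 e" using d3(2) fd by (simp add: d_def)
  have "0 : X Int ball 0 e" using X0 e(1) by simp
  hence "norm (h (f u) - h 0) <= L * norm (f u - 0)" using B 1 by blast
  also have "... < d1" using fd e(2) by (simp add: d_def field_simps)
  finally show "h (f u) : Y Int ball 0 d1" using B 1 e(3) by auto
 qed
 define S where "S = ball (0::complex) r - {0}"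
 have con: "connected S" unfolding S_def by (rule connected_punctured_ball) simp
 have Sr: "S <= ball 0 r" by (auto simp: S_def)
 have "continuous_on (ball 0 r) f" by (rule continuous_on_subset[OF hol_vec_continuous[OF R(2)] rR])
 hence "continuous_on (ball 0 r) (%u. h (f u))" by (rule continuous_on_compose2[OF bil_continuous[OF b]]) (use fX(1) in blast)
 hence cF: "continuous_on S (%u. h (f u))" using Sr by (rule continuous_on_subset)
 define A where "A j = S Int (%u. h (f u)) -` K j" for j
 have clA: "closedin (top_of_set S) (A j)" if "j : J" for j
  unfolding A_def using cF K that compact_imp_closed by (intro continuous_closedin_preimage) auto
 have nz: "h (f u) ~= 0" if "u : S" for u
 proof
  assume h0: "h (f u) = 0"
  have ur: "u : ball 0 r" using that Sr by blast
  have "k (h (f u)) = f u" using B fX(1)[OF ur] by blast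
  hence "f u = f 0" using h0 e(4) R(3) by simp
  moreover have "u : ball 0 R" "0 : ball (0::complex) R" using ur rR R(1) by auto
  ultimately have "u = 0" by (rule inj_onD[OF R(4)])
  thus False using that by (simp add: S_def)
 qed
 have cover: "EX j:J. u : A j" if "u : S" for u using d1(2) fX(2)[of u] that Sr by (auto simp: A_def)
 have disj: "i = j" if "u : A i" "u : A j" "i : J" "j : J" for u i j
 proof (rule ccontr)
  assume ij: "i ~= j"
  have "u : S" "h (f u) : K i" "h (f u) : K j" using that by (auto simp: A_def)
  hence "h (f u) : YB i Int ball 0 d0" "h (f u) : YB j" "h (f u) ~= 0" using that K nz by blast+
  moreover from this have "dist (h (f u)) 0 < d0" by simp
  ultimately show False using d0(2) that(3,4) ij by blast
 qed
 have u0: "of_real (r / 2) : S" using r(1) by (simp add: S_def)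
 then obtain j where j: "j : J" "of_real (r / 2) : A j" using cover by blast
 define E where "E = (\<Union>i\<in>J - {j}. A i)"
 have "closedin (top_of_set S) E" unfolding E_def using J(1) clA by (intro closedin_Union) auto
 moreover have "S <= A j Un E" using cover by (auto simp: E_def)
 moreover have "A j Int E = {}" using disj j(1) by (auto simp: E_def)
 ultimately have "E = {}" using con clA[OF j(1)] j(2) unfolding connected_closedin by blast
 hence SA: "S <= A j" using \<open>S <= A j Un E\<close> by blast
 obtain g S' where g: "branch_param (YB j) g S'" using J(2) j(1) by blast
 have hu: "h (f u) : YB j" if u: "u : ball 0 r" for u
 proof (cases "u = 0")
  case True
  thus ?thesis using branch_zero[OF g] R(3) e(3) by simp
 next
  case False
  hence "u : A j" using u SA by (auto simp: S_def)
  thus ?thesis using K j(1) by (auto simp: A_def)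
 qed
 have "germ_eq Z (f ` ball 0 r)" using f r by (auto simp: branch_param_def)
 hence "\<forall>\<^sub>F z in nhds 0. z : Z --> h z : YB j" unfolding germ_eq_def by (rule eventually_mono) (use hu in blast)
 thus ?thesis using j(1) by blast
qed

lemma bil_eventually: assumes b: "bil X Y h k L e" and P: "\<forall>\<^sub>F z in nhds 0. P z" and X0: "0 : X"
 shows "\<forall>\<^sub>F z in nhds 0. z : X --> P (h z)"
proof -
 note B = b[unfolded bil_def]
 obtain d where d: "d > 0" "ALL z. dist z 0 < d --> P z" using P unfolding eventually_nhds_metric by blast
 have "P (h z)" if z: "dist z 0 < min e (d / L)" "z : X" for z
 proof -
  have "z : X Int ball 0 e" "0 : X Int ball 0 e" using z X0 B by auto
  hence "norm (h z - h 0) <= L * norm (z - 0)" using B by blast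
  also have "... < d" using z(1) B by (simp add: field_simps)
  finally show ?thesis using d(2) B by simp
 qed
 moreover have "min e (d / L) > 0" using d(1) B by simp
 ultimately show ?thesis unfolding eventually_nhds_metric by blast
qed

lemma bilipschitz_bil: assumes "bilipschitz_equivalent X Y" "0 : X" shows "EX h k L e. bil X Y h k L e"
proof -
 obtain U V h k C D where h: "open U" "0 : U" "open V" "0 : V" "homeomorphism (X Int U) (Y Int V) h k" "h 0 = 0"
  "C-lipschitz_on (X Int U) h" "D-lipschitz_on (Y Int V) k"
  using assms(1) unfolding bilipschitz_equivalent_def by (elim exE conjE) (rule that)
 obtain e1 where e1: "e1 > 0" "ball 0 e1 <= U" using h(1,2) open_contains_ball by blast
 obtain e2 where e2: "e2 > 0" "ball 0 e2 <= V" using h(3,4) open_contains_ball by blast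
 define L where "L = C + D + 1"
 have CD: "0 <= C" "0 <= D" using h(7,8) lipschitz_on_nonneg by blast+
 note hm = h(5)[unfolded homeomorphism_def]
 have k0: "k 0 = 0" using hm assms(2) h(2,6) by force
 have 1: "h p : Y & k (h p) = p & (ALL q:X Int ball 0 (min e1 e2). norm (h p - h q) <= L * norm (p - q))"
  if p: "p : X Int ball 0 (min e1 e2)" for p
 proof (intro conjI ballI)
  have pU: "p : X Int U" using p e1(2) by auto
  thus "h p : Y" "k (h p) = p" using hm by blast+
  fix q assume "q : X Int ball 0 (min e1 e2)"
  hence "q : X Int U" using e1(2) by auto
  hence "norm (h p - h q) <= C * norm (p - q)" using lipschitz_onD[OF h(7) pU] by (simp add: dist_norm)
  also have "... <= L * norm (p - q)" using CD by (intro mult_right_mono) (auto simp: L_def)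
  finally show "norm (h p - h q) <= L * norm (p - q)" .
 qed
 have 2: "k p : X & h (k p) = p & (ALL q:Y Int ball 0 (min e1 e2). norm (k p - k q) <= L * norm (p - q))"
  if p: "p : Y Int ball 0 (min e1 e2)" for p
 proof (intro conjI ballI)
  have pU: "p : Y Int V" using p e2(2) by auto
  thus "k p : X" "h (k p) = p" using hm by blast+
  fix q assume "q : Y Int ball 0 (min e1 e2)"
  hence "q : Y Int V" using e2(2) by auto
  hence "norm (k p - k q) <= D * norm (p - q)" using lipschitz_onD[OF h(8) pU] by (simp add: dist_norm)
  also have "... <= L * norm (p - q)" using CD by (intro mult_right_mono) (auto simp: L_def)
  finally show "norm (k p - k q) <= L * norm (p - q)" .
 qed
 have "bil X Y h k L (min e1 e2)" unfolding bil_def using 1 2 e1(1) e2(1) CD h(6) k0 by (simp add: L_def)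
 thus ?thesis by blast
qed

text \<open>Both maps send branches into branches, which defines index maps in both directions. For
  each pair of branches the restriction is again bi-Lipschitz near 0, so self-contacts and maximal
  contacts are compared pair by pair.\<close>

lemma only_if:
 fixes X :: "(complex ^ 'n) set" and Y :: "(complex ^ 'm) set"
 assumes X: "curve_germ X" "branch_decomposition X r XB" and Y: "curve_germ Y" "branch_decomposition Y r' YB"
  and b: "bil X Y h k L e" shows "EX s. bij_betw s {1..r} {1..r'} & preserves_auxiliary_multiplicities r XB YB s"
proof -
 note fX = decomposition_facts[OF X] and fY = decomposition_facts[OF Y]
 have match: "EX s. ALL i:{1..r}. s i : {1..r'} & (\<forall>\<^sub>F z in nhds 0. z : XB i --> z : X & h z : YB (s i))"
  if X: "curve_germ X" "branch_decomposition X r XB" and Y: "curve_germ Y" "branch_decomposition Y r' YB" and b: "bil X Y h k L e"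
  for X XB r Y YB r' h k L e
 proof -
  note fX = decomposition_facts[OF X] and fY = decomposition_facts[OF Y]
  have "ALL i:{1..r}. EX j. j : {1..r'} & (\<forall>\<^sub>F z in nhds 0. z : XB i --> z : X & h z : YB j)"
  proof
   fix i assume i: "i : {1..r}"
   obtain f R where f: "branch_param (XB i) f R" using fX(1) i by blast
   have zx: "\<forall>\<^sub>F z in nhds 0. z : XB i --> z : X" using fX(3) by (rule eventually_mono) (use i in blast)
   have "\<forall>\<^sub>F z in nhds 0. z : Y --> (EX j:{1..r'}. z : YB j)" using fY(3) by (rule eventually_mono) blast
   from image_branch[OF b finite_atLeastAtMost fY(1) this fY(4) f zx]
   obtain j where j: "j : {1..r'}" "\<forall>\<^sub>F z in nhds 0. z : XB i --> h z : YB j" by blast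
   have "\<forall>\<^sub>F z in nhds 0. z : XB i --> z : X & h z : YB j" using zx j(2) by eventually_elim blast
   thus "EX j. j : {1..r'} & (\<forall>\<^sub>F z in nhds 0. z : XB i --> z : X & h z : YB j)" using j(1) by blast
  qed
  from bchoice[OF this] show ?thesis .
 qed
 obtain s where s: "ALL i:{1..r}. s i : {1..r'} & (\<forall>\<^sub>F z in nhds 0. z : XB i --> z : X & h z : YB (s i))"
  using match[OF X Y b] by blast
 obtain s' where s': "ALL i:{1..r'}. s' i : {1..r} & (\<forall>\<^sub>F z in nhds 0. z : YB i --> z : Y & k z : XB (s' i))"
  using match[OF Y X bil_sym[OF b]] by blast
 \<comment> \<open>Otherwise the branch \<open>i\<close> would be contained near 0 in a second
   branch as well, hence consist of the origin only.\<close>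
 have inv: "s' (s i) = i" if X: "curve_germ X" "branch_decomposition X r XB" and b: "bil X Y h k L e"
   and s: "ALL i:{1..r}. s i : {1..r'} & (\<forall>\<^sub>F z in nhds 0. z : XB i --> z : X & h z : YB (s i))"
   and s': "ALL i:{1..r'}. s' i : {1..r} & (\<forall>\<^sub>F z in nhds 0. z : YB i --> z : Y & k z : XB (s' i))" and i: "i : {1..r}"
  for X :: "(complex ^ 'c) set" and XB r and Y :: "(complex ^ 'd) set" and YB r' h k L e s s' i
 proof (rule ccontr)
  assume ne: "s' (s i) ~= i"
  note fX = decomposition_facts[OF X]
  obtain f R where f: "branch_param (XB i) f R" using fX(1) i by blast
  have si: "s i : {1..r'}" using s i by blast
  have ssi: "s' (s i) : {1..r}" using s' si by blast
  have "\<forall>\<^sub>F z in nhds 0. z : YB (s i) --> k z : XB (s' (s i))" using s' si by (auto elim: eventually_mono)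
  from bil_eventually[OF b this fX(5)] have 1: "\<forall>\<^sub>F z in nhds 0. z : X --> h z : YB (s i) --> k (h z) : XB (s' (s i))" .
  have 2: "\<forall>\<^sub>F z in nhds 0. z : XB i --> z : X & h z : YB (s i)" using s i by blast
  have 3: "\<forall>\<^sub>F z in nhds 0. z : X --> k (h z) = z" using b unfolding bil_def eventually_nhds_metric by (intro exI[of _ e]) auto
  have "\<forall>\<^sub>F z in nhds 0. z : XB i --> z = 0" using 1 2 3 fX(4)
  proof eventually_elim
   case (elim z)
   show ?case
   proof
    assume z: "z : XB i"
    hence "z : XB (s' (s i))" using elim(1,2,3) by metis
    thus "z = 0" using elim(4) i ssi ne z by blast
   qed
  qed
  thus False using branch_nontrivial[OF f] by blast
 qed
 have ss: "ALL i:{1..r}. s' (s i) = i" using inv[OF X b s s'] by blast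
 have ss': "ALL i:{1..r'}. s (s' i) = i" using inv[OF Y bil_sym[OF b] s' s] by blast
 have bij: "bij_betw s {1..r} {1..r'}" by (rule bij_betw_byWitness[OF ss ss']) (use s s' in blast)+
 have "\<forall>\<^sub>F z in nhds 0. ALL i:{1..r}. (z : XB i --> z : X & h z : YB (s i))" using s by (intro eventually_ball_finite) auto
 then obtain e1 where e1: "e1 > 0" "ALL z. dist z 0 < e1 --> (ALL i:{1..r}. z : XB i --> z : X & h z : YB (s i))"
  unfolding eventually_nhds_metric by blast
 have "\<forall>\<^sub>F z in nhds 0. ALL i:{1..r'}. (z : YB i --> z : Y & k z : XB (s' i))" using s' by (intro eventually_ball_finite) auto
 then obtain e2 where e2: "e2 > 0" "ALL z. dist z 0 < e2 --> (ALL i:{1..r'}. z : YB i --> z : Y & k z : XB (s' i))"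
  unfolding eventually_nhds_metric by blast
 define c where "c = min e (min e1 e2)"
 note B = b[unfolded bil_def]
 have e1': "z : X & h z : YB (s i)" if "z : ball 0 c" "i : {1..r}" "z : XB i" for z i using e1(2) that by (simp add: c_def)
 have e2': "z : Y & k z : XB i" if "z : ball 0 c" "i : {1..r}" "z : YB (s i)" for z i
 proof -
  have "s i : {1..r'}" using s that(2) by blast
  thus ?thesis using e2(2) that ss by (force simp: c_def)
 qed
 have ball: "ball 0 c <= ball (0::complex ^ 'n) e" "ball 0 c <= ball (0::complex ^ 'm) e" by (auto simp: c_def)
 have b2: "bil2 (XB i) (XB j) (YB (s i)) (YB (s j)) h k L c" if ij: "i : {1..r}" "j : {1..r}" for i j
 proof -
  have sub: "(XB i Un XB j) Int ball 0 c <= X Int ball 0 e" "(YB (s i) Un YB (s j)) Int ball 0 c <= Y Int ball 0 e"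
   using e1' e2' ij ball by blast+
  have "h p : YB (s i) Un YB (s j) & k (h p) = p & (ALL q:(XB i Un XB j) Int ball 0 c. norm (h p - h q) <= L * norm (p - q))"
   if "p : (XB i Un XB j) Int ball 0 c" for p using that e1' ij sub B by blast
  moreover have "k p : XB i Un XB j & h (k p) = p & (ALL q:(YB (s i) Un YB (s j)) Int ball 0 c. norm (k p - k q) <= L * norm (p - q))"
   if "p : (YB (s i) Un YB (s j)) Int ball 0 c" for p using that e2' ij sub B by blast
  moreover have "c > 0" using e1 e2 B by (simp add: c_def)
  ultimately have "bil (XB i Un XB j) (YB (s i) Un YB (s j)) h k L c" unfolding bil_def using B by blast
  thus ?thesis unfolding bil2_def using e1' e2' ij by blast
 qed
 have B: "ALL i:{1..r}. brn (XB i) & brn (YB (s i))" 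
 proof
  fix i assume i: "i : {1..r}"
  hence "s i : {1..r'}" using s by blast
  then obtain f R g S where "branch_param (XB i) f R" "branch_param (YB (s i)) g S" using fX(1) fY(1) i by blast
  from this[THEN ap_pparam] show "brn (XB i) & brn (YB (s i))" by (rule conjI)
 qed
 have nY: "ALL i:{1..r}. ALL j:{1..r}. i ~= j --> ~ germ_eq (XB i) (XB j) & ~ germ_eq (YB (s i)) (YB (s j))"
  using fX(2) fY(2) s ss by metis
 have "preserves_auxiliary_multiplicities r XB YB s" unfolding preserves_iff[where s = s, OF B nY]
 proof (intro conjI ballI impI)
  have p: "brn (XB i)" "brn (YB (s i))" if "i : {1..r}" for i using B that by blast+
  have inv: "mlt (YB (s i)) = mlt (XB i) & (ALL t:roots_of_unity (mlt (XB i)). chr (XB i) t = chr (YB (s i)) t)"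
   if i: "i : {1..r}" for i using char_invariant[OF p[OF i] bil2_single[OF b2[OF i i]]] unfolding chr_def by simp
  fix i assume i: "i : {1..r}"
  show "mlt (YB (s i)) = mlt (XB i)" using inv[OF i] by blast
  show "chr (XB i) t = chr (YB (s i)) t" if "t : roots_of_unity (mlt (XB i))" for t using inv[OF i] that by blast
  fix j assume j: "j : {1..r}" "i ~= j"
  have m: "mlt (YB (s i)) = mlt (XB i)" "mlt (YB (s j)) = mlt (XB j)" using inv i j(1) by auto
  note q = p(1)[OF i] p(2)[OF i, unfolded m] p(1)[OF j(1)] p(2)[OF j(1), unfolded m]
  have ne: "~ germ_eq (XB i) (XB j)" "~ germ_eq (YB (s i)) (YB (s j))" using nY i j by auto
  show "con (XB i) (XB j) = con (YB (s i)) (YB (s j))" unfolding con_def m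
   by (rule antisym[OF contact_le[OF q(1,3,2,4) _ ne(2) b2[OF i j(1)]]
    contact_le[OF q(2,4,1,3) _ ne(1) bil2_sym[OF b2[OF i j(1)]]]]) simp_all
 qed
 thus ?thesis using bij by blast
qed

section \<open>From the auxiliary multiplicities to a bi-Lipschitz map\<close>

section \<open>Rotating the parametrizations\<close>

text \<open>Contacts as an ultrametric on rotated parametrizations, large values meaning closeness.
  Rotating both members of a pair together changes nothing, so one relative rotation is recorded,
  and relative rotations multiply.\<close>

definition ultra :: "'i set => complex set => ('i => 'i => complex => enat) => bool" where
 "ultra I G k \<longleftrightarrow> (ALL i:I. ALL j:I. ALL l:I. ALL a:G. ALL b:G. min (k i j a) (k j l b) <= k i l (a * b)) &
  (ALL i:I. ALL j:I. ALL a:G. k j i (1 / a) = k i j a)"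

lemma unity_group:
 fixes a b :: complex assumes "a : {w. w ^ N = 1}" "b : {w. w ^ N = 1}" "N > 0"
 shows "a * b : {w. w ^ N = 1}" "a / b : {w. w ^ N = 1}" "a ~= 0"
 using assms by (auto simp: power_mult_distrib power_divide power_0_left)

text \<open>The isosceles property: \<open>i\<close> attains the contact \<open>M\<close> with
  \<open>x\<close>, and \<open>l\<close> has no larger contact with \<open>x\<close>. The contact of
  \<open>l\<close> with \<open>x\<close> is then the contact of \<open>l\<close> with
  \<open>i\<close>, cut off at \<open>M\<close>.\<close>

lemma ultra_formula: assumes u: "ultra I {w. w ^ N = 1} k" and N: "N > 0" and I: "i : I" "l : I" "x : I"
  and a: "a : {w. w ^ N = 1}" "c : {w. w ^ N = 1}" and M: "k i x c = M" "ALL b:{w. w ^ N = 1}. k l x b <= M"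
 shows "k l x a = min (k l i (a / c)) M"
proof -
 note g = unity_group[OF a N]
 have c0: "c ~= 0" using unity_group(3)[OF a(2,2) N] .
 have o: "1 / c : {w. w ^ N = 1}" using unity_group(2)[OF _ a(2) N, of 1] by simp
 have min: "min (k i j a) (k j l b) <= k i l (a * b)" if "i : I" "j : I" "l : I" "a : {w. w ^ N = 1}" "b : {w. w ^ N = 1}" for i j l a b
  using u that unfolding ultra_def by blast
 have 1: "min (k l i (a / c)) M <= k l x a" using min[OF I(2,1,3) g(2) a(2)] M(1) c0 by simp
 have 2: "k l x a <= M" using M(2) a(1) by blast
 have "k x i (1 / c) = M" using u I a(2) M(1) unfolding ultra_def by blast
 hence "k l x a <= k l i (a / c)" using min[OF I(2,3,1) a(1) o] 2 by (simp add: min_def split: if_splits)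
 thus ?thesis using 1 2 by (simp add: min_def split: if_splits)
qed

lemma ultra_twist:
 fixes z :: "'i => complex" assumes u: "ultra I {w. w ^ N = 1} k" and N: "N > 0" and z: "ALL i:I. z i : {w. w ^ N = 1}"
 shows "ultra I {w. w ^ N = 1} (%i j a. k i j (a * z j / z i))" unfolding ultra_def
proof (intro conjI ballI)
 fix i j l and a b :: complex assume h: "i : I" "j : I" "l : I" "a : {w. w ^ N = 1}" "b : {w. w ^ N = 1}"
 have zz: "z i : {w. w ^ N = 1}" "z j : {w. w ^ N = 1}" "z l : {w. w ^ N = 1}" using z h by blast+
 have g: "a * z j / z i : {w. w ^ N = 1}" "b * z l / z j : {w. w ^ N = 1}"
  using unity_group(2)[OF unity_group(1)[OF h(4) zz(2) N] zz(1) N] unity_group(2)[OF unity_group(1)[OF h(5) zz(3) N] zz(2) N] by auto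
 have "min (k i j (a * z j / z i)) (k j l (b * z l / z j)) <= k i l ((a * z j / z i) * (b * z l / z j))"
  using u h(1-3) g unfolding ultra_def by blast
 also have "(a * z j / z i) * (b * z l / z j) = a * b * z l / z i" using unity_group(3)[OF zz(2,2) N] by simp
 finally show "min (k i j (a * z j / z i)) (k j l (b * z l / z j)) <= k i l (a * b * z l / z i)" .
next
 fix i j and a :: complex assume h: "i : I" "j : I" "a : {w. w ^ N = 1}"
 have zz: "z i : {w. w ^ N = 1}" "z j : {w. w ^ N = 1}" using z h by blast+
 have "a * z j / z i : {w. w ^ N = 1}" using unity_group(2)[OF unity_group(1)[OF h(3) zz(2) N] zz(1) N] .
 hence "k j i (1 / (a * z j / z i)) = k i j (a * z j / z i)" using u h unfolding ultra_def by blast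
 thus "k j i (1 / a * z i / z j) = k i j (a * z j / z i)" by (simp add: mult.commute)
qed

text \<open>The branches are added one by one; the new one is rotated against a branch of maximal contact with it.\<close>

lemma rotation: assumes X: "ultra I {w. w ^ N = 1} kX" and Y: "ultra I {w. w ^ N = 1} kY" and N: "N > 0" and I: "finite I"
  and diag: "ALL i:I. ALL a:{w. w ^ N = 1}. kX i i a = kY i i a"
  and mx: "ALL i:I. ALL j:I. i ~= j --> (EX a:{w. w ^ N = 1}. kX i j a = M i j) & (EX a:{w. w ^ N = 1}. kY i j a = M i j) &
   (ALL a:{w. w ^ N = 1}. kX i j a <= M i j & kY i j a <= M i j)"
 shows "EX z. (ALL i:I. z i : {w. w ^ N = 1}) & (ALL i:I. ALL j:I. ALL a:{w. w ^ N = 1}. kX i j a = kY i j (a * z j / z i))"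
proof -
 let ?G = "{w::complex. w ^ N = 1}"
 have "A <= I ==> EX z. (ALL i:I. z i : ?G) & (ALL i:A. ALL j:A. ALL a:?G. kX i j a = kY i j (a * z j / z i))" if "finite A" for A using that
 proof (induction A)
  case empty
  show ?case by (intro exI[of _ "%_. 1"]) simp
 next
  case (insert x A)
  then obtain z where z: "ALL i:I. z i : ?G" "ALL i:A. ALL j:A. ALL a:?G. kX i j a = kY i j (a * z j / z i)" by blast
  have xI: "x : I" "A <= I" "x ~: A" using insert by auto
  show ?case
  proof (cases "A = {}")
   case True
   have "z x / z x = 1" using unity_group(3)[OF _ _ N] z(1) xI(1) by (metis divide_self)
   thus ?thesis using True z(1) diag xI(1) by (intro exI[of _ z]) (simp add: times_divide_eq_right[symmetric] del: times_divide_eq_right)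
  next
   case False
   have "finite ((%i. M i x) ` A)" "(%i. M i x) ` A ~= {}" using insert(1) False by auto
   \<comment> \<open>A branch of maximal contact: its contact with \<open>x\<close> bounds that of
     all earlier branches, as \<open>ultra_formula\<close> requires.\<close>
   from Max_in[OF this] Max_ge[OF this(1)] obtain i where i: "i : A" "ALL l:A. M l x <= M i x" by auto
   have ix: "i : I" "i ~= x" using i xI by auto
   obtain a0 where a0: "a0 : ?G" "kX i x a0 = M i x" using mx ix xI(1) by blast
   obtain b0 where b0: "b0 : ?G" "kY i x b0 = M i x" using mx ix xI(1) by blast
   have zi: "z i : ?G" using z(1) ix by blast
   \<comment> \<open>Chosen to satisfy \<open>a0 * z' x / z' i = b0\<close>, so that the maximal
     contact of \<open>i\<close> and \<open>x\<close> is attained at corresponding rotations in both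
     systems.\<close>
   define z' where "z' = z(x := b0 * z i / a0)"
   have z'G: "ALL i:I. z' i : ?G" using z(1) unity_group(2)[OF unity_group(1)[OF b0(1) zi N] a0(1) N] by (auto simp: z'_def)
   define K where "K i j a = kY i j (a * z' j / z' i)" for i j a
   have uK: "ultra I ?G K" unfolding K_def by (rule ultra_twist[OF Y N z'G])
   have z'A: "z' l = z l" if "l : A" for l using that xI(3) by (auto simp: z'_def)
   have KA: "kX l j a = K l j a" if "l : A" "j : A" "a : ?G" for l j a using z(2) that z'A unfolding K_def by metis
   have "a0 * z' x / z' i = b0" using unity_group(3)[OF a0(1,1) N] unity_group(3)[OF zi zi N] z'A[OF i(1)] by (simp add: z'_def)
   hence Ka: "K i x a0 = M i x" using b0(2) by (simp add: K_def)
   have new: "kX l x a = K l x a" if l: "l : A" "a : ?G" for l a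
   proof -
    have lI: "l : I" "l ~= x" using l xI by auto
    have le: "kX l x b <= M i x" "kY l x b <= M i x" if "b : ?G" for b using mx lI xI(1) that i(2) l(1) by (meson order_trans)+
    have Kle: "K l x b <= M i x" if b: "b : ?G" for b unfolding K_def
    proof (rule le(2))
     have "z' x : ?G" "z' l : ?G" using z'G xI(1) lI(1) by blast+
     thus "b * z' x / z' l : ?G" using unity_group(2)[OF unity_group(1)[OF b _ N] _ N] by blast
    qed
    have "kX l x a = min (kX l i (a / a0)) (M i x)" by (rule ultra_formula[OF X N ix(1) lI(1) xI(1) l(2) a0]) (use le in blast)
    also have "kX l i (a / a0) = K l i (a / a0)" by (rule KA[OF l(1) i(1) unity_group(2)[OF l(2) a0(1) N]])
    also have "min (K l i (a / a0)) (M i x) = K l x a"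
     by (rule ultra_formula[OF uK N ix(1) lI(1) xI(1) l(2) a0(1) Ka, symmetric]) (use Kle in blast)
    finally show ?thesis .
   qed
   have "kX l j a = K l j a" if h: "l : insert x A" "j : insert x A" "a : ?G" for l j a
   proof (cases "l = x")
    case l: True
    show ?thesis
    proof (cases "j = x")
     case True
     have "z' x / z' x = 1" using unity_group(3)[OF _ _ N] z'G xI(1) by (metis divide_self)
     hence "K x x a = kY x x a" unfolding K_def by (metis mult.right_neutral times_divide_eq_right)
     thus ?thesis using diag h(3) xI(1) l True by metis
    next
     case False
     hence j: "j : A" "j : I" using h(2) xI(2) by auto
     have o: "1 / a : ?G" using unity_group(2)[OF _ h(3) N, of 1] by simp
     have "kX x j (1 / (1 / a)) = kX j x (1 / a)" "K x j (1 / (1 / a)) = K j x (1 / a)"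
      using X uK xI(1) j(2) o unfolding ultra_def by blast+
     thus ?thesis using new[OF j(1) o] l by simp
    qed
   next
    case False
    thus ?thesis using h KA new by blast
   qed
   thus ?thesis using z'G unfolding K_def by blast
  qed
 qed
 from this[OF I] show ?thesis by blast
qed

lemma kap_ultra:
 fixes F G H :: "complex => complex ^ 'n" assumes F: "ram N F R" "ram N G R" "ram N H R" and a: "a ^ N = 1" "b ^ N = 1"
 shows "min (kap F G a) (kap G H b) <= kap F H (a * b)"
proof -
 have R: "R > 0" "N > 0" "hol_vec F (ball 0 R)" "hol_vec G (ball 0 R)" "hol_vec H (ball 0 R)" using F by (auto simp: ram_def)
 have n: "norm a = 1" "norm (a * b) = 1" using roots_of_unity_norm[OF a(1) R(2)] roots_of_unity_norm[OF a(2) R(2)] by (auto simp: norm_mult)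
 have a0: "a ~= 0" using n(1) by auto
 have "vord (%s. G (a * s ^ 1) - H (b * (a * s ^ 1))) = enat 1 * kap G H b"
  unfolding kap_def by (rule vord_reparam[OF kap_hol_vec[OF F(2,3) a(2)] R(1)]) (use a0 in auto)
 hence "vord (%s. G (a * s) - H (a * b * s)) = kap G H b" unfolding one_enat_def[symmetric] by (simp add: mult_ac)
 thus ?thesis
  using vord_ultra[OF R(3) hol_vec_rotate[OF R(4) n(1)] hol_vec_rotate[OF R(5) n(2)] R(1)] unfolding kap_def by simp
qed

lemma ultra_kap:
 fixes F :: "'i => complex => complex ^ 'n" assumes F: "ALL i:I. ram N (F i) R" shows "ultra I {w. w ^ N = 1} (%i j. kap (F i) (F j))"
 unfolding ultra_def
proof (intro conjI ballI)
 fix i j l and a b :: complex assume h: "i : I" "j : I" "l : I" "a : {w. w ^ N = 1}" "b : {w. w ^ N = 1}"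
 show "min (kap (F i) (F j) a) (kap (F j) (F l) b) <= kap (F i) (F l) (a * b)" by (rule kap_ultra) (use F h in auto)
next
 fix i j and a :: complex assume h: "i : I" "j : I" "a : {w. w ^ N = 1}"
 show "kap (F j) (F i) (1 / a) = kap (F i) (F j) a" by (rule kap_sym) (use F h in auto)
qed

lemma kap_rotate:
 fixes F G :: "complex => complex ^ 'n" assumes F: "ram N F R" "ram N G R" and a: "a ^ N = 1" "b ^ N = 1" "w ^ N = 1"
 shows "kap (%s. F (a * s)) (%s. G (b * s)) w = kap F G (w * b / a)"
proof -
 have R: "R > 0" "N > 0" using F by (auto simp: ram_def)
 have "norm a = 1" using roots_of_unity_norm[OF a(1) R(2)] .
 hence a0: "a ~= 0" by auto
 have w: "(w * b / a) ^ N = 1" using a by (simp add: power_mult_distrib power_divide)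
 have "vord (%s. F (a * s ^ 1) - G (w * b / a * (a * s ^ 1))) = enat 1 * kap F G (w * b / a)"
  unfolding kap_def by (rule vord_reparam[OF kap_hol_vec[OF F w] R(1)]) (use a0 in auto)
 thus ?thesis unfolding one_enat_def[symmetric] kap_def[of "%s. F (a * s)"] using a0 by (simp add: mult_ac)
qed

lemma contact_self: assumes f: "pparam Z m f j R" and t: "t : roots_of_unity m"
 shows "contact_mult m m f f t = enat m * char_mult f t"
proof -
 note p = pparamD[OF f]
 have "vord (%u. f (1 * u ^ m) - f (t * (1 * u ^ m))) = enat m * vord (%u. f u - f (t * u))"
  by (rule vord_reparam[OF hol_vec_diff[OF p(2) hol_vec_rotate[OF p(2) unity_norm[OF t p(6)]]] p(1,6)]) simp
 thus ?thesis by (simp add: contact_mult_vord char_mult_vord)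
qed

lemma rp_germ:
 fixes f :: "complex => complex ^ 'n" assumes f: "pparam Z m f j R" and n: "n > 0" and c: "norm c = 1" and d: "0 < d" "d <= min 1 R"
 shows "germ_eq Z (rp f n c ` ball 0 d)"
proof -
 have "rp f n c ` ball 0 d = f ` ball 0 (d ^ n)"
 proof (intro set_eqI iffI)
  fix y assume "y : rp f n c ` ball 0 d"
  then obtain s where s: "norm s < d" "y = f ((c * s) ^ n)" by (auto simp: rp_def)
  have "norm s ^ n < d ^ n" using s(1) n by (intro power_strict_mono) auto
  thus "y : f ` ball 0 (d ^ n)" using s(2) c by (auto simp: norm_power norm_mult)
 next
  fix y assume "y : f ` ball 0 (d ^ n)"
  then obtain v where v: "norm v < d ^ n" "y = f v" by auto
  obtain t :: complex where t: "t ^ n = v" using complex_root_exists[OF n] by blast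
  have "norm t < d" by (rule norm_root_less[OF t v(1) d(1)])
  moreover have "c ~= 0" using c by auto
  ultimately show "y : rp f n c ` ball 0 d" using t v(2) c by (intro image_eqI[of _ _ "t / c"]) (auto simp: rp_def norm_divide)
 qed
 moreover have "0 < d ^ n" "d ^ n <= R" using d power_decreasing[of 1 n d] n by auto
 ultimately show ?thesis using pparamD(8)[OF f] by (simp add: branch_param_def)
qed

text \<open>The map is well defined because the estimate forces equal points \<open>F i s\<close> to
  have equal images, also across different branches.\<close>

lemma assemble_map:
 fixes F :: "'i => complex => complex ^ 'n" and H :: "'i => complex => complex ^ 'm"
 assumes "ALL i:I. ALL j:I. ALL s:ball 0 d. ALL s':ball 0 d. norm (H i s - H j s') <= C * norm (F i s - F j s')"
 shows "EX h. ALL i:I. ALL s:ball 0 d. h (F i s) = H i s"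
proof (intro exI ballI)
 fix i s assume i: "i : I" "s : ball (0::complex) d"
 let ?P = "%q. EX j:I. EX s':ball 0 d. F i s = F j s' & q = H j s'"
 have "?P (H i s)" using i by blast
 hence "?P (SOME q. ?P q)" by (rule someI)
 then obtain j s' where j: "j : I" "s' : ball 0 d" "F i s = F j s'" "(SOME q. ?P q) = H j s'" by blast
 have "norm (H j s' - H i s) <= C * norm (F j s' - F i s)" using assms i j by blast
 thus "(%p. SOME q. EX j:I. EX s':ball 0 d. p = F j s' & q = H j s') (F i s) = H i s" using j(3,4) by simp
qed

text \<open>The points sent into the ball of radius \<open>e'\<close> need not form a ball, but by
  continuity they are relatively open, hence cut out on \<open>X\<close> by an open set
  \<open>U\<close>; such sets match under the two maps.\<close>

lemma assemble_half:
 fixes F :: "'i => complex => complex ^ 'n" and H :: "'i => complex => complex ^ 'm"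
 assumes est: "ALL i:I. ALL j:I. ALL s:ball 0 d. ALL s':ball 0 d. norm (H i s - H j s') <= C * norm (F i s - F j s')"
  and C: "C > 0" and h: "ALL i:I. ALL s:ball 0 d. h (F i s) = H i s"
  and e: "ALL z:ball 0 e. z : X \<longleftrightarrow> z : (\<Union>i\<in>I. F i ` ball 0 d)" "e' > 0" "e > 0" and z: "0 : X" "h 0 = 0"
 shows "EX U. open U & 0 : U & X Int U = {p : X Int ball 0 e. h p : ball 0 e'} & C-lipschitz_on (X Int ball 0 e) h"
proof -
 have L: "C-lipschitz_on (X Int ball 0 e) h"
 proof (rule lipschitz_onI)
  fix p q assume "p : X Int ball 0 e" "q : X Int ball 0 e"
  hence "p : (\<Union>i\<in>I. F i ` ball 0 d)" "q : (\<Union>i\<in>I. F i ` ball 0 d)" using e(1) by blast+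
  then obtain i s j s' where pq: "i : I" "s : ball 0 d" "p = F i s" "j : I" "s' : ball 0 d" "q = F j s'" by blast
  thus "dist (h p) (h q) <= C * dist p q" using est h unfolding dist_norm by metis
 qed (use C in simp)
 have "openin (top_of_set (X Int ball 0 e)) ((X Int ball 0 e) Int h -` ball 0 e')"
  by (rule continuous_openin_preimage_gen[OF lipschitz_on_continuous_on[OF L] open_ball])
 then obtain T where T: "open T" "(X Int ball 0 e) Int h -` ball 0 e' = (X Int ball 0 e) Int T" unfolding openin_open by blast
 have "open (ball 0 e Int T)" using T(1) by blast
 moreover have "0 : (X Int ball 0 e) Int h -` ball 0 e'" using z e(2,3) by simp
 hence "0 : ball 0 e Int T" using T(2) by blast
 moreover have "X Int (ball 0 e Int T) = {p : X Int ball 0 e. h p : ball 0 e'}" using T(2) by blast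
 ultimately show ?thesis using L by blast
qed

lemma assemble:
 fixes F :: "'i => complex => complex ^ 'n" and H :: "'i => complex => complex ^ 'm"
 assumes est: "ALL i:I. ALL j:I. ALL s:ball 0 d. ALL s':ball 0 d. norm (H i s - H j s') <= C * norm (F i s - F j s') &
   norm (F i s - F j s') <= C * norm (H i s - H j s')"
  and C: "C > 0" "d > 0" and X: "germ_eq X (\<Union>i\<in>I. F i ` ball 0 d)" "0 : X" and Y: "germ_eq Y (\<Union>i\<in>I. H i ` ball 0 d)" "0 : Y"
  and z: "ALL i:I. F i 0 = 0 & H i 0 = 0" shows "bilipschitz_equivalent X Y"
proof -
 have est1: "ALL i:I. ALL j:I. ALL s:ball 0 d. ALL s':ball 0 d. norm (H i s - H j s') <= C * norm (F i s - F j s')"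
  and est2: "ALL i:I. ALL j:I. ALL s:ball 0 d. ALL s':ball 0 d. norm (F i s - F j s') <= C * norm (H i s - H j s')" using est by blast+
 obtain h where h: "ALL i:I. ALL s:ball 0 d. h (F i s) = H i s" using assemble_map[OF est1] by blast
 obtain k where k: "ALL i:I. ALL s:ball 0 d. k (H i s) = F i s" using assemble_map[OF est2] by blast
 obtain e where e: "e > 0" "ALL z:ball 0 e. z : X \<longleftrightarrow> z : (\<Union>i\<in>I. F i ` ball 0 d)" using X(1) unfolding germ_eq_iff_ball by blast
 obtain e' where e': "e' > 0" "ALL z:ball 0 e'. z : Y \<longleftrightarrow> z : (\<Union>i\<in>I. H i ` ball 0 d)" using Y(1) unfolding germ_eq_iff_ball by blast
 have "0 : (\<Union>i\<in>I. F i ` ball 0 d)" using bspec[OF e(2), of 0] X(2) e(1) by simp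
 then obtain i0 where i0: "i0 : I" by blast
 have d0: "0 : ball (0::complex) d" using C(2) by simp
 have h0: "h 0 = 0" "k 0 = 0" using h k z i0 d0 by metis+
 obtain U where U: "open U" "0 : U" "X Int U = {p : X Int ball 0 e. h p : ball 0 e'}" "C-lipschitz_on (X Int ball 0 e) h"
  using assemble_half[OF est1 C(1) h e(2) e'(1) e(1) X(2) h0(1)] by (elim exE conjE) (rule that)
 obtain V where V: "open V" "0 : V" "Y Int V = {p : Y Int ball 0 e'. k p : ball 0 e}" "C-lipschitz_on (Y Int ball 0 e') k"
  using assemble_half[OF est2 C(1) k e'(2) e(1) e'(1) Y(2) h0(2)] by (elim exE conjE) (rule that)
 have hk: "h p : Y Int V" "k (h p) = p" if p: "p : X Int U" for p
 proof -
  have p': "p : X Int ball 0 e" "h p : ball 0 e'" using p unfolding U(3) by auto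
  hence "p : (\<Union>i\<in>I. F i ` ball 0 d)" using e(2) by blast
  then obtain i s where s: "i : I" "s : ball 0 d" "p = F i s" by blast
  hence "h p = H i s" using h by blast
  thus kp: "k (h p) = p" using k s by simp
  have "h p : Y" using e'(2) p'(2) s \<open>h p = H i s\<close> by blast
  thus "h p : Y Int V" unfolding V(3) using p' kp by simp
 qed
 have kh: "k p : X Int U" "h (k p) = p" if p: "p : Y Int V" for p
 proof -
  have p': "p : Y Int ball 0 e'" "k p : ball 0 e" using p unfolding V(3) by auto
  hence "p : (\<Union>i\<in>I. H i ` ball 0 d)" using e'(2) by blast
  then obtain i s where s: "i : I" "s : ball 0 d" "p = H i s" by blast
  hence "k p = F i s" using k by blast
  thus kp: "h (k p) = p" using h s by simp
  have "k p : X" using e(2) p'(2) s \<open>k p = F i s\<close> by blast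
  thus "k p : X Int U" unfolding U(3) using p' kp by simp
 qed
 have lip: "C-lipschitz_on (X Int U) h" "C-lipschitz_on (Y Int V) k"
  by (rule lipschitz_on_subset[OF U(4)], use U(3) in blast, rule lipschitz_on_subset[OF V(4)], use V(3) in blast)
 have "homeomorphism (X Int U) (Y Int V) h k"
 proof (rule homeomorphismI)
  show "continuous_on (X Int U) h" "continuous_on (Y Int V) k" using lip lipschitz_on_continuous_on by blast+
 qed (use hk kh in blast)+
 thus ?thesis unfolding bilipschitz_equivalent_def using U(1,2) V(1,2) lip h0(1) by blast
qed

lemma if_direction:
 fixes X :: "(complex ^ 'n) set" and Y :: "(complex ^ 'm) set"
 assumes X: "curve_germ X" "branch_decomposition X r XB" and Y: "curve_germ Y" "branch_decomposition Y r YB"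
  and s: "bij_betw s {1..r} {1..r}" and P: "preserves_auxiliary_multiplicities r XB YB s" shows "bilipschitz_equivalent X Y"
proof -
 note fX = decomposition_facts[OF X] and fY = decomposition_facts[OF Y]
 define I where "I = {1..r}"
 have sI: "s i : {1..r}" if "i : I" for i using s that bij_betwE unfolding I_def by blast
 have B: "ALL i:{1..r}. brn (XB i) & brn (YB (s i))" 
 proof
  fix i assume i: "i : {1..r}"
  then obtain f R g S where "branch_param (XB i) f R" "branch_param (YB (s i)) g S" using fX(1) fY(1) sI I_def by blast
  from this[THEN ap_pparam] show "brn (XB i) & brn (YB (s i))" by (rule conjI)
 qed
 have "ALL i:{1..r}. ALL j:{1..r}. i ~= j --> ~ germ_eq (XB i) (XB j) & ~ germ_eq (YB (s i)) (YB (s j))"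
  using fX(2) fY(2) sI s unfolding I_def bij_betw_def inj_on_def by metis
 note Q = P[unfolded preserves_iff[where s = s, OF B this]]
 define m where "m i = mlt (XB i)" for i
 have mY: "mlt (YB (s i)) = m i" if "i : I" for i using Q that by (simp add: m_def I_def)
 define f where "f i = ap (XB i)" for i
 define g where "g i = ap (YB (s i))" for i
 have "ALL i:I. EX R S. pparam (XB i) (m i) (f i) (tj (XB i)) R & pparam (YB (s i)) (m i) (g i) (tj (YB (s i))) S"
 proof
  fix i assume i: "i : I"
  hence "brn (XB i)" "brn (YB (s i))" using B by (auto simp: I_def)
  thus "EX R S. pparam (XB i) (m i) (f i) (tj (XB i)) R & pparam (YB (s i)) (m i) (g i) (tj (YB (s i))) S"
   unfolding mY[OF i] unfolding m_def f_def g_def by blast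
 qed
 then obtain RX RY where pp: "ALL i:I. pparam (XB i) (m i) (f i) (tj (XB i)) (RX i) & pparam (YB (s i)) (m i) (g i) (tj (YB (s i))) (RY i)" by metis
 note ppX = pp[rule_format, THEN conjunct1] and ppY = pp[rule_format, THEN conjunct2]
 have m0: "m i > 0" if "i : I" for i using pparamD(6)[OF ppX[OF that]] .
 have fin: "finite I" by (simp add: I_def)
 define p where "p = (\<Prod>i\<in>I. m i)"
 define q where "q i = p div m i" for i
 have pq: "p = m i * q i" if "i : I" for i using dvd_prodI[OF fin that, of m] unfolding p_def q_def by simp
 have p0: "p > 0" unfolding p_def using m0 by (simp add: prod_pos)
 have q0: "q i > 0" if "i : I" for i using pq[OF that] p0 by (cases "q i") auto
 \<comment> \<open>The square of the product of all multiplicities is a multiple of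
   \<open>m i * m j\<close> for every pair, including \<open>i = j\<close>; this is the shape that
   \<open>kap_contact\<close> requires, with \<open>e = q i * q j\<close>.\<close>
 define N where "N = p * p"
 define n where "n i = q i * p" for i
 have N0: "N > 0" using p0 by (simp add: N_def)
 have n0: "n i > 0" "N = n i * m i" if "i : I" for i using q0[OF that] p0 pq[OF that] by (simp_all add: n_def N_def mult_ac)
 have nij: "n i = q i * q j * m j" "N = q i * q j * m i * m j" if "i : I" "j : I" for i j
  using pq[OF that(1)] pq[OF that(2)] by (simp_all add: n_def N_def mult_ac)
 let ?G = "{w::complex. w ^ N = 1}"
 define W where "W i d C \<longleftrightarrow> (ALL z:?G. ALL c. 0 < c & c <= d --> ram N (rp (f i) (n i) 1) c & ram N (rp (g i) (n i) z) c &
   germ_eq (XB i) (rp (f i) (n i) 1 ` ball 0 c) & germ_eq (YB (s i)) (rp (g i) (n i) z ` ball 0 c))" for i d and C :: real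
 have "EX d>0. EX C>0. ALL i:I. W i d C"
 proof (rule finite_uniform[OF fin])
  show "ALL i:I. EX d>0. EX C>0. W i d C"
  proof
   fix i assume i: "i : I"
   note 1 = ppX[OF i] and 2 = ppY[OF i]
   define d where "d = min (min 1 (RX i)) (min 1 (RY i))"
   have d: "d > 0" "d <= min 1 (RX i)" "d <= min 1 (RY i)" using pparamD(1)[OF 1] pparamD(1)[OF 2] by (auto simp: d_def)
   have a: "ram N (rp (f i) (n i) 1) d'" "ram N (rp (g i) (n i) z) d'" "germ_eq (XB i) (rp (f i) (n i) 1 ` ball 0 d')"
    "germ_eq (YB (s i)) (rp (g i) (n i) z ` ball 0 d')" if "z : ?G" "0 < d'" "d' <= d" for z d'
   proof -
    have zN: "z ^ (n i * m i) = 1" using that n0(2)[OF i] by simp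
    have z1: "norm z = 1" using roots_of_unity_norm[of z N] that N0 by simp
    have le: "d' <= min 1 (RX i)" "d' <= min 1 (RY i)" using that d by linarith+
    show "ram N (rp (f i) (n i) 1) d'" "ram N (rp (g i) (n i) z) d'"
     using ram_shrink[OF rp_ram(1)[OF 1 n0(1)[OF i]] that(2) le(1), of 1] ram_shrink[OF rp_ram(1)[OF 2 n0(1)[OF i] zN] that(2) le(2)] n0(2)[OF i] by simp_all
    show "germ_eq (XB i) (rp (f i) (n i) 1 ` ball 0 d')" by (rule rp_germ[OF 1 n0(1)[OF i] _ that(2) le(1)]) simp
    show "germ_eq (YB (s i)) (rp (g i) (n i) z ` ball 0 d')" by (rule rp_germ[OF 2 n0(1)[OF i] z1 that(2) le(2)])
   qed
   hence "W i d 1" unfolding W_def by blast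
   thus "EX d>0. EX C>0. W i d C" using d(1) zero_less_one by blast
  qed
  show "ALL i d C d' C'. W i d C & 0 < d' & d' <= d & C <= C' --> W i d' C'" unfolding W_def by (meson order_trans)
 qed
 then obtain R C0 where R: "R > 0" and "ALL i:I. W i R C0" by blast
 hence W: "ram N (rp (f i) (n i) 1) c" "ram N (rp (g i) (n i) z) c" "germ_eq (XB i) (rp (f i) (n i) 1 ` ball 0 c)"
   "germ_eq (YB (s i)) (rp (g i) (n i) z ` ball 0 c)" if "i : I" "z : ?G" "0 < c" "c <= R" for i z c
  using that unfolding W_def by blast+
 have ram: "ALL i:I. ram N (rp (f i) (n i) 1) R & ram N (rp (g i) (n i) 1) R" using W(1,2)[of _ 1 R] R by simp
 define kX where "kX i j = kap (rp (f i) (n i) 1) (rp (f j) (n j) 1)" for i j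
 define kY where "kY i j = kap (rp (g i) (n i) 1) (rp (g j) (n j) 1)" for i j
 have uX: "ultra I ?G kX" unfolding kX_def by (rule ultra_kap) (use ram in blast)
 have uY: "ultra I ?G kY" unfolding kY_def by (rule ultra_kap) (use ram in blast)
 have rew: "rp F (n i) 1 = rp F (q i * q j * m j) 1" "rp F (n j) 1 = rp F (q i * q j * m i) 1" if "i : I" "j : I" for F i j
  using nij(1)[OF that] nij(1)[OF that(2,1)] by (simp_all add: mult_ac)
 \<comment> \<open>On a single branch the orders are, up to the ramification, the self-contacts,
   which agree by hypothesis.\<close>
 have diag: "ALL i:I. ALL a:?G. kX i i a = kY i i a"
 proof (intro ballI)
  fix i and a :: complex assume i: "i : I" and a: "a : ?G"
  note 1 = ppX[OF i] and 2 = ppY[OF i]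
  have e: "q i * q i > 0" using q0[OF i] by simp
  have a': "a ^ (q i * q i * m i * m i) = 1" using a nij(2)[OF i i] by simp
  have t: "a ^ (q i * q i * m i) : roots_of_unity (m i)" using a' by (simp add: roots_of_unity_def power_mult)
  hence "char_mult (f i) (a ^ (q i * q i * m i)) = char_mult (g i) (a ^ (q i * q i * m i))"
   using Q i unfolding chr_def f_def g_def m_def I_def by blast
  thus "kX i i a = kY i i a" unfolding kX_def kY_def rew(1)[OF i i]
   using kap_contact[OF 1 1 e a'] kap_contact[OF 2 2 e a'] contact_self[OF 1 t] contact_self[OF 2 t] by simp
 qed
 have mx: "ALL i:I. ALL j:I. i ~= j --> (EX a:?G. kX i j a = enat (q i * q j) * con (XB i) (XB j)) & (EX a:?G. kY i j a = enat (q i * q j) * con (XB i) (XB j)) &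
   (ALL a:?G. kX i j a <= enat (q i * q j) * con (XB i) (XB j) & kY i j a <= enat (q i * q j) * con (XB i) (XB j))"
 proof (intro ballI impI)
  fix i j assume ij: "i : I" "j : I" "i ~= j"
  note 1 = ppX[OF ij(1)] and 2 = ppY[OF ij(1)] and 3 = ppX[OF ij(2)] and 4 = ppY[OF ij(2)]
  have e: "q i * q j > 0" using q0 ij by simp
  have cX: "max_contact (m i) (m j) (f i) (f j) = con (XB i) (XB j)" by (simp add: con_def m_def f_def)
  have "con (XB i) (XB j) = con (YB (s i)) (YB (s j))" using Q ij unfolding I_def by blast
  hence cY: "max_contact (m i) (m j) (g i) (g j) = con (XB i) (XB j)" by (simp add: con_def mY ij g_def)
  show "(EX a:?G. kX i j a = enat (q i * q j) * con (XB i) (XB j)) & (EX a:?G. kY i j a = enat (q i * q j) * con (XB i) (XB j)) &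
   (ALL a:?G. kX i j a <= enat (q i * q j) * con (XB i) (XB j) & kY i j a <= enat (q i * q j) * con (XB i) (XB j))"
   unfolding kX_def kY_def rew(1)[OF ij(1,2)] rew(2)[OF ij(1,2)] nij(2)[OF ij(1,2)]
   using kap_max[OF 1 3 e] kap_max[OF 2 4 e] unfolding cX cY by blast
 qed
 obtain z where z: "ALL i:I. z i : ?G" "ALL i:I. ALL j:I. ALL a:?G. kX i j a = kY i j (a * z j / z i)"
  using rotation[OF uX uY N0 fin diag mx] by blast
 define F where "F i = rp (f i) (n i) 1" for i
 \<comment> \<open>The images are the same branches of \<open>Y\<close>; only the parameters are
   rotated, after which the orders of every pair agree with those of \<open>F\<close>.\<close>
 define H where "H i = rp (g i) (n i) (z i)" for i
 have H_rot: "H i = (%s. rp (g i) (n i) 1 (z i * s))" for i by (simp add: H_def rp_def fun_eq_iff)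
 define E where "E x d C \<longleftrightarrow> (ALL s:ball 0 d. ALL s':ball 0 d. norm (H (fst x) s - H (snd x) s') <= C * norm (F (fst x) s - F (snd x) s') &
   norm (F (fst x) s - F (snd x) s') <= C * norm (H (fst x) s - H (snd x) s'))" for x d C
 have "EX d>0. EX C>0. ALL x:I \<times> I. E x d C"
 proof (rule finite_uniform)
  show "ALL x:I \<times> I. EX d>0. EX C>0. E x d C"
  proof
   fix x assume x: "x : I \<times> I"
   define i where "i = fst x"
   define j where "j = snd x"
   have ij: "i : I" "j : I" using x by (auto simp: i_def j_def)
   note 1 = ppX[OF ij(1)] and 2 = ppY[OF ij(1)] and 3 = ppX[OF ij(2)] and 4 = ppY[OF ij(2)]
   have zz: "z i ^ N = 1" "z j ^ N = 1" using z(1) ij by auto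
   have cX: "common N (F i) (F j) | separated N (F i) (F j)" unfolding F_def
    by (rule rp_pair[OF 1 3 _ n0(2)[OF ij(1)] n0(2)[OF ij(2)] n0(1)[OF ij(1)] n0(1)[OF ij(2)]]) simp_all
   have cY: "common N (H i) (H j) | separated N (H i) (H j)" unfolding H_def
    by (rule rp_pair[OF 2 4 _ n0(2)[OF ij(1)] n0(2)[OF ij(2)] n0(1)[OF ij(1)] n0(1)[OF ij(2)] zz]) simp
   have rX: "ram N (F i) R" "ram N (F j) R" using ram ij by (auto simp: F_def)
   have rY: "ram N (H i) R" "ram N (H j) R" using W(2) z(1) ij R unfolding H_def by blast+
   have k: "kap (F i) (F j) w = kap (H i) (H j) w" if w: "w ^ N = 1" for w
   proof -
    have rg: "ram N (rp (g i) (n i) 1) R" "ram N (rp (g j) (n j) 1) R" using ram ij by auto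
    have "kap (H i) (H j) w = kY i j (w * z j / z i)" unfolding H_rot kY_def by (rule kap_rotate[OF rg zz w])
    thus ?thesis using z(2) ij w unfolding kX_def F_def by simp
   qed
   obtain d1 C1 where e1: "d1 > 0" "C1 > 0" "ALL s:ball 0 d1. ALL s':ball 0 d1. norm (H i s - H j s') <= C1 * norm (F i s - F j s')"
    using pair_compare[OF rX rY cX cY] k by blast
   obtain d2 C2 where e2: "d2 > 0" "C2 > 0" "ALL s:ball 0 d2. ALL s':ball 0 d2. norm (F i s - F j s') <= C2 * norm (H i s - H j s')"
    using pair_compare[OF rY rX cY cX] k by metis
   have "norm (H i s - H j s') <= (C1 + C2) * norm (F i s - F j s') & norm (F i s - F j s') <= (C1 + C2) * norm (H i s - H j s')"
    if "s : ball 0 (min d1 d2)" "s' : ball 0 (min d1 d2)" for s s'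
   proof -
    have "norm (H i s - H j s') <= C1 * norm (F i s - F j s')" "norm (F i s - F j s') <= C2 * norm (H i s - H j s')"
     using e1(3) e2(3) that by auto
    moreover have "0 <= C2 * norm (F i s - F j s')" "0 <= C1 * norm (H i s - H j s')" using e1 e2 by auto
    ultimately show ?thesis unfolding distrib_right by linarith
   qed
   moreover have "min d1 d2 > 0" "C1 + C2 > 0" using e1 e2 by auto
   ultimately show "EX d>0. EX C>0. E x d C" unfolding E_def i_def j_def by blast
  qed
  show "ALL x d C d' C'. E x d C & 0 < d' & d' <= d & C <= C' --> E x d' C'"
   unfolding E_def by (intro allI impI ballI conjI; elim conjE; rule mult_le_mono) auto
 qed (simp add: fin)
 then obtain d0 C where d0: "d0 > 0" "C > 0" "ALL i:I. ALL j:I. ALL s:ball 0 d0. ALL s':ball 0 d0. norm (H i s - H j s') <= C * norm (F i s - F j s') &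
   norm (F i s - F j s') <= C * norm (H i s - H j s')" unfolding E_def by force
 define d where "d = min d0 R"
 have d: "d > 0" "d <= R" using d0 R by (auto simp: d_def)
 show ?thesis
 proof (rule assemble[OF _ d0(2) d(1)])
  show "ALL i:I. ALL j:I. ALL s:ball 0 d. ALL s':ball 0 d. norm (H i s - H j s') <= C * norm (F i s - F j s') &
   norm (F i s - F j s') <= C * norm (H i s - H j s')" using d0(3) by (simp add: d_def)
  have "germ_eq (\<Union>i\<in>I. XB i) (\<Union>i\<in>I. F i ` ball 0 d)" by (rule germ_eq_UN[OF fin]) (use W(3) z(1) d in \<open>unfold F_def, blast\<close>)
  moreover have "germ_eq X (\<Union>i\<in>I. XB i)" using X(2) unfolding branch_decomposition_def I_def by blast
  ultimately show "germ_eq X (\<Union>i\<in>I. F i ` ball 0 d)" using germ_eq_trans by blast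
  have a: "germ_eq (\<Union>i\<in>I. YB (s i)) (\<Union>i\<in>I. H i ` ball 0 d)" by (rule germ_eq_UN[OF fin]) (use W(4) z(1) d in \<open>unfold H_def, blast\<close>)
  have "(\<Union>i\<in>I. YB (s i)) = (\<Union>i\<in>{1..r}. YB i)" using s unfolding I_def bij_betw_def by (metis image_image)
  hence "germ_eq Y (\<Union>i\<in>I. YB (s i))" using Y(2) unfolding branch_decomposition_def by simp
  thus "germ_eq Y (\<Union>i\<in>I. H i ` ball 0 d)" by (rule germ_eq_trans[OF _ a])
  show "ALL i:I. F i 0 = 0 & H i 0 = 0"
  proof
   fix i assume i: "i : I"
   note pparamD(3)[OF ppX[OF i]] pparamD(3)[OF ppY[OF i]]
   thus "F i 0 = 0 & H i 0 = 0" using n0(1)[OF i] by (simp add: F_def H_def rp_def power_0_left)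
  qed
 qed (use fX(5) fY(5) in auto)
qed

theorem theorem4p12:
  fixes X :: "(complex ^ 'n) set" and Y :: "(complex ^ 'm) set"
    and XB :: "nat \<Rightarrow> (complex ^ 'n) set" and YB :: "nat \<Rightarrow> (complex ^ 'm) set"
    and r r' :: nat
  assumes "CARD('n) \<ge> 2" and "CARD('m) \<ge> 2"
    and "curve_germ X" and "branch_decomposition X r XB"
    and "curve_germ Y" and "branch_decomposition Y r' YB"
  shows "bilipschitz_equivalent X Y \<longleftrightarrow>
    r = r' \<and>
    (\<exists>\<rho>. bij_betw \<rho> {1..r} {1..r'} \<and> preserves_auxiliary_multiplicities r XB YB \<rho>)"
proof
 assume "bilipschitz_equivalent X Y"
 then obtain h k L e where "bil X Y h k L e" using bilipschitz_bil decomposition_facts(5)[OF assms(3,4)] by blast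
 from only_if[OF assms(3-6) this] obtain s where s: "bij_betw s {1..r} {1..r'}" "preserves_auxiliary_multiplicities r XB YB s" by blast
 then show "r = r' \<and> (\<exists>\<rho>. bij_betw \<rho> {1..r} {1..r'} \<and> preserves_auxiliary_multiplicities r XB YB \<rho>)"
  using bij_betw_same_card[OF s(1)] by auto
next
 assume "r = r' \<and> (\<exists>\<rho>. bij_betw \<rho> {1..r} {1..r'} \<and> preserves_auxiliary_multiplicities r XB YB \<rho>)"
 then show "bilipschitz_equivalent X Y" using if_direction[OF assms(3,4)] assms(5,6) by blast
qed


end
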